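(* Let $G\subset\mathbb{R}^3$ be a rod-like domain with transverse sections $D_{x_1}$, $x_1\in(\ell_0,\ell_1)$, and for $\varepsilon\in(0,1)$ let $G_\varepsilon$, $\Gamma^D_\varepsilon$, the eigenvalues $\lambda_n^\varepsilon$ and the eigenfunctions $u_n^\varepsilon$ of the mixed eigenvalue problem in $G_\varepsilon$ be as described in the context. Let $U_n^\varepsilon(y_1,y_2,y_3):=u_n^\varepsilon(y_1,\varepsilon y_2,\varepsilon y_3)$ for $y\in G$. Assume that the area $|D_{x_1}|$ is a stepwise continuous (i.e. piecewise continuous) function of $x_1\in(\ell_0,\ell_1)$ and that there are constants $c_0,c_1$ independent of $x_1$ with $$0<c_0<|D_{x_1}|\le c_1\qquad \forall x_1\in[\ell_0,\ell_1].$$ Then, for any fixed $n\in\mathbb{N}$ and any sequence of values of $\varepsilon\in(0,1)$ tending to $0$ along which $$\lambda_n^\varepsilon\to\lambda_n^0\ \text{ in }\mathbb{R},\qquad U_n^\varepsilon\rightharpoonup U_n^0\ \text{ weakly in } H^1(G),$$ the limit $\lambda_n^0$ is an eigenvalue, and $U_n^0$ is an associated eigenfunction (in particular $U_n^0\not\equiv0$ and $U_n^0$ depends only on the first variable), of the one-dimensional Dirichlet problem $$-\frac{d}{dx_1}\Big(|D_{x_1}|\,\frac{dU^0}{dx_1}\Big)=\lambda^0\,|D_{x_1}|\,U^0\ \text{ in }(\ell_0,\ell_1),\qquad U^0(\ell_0)=U^0(\ell_1)=0,$$ understood in the weak sense given in the context.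
   Context: Geometry. Let $\ell_0\le 0<\ell_1$ be fixed real constants. $G\subset\mathbb{R}^3$ is a bounded open domain (connected) with Lipschitz boundary, of the form $$G=\bigcup_{x_1\in(\ell_0,\ell_1)}\{(x_1,x_2,x_3):(x_2,x_3)\in D_{x_1}\},$$ where for each $x_1\in(\ell_0,\ell_1)$ the transverse section $D_{x_1}\subset\mathbb{R}^2$ is an open (connected) domain with Lipschitz boundary, depending on $x_1$; $|D_{x_1}|$ denotes its area. The boundary is $\partial G=\overline{\Gamma_0}\cup\overline{\Gamma_1}\cup\overline{\Gamma_l}$, where $\Gamma_0,\Gamma_1$ are plane faces with $\overline{\Gamma_0}=\overline G\cap\{x_1=\ell_0\}$ and $\overline{\Gamma_1}=\overline G\cap\{x_1=\ell_1\}$, and $\Gamma_l$ is the lateral surface. At the endpoints, $D_{\ell_0}$ and $D_{\ell_1}$ are the planar sections corresponding to the faces $\Gamma_0$ and $\Gamma_1$. For a parameter $\varepsilon\in(0,1)$, $$G_\varepsilon=\{(x_1,x_2,x_3):(x_1,\varepsilon^{-1}x_2,\varepsilon^{-1}x_3)\in G\},$$ and $\Gamma^D_\varepsilon=\Gamma_0^\varepsilon\cup\Gamma_1^\varepsilon$ is the union of the two end faces of $G_\varepsilon$, with $\overline{\Gamma_0^\varepsilon}=\overline{G_\varepsilon}\cap\{x_1=\ell_0\}$, $\overline{\Gamma_1^\varepsilon}=\overline{G_\varepsilon}\cap\{x_1=\ell_1\}$. Eigenvalue problem. $H^1(G_\varepsilon,\Gamma^D_\varepsilon)$ is the completion of $\{u\in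 C^\infty(\overline{G_\varepsilon}):u=0\text{ on }\Gamma^D_\varepsilon\}$ for the norm generated by the scalar product $(\nabla u,\nabla v)_{L^2(G_\varepsilon)}$ (equivalent there to the usual $H^1(G_\varepsilon)$ norm). The problem $-\Delta u^\varepsilon=\lambda^\varepsilon u^\varepsilon$ in $G_\varepsilon$, $u^\varepsilon=0$ on $\Gamma_\varepsilon^D$, $\partial u^\varepsilon/\partial\nu=0$ on $\partial G_\varepsilon\setminus\Gamma^D_\varepsilon$ ($\nu$ the outward unit normal) is understood weakly: find $\lambda^\varepsilon\in\mathbb{R}$ and $u^\varepsilon\in H^1(G_\varepsilon,\Gamma^D_\varepsilon)$, $u^\varepsilon\not\equiv0$, with $$\int_{G_\varepsilon}\nabla u^\varepsilon\cdot\nabla v\,dx=\lambda^\varepsilon\int_{G_\varepsilon}u^\varepsilon v\,dx\qquad\forall v\in H^1(G_\varepsilon,\Gamma^D_\varepsilon).$$ Its spectrum is discrete; $0<\lambda_1^\varepsilon\le\lambda_2^\varepsilon\le\cdots\le\lambda_n^\varepsilon\le\cdots\to\infty$ are the eigenvalues repeated according to multiplicity, and $\{u_n^\varepsilon\}_{n\ge1}$ are corresponding eigenfunctions forming an orthogonal basis of $H^1(G_\varepsilon,\Gamma_\varepsilon^D)$ and of $L^2(G_\varepsilon)$, normalized by $\int_{G_\varepsilon}|u_n^\varepsilon|^2dx=\varepsilon^2$, equivalently $\int_G|U_n^\varepsilon|^2dy=1$ in the stretched variables $y_1=x_1$, $y_2=x_2/\varepsilon$, $y_3=x_3/\varepsilon$.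 Limit problem. $(\lambda^0,U^0)$ is an eigenvalue with associated eigenfunction of the one-dimensional Dirichlet problem if $\lambda^0\in\mathbb{R}$, $U^0\in H^1_0(\ell_0,\ell_1)$, $U^0\not\equiv0$, and $$\int_{\ell_0}^{\ell_1}|D_{y_1}|\,(U^0)'\,\varphi'\,dy_1=\lambda^0\int_{\ell_0}^{\ell_1}|D_{y_1}|\,U^0\,\varphi\,dy_1\qquad\forall\varphi\in H^1_0(\ell_0,\ell_1).$$ A function on $G$ depending only on $y_1$ is identified with a function on $(\ell_0,\ell_1)$. *)

theory Defs
  imports "HOL-Analysis.Analysis"
begin

section \<open>Smooth functions and Lipschitz domains\<close>

primrec Ck :: "nat \<Rightarrow> ('a::euclidean_space \<Rightarrow> real) \<Rightarrow> bool" where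
  "Ck 0 f \<longleftrightarrow> continuous_on UNIV f"
| "Ck (Suc k) f \<longleftrightarrow> (\<forall>x. f differentiable at x) \<and>
     (\<forall>b\<in>Basis. Ck k (\<lambda>x. frechet_derivative f (at x) b))"

definition smooth :: "('a::euclidean_space \<Rightarrow> real) \<Rightarrow> bool" where
  "smooth f \<longleftrightarrow> (\<forall>k. Ck k f)"

definition test_functions :: "'a::euclidean_space set \<Rightarrow> ('a \<Rightarrow> real) set" where
  "test_functions S =
     {f. smooth f \<and> compact (closure {x. f x \<noteq> 0}) \<and> closure {x. f x \<noteq> 0} \<subseteq> S}"

text \<open>Near each boundary point, \<open>S\<close> is the strict epigraph, in some direction \<open>e\<close>, of a Lipschitz
  function \<open>h\<close> on the hyperplane orthogonal to \<open>e\<close>.\<close>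

definition lipschitz_boundary :: "'a::euclidean_space set \<Rightarrow> bool" where
  "lipschitz_boundary S \<longleftrightarrow>
     (\<forall>p\<in>frontier S. \<exists>e h L r. norm e = 1 \<and> r > 0 \<and> L-lipschitz_on {z. z \<bullet> e = 0} h \<and>
        (\<forall>y\<in>ball p r. y \<in> S \<longleftrightarrow> y \<bullet> e > (h (y - (y \<bullet> e) *\<^sub>R e) :: real)))"

definition lipschitz_domain :: "'a::euclidean_space set \<Rightarrow> bool" where
  "lipschitz_domain S \<longleftrightarrow> open S \<and> connected S \<and> S \<noteq> {} \<and> lipschitz_boundary S"

section \<open>Sobolev spaces\<close>

text \<open>Elements of the Lebesgue and Sobolev spaces are functions, not classes of functions that agree
  almost everywhere; only the values on \<open>S\<close> matter.\<close>

definition L2 :: "'a::euclidean_space set \<Rightarrow> ('a \<Rightarrow> 'b::euclidean_space) set" where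
  "L2 S = {f. f \<in> borel_measurable (lebesgue_on S) \<and>
              integrable (lebesgue_on S) (\<lambda>x. (norm (f x))\<^sup>2)}"

definition L2_inner :: "'a::euclidean_space set \<Rightarrow> ('a \<Rightarrow> 'b::euclidean_space) \<Rightarrow> ('a \<Rightarrow> 'b) \<Rightarrow> real"
  where "L2_inner S f g = (LINT x|lebesgue_on S. f x \<bullet> g x)"

definition L2_norm :: "'a::euclidean_space set \<Rightarrow> ('a \<Rightarrow> 'b::euclidean_space) \<Rightarrow> real" where
  "L2_norm S f = sqrt (L2_inner S f f)"

definition is_weak_grad :: "'a::euclidean_space set \<Rightarrow> ('a \<Rightarrow> real) \<Rightarrow> ('a \<Rightarrow> 'a) \<Rightarrow> bool" where
  "is_weak_grad S u g \<longleftrightarrow>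
     (\<forall>\<phi>\<in>test_functions S. \<forall>b\<in>Basis.
        (LINT x|lebesgue_on S. u x * frechet_derivative \<phi> (at x) b) =
        - (LINT x|lebesgue_on S. (g x \<bullet> b) * \<phi> x))"

definition H1 :: "'a::euclidean_space set \<Rightarrow> ('a \<Rightarrow> real) set" where
  "H1 S = {u \<in> L2 S. \<exists>g\<in>L2 S. is_weak_grad S u g}"

text \<open>The weak gradient is determined only almost everywhere; a representative is chosen. On the
  real line it is the weak derivative.\<close>

definition weak_grad :: "'a::euclidean_space set \<Rightarrow> ('a \<Rightarrow> real) \<Rightarrow> 'a \<Rightarrow> 'a" where
  "weak_grad S u = (SOME g. g \<in> L2 S \<and> is_weak_grad S u g)"

definition H1_norm :: "'a::euclidean_space set \<Rightarrow> ('a \<Rightarrow> real) \<Rightarrow> real" where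
  "H1_norm S u = sqrt ((L2_norm S u)\<^sup>2 + (L2_norm S (weak_grad S u))\<^sup>2)"

definition H1_closure :: "'a::euclidean_space set \<Rightarrow> ('a \<Rightarrow> real) set \<Rightarrow> ('a \<Rightarrow> real) set" where
  "H1_closure S A = {u \<in> H1 S. \<exists>w. (\<forall>k::nat. w k \<in> A) \<and>
     (\<lambda>k. H1_norm S (\<lambda>x. w k x - u x)) \<longlonglongrightarrow> 0}"

definition H1_0 :: "'a::euclidean_space set \<Rightarrow> ('a \<Rightarrow> real) set" where
  "H1_0 S = H1_closure S (test_functions S)"

text \<open>Since the gradient norm and the \<open>H1\<close> norm are equivalent on the smooth functions that vanish
  on \<open>\<Gamma>\<close>, the completion for the gradient norm is realised as a closure in \<open>H1 S\<close>. Functions smooth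
  up to the boundary are represented by smooth functions on the whole space.\<close>

definition H1_vanishing :: "'a::euclidean_space set \<Rightarrow> 'a set \<Rightarrow> ('a \<Rightarrow> real) set" where
  "H1_vanishing S \<Gamma> = H1_closure S {w. smooth w \<and> (\<forall>x\<in>\<Gamma>. w x = 0)}"

definition H1_weakly_converges ::
    "'a::euclidean_space set \<Rightarrow> (nat \<Rightarrow> 'a \<Rightarrow> real) \<Rightarrow> ('a \<Rightarrow> real) \<Rightarrow> bool" where
  "H1_weakly_converges S U V \<longleftrightarrow> (\<forall>j. U j \<in> H1 S) \<and> V \<in> H1 S \<and>
     (\<forall>F. (\<forall>v\<in>H1 S. \<forall>w\<in>H1 S. \<forall>a b. F (\<lambda>x. a * v x + b * w x) = a * F v + b * F w) \<and>
          (\<exists>C. \<forall>v\<in>H1 S. \<bar>F v\<bar> \<le> C * H1_norm S v)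
        \<longrightarrow> (\<lambda>j. F (U j)) \<longlonglongrightarrow> (F V :: real))"

section \<open>Rod-like domains\<close>

definition transverse :: "real^3 \<Rightarrow> real^2" where
  "transverse x = vector [x $ 2, x $ 3]"

definition scale_transverse :: "real \<Rightarrow> real^3 \<Rightarrow> real^3" where
  "scale_transverse c x = vector [x $ 1, c * x $ 2, c * x $ 3]"

definition plane_face :: "(real \<Rightarrow> (real^2) set) \<Rightarrow> real \<Rightarrow> (real^3) set" where
  "plane_face D l = {x. x $ 1 = l \<and> transverse x \<in> D l}"

text \<open>The lateral surface is the part of the frontier where the first coordinate lies strictly
  between \<open>l\<^sub>0\<close> and \<open>l\<^sub>1\<close>; the frontier is then the union of its closure and the two closed faces
  without any further condition.\<close>

definition rod_domain :: "real \<Rightarrow> real \<Rightarrow> (real \<Rightarrow> (real^2) set) \<Rightarrow> (real^3) set \<Rightarrow> bool" where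
  "rod_domain l\<^sub>0 l\<^sub>1 D G \<longleftrightarrow>
     bounded G \<and> lipschitz_domain G \<and>
     G = {x. x $ 1 \<in> {l\<^sub>0<..<l\<^sub>1} \<and> transverse x \<in> D (x $ 1)} \<and>
     (\<forall>t\<in>{l\<^sub>0<..<l\<^sub>1}. lipschitz_domain (D t)) \<and>
     (\<forall>l\<in>{l\<^sub>0, l\<^sub>1}. open (D l) \<and> closure (plane_face D l) = closure G \<inter> {x. x $ 1 = l})"

definition area :: "(real \<Rightarrow> (real^2) set) \<Rightarrow> real \<Rightarrow> real" where
  "area D t = measure lebesgue (D t)"

definition thin_rod :: "(real^3) set \<Rightarrow> real \<Rightarrow> (real^3) set" where
  "thin_rod G \<epsilon> = {x. scale_transverse (1 / \<epsilon>) x \<in> G}"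

definition end_faces :: "real \<Rightarrow> real \<Rightarrow> (real \<Rightarrow> (real^2) set) \<Rightarrow> real \<Rightarrow> (real^3) set" where
  "end_faces l\<^sub>0 l\<^sub>1 D \<epsilon> = {x. scale_transverse (1 / \<epsilon>) x \<in> plane_face D l\<^sub>0 \<union> plane_face D l\<^sub>1}"

definition piecewise_continuous :: "real \<Rightarrow> real \<Rightarrow> (real \<Rightarrow> real) \<Rightarrow> bool" where
  "piecewise_continuous a b f \<longleftrightarrow>
     (\<exists>P. finite P \<and> P \<subseteq> {a<..<b} \<and> continuous_on ({a<..<b} - P) f \<and>
        (\<forall>p\<in>P. (\<exists>l. (f \<longlongrightarrow> l) (at_left p)) \<and> (\<exists>r. (f \<longlongrightarrow> r) (at_right p))))"

section \<open>The eigenvalue problems\<close>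

definition mixed_eigenpair ::
    "(real^3) set \<Rightarrow> (real^3) set \<Rightarrow> real \<Rightarrow> (real^3 \<Rightarrow> real) \<Rightarrow> bool" where
  "mixed_eigenpair S \<Gamma> \<mu> u \<longleftrightarrow>
     u \<in> H1_vanishing S \<Gamma> \<and> \<not> (AE x in lebesgue_on S. u x = 0) \<and>
     (\<forall>v\<in>H1_vanishing S \<Gamma>. L2_inner S (weak_grad S u) (weak_grad S v) = \<mu> * L2_inner S u v)"

text \<open>Indices start at \<open>0\<close>: \<open>lam k\<close> is the eigenvalue number \<open>k + 1\<close>. The sixth and seventh conditions
  say that every eigenvalue is listed, as often as the dimension of its eigenspace (the sum is finite
  because \<open>lam\<close> tends to infinity). The last four express that \<open>u\<close> is an orthogonal basis of
  \<open>H1_vanishing S \<Gamma>\<close> for the gradient scalar product and of \<open>L2 S\<close>.\<close>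

definition mixed_eigensystem ::
    "(real^3) set \<Rightarrow> (real^3) set \<Rightarrow> real \<Rightarrow> (nat \<Rightarrow> real) \<Rightarrow> (nat \<Rightarrow> real^3 \<Rightarrow> real) \<Rightarrow> bool" where
  "mixed_eigensystem S \<Gamma> m lam u \<longleftrightarrow>
     (\<forall>k. 0 < lam k) \<and> incseq lam \<and> filterlim lam at_top sequentially \<and>
     (\<forall>k. mixed_eigenpair S \<Gamma> (lam k) (u k)) \<and>
     (\<forall>k. (LINT x|lebesgue_on S. \<bar>u k x\<bar>\<^sup>2) = m) \<and>
     (\<forall>\<mu> v. mixed_eigenpair S \<Gamma> \<mu> v \<longrightarrow> \<mu> \<in> range lam) \<and>
     (\<forall>\<mu> v. mixed_eigenpair S \<Gamma> \<mu> v \<longrightarrow>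
        (\<exists>c. AE x in lebesgue_on S. v x = (\<Sum>k | lam k = \<mu>. c k * u k x))) \<and>
     (\<forall>i j. i \<noteq> j \<longrightarrow> L2_inner S (weak_grad S (u i)) (weak_grad S (u j)) = 0) \<and>
     (\<forall>v\<in>H1_vanishing S \<Gamma>. \<forall>e>0. \<exists>N c.
        L2_norm S (weak_grad S (\<lambda>x. v x - (\<Sum>k<N. c k * u k x))) < e) \<and>
     (\<forall>i j. i \<noteq> j \<longrightarrow> L2_inner S (u i) (u j) = 0) \<and>
     (\<forall>v\<in>L2 S. \<forall>e>0. \<exists>N c. L2_norm S (\<lambda>x. v x - (\<Sum>k<N. c k * u k x)) < e)"

text \<open>The one-dimensional Dirichlet problem with weight \<open>a\<close>, in weak form.\<close>

definition limit_eigenpair ::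
    "real \<Rightarrow> real \<Rightarrow> (real \<Rightarrow> real) \<Rightarrow> real \<Rightarrow> (real \<Rightarrow> real) \<Rightarrow> bool" where
  "limit_eigenpair l\<^sub>0 l\<^sub>1 a \<mu> V \<longleftrightarrow>
     (let I = {l\<^sub>0<..<l\<^sub>1} in
        V \<in> H1_0 I \<and> \<not> (AE t in lebesgue_on I. V t = 0) \<and>
        (\<forall>\<phi>\<in>H1_0 I.
           (LINT t|lebesgue_on I. a t * weak_grad I V t * weak_grad I \<phi> t) =
           \<mu> * (LINT t|lebesgue_on I. a t * V t * \<phi> t)))"

end

theory Submission
  imports Defs
begin

text \<open>Approximate the eigenfunctions by smooth functions vanishing on the end faces and rescale them
  to functions \<open>W\<close> on \<open>G\<close>. Rescaling turns the gradient bound into a transverse gradient of order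
  \<open>\<epsilon>\<close>. A Lipschitz domain has the cone property, and comparing a function with its averages
  over the admissible shifts turns weak convergence with bounded gradients into strong \<open>L2\<close>
  convergence; so the limit \<open>U\<close> has norm one, and on almost every section \<open>W\<close> converges to a function
  with gradient zero, which is a constant since sections are connected. This gives the profile \<open>V\<close>.

  On a thin cylinder inside \<open>G\<close> with disc-shaped base the increments of the disc means of \<open>V\<close> are
  integrals of the axial derivative \<open>\<gamma>\<close> of \<open>U\<close>; as weak derivatives are unique, \<open>\<gamma>\<close>
  depends on the axial variable only and \<open>V\<close> is its primitive. Near an interior point of an end face \<open>G\<close>
  is a half-space, so there are such cylinders that reach the face, where \<open>W\<close> vanishes: hence \<open>V\<close> has
  zero boundary values. Testing the rescaled eigenvalue equation with functions of the axial variable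
  alone and integrating over the sections gives the limit equation.\<close>

subsection \<open>Calculus of smooth functions\<close>

text \<open>The sections may jump with the axial variable, so the mean of \<open>W\<close> over a
  whole section need not be continuous along the axis even though \<open>W\<close> is smooth. A disc
  contained in all nearby sections does not move: the increment of its mean is the integral of the
  axial derivative over a cylinder, divided by the area of the disc. This is a pairing with an
  \<open>L2\<close> function, the indicator of the cylinder, and survives weak convergence. The same
  device replaces traces: an increment may start or end on a face itself, where the smooth
  \<open>W\<close> vanishes pointwise. Strong convergence is needed twice. Weak convergence could
  lose the norm and allow the limit zero, and restriction to single sections needs convergence in
  norm, where it works for almost every section along a subsequence. The power
  \<open>\<epsilon>\<^sup>2\<close> of the normalisation is the Jacobian of the rescaling, and the
  chain rule multiplies the transverse derivatives by \<open>\<epsilon>\<close>: they vanish in the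
  limit while the axial one is only bounded.\<close>

definition grad :: "('a::euclidean_space \<Rightarrow> real) \<Rightarrow> 'a \<Rightarrow> 'a" where
  "grad f x = (\<Sum>b\<in>Basis. frechet_derivative f (at x) b *\<^sub>R b)"

lemma grad_inner_Basis: "b \<in> Basis \<Longrightarrow> grad f x \<bullet> b = frechet_derivative f (at x) b"
  unfolding grad_def by simp

lemma has_derivative_grad:
  fixes f :: "'a::euclidean_space \<Rightarrow> real"
  assumes "f differentiable at x"
  shows "(f has_derivative (\<lambda>h. grad f x \<bullet> h)) (at x)"
proof -
  have d: "(f has_derivative frechet_derivative f (at x)) (at x)"
    using assms frechet_derivative_works by blast
  have l: "linear (frechet_derivative f (at x))"
    using assms linear_frechet_derivative by blast
  have "frechet_derivative f (at x) = (\<lambda>h. grad f x \<bullet> h)"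
  proof
    fix h
    have "frechet_derivative f (at x) h = frechet_derivative f (at x) (\<Sum>b\<in>Basis. (h \<bullet> b) *\<^sub>R b)"
      by (simp add: euclidean_representation)
    also have "\<dots> = (\<Sum>b\<in>Basis. (h \<bullet> b) * frechet_derivative f (at x) b)"
      by (simp add: linear_sum[OF l] linear_cmul[OF l])
    also have "\<dots> = grad f x \<bullet> h"
      unfolding grad_def inner_sum_left by (intro sum.cong) (auto simp: inner_commute)
    finally show "frechet_derivative f (at x) h = grad f x \<bullet> h" .
  qed
  then show ?thesis using d by simp
qed

lemma grad_eqI:
  fixes f :: "'a::euclidean_space \<Rightarrow> real"
  assumes "(f has_derivative (\<lambda>h. g \<bullet> h)) (at x)"
  shows "grad f x = g"
proof -
  have "frechet_derivative f (at x) = (\<lambda>h. g \<bullet> h)"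
    using assms frechet_derivative_at by metis
  then show ?thesis unfolding grad_def by (simp add: euclidean_representation)
qed

lemma Ck_Suc_iff:
  fixes f :: "'a::euclidean_space \<Rightarrow> real"
  shows "Ck (Suc k) f \<longleftrightarrow> (\<forall>x. (f has_derivative (\<lambda>h. grad f x \<bullet> h)) (at x)) \<and> (\<forall>b\<in>Basis. Ck k (\<lambda>x. grad f x \<bullet> b))"
proof -
  have "(\<forall>x. f differentiable at x) \<longleftrightarrow> (\<forall>x. (f has_derivative (\<lambda>h. grad f x \<bullet> h)) (at x))"
    using has_derivative_grad differentiable_def by blast
  then show ?thesis by (simp add: grad_inner_Basis)
qed

text \<open>Any vector field that represents the derivative may serve as the gradient, so sums,
  products and compositions are treated by writing down theirs.\<close>

lemma Ck_SucI:
  fixes f :: "'a::euclidean_space \<Rightarrow> real"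
  assumes "\<And>x. (f has_derivative (\<lambda>h. g x \<bullet> h)) (at x)" "\<And>b. b \<in> Basis \<Longrightarrow> Ck k (\<lambda>x. g x \<bullet> b)"
  shows "Ck (Suc k) f"
proof -
  have "grad f x = g x" for x using assms(1) grad_eqI by blast
  then show ?thesis unfolding Ck_Suc_iff using assms by simp
qed

lemma Ck_continuous: "Ck k f \<Longrightarrow> continuous_on UNIV f"
proof (cases k)
  case (Suc m)
  assume "Ck k f"
  then have "\<forall>x. f differentiable at x" using Suc by simp
  then show ?thesis
    by (simp add: continuous_at_imp_continuous_on differentiable_imp_continuous_within)
qed simp

lemma Ck_Suc_imp: "Ck (Suc k) f \<Longrightarrow> Ck k f"
proof (induction k arbitrary: f)
  case 0
  then show ?case using Ck_continuous[of "Suc 0" f] by simp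
qed simp

lemma Ck_const: "Ck k (\<lambda>x. c)"
  by (induction k arbitrary: c) auto

declare Ck.simps(2) [simp del]

lemma Ck_add: "Ck k f \<Longrightarrow> Ck k g \<Longrightarrow> Ck k (\<lambda>x. f x + g x)"
proof (induction k arbitrary: f g)
  case 0
  then show ?case by (auto intro: continuous_on_add)
next
  case (Suc k)
  show ?case
    by (rule Ck_SucI[where g="\<lambda>x. grad f x + grad g x"])
      (use Suc in \<open>auto simp: Ck_Suc_iff inner_add_left intro!: has_derivative_add\<close>)
qed

lemma Ck_mult: "Ck k f \<Longrightarrow> Ck k g \<Longrightarrow> Ck k (\<lambda>x. f x * g x)"
proof (induction k arbitrary: f g)
  case 0
  then show ?case by (auto intro: continuous_on_mult)
next
  case (Suc k)
  \<comment> \<open>The product rule multiplies each gradient by the other undifferentiated factor,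
    so the factors are needed at order \<open>k\<close> too.\<close>
  have f: "Ck k f" "Ck k g" using Suc Ck_Suc_imp by auto
  have df: "(f has_derivative (\<lambda>h. grad f x \<bullet> h)) (at x)" "(g has_derivative (\<lambda>h. grad g x \<bullet> h)) (at x)" for x
    using Suc.prems unfolding Ck_Suc_iff by auto
  show ?case
  proof (rule Ck_SucI[where g="\<lambda>x. f x *\<^sub>R grad g x + g x *\<^sub>R grad f x"])
    fix x
    show "((\<lambda>x. f x * g x) has_derivative (\<lambda>h. (f x *\<^sub>R grad g x + g x *\<^sub>R grad f x) \<bullet> h)) (at x)"
      by (rule has_derivative_eq_rhs[OF has_derivative_mult[OF df]]) (auto simp: inner_add_left)
  next
    fix b :: 'a assume b: "b \<in> Basis"
    have "Ck k (\<lambda>x. grad f x \<bullet> b)" "Ck k (\<lambda>x. grad g x \<bullet> b)"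
      using Suc.prems b unfolding Ck_Suc_iff by auto
    then have "Ck k (\<lambda>x. f x * (grad g x \<bullet> b) + g x * (grad f x \<bullet> b))"
      using Suc.IH f Ck_add by blast
    then show "Ck k (\<lambda>x. (f x *\<^sub>R grad g x + g x *\<^sub>R grad f x) \<bullet> b)"
      by (simp add: inner_add_left)
  qed
qed

lemma Ck_sum: "(\<And>i. i \<in> A \<Longrightarrow> Ck k (f i)) \<Longrightarrow> Ck k (\<lambda>x. \<Sum>i\<in>A. f i x)"
  by (induction A rule: infinite_finite_induct) (auto intro: Ck_const Ck_add)

lemma Ck_prod: "(\<And>i. i \<in> A \<Longrightarrow> Ck k (f i)) \<Longrightarrow> Ck k (\<lambda>x. \<Prod>i\<in>A. f i x)"
  by (induction A rule: infinite_finite_induct) (auto intro: Ck_const Ck_mult)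

lemma Ck_bounded_linear: "bounded_linear f \<Longrightarrow> Ck k f"
proof -
  assume f: "bounded_linear f"
  then have l: "linear f" by (simp add: bounded_linear.linear)
  have c: "continuous_on UNIV f" using f by (simp add: linear_continuous_on)
  define g where "g = (\<Sum>b\<in>Basis. f b *\<^sub>R b)"
  have "f h = g \<bullet> h" for h
  proof -
    have "f h = f (\<Sum>b\<in>Basis. (h \<bullet> b) *\<^sub>R b)" by (simp add: euclidean_representation)
    also have "\<dots> = g \<bullet> h"
      unfolding g_def inner_sum_left linear_sum[OF l] linear_cmul[OF l]
      by (intro sum.cong) (auto simp: inner_commute)
    finally show ?thesis .
  qed
  then have fg: "f = (\<lambda>h. g \<bullet> h)" by auto
  show ?thesis
  proof (cases k)
    case 0
    then show ?thesis using c by simp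
  next
    case (Suc m)
    have "(f has_derivative (\<lambda>h. g \<bullet> h)) (at x)" for x
      using f fg bounded_linear_imp_has_derivative by metis
    then show ?thesis unfolding Suc
      by (intro Ck_SucI[where g="\<lambda>_. g"]) (auto intro: Ck_const)
  qed
qed

text \<open>The sum is the adjoint of \<open>L\<close> applied to \<open>g\<close>, written in
  coordinates. Slicing and transverse scaling are the maps \<open>L\<close> to which this is applied
  later.\<close>

lemma has_derivative_affine_compose:
  fixes f :: "'b::euclidean_space \<Rightarrow> real" and L :: "'a::euclidean_space \<Rightarrow> 'b"
  assumes f: "(f has_derivative (\<lambda>h. g \<bullet> h)) (at (L x + c))" and L: "bounded_linear L"
  shows "((\<lambda>x. f (L x + c)) has_derivative (\<lambda>h. (\<Sum>b\<in>Basis. (g \<bullet> L b) *\<^sub>R b) \<bullet> h)) (at x)"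
proof -
  have "((\<lambda>x. L x + c) has_derivative L) (at x)"
    using L by (auto intro!: derivative_eq_intros bounded_linear_imp_has_derivative)
  from has_derivative_compose[OF this f] show ?thesis
  proof (rule has_derivative_eq_rhs)
    have l: "linear L" using L by (simp add: bounded_linear.linear)
    show "(\<lambda>h. g \<bullet> L h) = (\<lambda>h. (\<Sum>b\<in>Basis. (g \<bullet> L b) *\<^sub>R b) \<bullet> h)"
    proof
      fix h
      have "L h = L (\<Sum>b\<in>Basis. (h \<bullet> b) *\<^sub>R b)" by (simp add: euclidean_representation)
      also have "\<dots> = (\<Sum>b\<in>Basis. (h \<bullet> b) *\<^sub>R L b)"
        unfolding linear_sum[OF l] linear_cmul[OF l] by simp
      finally show "g \<bullet> L h = (\<Sum>b\<in>Basis. (g \<bullet> L b) *\<^sub>R b) \<bullet> h"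
        by (simp add: inner_sum_left inner_sum_right inner_commute mult.commute)
    qed
  qed
qed

lemma Ck_affine_compose:
  fixes f :: "'b::euclidean_space \<Rightarrow> real" and L :: "'a::euclidean_space \<Rightarrow> 'b"
  assumes "Ck k f" and L: "bounded_linear L"
  shows "Ck k (\<lambda>x. f (L x + c))"
  using assms(1)
proof (induction k arbitrary: f)
  case 0
  then show ?case
    using continuous_on_compose2[of UNIV f UNIV "\<lambda>x. L x + c"]
      continuous_on_add[OF linear_continuous_on[OF L] continuous_on_const] by simp
next
  case (Suc k)
  show ?case
  proof (rule Ck_SucI)
    show "((\<lambda>x. f (L x + c)) has_derivative (\<lambda>h. (\<Sum>b\<in>Basis. (grad f (L x + c) \<bullet> L b) *\<^sub>R b) \<bullet> h)) (at x)" for x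
      using Suc.prems L by (intro has_derivative_affine_compose) (auto simp: Ck_Suc_iff)
    fix b :: 'a assume b: "b \<in> Basis"
    have "Ck k (\<lambda>x. \<Sum>d\<in>Basis. (L b \<bullet> d) * (grad f (L x + c) \<bullet> d))"
      using Suc.prems by (intro Ck_sum Ck_mult Ck_const Suc.IH) (auto simp: Ck_Suc_iff)
    also have "(\<lambda>x. \<Sum>d\<in>Basis. (L b \<bullet> d) * (grad f (L x + c) \<bullet> d)) = (\<lambda>x. (\<Sum>b\<in>Basis. (grad f (L x + c) \<bullet> L b) *\<^sub>R b) \<bullet> b)"
      using b by (simp add: euclidean_inner[of _ "L b"] mult.commute)
    finally show "Ck k (\<lambda>x. (\<Sum>b\<in>Basis. (grad f (L x + c) \<bullet> L b) *\<^sub>R b) \<bullet> b)" .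
  qed
qed

lemma Ck_real_SucI:
  fixes f :: "real \<Rightarrow> real"
  assumes "\<And>x. (f has_real_derivative f' x) (at x)" "Ck k f'"
  shows "Ck (Suc k) f"
  using assms by (intro Ck_SucI[where g=f']) (auto simp: has_field_derivative_def)

lemma smooth_const: "smooth (\<lambda>x. c)"
  and smooth_add: "smooth f \<Longrightarrow> smooth g \<Longrightarrow> smooth (\<lambda>x. f x + g x)"
  and smooth_mult: "smooth f \<Longrightarrow> smooth g \<Longrightarrow> smooth (\<lambda>x. f x * g x)"
  and smooth_prod: "(\<And>i. i \<in> A \<Longrightarrow> smooth (F i)) \<Longrightarrow> smooth (\<lambda>x. \<Prod>i\<in>A. F i x)"
  and smooth_bounded_linear: "bounded_linear f \<Longrightarrow> smooth f"
  by (auto simp: smooth_def Ck_const Ck_add Ck_mult Ck_prod Ck_bounded_linear)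

lemma smooth_affine_compose:
  fixes f :: "'b::euclidean_space \<Rightarrow> real" and L :: "'a::euclidean_space \<Rightarrow> 'b"
  shows "smooth f \<Longrightarrow> bounded_linear L \<Longrightarrow> smooth (\<lambda>x. f (L x + c))"
  unfolding smooth_def using Ck_affine_compose by blast

lemma smooth_uminus: "smooth f \<Longrightarrow> smooth (\<lambda>x. - f x)"
  using smooth_mult[OF smooth_const[of "-1"]] by force

lemma smooth_diff: "smooth f \<Longrightarrow> smooth g \<Longrightarrow> smooth (\<lambda>x. f x - g x)"
  using smooth_add smooth_uminus by fastforce

text \<open>Makes the polynomials of the Stone-Weierstrass theorem available as smooth
  approximants.\<close>

lemma smooth_real_polynomial_function: "real_polynomial_function p \<Longrightarrow> smooth p"
  by (induction rule: real_polynomial_function.induct)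
    (auto intro: smooth_const smooth_add smooth_mult smooth_bounded_linear)

lemma smooth_continuous: "smooth f \<Longrightarrow> continuous_on S f"
  unfolding smooth_def using Ck_continuous continuous_on_subset by blast

lemma smooth_has_derivative: "smooth f \<Longrightarrow> (f has_derivative (\<lambda>h. grad f x \<bullet> h)) (at x)"
  unfolding smooth_def using Ck_Suc_iff[of 0 f] by blast

lemma smooth_grad_inner:
  assumes "smooth f" "b \<in> Basis" shows "smooth (\<lambda>x. grad f x \<bullet> b)"
  unfolding smooth_def
proof
  fix k
  have "Ck (Suc k) f" using assms unfolding smooth_def by blast
  then show "Ck k (\<lambda>x. grad f x \<bullet> b)" unfolding Ck_Suc_iff using assms by blast
qed

lemma smooth_grad_continuous: "smooth f \<Longrightarrow> continuous_on S (grad f)"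
  by (subst continuous_on_componentwise) (auto intro: smooth_continuous smooth_grad_inner)

lemma grad_mult:
  "smooth f \<Longrightarrow> smooth g \<Longrightarrow> grad (\<lambda>x. f x * g x) x = f x *\<^sub>R grad g x + g x *\<^sub>R grad f x"
  by (rule grad_eqI, rule has_derivative_eq_rhs[OF has_derivative_mult])
    (auto intro: smooth_has_derivative simp: inner_add_left)

lemma grad_diff: "smooth f \<Longrightarrow> smooth g \<Longrightarrow> grad (\<lambda>x. f x - g x) x = grad f x - grad g x"
  by (rule grad_eqI) (auto intro!: has_derivative_diff smooth_has_derivative simp: inner_diff_left)

subsection \<open>Bump functions\<close>

text \<open>The usual flat function is the case \<open>n = 0\<close>. The powers of
  \<open>1 / x\<close> are added because the resulting family is closed under differentiation up to
  linear combinations, so that smoothness becomes an induction over all \<open>n\<close> at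
  once.\<close>

definition exp_recip :: "nat \<Rightarrow> real \<Rightarrow> real" where
  "exp_recip n x = (if x > 0 then (1 / x) ^ n * exp (- (1 / x)) else 0)"

lemma exp_recip_tendsto_0: "((\<lambda>x. (1 / x) ^ n * exp (- (1 / x))) \<longlongrightarrow> 0) (at_right (0::real))"
proof -
  have "((\<lambda>x::real. x ^ n / exp x) \<longlongrightarrow> 0) at_top" by (rule tendsto_power_div_exp_0)
  then have "((\<lambda>x::real. (inverse x) ^ n / exp (inverse x)) \<longlongrightarrow> 0) (at_right 0)"
    by (rule filterlim_compose[OF _ filterlim_inverse_at_top_right])
  then show ?thesis by (simp add: exp_minus field_simps)
qed

lemma exp_recip_has_derivative:
  "(exp_recip n has_real_derivative (exp_recip (n + 2) x - n * exp_recip (n + 1) x)) (at x)"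
proof -
  consider "x > 0" | "x < 0" | "x = 0" by linarith
  then show ?thesis
  proof cases
    case 1
    have "((\<lambda>x. (1 / x) ^ n * exp (- (1 / x))) has_real_derivative
        (1 / x) ^ n * ((1/x)^2 * exp (- (1 / x))) + (of_nat n * (1/x)^(n - 1) * (- ((1/x)^2))) * exp (- (1/x))) (at x)"
      using 1 by (auto intro!: derivative_eq_intros simp: power2_eq_square divide_inverse)
    moreover have "(1 / x) ^ n * ((1/x)^2 * exp (- (1 / x))) + (of_nat n * (1/x)^(n - 1) * (- ((1/x)^2))) * exp (- (1/x))
       = exp_recip (n + 2) x - n * exp_recip (n + 1) x"
      using 1 by (cases n) (auto simp: exp_recip_def power2_eq_square algebra_simps divide_inverse)
    ultimately have d: "((\<lambda>x. (1 / x) ^ n * exp (- (1 / x))) has_real_derivative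
        exp_recip (n + 2) x - n * exp_recip (n + 1) x) (at x)"
      by simp
    show ?thesis
      by (rule has_field_derivative_transform_within_open[OF d, of "{0<..}"]) (use 1 in \<open>auto simp: exp_recip_def\<close>)
  next
    case 2
    have d: "((\<lambda>_. 0) has_real_derivative exp_recip (n + 2) x - n * exp_recip (n + 1) x) (at x)"
      using 2 by (simp add: exp_recip_def)
    show ?thesis
      by (rule has_field_derivative_transform_within_open[OF d, of "{..<0}"]) (use 2 in \<open>auto simp: exp_recip_def\<close>)
  next
    case 3
    \<comment> \<open>To the right of \<open>0\<close> the difference quotient is the same
      expression with exponent \<open>Suc n\<close>, which tends to \<open>0\<close> as
      well.\<close>
    have r: "((\<lambda>y. (exp_recip n y - exp_recip n 0) / (y - 0)) \<longlongrightarrow> 0) (at_right 0)"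
    proof (rule Lim_transform_eventually[OF exp_recip_tendsto_0[of "Suc n"]])
      show "\<forall>\<^sub>F y in at_right 0. (1 / y) ^ Suc n * exp (- (1 / y)) = (exp_recip n y - exp_recip n 0) / (y - 0)"
        using eventually_at_right_less[of 0] by eventually_elim (auto simp: exp_recip_def)
    qed
    have l: "((\<lambda>y. (exp_recip n y - exp_recip n 0) / (y - 0)) \<longlongrightarrow> 0) (at_left 0)"
    proof (rule Lim_transform_eventually[OF tendsto_const])
      show "\<forall>\<^sub>F y in at_left 0. 0 = (exp_recip n y - exp_recip n 0) / (y - 0)"
        unfolding eventually_at_filter by (rule always_eventually) (auto simp: exp_recip_def)
    qed
    have "(exp_recip n has_real_derivative 0) (at 0)"
      unfolding has_field_derivative_iff using filterlim_split_at[OF l r] by simp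
    then show ?thesis using 3 by (simp add: exp_recip_def)
  qed
qed

lemma Ck_exp_recip: "Ck k (exp_recip n)"
proof (induction k arbitrary: n)
  case 0
  show ?case
    using exp_recip_has_derivative DERIV_isCont
    by (simp add: continuous_on_eq_continuous_at) blast
next
  case (Suc k)
  have "Ck k (\<lambda>x. exp_recip (n + 2) x + (- real n) * exp_recip (n + 1) x)"
    by (intro Ck_add Ck_mult Ck_const Suc.IH)
  then show ?case
    by (intro Ck_real_SucI[OF exp_recip_has_derivative]) simp
qed

text \<open>Subtracting \<open>1\<close> makes the bump vanish within distance \<open>1 / k\<close>
  of every face, so that its support is compact in the open box. The growing factor \<open>k\<close>
  makes the values tend to \<open>1\<close> at each interior point.\<close>

definition box_bump :: "nat \<Rightarrow> 'a::euclidean_space \<Rightarrow> 'a \<Rightarrow> 'a \<Rightarrow> real" where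
  "box_bump k p q x = (\<Prod>b\<in>Basis. exp_recip 0 (real k * ((x - p) \<bullet> b) - 1) * exp_recip 0 (real k * ((q - x) \<bullet> b) - 1))"

lemma exp_recip_0_bounds: "0 \<le> exp_recip 0 x" "exp_recip 0 x \<le> 1"
  by (auto simp: exp_recip_def)

lemma smooth_box_bump: "smooth (box_bump k p q)"
proof -
  have e: "smooth (exp_recip 0)" by (simp add: smooth_def Ck_exp_recip)
  have 1: "smooth (\<lambda>x. exp_recip 0 (real k * ((x - p) \<bullet> b) - 1))" for b
  proof -
    have "smooth (\<lambda>x. exp_recip 0 (real k * (x \<bullet> b) + (- real k * (p \<bullet> b) - 1)))"
      by (rule smooth_affine_compose[OF e]) (intro bounded_linear_intros)
    then show ?thesis by (simp add: algebra_simps inner_diff_left)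
  qed
  have 2: "smooth (\<lambda>x. exp_recip 0 (real k * ((q - x) \<bullet> b) - 1))" for b
  proof -
    have "smooth (\<lambda>x. exp_recip 0 ((- real k) * (x \<bullet> b) + (real k * (q \<bullet> b) - 1)))"
      by (rule smooth_affine_compose[OF e]) (intro bounded_linear_intros)
    then show ?thesis by (simp add: algebra_simps inner_diff_left)
  qed
  have "smooth (\<lambda>x. \<Prod>b\<in>Basis. exp_recip 0 (real k * ((x - p) \<bullet> b) - 1) * exp_recip 0 (real k * ((q - x) \<bullet> b) - 1))"
    by (intro smooth_prod smooth_mult 1 2)
  then show ?thesis
    unfolding box_bump_def by simp
qed

lemma box_bump_bounds: "0 \<le> box_bump k p q x" "box_bump k p q x \<le> 1"
  unfolding box_bump_def
  by (auto intro!: prod_nonneg prod_le_1 mult_nonneg_nonneg mult_le_one simp: exp_recip_0_bounds)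

lemma box_bump_support: "\<exists>K. compact K \<and> K \<subseteq> box p q \<and> {x. box_bump k p q x \<noteq> 0} \<subseteq> K"
proof (intro exI conjI)
  let ?o = "(1 / real k) *\<^sub>R One :: 'a"
  \<comment> \<open>For \<open>k = 0\<close> every factor is \<open>exp_recip 0 (- 1) = 0\<close>;
    the bump vanishes identically and the empty set serves.\<close>
  show "compact (if k = 0 then {} else cbox (p + ?o) (q - ?o))" by simp
  show "(if k = 0 then {} else cbox (p + ?o) (q - ?o)) \<subseteq> box p q"
    by (auto simp: mem_box inner_add_left inner_diff_left) (smt (verit) divide_pos_pos of_nat_0_less_iff neq0_conv)+
  show "{x. box_bump k p q x \<noteq> 0} \<subseteq> (if k = 0 then {} else cbox (p + ?o) (q - ?o))"
  proof
    fix x assume "x \<in> {x. box_bump k p q x \<noteq> 0}"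
    then have *: "exp_recip 0 (real k * ((x - p) \<bullet> b) - 1) \<noteq> 0" "exp_recip 0 (real k * ((q - x) \<bullet> b) - 1) \<noteq> 0" if "b \<in> Basis" for b
      using that unfolding box_bump_def by auto
    then have **: "real k * ((x - p) \<bullet> b) > 1" "real k * ((q - x) \<bullet> b) > 1" if "b \<in> Basis" for b
      using *[OF that] unfolding exp_recip_def by (metis diff_gt_0_iff_gt)+
    obtain b0 :: 'a where b0: "b0 \<in> Basis" using nonempty_Basis by blast
    have k: "k \<noteq> 0"
      using **(1)[OF b0] by (cases k) auto
    then show "x \<in> (if k = 0 then {} else cbox (p + ?o) (q - ?o))"
      using ** by (fastforce simp: mem_box inner_add_left inner_diff_left field_simps)
  qed
qed

lemma box_bump_tendsto:
  assumes "x \<in> box p q" shows "(\<lambda>k. box_bump k p q x) \<longlonglongrightarrow> 1"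
proof -
  have 1: "(\<lambda>k. exp_recip 0 (real k * c - 1)) \<longlonglongrightarrow> 1" if "c > 0" for c
  proof -
    have lim: "filterlim (\<lambda>k. real k * c - 1) at_top sequentially"
      using filterlim_tendsto_add_at_top[OF tendsto_const[of "-1"]
          filterlim_at_top_mult_tendsto_pos[OF tendsto_const that filterlim_real_sequentially]] by simp
    have "(\<lambda>k. exp (- (1 / (real k * c - 1)))) \<longlonglongrightarrow> exp (- 0)"
      by (intro tendsto_intros tendsto_divide_0[OF tendsto_const] filterlim_at_top_imp_at_infinity lim)
    moreover have "\<forall>\<^sub>F k in sequentially. exp (- (1 / (real k * c - 1))) = exp_recip 0 (real k * c - 1)"
      using lim[unfolded filterlim_at_top_dense, rule_format, of 0] by eventually_elim (simp add: exp_recip_def)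
    ultimately show ?thesis by (simp add: Lim_transform_eventually)
  qed
  have "(\<lambda>k. box_bump k p q x) \<longlonglongrightarrow> (\<Prod>b\<in>(Basis::'a set). 1 * 1)"
    unfolding box_bump_def using assms
    by (intro tendsto_prod tendsto_mult 1) (auto simp: mem_box inner_diff_left)
  then show ?thesis by simp
qed

lemma test_functionsI:
  assumes "smooth f" "compact K" "K \<subseteq> S" "{x. f x \<noteq> 0} \<subseteq> K"
  shows "f \<in> test_functions S"
proof -
  have "closure {x. f x \<noteq> 0} \<subseteq> K"
    using assms(2,4) by (simp add: closure_minimal compact_imp_closed)
  then show ?thesis unfolding test_functions_def
    using assms bounded_subset[OF compact_imp_bounded] by auto
qed

lemma test_functionsE:
  assumes "f \<in> test_functions S"
  obtains K where "smooth f" "compact K" "K \<subseteq> S" "{x. f x \<noteq> 0} \<subseteq> K"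
  using assms that[of "closure {x. f x \<noteq> 0}"] closure_subset[of "{x. f x \<noteq> 0}"]
  unfolding test_functions_def by simp

lemma test_functions_mult:
  assumes "f \<in> test_functions S" "smooth g"
  shows "(\<lambda>x. g x * f x) \<in> test_functions S"
proof -
  obtain K where "smooth f" "compact K" "K \<subseteq> S" "{x. f x \<noteq> 0} \<subseteq> K"
    using assms test_functionsE by blast
  then show ?thesis using assms by (intro test_functionsI[of _ K]) (auto intro: smooth_mult)
qed

text \<open>An open set is a countable union of open boxes. One minus the product of the complements
  \<open>1 - \<beta>\<close> of the first \<open>k\<close> bumps acts as a smooth union: it is
  supported in finitely many compact sets, stays between \<open>0\<close> and \<open>1\<close>, and
  dominates each of these bumps.\<close>

lemma open_cutoffs:
  fixes S :: "'a::euclidean_space set"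
  assumes "open S"
  obtains \<zeta> :: "nat \<Rightarrow> 'a \<Rightarrow> real" where "\<And>k. \<zeta> k \<in> test_functions S" "\<And>k x. 0 \<le> \<zeta> k x" "\<And>k x. \<zeta> k x \<le> 1"
    "\<And>x. x \<in> S \<Longrightarrow> (\<lambda>k. \<zeta> k x) \<longlonglongrightarrow> 1"
proof -
  obtain \<D> :: "'a set set" where D: "countable \<D>" "\<D> \<subseteq> Pow S" "\<And>X. X \<in> \<D> \<Longrightarrow> \<exists>a b. X = box a b" "\<Union>\<D> = S"
    using open_countable_Union_open_box[OF assms] by metis
  obtain a b where ab: "\<And>X. X \<in> \<D> \<Longrightarrow> X = box (a X) (b X)"
    using D(3) by metis
  define P where "P i = (a (from_nat_into \<D> i), b (from_nat_into \<D> i))" for i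
  have P: "\<exists>i. X = box (fst (P i)) (snd (P i))" if "X \<in> \<D>" for X
    using from_nat_into_surj[OF D(1) that] ab[OF that] unfolding P_def by auto
  \<comment> \<open>For an empty \<open>\<D>\<close> the enumeration returns arbitrary boxes; any
    box that leaves \<open>S\<close> is replaced by the empty \<open>box 0 0\<close>.\<close>
  define Q where "Q i = (if box (fst (P i)) (snd (P i)) \<subseteq> S then P i else (0, 0))" for i
  have Qs: "box (fst (Q i)) (snd (Q i)) \<subseteq> S" for i by (auto simp: Q_def)
  have Qc: "\<exists>i. x \<in> box (fst (Q i)) (snd (Q i))" if x: "x \<in> S" for x
  proof -
    obtain X where X: "X \<in> \<D>" "x \<in> X" using x D(4) by blast
    obtain i where i: "X = box (fst (P i)) (snd (P i))" using P X by blast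
    have "X \<subseteq> S" using X D(2) by blast
    then show ?thesis using X i unfolding Q_def by (intro exI[of _ i]) auto
  qed
  define \<beta> where "\<beta> i k = box_bump k (fst (Q i)) (snd (Q i))" for i k
  define \<zeta> where "\<zeta> k x = 1 - (\<Prod>i<k. 1 - \<beta> i k x)" for k x
  have b: "0 \<le> 1 - \<beta> i k x" "1 - \<beta> i k x \<le> 1" for i k x
    unfolding \<beta>_def using box_bump_bounds[of k "fst (Q i)" "snd (Q i)" x] by auto
  show thesis
  proof (rule that[of \<zeta>])
    fix k
    show "\<zeta> k x \<le> 1" for x unfolding \<zeta>_def using b by (simp add: prod_nonneg)
    show "0 \<le> \<zeta> k x" for x unfolding \<zeta>_def using b by (simp add: prod_le_1)
    have "\<forall>i. \<exists>K. compact K \<and> K \<subseteq> S \<and> {x. \<beta> i k x \<noteq> 0} \<subseteq> K"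
      unfolding \<beta>_def using box_bump_support Qs by (metis subset_trans)
    then obtain K where K: "\<And>i. compact (K i)" "\<And>i. K i \<subseteq> S" "\<And>i. {x. \<beta> i k x \<noteq> 0} \<subseteq> K i"
      by metis
    show "\<zeta> k \<in> test_functions S"
    proof (rule test_functionsI)
      show "smooth (\<zeta> k)" unfolding \<zeta>_def \<beta>_def
        by (intro smooth_diff smooth_const smooth_prod smooth_box_bump)
      show "compact (\<Union>i<k. K i)" using K by (intro compact_UN) auto
      show "(\<Union>i<k. K i) \<subseteq> S" using K by blast
      show "{x. \<zeta> k x \<noteq> 0} \<subseteq> (\<Union>i<k. K i)"
      proof
        fix x assume "x \<in> {x. \<zeta> k x \<noteq> 0}"
        then have "\<exists>i<k. \<beta> i k x \<noteq> 0" unfolding \<zeta>_def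
          by (metis (mono_tags, lifting) diff_zero lessThan_iff mem_Collect_eq prod.neutral right_minus_eq)
        then show "x \<in> (\<Union>i<k. K i)" using K(3) by blast
      qed
    qed
  next
    fix x assume "x \<in> S"
    then obtain m where m: "x \<in> box (fst (Q m)) (snd (Q m))" using Qc by blast
    have l1: "(\<lambda>k. \<beta> m k x) \<longlonglongrightarrow> 1" unfolding \<beta>_def using box_bump_tendsto[OF m] .
    \<comment> \<open>Once \<open>k\<close> exceeds \<open>m\<close> the product contains the factor
      of index \<open>m\<close>, and all other factors are at most \<open>1\<close>.\<close>
    have l2: "\<forall>\<^sub>F k in sequentially. \<beta> m k x \<le> \<zeta> k x"
    proof (rule eventually_sequentiallyI[of "Suc m"])
      fix k assume "Suc m \<le> k"
      then have "(\<Prod>i<k. 1 - \<beta> i k x) = (1 - \<beta> m k x) * (\<Prod>i\<in>{..<k} - {m}. 1 - \<beta> i k x)"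
        by (intro prod.remove) auto
      also have "\<dots> \<le> (1 - \<beta> m k x) * 1"
        using b by (intro mult_left_mono prod_le_1) auto
      finally show "\<beta> m k x \<le> \<zeta> k x" unfolding \<zeta>_def by simp
    qed
    have l3: "\<forall>\<^sub>F k in sequentially. \<zeta> k x \<le> 1"
      unfolding \<zeta>_def using b by (intro always_eventually) (simp add: prod_nonneg)
    show "(\<lambda>k. \<zeta> k x) \<longlonglongrightarrow> 1"
      by (rule tendsto_sandwich[OF l2 l3 l1 tendsto_const])
  qed
qed

subsection \<open>Square-integrable functions\<close>

text \<open>Stated for an arbitrary measure because the same estimates are used for
  \<open>lebesgue_on S\<close> and for \<open>restrict_space lborel A\<close>.\<close>

definition sq_integrable :: "'m measure \<Rightarrow> ('m \<Rightarrow> 'b::euclidean_space) \<Rightarrow> bool" where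
  "sq_integrable M f \<longleftrightarrow> f \<in> borel_measurable M \<and> integrable M (\<lambda>x. (norm (f x))\<^sup>2)"

definition l2norm :: "'m measure \<Rightarrow> ('m \<Rightarrow> 'b::euclidean_space) \<Rightarrow> real" where
  "l2norm M f = sqrt (\<integral>x. (norm (f x))\<^sup>2 \<partial>M)"

lemma L2_iff: "f \<in> L2 S \<longleftrightarrow> sq_integrable (lebesgue_on S) f"
  by (simp add: L2_def sq_integrable_def)

lemma L2_norm_eq: "L2_norm S f = l2norm (lebesgue_on S) f"
  by (simp add: L2_norm_def L2_inner_def l2norm_def dot_square_norm)

lemma l2norm_nonneg: "0 \<le> l2norm M f"
  by (simp add: l2norm_def)

lemma l2norm_power2: "(l2norm M f)\<^sup>2 = (\<integral>x. (norm (f x))\<^sup>2 \<partial>M)"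
  by (simp add: l2norm_def)

lemma sq_integrable_inner:
  assumes "sq_integrable M f" "sq_integrable M g"
  shows "integrable M (\<lambda>x. f x \<bullet> g x)"
proof (rule Bochner_Integration.integrable_bound)
  show "integrable M (\<lambda>x. (norm (f x))\<^sup>2 + (norm (g x))\<^sup>2)"
    using assms by (auto simp: sq_integrable_def)
  show "(\<lambda>x. f x \<bullet> g x) \<in> borel_measurable M"
    using assms by (auto simp: sq_integrable_def)
  have "\<bar>f x \<bullet> g x\<bar> \<le> (norm (f x))\<^sup>2 + (norm (g x))\<^sup>2" for x
  proof -
    have "\<bar>f x \<bullet> g x\<bar> \<le> norm (f x) * norm (g x)" by (rule Cauchy_Schwarz_ineq2)
    also have "\<dots> \<le> 2 * norm (f x) * norm (g x)" by simp
    also have "\<dots> \<le> (norm (f x))\<^sup>2 + (norm (g x))\<^sup>2"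
      by (rule sum_squares_bound)
    finally show ?thesis .
  qed
  then show "AE x in M. norm (f x \<bullet> g x) \<le> norm ((norm (f x))\<^sup>2 + (norm (g x))\<^sup>2)"
    by (intro AE_I2) (auto intro: order_trans[OF _ abs_ge_self])
qed

lemma sq_integrable_mult:
  fixes f g :: "'m \<Rightarrow> real"
  shows "sq_integrable M f \<Longrightarrow> sq_integrable M g \<Longrightarrow> integrable M (\<lambda>x. f x * g x)"
  using sq_integrable_inner[of M f g] by simp

lemma sq_integrable_add:
  assumes "sq_integrable M f" "sq_integrable M g"
  shows "sq_integrable M (\<lambda>x. f x + g x)"
  unfolding sq_integrable_def
proof
  show "(\<lambda>x. f x + g x) \<in> borel_measurable M" using assms by (auto simp: sq_integrable_def)
  have "integrable M (\<lambda>x. (norm (f x))\<^sup>2 + (norm (g x))\<^sup>2 + 2 * (f x \<bullet> g x))"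
    using assms sq_integrable_inner[OF assms] by (auto simp: sq_integrable_def)
  moreover have "(norm (f x))\<^sup>2 + (norm (g x))\<^sup>2 + 2 * (f x \<bullet> g x) = (norm (f x + g x))\<^sup>2" for x
    by (simp add: power2_norm_eq_inner inner_add_left inner_add_right inner_commute)
  ultimately show "integrable M (\<lambda>x. (norm (f x + g x))\<^sup>2)" by simp
qed

lemma sq_integrable_scaleR: "sq_integrable M f \<Longrightarrow> sq_integrable M (\<lambda>x. c *\<^sub>R f x)"
  by (auto simp: sq_integrable_def power_mult_distrib)

lemma sq_integrable_cmult: "sq_integrable M f \<Longrightarrow> sq_integrable M (\<lambda>x. c * f x :: real)"
  using sq_integrable_scaleR[of M f c] by simp

lemma sq_integrable_diff:
  "sq_integrable M f \<Longrightarrow> sq_integrable M g \<Longrightarrow> sq_integrable M (\<lambda>x. f x - g x)"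
  using sq_integrable_add[of M f "\<lambda>x. - g x"] sq_integrable_scaleR[of M g "-1"] by simp

lemma sq_integrable_inner_const: "sq_integrable M f \<Longrightarrow> sq_integrable M (\<lambda>x. f x \<bullet> b)"
proof -
  assume f: "sq_integrable M f"
  have "integrable M (\<lambda>x. (norm (f x \<bullet> b))\<^sup>2)"
  proof (rule Bochner_Integration.integrable_bound)
    show "integrable M (\<lambda>x. (norm (f x))\<^sup>2 * (norm b)\<^sup>2)" using f by (auto simp: sq_integrable_def)
    show "(\<lambda>x. (norm (f x \<bullet> b))\<^sup>2) \<in> borel_measurable M" using f by (auto simp: sq_integrable_def)
    have "(norm (f x \<bullet> b))\<^sup>2 \<le> (norm (f x))\<^sup>2 * (norm b)\<^sup>2" for x
      using Cauchy_Schwarz_ineq2[of "f x" b] by (metis norm_ge_zero power_mono power_mult_distrib real_norm_def)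
    then show "AE x in M. norm ((norm (f x \<bullet> b))\<^sup>2) \<le> norm ((norm (f x))\<^sup>2 * (norm b)\<^sup>2)" by simp
  qed
  then show ?thesis using f by (auto simp: sq_integrable_def)
qed

lemma sq_integrable_bounded:
  assumes "finite_measure M" "f \<in> borel_measurable M" "\<And>x. x \<in> space M \<Longrightarrow> norm (f x) \<le> B"
  shows "sq_integrable M f"
proof -
  have "(norm (f x))\<^sup>2 \<le> B\<^sup>2" if "x \<in> space M" for x using assms(3)[OF that] by (simp add: power_mono)
  then show ?thesis unfolding sq_integrable_def
    using assms(1,2) by (auto intro!: finite_measure.integrable_const_bound[where B="B\<^sup>2"])
qed

lemma sq_integrable_AE_cong:
  "sq_integrable M f \<Longrightarrow> g \<in> borel_measurable M \<Longrightarrow> (AE x in M. f x = g x) \<Longrightarrow> sq_integrable M g"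
  unfolding sq_integrable_def by (auto intro: integrable_cong_AE_imp)

lemma l2norm_AE_cong:
  "f \<in> borel_measurable M \<Longrightarrow> g \<in> borel_measurable M \<Longrightarrow> (AE x in M. f x = g x) \<Longrightarrow> l2norm M f = l2norm M g"
  unfolding l2norm_def by (auto intro!: arg_cong[of _ _ sqrt] integral_cong_AE)

text \<open>The squared norm of \<open>f - t g\<close> is a quadratic in \<open>t\<close> that is
  never negative.\<close>

lemma l2_Cauchy_Schwarz:
  assumes f: "sq_integrable M f" and g: "sq_integrable M g"
  shows "\<bar>\<integral>x. f x \<bullet> g x \<partial>M\<bar> \<le> l2norm M f * l2norm M g"
proof -
  define F where "F = (\<integral>x. (norm (f x))\<^sup>2 \<partial>M)"
  define G where "G = (\<integral>x. (norm (g x))\<^sup>2 \<partial>M)"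
  define I where "I = (\<integral>x. f x \<bullet> g x \<partial>M)"
  have q: "0 \<le> F - 2 * t * I + t\<^sup>2 * G" for t
  proof -
    have "0 \<le> (\<integral>x. (norm (f x - t *\<^sub>R g x))\<^sup>2 \<partial>M)" by simp
    also have "\<dots> = (\<integral>x. (norm (f x))\<^sup>2 - 2 * t * (f x \<bullet> g x) + t\<^sup>2 * (norm (g x))\<^sup>2 \<partial>M)"
    proof (intro Bochner_Integration.integral_cong refl)
      fix x
      show "(norm (f x - t *\<^sub>R g x))\<^sup>2 = (norm (f x))\<^sup>2 - 2 * t * (f x \<bullet> g x) + t\<^sup>2 * (norm (g x))\<^sup>2"
        unfolding power2_norm_eq_inner
        by (simp add: inner_diff_left inner_diff_right inner_commute power2_eq_square algebra_simps)
    qed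
    also have "\<dots> = F - 2 * t * I + t\<^sup>2 * G"
      unfolding F_def G_def I_def
      using f g sq_integrable_inner[OF f g] by (simp add: sq_integrable_def)
    finally show ?thesis .
  qed
  have G0: "0 \<le> G" unfolding G_def by simp
  have "I\<^sup>2 \<le> F * G"
  proof (cases "G = 0")
    case True
    have "I = 0"
    proof (rule ccontr)
      assume "I \<noteq> 0"
      \<comment> \<open>At this \<open>t\<close> the quadratic, linear because \<open>G = 0\<close>,
        takes the value \<open>- 1\<close>.\<close>
      then show False using q[of "(F + 1) / (2 * I)"] True by simp
    qed
    then show ?thesis using True by simp
  next
    case False
    then have G: "G > 0" using G0 by simp
    \<comment> \<open>\<open>I / G\<close> is the minimiser of the quadratic.\<close>
    have "0 \<le> F - 2 * (I / G) * I + (I / G)\<^sup>2 * G" by (rule q)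
    then have "0 \<le> F - I\<^sup>2 / G" using G by (simp add: power2_eq_square)
    then show ?thesis using G by (simp add: field_simps)
  qed
  then have "sqrt (I\<^sup>2) \<le> sqrt (F * G)" by (rule real_sqrt_le_mono)
  then show ?thesis unfolding I_def F_def G_def l2norm_def by (simp add: real_sqrt_mult)
qed

lemma l2_Cauchy_Schwarz_real:
  fixes f g :: "'m \<Rightarrow> real"
  shows "sq_integrable M f \<Longrightarrow> sq_integrable M g \<Longrightarrow> \<bar>\<integral>x. f x * g x \<partial>M\<bar> \<le> l2norm M f * l2norm M g"
  using l2_Cauchy_Schwarz[of M f g] by simp

lemma l2norm_triangle:
  assumes f: "sq_integrable M f" and g: "sq_integrable M g"
  shows "l2norm M (\<lambda>x. f x + g x) \<le> l2norm M f + l2norm M g"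
proof (rule power2_le_imp_le)
  have "(l2norm M (\<lambda>x. f x + g x))\<^sup>2 = (\<integral>x. (norm (f x))\<^sup>2 + 2 * (f x \<bullet> g x) + (norm (g x))\<^sup>2 \<partial>M)"
    unfolding l2norm_power2
    by (intro Bochner_Integration.integral_cong)
      (auto simp: power2_norm_eq_inner inner_add_left inner_add_right inner_commute)
  also have "\<dots> = (l2norm M f)\<^sup>2 + 2 * (\<integral>x. f x \<bullet> g x \<partial>M) + (l2norm M g)\<^sup>2"
    unfolding l2norm_power2 using f g sq_integrable_inner[OF f g] by (simp add: sq_integrable_def)
  also have "\<dots> \<le> (l2norm M f)\<^sup>2 + 2 * (l2norm M f * l2norm M g) + (l2norm M g)\<^sup>2"
    using l2_Cauchy_Schwarz[OF f g] by simp
  also have "\<dots> = (l2norm M f + l2norm M g)\<^sup>2" by (simp add: power2_sum)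
  finally show "(l2norm M (\<lambda>x. f x + g x))\<^sup>2 \<le> (l2norm M f + l2norm M g)\<^sup>2" .
  show "0 \<le> l2norm M f + l2norm M g" by (simp add: l2norm_nonneg)
qed

lemma l2norm_uminus: "l2norm M (\<lambda>x. - f x) = l2norm M f"
  by (simp add: l2norm_def)

lemma l2norm_minus_commute: "l2norm M (\<lambda>x. f x - g x) = l2norm M (\<lambda>x. g x - f x)"
  by (simp add: l2norm_def norm_minus_commute)

lemma l2norm_triangle_diff:
  assumes "sq_integrable M f" "sq_integrable M g" "sq_integrable M h"
  shows "l2norm M (\<lambda>x. f x - h x) \<le> l2norm M (\<lambda>x. f x - g x) + l2norm M (\<lambda>x. g x - h x)"
  using l2norm_triangle[OF sq_integrable_diff[OF assms(1,2)] sq_integrable_diff[OF assms(2,3)]] by simp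

lemma l2norm_le_add_diff:
  assumes "sq_integrable M f" "sq_integrable M g"
  shows "l2norm M f \<le> l2norm M g + l2norm M (\<lambda>x. f x - g x)"
  using l2norm_triangle[OF assms(2) sq_integrable_diff[OF assms]] by simp

lemma l2norm_inner_Basis_le:
  assumes f: "sq_integrable M f" and "b \<in> Basis"
  shows "l2norm M (\<lambda>x. f x \<bullet> b) \<le> l2norm M f"
  unfolding l2norm_def real_sqrt_le_iff
proof (rule integral_mono)
  show "integrable M (\<lambda>x. (norm (f x \<bullet> b))\<^sup>2)" "integrable M (\<lambda>x. (norm (f x))\<^sup>2)"
    using f sq_integrable_inner_const[OF f] by (auto simp: sq_integrable_def)
  show "(norm (f x \<bullet> b))\<^sup>2 \<le> (norm (f x))\<^sup>2" for x
    using power_mono[OF Basis_le_norm[OF assms(2), of "f x"], of 2] by simp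
qed

lemma l2norm_eq_0_imp:
  assumes f: "sq_integrable M f" and "l2norm M f = 0" shows "AE x in M. f x = 0"
proof -
  have "AE x in M. (norm (f x))\<^sup>2 = 0"
    using f assms(2) integral_nonneg_eq_0_iff_AE[of M "\<lambda>x. (norm (f x))\<^sup>2"]
    by (auto simp: sq_integrable_def l2norm_def)
  then show ?thesis by simp
qed

lemma l2norm_tendsto_0_dominated:
  assumes f: "sq_integrable M f" "\<And>k::nat. F k \<in> borel_measurable M" and w: "integrable M w"
    and lim: "AE x in M. (\<lambda>k. F k x) \<longlonglongrightarrow> f x" and le: "\<And>k x. x \<in> space M \<Longrightarrow> (norm (F k x - f x))\<^sup>2 \<le> w x"
  shows "(\<lambda>k. l2norm M (\<lambda>x. F k x - f x)) \<longlonglongrightarrow> 0"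
proof -
  have m[measurable]: "F k \<in> borel_measurable M" "f \<in> borel_measurable M" for k using f by (auto simp: sq_integrable_def)
  have "(\<lambda>k. \<integral>x. (norm (F k x - f x))\<^sup>2 \<partial>M) \<longlonglongrightarrow> (\<integral>x. 0 \<partial>M)"
  proof (rule integral_dominated_convergence[OF _ _ w])
    show "AE x in M. (\<lambda>k. (norm (F k x - f x))\<^sup>2) \<longlonglongrightarrow> 0"
      using lim
    proof eventually_elim
      fix x assume "(\<lambda>k. F k x) \<longlonglongrightarrow> f x"
      from tendsto_power[OF tendsto_norm[OF tendsto_diff[OF this tendsto_const[of "f x"]]], of 2]
      show "(\<lambda>k. (norm (F k x - f x))\<^sup>2) \<longlonglongrightarrow> 0" by simp
    qed
    show "AE x in M. norm ((norm (F k x - f x))\<^sup>2) \<le> w x" for k using le by (intro AE_I2) simp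
  qed auto
  then have "(\<lambda>k. sqrt (\<integral>x. (norm (F k x - f x))\<^sup>2 \<partial>M)) \<longlonglongrightarrow> sqrt 0"
    by (intro tendsto_real_sqrt) simp
  then show ?thesis by (simp add: l2norm_def)
qed

lemma tendsto_integral_l2:
  fixes f :: "'m \<Rightarrow> real"
  assumes F: "\<And>k::nat. sq_integrable M (F k)" and f: "sq_integrable M f" and h: "sq_integrable M h"
    and lim: "(\<lambda>k. l2norm M (\<lambda>x. F k x - f x)) \<longlonglongrightarrow> 0"
  shows "(\<lambda>k. \<integral>x. F k x * h x \<partial>M) \<longlonglongrightarrow> (\<integral>x. f x * h x \<partial>M)"
proof (rule LIM_zero_cancel, rule Lim_null_comparison)
  show "(\<lambda>k. l2norm M (\<lambda>x. F k x - f x) * l2norm M h) \<longlonglongrightarrow> 0"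
    using tendsto_mult_left_zero[OF lim] by simp
  have "norm ((\<integral>x. F k x * h x \<partial>M) - (\<integral>x. f x * h x \<partial>M)) \<le> l2norm M (\<lambda>x. F k x - f x) * l2norm M h" for k
  proof -
    have "(\<integral>x. F k x * h x \<partial>M) - (\<integral>x. f x * h x \<partial>M) = (\<integral>x. (F k x - f x) * h x \<partial>M)"
      using sq_integrable_mult[OF F h] sq_integrable_mult[OF f h] by (simp add: left_diff_distrib)
    then show ?thesis using l2_Cauchy_Schwarz_real[OF sq_integrable_diff[OF F f] h] by simp
  qed
  then show "\<forall>\<^sub>F k in sequentially. norm ((\<integral>x. F k x * h x \<partial>M) - (\<integral>x. f x * h x \<partial>M)) \<le> l2norm M (\<lambda>x. F k x - f x) * l2norm M h"
    by simp
qed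

lemma l2norm_tendsto:
  assumes F: "\<And>k::nat. sq_integrable M (F k)" and f: "sq_integrable M f"
    and lim: "(\<lambda>k. l2norm M (\<lambda>x. F k x - f x)) \<longlonglongrightarrow> 0"
  shows "(\<lambda>k. l2norm M (F k)) \<longlonglongrightarrow> l2norm M f"
proof (rule LIM_zero_cancel, rule Lim_null_comparison[OF _ lim])
  have "norm (l2norm M (F k) - l2norm M f) \<le> l2norm M (\<lambda>x. F k x - f x)" for k
    using l2norm_le_add_diff[OF F[of k] f] l2norm_le_add_diff[OF f F[of k]] l2norm_minus_commute[of M "F k" f] by simp
  then show "\<forall>\<^sub>F k in sequentially. norm (l2norm M (F k) - l2norm M f) \<le> l2norm M (\<lambda>x. F k x - f x)" by simp
qed

text \<open>Cauchy-Schwarz against the constant function \<open>1\<close>; this is the form of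
  Jensen's inequality behind all estimates of means.\<close>

lemma integral_power2_le:
  fixes f :: "'m \<Rightarrow> real"
  assumes "finite_measure M" "sq_integrable M f"
  shows "(\<integral>x. f x \<partial>M)\<^sup>2 \<le> measure M (space M) * (\<integral>x. (f x)\<^sup>2 \<partial>M)"
proof -
  interpret finite_measure M by fact
  have 1: "sq_integrable M (\<lambda>x. 1::real)" by (rule sq_integrable_bounded[OF assms(1), where B=1]) auto
  have "\<bar>\<integral>x. f x * 1 \<partial>M\<bar> \<le> l2norm M f * l2norm M (\<lambda>x. 1::real)"
    by (rule l2_Cauchy_Schwarz_real[OF assms(2) 1])
  then have "\<bar>\<integral>x. f x \<partial>M\<bar>\<^sup>2 \<le> (l2norm M f * l2norm M (\<lambda>x. 1::real))\<^sup>2"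
    by (intro power_mono) auto
  then show ?thesis by (simp add: power_mult_distrib l2norm_power2 mult.commute)
qed

subsection \<open>Density of the test functions\<close>

lemma borel_measurable_lebesgue_on: "f \<in> borel_measurable borel \<Longrightarrow> f \<in> borel_measurable (lebesgue_on S)"
  by (intro measurable_restrict_space1 measurable_completion) simp

text \<open>The notions of the theorem live on \<open>lebesgue_on\<close>, whereas Fubini and
  translation arguments are carried out on \<open>lborel\<close>. For Borel integrands the two are
  interchangeable.\<close>

lemma lebesgue_on_integral:
  fixes f :: "'a::euclidean_space \<Rightarrow> 'b::{banach, second_countable_topology}"
  assumes S: "S \<in> sets borel" and f: "f \<in> borel_measurable borel"
  shows "(LINT x|lebesgue_on S. f x) = (LINT x:S|lborel. f x)"
    and "integrable (lebesgue_on S) f \<longleftrightarrow> set_integrable lborel S f"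
proof -
  have S': "S \<inter> space lebesgue \<in> sets lebesgue" using S by simp
  have m: "(\<lambda>x. indicator S x *\<^sub>R f x) \<in> borel_measurable lborel" using S f by measurable
  show "(LINT x|lebesgue_on S. f x) = (LINT x:S|lborel. f x)"
    unfolding integral_restrict_space[OF S'] set_lebesgue_integral_def by (rule integral_completion[OF m])
  show "integrable (lebesgue_on S) f \<longleftrightarrow> set_integrable lborel S f"
    unfolding integrable_restrict_space[OF S'] set_integrable_def by (rule integrable_completion[OF m])
qed

lemma finite_lebesgue_on: "bounded S \<Longrightarrow> open S \<Longrightarrow> finite_measure (lebesgue_on S)"
  by (simp add: finite_measure_lebesgue_on lmeasurable_open)

lemma continuous_L2:
  fixes f :: "'a::euclidean_space \<Rightarrow> 'b::euclidean_space"
  assumes "bounded S" "open S" "continuous_on UNIV f" shows "f \<in> L2 S"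
proof -
  have "compact (f ` closure S)"
    using assms by (intro compact_continuous_image) (auto intro: continuous_on_subset)
  then obtain B where B: "\<And>x. x \<in> closure S \<Longrightarrow> norm (f x) \<le> B"
    using compact_imp_bounded bounded_iff by (metis imageI)
  show ?thesis unfolding L2_iff
  proof (rule sq_integrable_bounded[OF finite_lebesgue_on])
    show "f \<in> borel_measurable (lebesgue_on S)"
      using assms by (intro borel_measurable_lebesgue_on borel_measurable_continuous_onI)
    show "norm (f x) \<le> B" if "x \<in> space (lebesgue_on S)" for x using that B closure_subset by force
  qed (use assms in auto)
qed

lemma smooth_L2: "bounded S \<Longrightarrow> open S \<Longrightarrow> smooth f \<Longrightarrow> f \<in> L2 S"
  and smooth_grad_L2: "bounded S \<Longrightarrow> open S \<Longrightarrow> smooth f \<Longrightarrow> grad f \<in> L2 S"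
  by (auto intro: continuous_L2 smooth_continuous smooth_grad_continuous)

lemma test_functions_smooth: "f \<in> test_functions S \<Longrightarrow> smooth f"
  by (simp add: test_functions_def)

text \<open>A predicate on functions, so that density can be shown in stages: smooth, continuous,
  bounded measurable and finally square-integrable functions, each class approximated by the
  previous one.\<close>

definition test_approx :: "'a::euclidean_space set \<Rightarrow> ('a \<Rightarrow> real) \<Rightarrow> bool" where
  "test_approx S f \<longleftrightarrow> (\<forall>e>0. \<exists>\<phi>\<in>test_functions S. l2norm (lebesgue_on S) (\<lambda>x. f x - \<phi> x) < e)"

lemma test_approx_closed:
  assumes S: "bounded S" "open S" and f: "f \<in> L2 S"
    and g: "\<And>e. e > 0 \<Longrightarrow> \<exists>g\<in>L2 S. test_approx S g \<and> l2norm (lebesgue_on S) (\<lambda>x. f x - g x) < e"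
  shows "test_approx S f"
  unfolding test_approx_def
proof (intro allI impI)
  fix e :: real assume e: "e > 0"
  obtain g where g: "g \<in> L2 S" "test_approx S g" "l2norm (lebesgue_on S) (\<lambda>x. f x - g x) < e / 2"
    using g[of "e/2"] e by auto
  obtain \<phi> where p: "\<phi> \<in> test_functions S" "l2norm (lebesgue_on S) (\<lambda>x. g x - \<phi> x) < e / 2"
    using g(2) e unfolding test_approx_def by (meson half_gt_zero)
  have "\<phi> \<in> L2 S" using p S test_functions_smooth smooth_L2 by blast
  then have "l2norm (lebesgue_on S) (\<lambda>x. f x - \<phi> x) < e"
    using l2norm_triangle_diff[of "lebesgue_on S" f g \<phi>] f g p by (simp add: L2_iff)
  then show "\<exists>\<phi>\<in>test_functions S. l2norm (lebesgue_on S) (\<lambda>x. f x - \<phi> x) < e" using p by blast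
qed

lemma test_approx_limit:
  assumes S: "bounded S" "open S" and f: "f \<in> L2 S" and F: "\<And>k::nat. F k \<in> L2 S" "\<And>k. test_approx S (F k)"
    and lim: "(\<lambda>k. l2norm (lebesgue_on S) (\<lambda>x. F k x - f x)) \<longlonglongrightarrow> 0"
  shows "test_approx S f"
proof (rule test_approx_closed[OF S f])
  fix e :: real assume "e > 0"
  then have "\<forall>\<^sub>F k in sequentially. l2norm (lebesgue_on S) (\<lambda>x. F k x - f x) < e"
    using lim order_tendstoD(2) by blast
  then obtain k where "l2norm (lebesgue_on S) (\<lambda>x. F k x - f x) < e"
    using eventually_sequentially by auto
  then show "\<exists>g\<in>L2 S. test_approx S g \<and> l2norm (lebesgue_on S) (\<lambda>x. f x - g x) < e"
    using F l2norm_minus_commute by metis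
qed

text \<open>Multiplication by the cutoffs of \<open>open_cutoffs\<close> gives test functions that
  converge pointwise on \<open>S\<close>, with errors dominated by \<open>p\<close> itself.\<close>

lemma smooth_test_approx:
  assumes S: "bounded S" "open S" and p: "smooth p"
  shows "test_approx S p"
proof -
  obtain \<zeta> :: "nat \<Rightarrow> 'a \<Rightarrow> real" where z: "\<And>k. \<zeta> k \<in> test_functions S" "\<And>k x. 0 \<le> \<zeta> k x" "\<And>k x. \<zeta> k x \<le> 1"
    "\<And>x. x \<in> S \<Longrightarrow> (\<lambda>k. \<zeta> k x) \<longlonglongrightarrow> 1"
    using open_cutoffs[OF S(2)] by metis
  have pL: "p \<in> L2 S" using smooth_L2[OF S p] .
  have t: "(\<lambda>x. p x * \<zeta> k x) \<in> test_functions S" for k using test_functions_mult[OF z(1) p] .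
  have "(\<lambda>k. l2norm (lebesgue_on S) (\<lambda>x. p x * \<zeta> k x - p x)) \<longlonglongrightarrow> 0"
  proof (rule l2norm_tendsto_0_dominated)
    show "sq_integrable (lebesgue_on S) p" using pL by (simp add: L2_iff)
    then show "integrable (lebesgue_on S) (\<lambda>x. (norm (p x))\<^sup>2)" by (simp add: sq_integrable_def)
    show "(\<lambda>x. p x * \<zeta> k x) \<in> borel_measurable (lebesgue_on S)" for k
      using t[of k] S test_functions_smooth smooth_L2 L2_iff sq_integrable_def by blast
    have "(\<lambda>k. p x * \<zeta> k x) \<longlonglongrightarrow> p x" if "x \<in> S" for x
      using tendsto_mult[OF tendsto_const z(4)[OF that], of "p x"] by simp
    then show "AE x in lebesgue_on S. (\<lambda>k. p x * \<zeta> k x) \<longlonglongrightarrow> p x"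
      by (intro AE_I2) simp
    show "(norm (p x * \<zeta> k x - p x))\<^sup>2 \<le> (norm (p x))\<^sup>2" for k x
    proof (rule power_mono)
      have "p x * \<zeta> k x - p x = p x * (\<zeta> k x - 1)" by (simp add: algebra_simps)
      then show "norm (p x * \<zeta> k x - p x) \<le> norm (p x)"
        using z(2,3)[of k x] by (auto simp: abs_mult intro: mult_left_le)
    qed simp
  qed
  then show ?thesis unfolding test_approx_def
  proof (intro allI impI)
    fix e :: real assume lim: "(\<lambda>k. l2norm (lebesgue_on S) (\<lambda>x. p x * \<zeta> k x - p x)) \<longlonglongrightarrow> 0" and "e > 0"
    then have "\<forall>\<^sub>F k in sequentially. l2norm (lebesgue_on S) (\<lambda>x. p x * \<zeta> k x - p x) < e"
      using order_tendstoD(2) by blast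
    then obtain k where "l2norm (lebesgue_on S) (\<lambda>x. p x * \<zeta> k x - p x) < e"
      using eventually_sequentially by auto
    then show "\<exists>\<phi>\<in>test_functions S. l2norm (lebesgue_on S) (\<lambda>x. p x - \<phi> x) < e"
      using t l2norm_minus_commute[of _ p] by (intro bexI[of _ "\<lambda>x. p x * \<zeta> k x"]) auto
  qed
qed

lemma continuous_test_approx:
  assumes S: "bounded S" "open S" and g: "continuous_on UNIV g"
  shows "test_approx S g"
proof (rule test_approx_closed[OF S continuous_L2[OF S g]])
  fix e :: real assume e: "e > 0"
  define m where "m = measure (lebesgue_on S) (space (lebesgue_on S))"
  \<comment> \<open>A uniform error \<open>d\<close> has squared \<open>L2\<close> norm at most
    \<open>d\<^sup>2 * m\<close>. The added \<open>1\<close> makes this strictly less than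
    \<open>e\<^sup>2\<close> and keeps the quotient meaningful when \<open>m = 0\<close>.\<close>
  define d where "d = e / sqrt (m + 1)"
  have m: "m \<ge> 0" unfolding m_def by simp
  have d: "d > 0" using e m unfolding d_def by simp
  have "compact (closure S)" using S by simp
  then obtain p where p: "real_polynomial_function p" "\<And>x. x \<in> closure S \<Longrightarrow> \<bar>g x - p x\<bar> < d"
    using Stone_Weierstrass_real_polynomial_function[of "closure S" g d] continuous_on_subset[OF g] d by blast
  have sp: "smooth p" using p smooth_real_polynomial_function by blast
  have gp: "sq_integrable (lebesgue_on S) (\<lambda>x. g x - p x)"
    using sq_integrable_diff continuous_L2[OF S g] smooth_L2[OF S sp] by (simp add: L2_iff)
  interpret finite_measure "lebesgue_on S" using finite_lebesgue_on[OF S] .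
  have "(\<integral>x. (norm (g x - p x))\<^sup>2 \<partial>(lebesgue_on S)) \<le> (\<integral>x. d\<^sup>2 \<partial>(lebesgue_on S))"
  proof (rule integral_mono)
    show "(norm (g x - p x))\<^sup>2 \<le> d\<^sup>2" if "x \<in> space (lebesgue_on S)" for x
      using that p(2)[of x] closure_subset[of S] d by (intro power_mono) (auto simp: less_imp_le subset_iff)
  qed (use gp in \<open>auto simp: sq_integrable_def\<close>)
  also have "\<dots> = d\<^sup>2 * m" by (simp add: m_def)
  also have "\<dots> < e\<^sup>2"
  proof -
    have "d\<^sup>2 * (m + 1) = e\<^sup>2" unfolding d_def using m by (simp add: power_divide)
    then have "d\<^sup>2 * m + d\<^sup>2 = e\<^sup>2" by (simp add: algebra_simps)
    moreover have "0 < d\<^sup>2" using d by simp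
    ultimately show ?thesis by linarith
  qed
  finally have "l2norm (lebesgue_on S) (\<lambda>x. g x - p x) < sqrt (e\<^sup>2)"
    unfolding l2norm_def by (rule real_sqrt_less_mono)
  then have "l2norm (lebesgue_on S) (\<lambda>x. g x - p x) < e" using e by simp
  then show "\<exists>h\<in>L2 S. test_approx S h \<and> l2norm (lebesgue_on S) (\<lambda>x. g x - h x) < e"
    using smooth_L2[OF S sp] smooth_test_approx[OF S sp] by blast
qed

lemma clamp_real_bounds: "\<bar>max (-m) (min m (t::real))\<bar> \<le> m" if "m \<ge> 0"
  using that by auto

lemma bounded_test_approx:
  assumes S: "bounded S" "open S" and f: "f \<in> borel_measurable (lebesgue_on S)" and m: "\<And>x. \<bar>f x\<bar> \<le> m"
  shows "test_approx S f"
proof -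
  have m0: "m \<ge> 0" using m[of undefined] by linarith
  have Sl: "S \<in> sets lebesgue" using S by auto
  interpret finite_measure "lebesgue_on S" using finite_lebesgue_on[OF S] .
  have fL: "f \<in> L2 S" unfolding L2_iff
    by (rule sq_integrable_bounded[where B=m]) (use f m finite_measure_axioms in auto)
  have "f measurable_on S" using f Sl by (simp add: measurable_on_iff_borel_measurable)
  then obtain N g where N: "negligible N" "\<And>n. continuous_on UNIV (g n)"
     and g: "\<And>x. x \<notin> N \<Longrightarrow> (\<lambda>n. g n x) \<longlonglongrightarrow> (if x \<in> S then f x else 0)"
    unfolding measurable_on_def by blast
  \<comment> \<open>Clamping to the range of \<open>f\<close> does not disturb the pointwise limit
    and supplies the constant bound for dominated convergence.\<close>
  define h where "h n x = max (-m) (min m (g n x))" for n x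
  have hc: "continuous_on UNIV (h n)" for n unfolding h_def using N
    by (intro continuous_intros) auto
  have hL: "h n \<in> L2 S" for n using continuous_L2[OF S hc] .
  show ?thesis
  proof (rule test_approx_limit[OF S fL hL])
    show "test_approx S (h k)" for k using continuous_test_approx[OF S hc] .
    show "(\<lambda>k. l2norm (lebesgue_on S) (\<lambda>x. h k x - f x)) \<longlonglongrightarrow> 0"
    proof (rule l2norm_tendsto_0_dominated)
      show "sq_integrable (lebesgue_on S) f" using fL by (simp add: L2_iff)
      show "h k \<in> borel_measurable (lebesgue_on S)" for k using hL[of k] by (simp add: L2_iff sq_integrable_def)
      show "integrable (lebesgue_on S) (\<lambda>x. (2 * m)\<^sup>2)" by simp
      have hx: "(\<lambda>k. h k x) \<longlonglongrightarrow> f x" if "x \<in> S" "x \<notin> N" for x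
      proof -
        have "(\<lambda>k. h k x) \<longlonglongrightarrow> max (-m) (min m (f x))"
          unfolding h_def using g[OF that(2)] that(1) by (intro tendsto_intros) auto
        then show ?thesis using m[of x] by (simp add: abs_le_iff min_def max_def split: if_splits)
      qed
      have "N \<in> null_sets lebesgue" using N(1) by (simp add: negligible_iff_null_sets)
      then have "AE x in lebesgue. x \<notin> N" by (rule AE_not_in)
      then show "AE x in lebesgue_on S. (\<lambda>k. h k x) \<longlonglongrightarrow> f x"
        using hx Sl by (auto simp: AE_restrict_space_iff elim!: eventually_mono)
      show "(norm (h k x - f x))\<^sup>2 \<le> (2 * m)\<^sup>2" for k x
      proof (rule power_mono)
        have "\<bar>h k x\<bar> \<le> m" unfolding h_def using m0 by (rule clamp_real_bounds)
        then show "norm (h k x - f x) \<le> 2 * m" using m[of x] by simp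
      qed simp
    qed
  qed
qed

text \<open>Truncation at height \<open>k\<close> reduces to bounded functions: at each point it is
  eventually the identity, and the error never exceeds the function itself.\<close>

theorem L2_test_approx:
  assumes S: "bounded S" "open S" and f: "f \<in> L2 S"
  shows "test_approx S f"
proof -
  define F where "F k x = max (- real k) (min (real k) (f x))" for k x
  have fm: "f \<in> borel_measurable (lebesgue_on S)" using f by (simp add: L2_iff sq_integrable_def)
  have Fm: "F k \<in> borel_measurable (lebesgue_on S)" for k unfolding F_def using fm by measurable
  have Fb: "\<bar>F k x\<bar> \<le> real k" for k x unfolding F_def by (rule clamp_real_bounds) simp
  interpret finite_measure "lebesgue_on S" using finite_lebesgue_on[OF S] .
  show ?thesis
  proof (rule test_approx_limit[OF S f])
    show "F k \<in> L2 S" for k unfolding L2_iff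
      by (rule sq_integrable_bounded[where B="real k"]) (use Fm Fb finite_measure_axioms in auto)
    show "test_approx S (F k)" for k using bounded_test_approx[OF S Fm Fb] .
    show "(\<lambda>k. l2norm (lebesgue_on S) (\<lambda>x. F k x - f x)) \<longlonglongrightarrow> 0"
    proof (rule l2norm_tendsto_0_dominated)
      show "sq_integrable (lebesgue_on S) f" using f by (simp add: L2_iff)
      then show "integrable (lebesgue_on S) (\<lambda>x. (norm (f x))\<^sup>2)" by (simp add: sq_integrable_def)
      have "(\<lambda>k. F k x) \<longlonglongrightarrow> f x" for x
      proof (rule tendsto_eventually)
        show "\<forall>\<^sub>F k in sequentially. F k x = f x"
          using eventually_ge_at_top[of "nat \<lceil>\<bar>f x\<bar>\<rceil>"]
        proof eventually_elim
          case (elim k)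
          then have "\<bar>f x\<bar> \<le> real k" by linarith
          then show ?case by (simp add: F_def)
        qed
      qed
      then show "AE x in lebesgue_on S. (\<lambda>k. F k x) \<longlonglongrightarrow> f x" by simp
      show "(norm (F k x - f x))\<^sup>2 \<le> (norm (f x))\<^sup>2" for k x
        by (rule power_mono) (auto simp: F_def min_def max_def)
    qed (rule Fm)
  qed
qed

lemma L2_test_sequence:
  assumes S: "bounded S" "open S" and f: "f \<in> L2 S"
  obtains \<phi> where "\<And>k::nat. \<phi> k \<in> test_functions S" "(\<lambda>k. l2norm (lebesgue_on S) (\<lambda>x. \<phi> k x - f x)) \<longlonglongrightarrow> 0"
proof -
  have "\<exists>\<phi>\<in>test_functions S. l2norm (lebesgue_on S) (\<lambda>x. f x - \<phi> x) < 1 / real (Suc k)" for k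
    using L2_test_approx[OF assms] unfolding test_approx_def by (meson of_nat_0_less_iff zero_less_Suc zero_less_divide_1_iff)
  then obtain \<phi> where p: "\<And>k. \<phi> k \<in> test_functions S" "\<And>k. l2norm (lebesgue_on S) (\<lambda>x. f x - \<phi> k x) < 1 / real (Suc k)"
    by metis
  have "(\<lambda>k. l2norm (lebesgue_on S) (\<lambda>x. \<phi> k x - f x)) \<longlonglongrightarrow> 0"
  proof (rule Lim_null_comparison)
    show "(\<lambda>k. 1 / real (Suc k)) \<longlonglongrightarrow> 0" using LIMSEQ_inverse_real_of_nat by (simp add: inverse_eq_divide)
    show "\<forall>\<^sub>F k in sequentially. norm (l2norm (lebesgue_on S) (\<lambda>x. \<phi> k x - f x)) \<le> 1 / real (Suc k)"
      using p(2) by (intro always_eventually) (metis abs_of_nonneg l2norm_minus_commute l2norm_nonneg less_imp_le real_norm_def)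
  qed
  then show thesis using p(1) that by blast
qed

text \<open>Approximating \<open>f\<close> itself by test functions shows that \<open>f\<close> is
  orthogonal to \<open>f\<close>.\<close>

lemma L2_test_orthogonal_imp_0:
  assumes S: "bounded S" "open S" and f: "f \<in> L2 S"
    and 0: "\<And>\<phi>. \<phi> \<in> test_functions S \<Longrightarrow> (LINT x|lebesgue_on S. f x * \<phi> x) = 0"
  shows "AE x in lebesgue_on S. f x = 0"
proof -
  obtain \<phi> where p: "\<And>k::nat. \<phi> k \<in> test_functions S" "(\<lambda>k. l2norm (lebesgue_on S) (\<lambda>x. \<phi> k x - f x)) \<longlonglongrightarrow> 0"
    using L2_test_sequence[OF assms(1-3)] by metis
  have f': "sq_integrable (lebesgue_on S) f" using f by (simp add: L2_iff)
  have p': "sq_integrable (lebesgue_on S) (\<phi> k)" for k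
    using p(1)[of k] S test_functions_smooth smooth_L2 L2_iff by blast
  have "(\<lambda>k. LINT x|lebesgue_on S. \<phi> k x * f x) \<longlonglongrightarrow> (LINT x|lebesgue_on S. f x * f x)"
    by (rule tendsto_integral_l2[OF p' f' f' p(2)])
  moreover have "(LINT x|lebesgue_on S. \<phi> k x * f x) = 0" for k using 0[OF p(1)[of k]] by (simp add: mult.commute)
  ultimately have "(LINT x|lebesgue_on S. f x * f x) = 0" by (simp add: LIMSEQ_const_iff)
  then have "l2norm (lebesgue_on S) f = 0" by (simp add: l2norm_def power2_eq_square)
  then show ?thesis using l2norm_eq_0_imp[OF f'] by blast
qed

subsection \<open>Weak gradients\<close>

lemma has_real_derivative_along_line:
  fixes f :: "'a::euclidean_space \<Rightarrow> real"
  assumes "\<And>x. (f has_derivative (\<lambda>h. grad f x \<bullet> h)) (at x)"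
  shows "((\<lambda>t. f (x + t *\<^sub>R v)) has_real_derivative (grad f (x + t *\<^sub>R v) \<bullet> v)) (at t)"
proof -
  have "((\<lambda>t. x + t *\<^sub>R v) has_derivative (\<lambda>t. t *\<^sub>R v)) (at t)"
    by (auto intro!: derivative_eq_intros)
  from has_derivative_compose[OF this assms]
  show ?thesis unfolding has_field_derivative_def
    by (rule has_derivative_eq_rhs) auto
qed

lemma lborel_integral_translate:
  fixes f :: "'a::euclidean_space \<Rightarrow> real"
  assumes "f \<in> borel_measurable borel"
  shows "(LBINT x. f (x + c)) = (LBINT x. f x)"
proof -
  have "(LBINT x. f x) = (\<integral>x. f x \<partial>(distr lborel borel ((+) c)))" by (simp add: lborel_distr_plus)
  also have "\<dots> = (LBINT x. f (c + x))" using assms by (intro integral_distr) auto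
  finally show ?thesis by (simp add: add.commute)
qed

lemma lborel_integrable_translate:
  fixes f :: "'a::euclidean_space \<Rightarrow> real"
  assumes "integrable lborel f"
  shows "integrable lborel (\<lambda>x. f (x + c))"
proof -
  have "f \<in> borel_measurable borel" using assms by auto
  moreover have "integrable (distr lborel borel ((+) c)) f" using assms by (simp add: lborel_distr_plus)
  ultimately have "integrable lborel (\<lambda>x. f (c + x))" by (subst (asm) integrable_distr_eq) auto
  then show ?thesis by (simp add: add.commute)
qed

lemma test_functions_grad_supportE:
  assumes "f \<in> test_functions S"
  obtains K where "compact K" "K \<subseteq> S" "\<And>x. x \<notin> K \<Longrightarrow> f x = 0" "\<And>x. x \<notin> K \<Longrightarrow> grad f x = 0"
proof (rule that)
  let ?K = "closure {x. f x \<noteq> 0}"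
  show "compact ?K" "?K \<subseteq> S" using assms by (auto simp: test_functions_def)
  show 0: "f x = 0" if "x \<notin> ?K" for x
    using that closure_subset[of "{x. f x \<noteq> 0}"] by auto
  show "grad f x = 0" if "x \<notin> ?K" for x
  proof (rule grad_eqI)
    have "((\<lambda>x. 0) has_derivative (\<lambda>h. (0::'a) \<bullet> h)) (at x)" by (simp only: inner_zero_left has_derivative_const)
    moreover have "open (- ?K)" by (rule open_Compl[OF closed_closure])
    moreover have "x \<in> - ?K" using that unfolding Compl_iff .
    moreover have "0 = f y" if "y \<in> - ?K" for y using 0[OF ComplD[OF that]] by (rule sym)
    ultimately show "(f has_derivative (\<bullet>) 0) (at x)"
      by (rule has_derivative_transform_within_open)
  qed
qed

text \<open>By translation invariance every difference quotient of \<open>f\<close> has integral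
  zero. The quotients converge to the directional derivative and are bounded by a Lipschitz constant
  on a fixed ball, so dominated convergence applies.\<close>

lemma integral_grad_test_function:
  fixes f :: "'a::euclidean_space \<Rightarrow> real"
  assumes f: "f \<in> test_functions S"
  shows "(LBINT x. grad f x \<bullet> v) = 0"
proof -
  obtain K where K: "compact K" "K \<subseteq> S" "\<And>x. x \<notin> K \<Longrightarrow> f x = 0" "\<And>x. x \<notin> K \<Longrightarrow> grad f x = 0"
    using test_functions_grad_supportE[OF f] by metis
  have sm: "smooth f" using f by (rule test_functions_smooth)
  have fm[measurable]: "f \<in> borel_measurable borel" using smooth_continuous[OF sm] by (intro borel_measurable_continuous_onI)
  have "compact (grad f ` K)" using K sm by (intro compact_continuous_image smooth_grad_continuous)
  then obtain C where "\<And>x. x \<in> K \<Longrightarrow> norm (grad f x) \<le> C"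
    using compact_imp_bounded bounded_iff by (metis imageI)
  then have C: "norm (grad f x) \<le> max C 0" for x using K(4)[of x] by (cases "x \<in> K") (auto simp: le_max_iff_disj)
  obtain R where R: "\<And>x. x \<in> K \<Longrightarrow> norm x \<le> R"
    using compact_imp_bounded[OF K(1)] unfolding bounded_iff by auto
  have Rb: "f x = 0" if "norm x > R" for x using R[of x] K(3)[of x] that by force
  define h where "h n = 1 / real (Suc n)" for n
  have h: "h n > 0" "h n \<le> 1" for n by (auto simp: h_def)
  define D where "D n x = (f (x + h n *\<^sub>R v) - f x) / h n" for n x
  have lim: "(\<lambda>n. D n x) \<longlonglongrightarrow> grad f x \<bullet> v" for x
  proof -
    have "((\<lambda>t. f (x + t *\<^sub>R v)) has_real_derivative (grad f x \<bullet> v)) (at 0)"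
      using has_real_derivative_along_line[OF smooth_has_derivative[OF sm], of x v 0] by simp
    then have "((\<lambda>t. (f (x + t *\<^sub>R v) - f x) / t) \<longlongrightarrow> grad f x \<bullet> v) (at 0)"
      by (simp add: has_field_derivative_iff)
    moreover have "filterlim h (at 0) sequentially"
      unfolding filterlim_at h_def using LIMSEQ_inverse_real_of_nat by (auto simp: inverse_eq_divide)
    ultimately show ?thesis unfolding D_def by (rule filterlim_compose)
  qed
  \<comment> \<open>Since \<open>h n\<close> is at most \<open>1\<close>, for \<open>x\<close>
    outside the ball of radius \<open>R + norm v\<close> both points of the quotient lie outside the
    support; inside, the mean value inequality applies.\<close>
  have bound: "\<bar>D n x\<bar> \<le> max C 0 * norm v * indicator (cball 0 (R + norm v)) x" for n x
  proof (cases "norm x > R + norm v")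
    case True
    have "norm (h n *\<^sub>R v) \<le> 1 * norm v" using h[of n] by (simp only: norm_scaleR) (intro mult_right_mono, auto)
    then have "norm (x + h n *\<^sub>R v) > R" using True norm_diff_ineq[of x "h n *\<^sub>R v"] by simp
    moreover have "norm x > R" using True by (smt (verit) norm_ge_zero)
    ultimately show ?thesis using Rb by (simp add: D_def indicator_def)
  next
    case False
    have "norm (f (x + h n *\<^sub>R v) - f x) \<le> max C 0 * norm ((x + h n *\<^sub>R v) - x)"
    proof (rule differentiable_bound[of UNIV])
      show "(f has_derivative (\<bullet>) (grad f y)) (at y within UNIV)" for y using smooth_has_derivative[OF sm] by simp
      show "onorm ((\<bullet>) (grad f y)) \<le> max C 0" for y
        by (rule onorm_le) (metis C Cauchy_Schwarz_ineq2 mult_right_mono norm_ge_zero order_trans real_norm_def)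
    qed auto
    then have "\<bar>f (x + h n *\<^sub>R v) - f x\<bar> \<le> (max C 0 * norm v) * h n" using h[of n] by (simp add: mult_ac)
    then have "\<bar>D n x\<bar> \<le> max C 0 * norm v" unfolding D_def using h[of n] by (simp add: abs_div divide_le_eq)
    then show ?thesis using False by (simp add: indicator_def)
  qed
  have fint: "integrable lborel f"
  proof -
    have "set_integrable lborel K f"
      unfolding set_integrable_def by (rule borel_integrable_compact[OF K(1) smooth_continuous[OF sm]])
    moreover have "(\<lambda>x. indicator K x *\<^sub>R f x) = f" using K(3) by (force simp: indicator_def)
    ultimately show ?thesis unfolding set_integrable_def by simp
  qed
  have D0: "(LBINT x. D n x) = 0" for n
    unfolding D_def using lborel_integral_translate[OF fm, of "h n *\<^sub>R v"] lborel_integrable_translate[OF fint, of "h n *\<^sub>R v"] fint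
    by simp
  have "(\<lambda>n. LBINT x. D n x) \<longlonglongrightarrow> (LBINT x. grad f x \<bullet> v)"
  proof (rule integral_dominated_convergence[where w="\<lambda>x. max C 0 * norm v * indicator (cball 0 (R + norm v)) x"])
    show "(\<lambda>x. grad f x \<bullet> v) \<in> borel_measurable lborel"
      using smooth_grad_continuous[OF sm] by (auto intro!: borel_measurable_continuous_onI continuous_intros)
    show "D n \<in> borel_measurable lborel" for n unfolding D_def by measurable
    show "integrable lborel (\<lambda>x. max C 0 * norm v * indicator (cball 0 (R + norm v)) x)"
      by (intro integrable_mult_right integrable_real_indicator) (use emeasure_lborel_cball_finite in auto)
  qed (use lim bound in auto)
  then show ?thesis using D0 by (simp add: LIMSEQ_const_iff)
qed

lemma lebesgue_on_integral_support:
  fixes f :: "'a::euclidean_space \<Rightarrow> real"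
  assumes "S \<in> sets borel" "f \<in> borel_measurable borel" "\<And>x. x \<notin> S \<Longrightarrow> f x = 0"
  shows "(LINT x|lebesgue_on S. f x) = (LBINT x. f x)"
proof -
  have "(\<lambda>x. indicator S x *\<^sub>R f x) = f" using assms(3) by (force simp: indicator_def)
  then show ?thesis using lebesgue_on_integral(1)[OF assms(1,2)] by (simp add: set_lebesgue_integral_def)
qed

lemma test_function_L2: "bounded S \<Longrightarrow> open S \<Longrightarrow> \<phi> \<in> test_functions S \<Longrightarrow> sq_integrable (lebesgue_on S) \<phi>"
  using smooth_L2 test_functions_smooth unfolding L2_iff by metis

lemma test_function_grad_L2:
  "bounded S \<Longrightarrow> open S \<Longrightarrow> \<phi> \<in> test_functions S \<Longrightarrow> sq_integrable (lebesgue_on S) (\<lambda>x. grad \<phi> x \<bullet> b)"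
  by (rule sq_integrable_inner_const, unfold L2_iff[symmetric]) (intro smooth_grad_L2 test_functions_smooth)

lemma test_function_integrable:
  assumes "bounded S" "open S" "\<phi> \<in> test_functions S"
  shows "f \<in> L2 S \<Longrightarrow> integrable (lebesgue_on S) (\<lambda>x. f x * (grad \<phi> x \<bullet> b))"
    and "g \<in> L2 S \<Longrightarrow> integrable (lebesgue_on S) (\<lambda>x. (g x \<bullet> b) * \<phi> x)"
  unfolding L2_iff
  using sq_integrable_mult[OF _ test_function_grad_L2[OF assms]]
    sq_integrable_mult[OF sq_integrable_inner_const test_function_L2[OF assms]]
  by auto

lemma L2_diff: "f \<in> L2 S \<Longrightarrow> g \<in> L2 S \<Longrightarrow> (\<lambda>x. f x - g x) \<in> L2 S"
  unfolding L2_iff by (rule sq_integrable_diff)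

lemma L2_inner_const: "f \<in> L2 S \<Longrightarrow> (\<lambda>x. f x \<bullet> b) \<in> L2 S"
  unfolding L2_iff by (rule sq_integrable_inner_const)

lemma is_weak_grad_iff:
  "is_weak_grad S u g \<longleftrightarrow> (\<forall>\<phi>\<in>test_functions S. \<forall>b\<in>Basis.
     (LINT x|lebesgue_on S. u x * (grad \<phi> x \<bullet> b)) = - (LINT x|lebesgue_on S. (g x \<bullet> b) * \<phi> x))"
  unfolding is_weak_grad_def by (simp add: grad_inner_Basis cong: ball_cong)

text \<open>The product \<open>w * \<phi>\<close> is a test function although \<open>w\<close> need
  not have compact support. Its derivative has integral zero, which is the integration by parts
  formula.\<close>

lemma is_weak_grad_smooth:
  assumes S: "bounded S" "open S" and w: "smooth w"
  shows "is_weak_grad S w (grad w)"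
  unfolding is_weak_grad_iff
proof (intro ballI)
  fix \<phi> b assume p: "\<phi> \<in> test_functions S" and b: "(b::'a) \<in> Basis"
  have sp: "smooth \<phi>" using p by (rule test_functions_smooth)
  let ?\<psi> = "\<lambda>x. w x * \<phi> x"
  have t: "?\<psi> \<in> test_functions S" using test_functions_mult[OF p w] .
  obtain K where "K \<subseteq> S" "\<And>x. x \<notin> K \<Longrightarrow> grad ?\<psi> x = 0"
    using test_functions_grad_supportE[OF t] by metis
  then have "grad ?\<psi> x = 0" if "x \<notin> S" for x using that by (meson subsetD)
  moreover have "(\<lambda>x. grad ?\<psi> x \<bullet> b) \<in> borel_measurable borel"
    using smooth_continuous[OF smooth_grad_inner[OF smooth_mult[OF w sp] b]] by (intro borel_measurable_continuous_onI)
  ultimately have "(LINT x|lebesgue_on S. grad ?\<psi> x \<bullet> b) = (LBINT x. grad ?\<psi> x \<bullet> b)"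
    using S by (intro lebesgue_on_integral_support) auto
  also have "\<dots> = 0" by (rule integral_grad_test_function[OF t])
  finally have "0 = (LINT x|lebesgue_on S. w x * (grad \<phi> x \<bullet> b) + (grad w x \<bullet> b) * \<phi> x)"
    by (simp only: grad_mult[OF w sp] inner_add_left inner_scaleR_left mult.commute[of "\<phi> _"])
  also have "\<dots> = (LINT x|lebesgue_on S. w x * (grad \<phi> x \<bullet> b)) + (LINT x|lebesgue_on S. (grad w x \<bullet> b) * \<phi> x)"
  proof (rule Bochner_Integration.integral_add)
    show "integrable (lebesgue_on S) (\<lambda>x. w x * (grad \<phi> x \<bullet> b))" "integrable (lebesgue_on S) (\<lambda>x. (grad w x \<bullet> b) * \<phi> x)"
      using test_function_integrable[OF S p] smooth_L2[OF S w] smooth_grad_L2[OF S w] by auto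
  qed
  finally show "(LINT x|lebesgue_on S. w x * (grad \<phi> x \<bullet> b)) = - (LINT x|lebesgue_on S. (grad w x \<bullet> b) * \<phi> x)" by simp
qed

lemma is_weak_grad_lincomb:
  assumes S: "bounded S" "open S" and L: "u \<in> L2 S" "v \<in> L2 S" "g \<in> L2 S" "h \<in> L2 S"
    and u: "is_weak_grad S u g" and v: "is_weak_grad S v h"
  shows "is_weak_grad S (\<lambda>x. u x - v x) (\<lambda>x. g x - h x)"
  unfolding is_weak_grad_iff
proof (intro ballI)
  fix \<phi> b assume p: "\<phi> \<in> test_functions S" and b: "(b::'a) \<in> Basis"
  note i = test_function_integrable(1)[OF S p] and j = test_function_integrable(2)[OF S p]
  show "(LINT x|lebesgue_on S. (u x - v x) * (grad \<phi> x \<bullet> b)) = - (LINT x|lebesgue_on S. ((g x - h x) \<bullet> b) * \<phi> x)"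
    using u v p b i[OF L(1)] i[OF L(2)] j[OF L(3)] j[OF L(4)]
    by (simp add: left_diff_distrib inner_diff_left is_weak_grad_iff)
qed

text \<open>Each component of the difference is orthogonal to all test functions.\<close>

lemma weak_grad_unique:
  fixes u :: "'a::euclidean_space \<Rightarrow> real"
  assumes S: "bounded S" "open S" and L: "g \<in> L2 S" "h \<in> L2 S"
    and g: "is_weak_grad S u g" and h: "is_weak_grad S u h"
  shows "AE x in lebesgue_on S. g x = h x"
proof -
  have "AE x in lebesgue_on S. (g x - h x) \<bullet> b = 0" if b: "b \<in> Basis" for b
  proof (rule L2_test_orthogonal_imp_0[OF S])
    show "(\<lambda>x. (g x - h x) \<bullet> b) \<in> L2 S"
      using L by (intro L2_inner_const L2_diff)
    fix \<phi> assume p: "\<phi> \<in> test_functions S"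
    note j = test_function_integrable(2)[OF S p]
    show "(LINT x|lebesgue_on S. ((g x - h x) \<bullet> b) * \<phi> x) = 0"
      using j[OF L(1)] j[OF L(2)] g h p b unfolding is_weak_grad_iff
      by (simp add: left_diff_distrib inner_diff_left)
  qed
  then have "AE x in lebesgue_on S. \<forall>b\<in>Basis. (g x - h x) \<bullet> b = 0"
    by (intro AE_finite_allI) auto
  then show ?thesis
    by eventually_elim (metis euclidean_all_zero_iff right_minus_eq)
qed

lemma weak_grad_H1:
  assumes "u \<in> H1 S" shows "weak_grad S u \<in> L2 S" "is_weak_grad S u (weak_grad S u)"
proof -
  have "\<exists>g. g \<in> L2 S \<and> is_weak_grad S u g" using assms by (auto simp: H1_def)
  from someI_ex[OF this] show "weak_grad S u \<in> L2 S" "is_weak_grad S u (weak_grad S u)"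
    unfolding weak_grad_def by auto
qed

lemma weak_grad_AE_eq:
  assumes S: "bounded S" "open S" and g: "g \<in> L2 S" "is_weak_grad S u g"
  shows "AE x in lebesgue_on S. weak_grad S u x = g x"
proof -
  from someI[of "\<lambda>g. g \<in> L2 S \<and> is_weak_grad S u g" g] g
  have "weak_grad S u \<in> L2 S" "is_weak_grad S u (weak_grad S u)"
    unfolding weak_grad_def by auto
  then show ?thesis using weak_grad_unique[OF S] g by blast
qed

lemma H1_L2: "u \<in> H1 S \<Longrightarrow> u \<in> L2 S"
  by (simp add: H1_def)

lemma H1I: "u \<in> L2 S \<Longrightarrow> g \<in> L2 S \<Longrightarrow> is_weak_grad S u g \<Longrightarrow> u \<in> H1 S"
  unfolding H1_def by blast

lemma smooth_H1: "bounded S \<Longrightarrow> open S \<Longrightarrow> smooth w \<Longrightarrow> w \<in> H1 S"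
  by (rule H1I[OF smooth_L2 smooth_grad_L2 is_weak_grad_smooth])

lemma weak_grad_smooth:
  "bounded S \<Longrightarrow> open S \<Longrightarrow> smooth w \<Longrightarrow> AE x in lebesgue_on S. weak_grad S w x = grad w x"
  by (rule weak_grad_AE_eq[OF _ _ smooth_grad_L2 is_weak_grad_smooth])

text \<open>\<open>weak_grad\<close> is a chosen representative. Uniqueness almost everywhere allows
  the norm to be computed from any admissible gradients, such as the classical gradient of a smooth
  function.\<close>

lemma H1_norm_diff:
  assumes S: "bounded S" "open S" and L: "u \<in> L2 S" "v \<in> L2 S" "g \<in> L2 S" "h \<in> L2 S"
    and u: "is_weak_grad S u g" and v: "is_weak_grad S v h"
  shows "H1_norm S (\<lambda>x. u x - v x) =
    sqrt ((l2norm (lebesgue_on S) (\<lambda>x. u x - v x))\<^sup>2 + (l2norm (lebesgue_on S) (\<lambda>x. g x - h x))\<^sup>2)"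
proof -
  have gh: "(\<lambda>x. g x - h x) \<in> L2 S" using L by (intro L2_diff)
  have w: "is_weak_grad S (\<lambda>x. u x - v x) (\<lambda>x. g x - h x)"
    using is_weak_grad_lincomb[OF assms] .
  have uv: "(\<lambda>x. u x - v x) \<in> H1 S"
    by (rule H1I[OF L2_diff[OF L(1,2)] gh w])
  have "l2norm (lebesgue_on S) (weak_grad S (\<lambda>x. u x - v x)) = l2norm (lebesgue_on S) (\<lambda>x. g x - h x)"
    using weak_grad_AE_eq[OF S gh w] weak_grad_H1(1)[OF uv] gh
    by (intro l2norm_AE_cong) (auto simp: L2_iff sq_integrable_def)
  then show ?thesis unfolding H1_norm_def L2_norm_eq by simp
qed

lemma H1_closure_approx:
  assumes S: "bounded S" "open S" and u: "u \<in> H1_closure S A" and A: "\<And>w. w \<in> A \<Longrightarrow> smooth w" and e: "e > 0"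
  obtains w where "w \<in> A" "l2norm (lebesgue_on S) (\<lambda>x. w x - u x) < e"
    "l2norm (lebesgue_on S) (\<lambda>x. grad w x - weak_grad S u x) < e"
proof -
  obtain w where w: "\<And>k::nat. w k \<in> A" "(\<lambda>k. H1_norm S (\<lambda>x. w k x - u x)) \<longlonglongrightarrow> 0" and uH: "u \<in> H1 S"
    using u unfolding H1_closure_def by auto
  have "\<forall>\<^sub>F k in sequentially. H1_norm S (\<lambda>x. w k x - u x) < e" using w(2) e order_tendstoD(2) by blast
  then obtain k where k: "H1_norm S (\<lambda>x. w k x - u x) < e" using eventually_sequentially by auto
  have sm: "smooth (w k)" using w A by blast
  have eq: "H1_norm S (\<lambda>x. w k x - u x) =
    sqrt ((l2norm (lebesgue_on S) (\<lambda>x. w k x - u x))\<^sup>2 + (l2norm (lebesgue_on S) (\<lambda>x. grad (w k) x - weak_grad S u x))\<^sup>2)"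
    by (rule H1_norm_diff[OF S smooth_L2[OF S sm] H1_L2[OF uH] smooth_grad_L2[OF S sm] weak_grad_H1(1)[OF uH]
        is_weak_grad_smooth[OF S sm] weak_grad_H1(2)[OF uH]])
  have "a \<le> sqrt (a\<^sup>2 + b\<^sup>2)" "b \<le> sqrt (a\<^sup>2 + b\<^sup>2)" for a b :: real
    by (auto intro: real_le_rsqrt)
  then show thesis using that[OF w(1)] k unfolding eq by (meson le_less_trans)
qed

lemma H1_closureI:
  fixes w :: "nat \<Rightarrow> 'a::euclidean_space \<Rightarrow> real"
  assumes S: "bounded S" "open S" and u: "u \<in> L2 S" "g \<in> L2 S" "is_weak_grad S u g"
    and w: "\<And>k. w k \<in> A" "\<And>k. smooth (w k)"
    and lim: "(\<lambda>k. l2norm (lebesgue_on S) (\<lambda>x. w k x - u x)) \<longlonglongrightarrow> 0"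
      "(\<lambda>k. l2norm (lebesgue_on S) (\<lambda>x. grad (w k) x - g x)) \<longlonglongrightarrow> 0"
  shows "u \<in> H1_closure S A"
proof -
  have eq: "H1_norm S (\<lambda>x. w k x - u x) =
    sqrt ((l2norm (lebesgue_on S) (\<lambda>x. w k x - u x))\<^sup>2 + (l2norm (lebesgue_on S) (\<lambda>x. grad (w k) x - g x))\<^sup>2)" for k
    using H1_norm_diff[OF S smooth_L2[OF S w(2)[of k]] u(1) smooth_grad_L2[OF S w(2)[of k]] u(2) is_weak_grad_smooth[OF S w(2)[of k]] u(3)] .
  have "(\<lambda>k. H1_norm S (\<lambda>x. w k x - u x)) \<longlonglongrightarrow> sqrt (0\<^sup>2 + 0\<^sup>2)"
    unfolding eq by (rule tendsto_real_sqrt[OF tendsto_add[OF tendsto_power[OF lim(1)] tendsto_power[OF lim(2)]]])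
  then have c: "(\<lambda>k. H1_norm S (\<lambda>x. w k x - u x)) \<longlonglongrightarrow> 0" by simp
  have "u \<in> H1 S" by (rule H1I[OF u])
  then show ?thesis unfolding H1_closure_def mem_Collect_eq
    by (intro conjI exI[of _ w] allI w(1) c)
qed

lemma smooth_H1_closure:
  assumes S: "bounded S" "open S" and w: "w \<in> A" "smooth w"
  shows "w \<in> H1_closure S A"
  by (rule H1_closureI[OF S smooth_L2[OF S w(2)] smooth_grad_L2[OF S w(2)] is_weak_grad_smooth[OF S w(2)], of "\<lambda>_. w"])
    (use w in \<open>auto simp: l2norm_def\<close>)

subsection \<open>Translation estimates\<close>

lemma nn_integral_lborel_translate:
  fixes f :: "'a::euclidean_space \<Rightarrow> ennreal"
  assumes "f \<in> borel_measurable borel"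
  shows "(\<integral>\<^sup>+x. f (x + c) \<partial>lborel) = (\<integral>\<^sup>+x. f x \<partial>lborel)"
proof -
  have "(\<integral>\<^sup>+x. f x \<partial>lborel) = (\<integral>\<^sup>+x. f x \<partial>(distr lborel borel ((+) c)))" by (simp add: lborel_distr_plus)
  also have "\<dots> = (\<integral>\<^sup>+x. f (c + x) \<partial>lborel)" using assms by (intro nn_integral_distr) auto
  finally show ?thesis by (simp add: add.commute)
qed

lemma bounded_borel_restrict:
  assumes "A \<in> sets borel" "bounded A"
  shows "finite_measure (restrict_space lborel A)"
    and "measure (restrict_space lborel A) (space (restrict_space lborel A)) = measure lborel A"
proof -
  have "emeasure (restrict_space lborel A) (space (restrict_space lborel A)) = emeasure lborel A"
    using assms by (simp add: emeasure_restrict_space space_restrict_space)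
  then show "measure (restrict_space lborel A) (space (restrict_space lborel A)) = measure lborel A"
    "finite_measure (restrict_space lborel A)"
    using emeasure_bounded_finite[OF assms(2)] by (auto simp: measure_def intro!: finite_measureI)
qed

lemma continuous_sq_integrable_restrict:
  fixes f :: "'a::euclidean_space \<Rightarrow> real"
  assumes "A \<in> sets borel" "bounded A" "continuous_on UNIV f"
  shows "sq_integrable (restrict_space lborel A) f" "set_integrable lborel A f"
proof -
  have "compact (f ` closure A)"
    using assms by (intro compact_continuous_image) (auto intro: continuous_on_subset)
  then obtain B where B: "\<And>x. x \<in> closure A \<Longrightarrow> norm (f x) \<le> B"
    using compact_imp_bounded bounded_iff by (metis imageI)
  then have B': "norm (f x) \<le> B" if "x \<in> A" for x using that closure_subset[of A] by blast
  have m: "f \<in> borel_measurable (restrict_space lborel A)"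
    using assms by (intro measurable_restrict_space1) (simp add: borel_measurable_continuous_onI)
  show "sq_integrable (restrict_space lborel A) f"
    by (rule sq_integrable_bounded[OF bounded_borel_restrict(1)[OF assms(1,2)] m, of B])
      (use B' in \<open>simp add: space_restrict_space\<close>)
  have "integrable (restrict_space lborel A) f"
    by (rule finite_measure.integrable_const_bound[OF bounded_borel_restrict(1)[OF assms(1,2)] _ m, of B])
      (use B' in \<open>auto simp: space_restrict_space intro!: AE_I2\<close>)
  then show "set_integrable lborel A f"
    unfolding set_integrable_def using assms(1) by (subst (asm) integrable_restrict_space) auto
qed

text \<open>Jensen's inequality for the square. It is phrased with nonnegative integrals so that
  later exchanges of integrals are instances of Tonelli's theorem and need no integrability.\<close>

lemma mean_deviation_le:
  fixes f :: "'a::euclidean_space \<Rightarrow> real"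
  assumes A: "A \<in> sets borel" "bounded A" "measure lborel A > 0" and f: "continuous_on UNIV f"
  shows "ennreal (((LINT x:A|lborel. f x) / measure lborel A - c)\<^sup>2) * ennreal (measure lborel A)
     \<le> (\<integral>\<^sup>+x\<in>A. ennreal ((f x - c)\<^sup>2) \<partial>lborel)"
proof -
  let ?M = "restrict_space lborel A"
  let ?m = "measure lborel A"
  interpret finite_measure ?M by (rule bounded_borel_restrict(1)[OF A(1,2)])
  have fc: "continuous_on UNIV (\<lambda>x. f x - c)" using f by (intro continuous_intros)
  have s: "sq_integrable ?M (\<lambda>x. f x - c)" by (rule continuous_sq_integrable_restrict(1)[OF A(1,2) fc])
  have i: "set_integrable lborel A f" by (rule continuous_sq_integrable_restrict(2)[OF A(1,2) f])
  have R: "(\<integral>x. g x \<partial>?M) = (LINT x:A|lborel. g x)" for g :: "'a \<Rightarrow> real"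
    unfolding set_lebesgue_integral_def using A(1) by (intro integral_restrict_space) auto
  have "integrable ?M f" unfolding integrable_restrict_space[of A lborel f, simplified, OF A(1)]
    using i by (simp add: set_integrable_def)
  then have "(\<integral>x. f x - c \<partial>?M) = (LINT x:A|lborel. f x) - c * ?m"
    using bounded_borel_restrict(2)[OF A(1,2)] R[of f] by simp
  then have *: "((LINT x:A|lborel. f x) - c * ?m)\<^sup>2 \<le> ?m * (\<integral>x. (f x - c)\<^sup>2 \<partial>?M)"
    using integral_power2_le[OF finite_measure_axioms s] bounded_borel_restrict(2)[OF A(1,2)] by simp
  have "((LINT x:A|lborel. f x) / ?m - c)\<^sup>2 * ?m = ((LINT x:A|lborel. f x) - c * ?m)\<^sup>2 / ?m"
    using A(3) by (simp add: field_simps power2_eq_square)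
  also have "\<dots> \<le> (\<integral>x. (f x - c)\<^sup>2 \<partial>?M)"
    using * A(3) by (simp add: divide_le_eq mult.commute)
  finally have "ennreal (((LINT x:A|lborel. f x) / ?m - c)\<^sup>2 * ?m) \<le> ennreal (\<integral>x. (f x - c)\<^sup>2 \<partial>?M)"
    by (rule ennreal_leI)
  also have "\<dots> = (\<integral>\<^sup>+x. ennreal ((f x - c)\<^sup>2) \<partial>?M)"
    using s by (intro nn_integral_eq_integral[symmetric]) (auto simp: sq_integrable_def)
  also have "\<dots> = (\<integral>\<^sup>+x\<in>A. ennreal ((f x - c)\<^sup>2) \<partial>lborel)"
    using A(1) by (intro nn_integral_restrict_space) auto
  finally show ?thesis using A(3) by (simp add: ennreal_mult)
qed

text \<open>The increment is the integral of the derivative along the segment from \<open>y\<close>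
  to \<open>y + z\<close>. Jensen on the unit interval, Tonelli, and for each \<open>s\<close> the
  translation by \<open>s *\<^sub>R z\<close>, which maps \<open>E\<close> into \<open>S\<close>,
  give the bound.\<close>

lemma shift_estimate:
  fixes w :: "'a::euclidean_space \<Rightarrow> real"
  assumes w: "smooth w" and E[measurable]: "E \<in> sets borel" and S[measurable]: "S \<in> sets borel"
    and ES: "\<And>y s. y \<in> E \<Longrightarrow> s \<in> {0..1} \<Longrightarrow> y + s *\<^sub>R z \<in> S"
  shows "(\<integral>\<^sup>+y\<in>E. ennreal ((w (y + z) - w y)\<^sup>2) \<partial>lborel)
      \<le> ennreal ((norm z)\<^sup>2) * (\<integral>\<^sup>+x\<in>S. ennreal ((norm (grad w x))\<^sup>2) \<partial>lborel)"
proof -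
  have gc: "continuous_on UNIV (grad w)" using w by (rule smooth_grad_continuous)
  have [measurable]: "grad w \<in> borel_measurable borel" "w \<in> borel_measurable borel"
    using gc smooth_continuous[OF w] by (auto intro: borel_measurable_continuous_onI)
  define g where "g x = ennreal ((norm z)\<^sup>2) * ennreal ((norm (grad w x))\<^sup>2)" for x
  have [measurable]: "g \<in> borel_measurable borel" unfolding g_def by measurable
  have pt: "ennreal ((w (y + z) - w y)\<^sup>2) \<le> (\<integral>\<^sup>+s\<in>{0..1}. g (y + s *\<^sub>R z) \<partial>lborel)" for y
  proof -
    define f where "f s = grad w (y + s *\<^sub>R z) \<bullet> z" for s
    have fc: "continuous_on UNIV f" unfolding f_def
      by (intro continuous_intros continuous_on_compose2[OF gc]) auto
    have "(LINT s:{0..1}|lborel. f s) = w (y + 1 *\<^sub>R z) - w (y + 0 *\<^sub>R z)"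
      unfolding set_lebesgue_integral_def
    proof (rule integral_FTC_Icc)
      show "((\<lambda>t. w (y + t *\<^sub>R z)) has_vector_derivative f s) (at s within {0..1})" for s
        unfolding f_def using has_real_derivative_along_line[OF smooth_has_derivative[OF w], of y z s]
        by (simp add: has_real_derivative_iff_has_vector_derivative has_vector_derivative_at_within)
    qed (use fc continuous_on_subset in auto)
    \<comment> \<open>The unit interval has length \<open>1\<close>, so
      \<open>mean_deviation_le\<close> with \<open>c = 0\<close> bounds the square of the integral
      by the integral of the square.\<close>
    then have "ennreal ((w (y + z) - w y)\<^sup>2) \<le> (\<integral>\<^sup>+s\<in>{0..1}. ennreal ((f s)\<^sup>2) \<partial>lborel)"
      using mean_deviation_le[OF _ _ _ fc, of "{0..1}" 0] by simp
    also have "\<dots> \<le> (\<integral>\<^sup>+s\<in>{0..1}. g (y + s *\<^sub>R z) \<partial>lborel)"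
    proof (intro nn_integral_mono mult_right_mono)
      fix s
      have "(f s)\<^sup>2 \<le> (norm z * norm (grad w (y + s *\<^sub>R z)))\<^sup>2"
        unfolding f_def using Cauchy_Schwarz_ineq2[of "grad w (y + s *\<^sub>R z)" z]
        by (intro abs_le_square_iff[THEN iffD1]) (simp add: mult.commute abs_mult)
      then show "ennreal ((f s)\<^sup>2) \<le> g (y + s *\<^sub>R z)"
        unfolding g_def by (simp add: power_mult_distrib flip: ennreal_mult)
    qed simp
    finally show ?thesis .
  qed
  have "(\<integral>\<^sup>+y\<in>E. ennreal ((w (y + z) - w y)\<^sup>2) \<partial>lborel) \<le> (\<integral>\<^sup>+y\<in>E. (\<integral>\<^sup>+s\<in>{0..1}. g (y + s *\<^sub>R z) \<partial>lborel) \<partial>lborel)"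
    by (intro nn_integral_mono mult_right_mono pt) simp
  also have "\<dots> = (\<integral>\<^sup>+y. (\<integral>\<^sup>+s. g (y + s *\<^sub>R z) * indicator {0..1} s * indicator E y \<partial>lborel) \<partial>lborel)"
    by (intro nn_integral_cong nn_integral_multc[symmetric]) measurable
  also have "\<dots> = (\<integral>\<^sup>+s. (\<integral>\<^sup>+y. g (y + s *\<^sub>R z) * indicator {0..1} s * indicator E y \<partial>lborel) \<partial>lborel)"
    by (rule lborel_pair.Fubini'[symmetric]) measurable
  also have "\<dots> \<le> (\<integral>\<^sup>+(s::real). (\<integral>\<^sup>+x\<in>S. g x \<partial>lborel) * indicator {0..1} s \<partial>lborel)"
  proof (rule nn_integral_mono)
    fix s :: real
    have "(\<integral>\<^sup>+y. g (y + s *\<^sub>R z) * indicator {0..1} s * indicator E y \<partial>lborel)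
        \<le> (\<integral>\<^sup>+y. g (y + s *\<^sub>R z) * indicator S (y + s *\<^sub>R z) * indicator {0..1} s \<partial>lborel)"
      using ES by (intro nn_integral_mono) (auto simp: indicator_def)
    also have "\<dots> = (\<integral>\<^sup>+y. g (y + s *\<^sub>R z) * indicator S (y + s *\<^sub>R z) \<partial>lborel) * indicator {0..1} s"
      by (rule nn_integral_multc) measurable
    also have "\<dots> = (\<integral>\<^sup>+x\<in>S. g x \<partial>lborel) * indicator {0..1} s"
      by (subst nn_integral_lborel_translate) auto
    finally show "(\<integral>\<^sup>+y. g (y + s *\<^sub>R z) * indicator {0..1} s * indicator E y \<partial>lborel) \<le> (\<integral>\<^sup>+x\<in>S. g x \<partial>lborel) * indicator {0..1} s" .
  qed
  also have "\<dots> = (\<integral>\<^sup>+x\<in>S. g x \<partial>lborel)" by (simp add: nn_integral_cmult)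
  also have "\<dots> = ennreal ((norm z)\<^sup>2) * (\<integral>\<^sup>+x\<in>S. ennreal ((norm (grad w x))\<^sup>2) \<partial>lborel)"
    unfolding g_def by (simp add: mult.assoc nn_integral_cmult)
  finally show ?thesis .
qed

text \<open>Jensen over the set of shifts reduces the deviation from the mean to single shifts,
  which are controlled by \<open>shift_estimate\<close>. The measure of \<open>Z\<close> appears on
  both sides and cancels, so the bound depends on \<open>Z\<close> only through
  \<open>r\<close>.\<close>

lemma average_estimate:
  fixes w :: "'a::euclidean_space \<Rightarrow> real"
  assumes w: "smooth w" and P[measurable]: "P \<in> sets borel" and S[measurable]: "S \<in> sets borel"
    and Z[measurable]: "Z \<in> sets borel" and Z': "measure lborel Z > 0" "Z \<subseteq> cball 0 r"
    and PS: "\<And>y z s. y \<in> P \<Longrightarrow> z \<in> Z \<Longrightarrow> s \<in> {0..1} \<Longrightarrow> y + s *\<^sub>R z \<in> S"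
  shows "(\<integral>\<^sup>+y\<in>P. ennreal (((LINT z:Z|lborel. w (y + z)) / measure lborel Z - w y)\<^sup>2) \<partial>lborel)
      \<le> ennreal (r\<^sup>2) * (\<integral>\<^sup>+x\<in>S. ennreal ((norm (grad w x))\<^sup>2) \<partial>lborel)"
    (is "?I \<le> ?r * ?K")
proof -
  have wc: "continuous_on UNIV w" using smooth_continuous[OF w] .
  have [measurable]: "w \<in> borel_measurable borel" using wc by (rule borel_measurable_continuous_onI)
  let ?m = "measure lborel Z"
  have bZ: "bounded Z" using Z'(2) bounded_subset[OF bounded_cball] by blast
  have em: "emeasure lborel Z = ennreal ?m"
    using emeasure_bounded_finite[OF bZ] by (intro emeasure_eq_ennreal_measure) auto
  have "?I * ennreal ?m = (\<integral>\<^sup>+y. ennreal (((LINT z:Z|lborel. w (y + z)) / ?m - w y)\<^sup>2) * indicator P y * ennreal ?m \<partial>lborel)"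
    unfolding set_lebesgue_integral_def by (rule nn_integral_multc[symmetric]) measurable
  also have "\<dots> \<le> (\<integral>\<^sup>+y. (\<integral>\<^sup>+z\<in>Z. ennreal ((w (y + z) - w y)\<^sup>2) \<partial>lborel) * indicator P y \<partial>lborel)"
  proof (rule nn_integral_mono)
    fix y
    have "continuous_on UNIV (\<lambda>z. w (y + z))" by (intro continuous_on_compose2[OF wc] continuous_intros) auto
    from mean_deviation_le[OF Z bZ Z'(1) this, of "w y"]
    show "ennreal (((LINT z:Z|lborel. w (y + z)) / ?m - w y)\<^sup>2) * indicator P y * ennreal ?m
      \<le> (\<integral>\<^sup>+z\<in>Z. ennreal ((w (y + z) - w y)\<^sup>2) \<partial>lborel) * indicator P y"
      by (auto simp: indicator_def)
  qed
  also have "\<dots> = (\<integral>\<^sup>+y. (\<integral>\<^sup>+z. ennreal ((w (y + z) - w y)\<^sup>2) * indicator Z z * indicator P y \<partial>lborel) \<partial>lborel)"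
    by (intro nn_integral_cong nn_integral_multc[symmetric]) measurable
  also have "\<dots> = (\<integral>\<^sup>+z. (\<integral>\<^sup>+y. ennreal ((w (y + z) - w y)\<^sup>2) * indicator Z z * indicator P y \<partial>lborel) \<partial>lborel)"
    by (rule lborel_pair.Fubini'[symmetric]) measurable
  also have "\<dots> \<le> (\<integral>\<^sup>+z. (?r * ?K) * indicator Z z \<partial>lborel)"
  proof (rule nn_integral_mono)
    fix z
    show "(\<integral>\<^sup>+y. ennreal ((w (y + z) - w y)\<^sup>2) * indicator Z z * indicator P y \<partial>lborel) \<le> (?r * ?K) * indicator Z z"
    proof (cases "z \<in> Z")
      case True
      have "(\<integral>\<^sup>+y\<in>P. ennreal ((w (y + z) - w y)\<^sup>2) \<partial>lborel) \<le> ennreal ((norm z)\<^sup>2) * ?K"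
        by (rule shift_estimate[OF w P S]) (use PS True in auto)
      also have "\<dots> \<le> ?r * ?K"
        using Z'(2) True by (intro mult_right_mono ennreal_leI power_mono) auto
      finally show ?thesis using True by simp
    qed simp
  qed
  also have "\<dots> = (?r * ?K) * ennreal ?m" using em by (simp add: nn_integral_cmult)
  finally have "?I * ennreal ?m \<le> (?r * ?K) * ennreal ?m" .
  then show ?thesis using Z'(1) by (simp add: mult.commute ennreal_mult_le_mult_iff)
qed

text \<open>A Poincare inequality; the constant is not optimal.\<close>

lemma poincare_ball:
  fixes w :: "'a::euclidean_space \<Rightarrow> real" and p :: 'a
  assumes w: "smooth w" and r: "r > 0"
  defines "m \<equiv> measure lborel (ball p r)"
  shows "(\<integral>\<^sup>+x\<in>ball p r. ennreal (((LINT x:ball p r|lborel. w x) / m - w x)\<^sup>2) \<partial>lborel) * ennreal m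
     \<le> ennreal (4 * r\<^sup>2) * emeasure lborel (ball (0::'a) (2 * r)) * (\<integral>\<^sup>+x\<in>ball p r. ennreal ((norm (grad w x))\<^sup>2) \<partial>lborel)"
    (is "?I * _ \<le> ?r * ?e * ?K")
proof -
  let ?B = "ball p r"
  have wc: "continuous_on UNIV w" using smooth_continuous[OF w] .
  have [measurable]: "w \<in> borel_measurable borel" using wc by (rule borel_measurable_continuous_onI)
  have [measurable]: "ball p r \<in> sets borel" "ball (0::'a) (2 * r) \<in> sets borel" by auto
  have m: "m > 0" unfolding m_def using content_ball_pos[OF r] by simp
  have "?I * ennreal m = (\<integral>\<^sup>+x. ennreal (((LINT x:?B|lborel. w x) / m - w x)\<^sup>2) * indicator ?B x * ennreal m \<partial>lborel)"
    by (rule nn_integral_multc[symmetric]) measurable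
  also have "\<dots> \<le> (\<integral>\<^sup>+x. (\<integral>\<^sup>+y\<in>?B. ennreal ((w y - w x)\<^sup>2) \<partial>lborel) * indicator ?B x \<partial>lborel)"
  proof (rule nn_integral_mono)
    fix x
    from mean_deviation_le[of ?B w "w x"] m wc
    show "ennreal (((LINT x:?B|lborel. w x) / m - w x)\<^sup>2) * indicator ?B x * ennreal m
      \<le> (\<integral>\<^sup>+y\<in>?B. ennreal ((w y - w x)\<^sup>2) \<partial>lborel) * indicator ?B x"
      by (auto simp: indicator_def m_def)
  qed
  \<comment> \<open>Pairs of points of the ball are parametrised by one point and the difference
    \<open>z\<close>. Differences are shorter than \<open>2 * r\<close>, which is the origin of
    \<open>4 * r\<^sup>2\<close> and of the ball of radius \<open>2 * r\<close>; convexity keeps the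
    segments inside.\<close>
  also have "\<dots> = (\<integral>\<^sup>+x. (\<integral>\<^sup>+z. ennreal ((w (z + x) - w x)\<^sup>2) * indicator ?B (z + x) \<partial>lborel) * indicator ?B x \<partial>lborel)"
    by (intro nn_integral_cong arg_cong2[of _ _ _ _ "(*)"] refl nn_integral_lborel_translate[symmetric]) measurable
  also have "\<dots> = (\<integral>\<^sup>+x. (\<integral>\<^sup>+z. ennreal ((w (z + x) - w x)\<^sup>2) * indicator ?B (z + x) * indicator ?B x \<partial>lborel) \<partial>lborel)"
    by (intro nn_integral_cong nn_integral_multc[symmetric]) measurable
  also have "\<dots> = (\<integral>\<^sup>+z. (\<integral>\<^sup>+x. ennreal ((w (z + x) - w x)\<^sup>2) * indicator ?B (z + x) * indicator ?B x \<partial>lborel) \<partial>lborel)"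
    by (rule lborel_pair.Fubini'[symmetric]) measurable
  also have "\<dots> \<le> (\<integral>\<^sup>+(z::'a). (?r * ?K) * indicator (ball 0 (2 * r)) z \<partial>lborel)"
  proof (rule nn_integral_mono)
    fix z :: 'a
    have E: "{x. x \<in> ?B \<and> z + x \<in> ?B} \<in> sets borel" by measurable
    have eq: "(\<integral>\<^sup>+x. ennreal ((w (z + x) - w x)\<^sup>2) * indicator ?B (z + x) * indicator ?B x \<partial>lborel)
       = (\<integral>\<^sup>+x\<in>{x. x \<in> ?B \<and> z + x \<in> ?B}. ennreal ((w (x + z) - w x)\<^sup>2) \<partial>lborel)"
      by (intro nn_integral_cong) (auto simp: indicator_def add.commute)
    show "(\<integral>\<^sup>+x. ennreal ((w (z + x) - w x)\<^sup>2) * indicator ?B (z + x) * indicator ?B x \<partial>lborel) \<le> (?r * ?K) * indicator (ball 0 (2 * r)) z"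
    proof (cases "norm z < 2 * r")
      case True
      have "(\<integral>\<^sup>+x\<in>{x. x \<in> ?B \<and> z + x \<in> ?B}. ennreal ((w (x + z) - w x)\<^sup>2) \<partial>lborel) \<le> ennreal ((norm z)\<^sup>2) * ?K"
      proof (rule shift_estimate[OF w E])
        fix y and s :: real assume y: "y \<in> {x. x \<in> ?B \<and> z + x \<in> ?B}" and s: "s \<in> {0..1}"
        have "(1 - s) *\<^sub>R y + s *\<^sub>R (z + y) \<in> ?B"
          using y s convex_ball[of p r] by (intro convexD) auto
        then show "y + s *\<^sub>R z \<in> ?B" by (simp add: algebra_simps)
      qed simp
      also have "\<dots> \<le> ?r * ?K"
      proof (intro mult_right_mono ennreal_leI)
        have "(norm z)\<^sup>2 \<le> (2 * r)\<^sup>2" using True by (intro power_mono) auto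
        then show "(norm z)\<^sup>2 \<le> 4 * r\<^sup>2" by (simp add: power_mult_distrib)
      qed simp
      finally show ?thesis unfolding eq using True by simp
    next
      case False
      have "\<not> (x \<in> ?B \<and> z + x \<in> ?B)" for x
      proof
        assume "x \<in> ?B \<and> z + x \<in> ?B"
        then have "norm (p - x) < r" "norm (p - (z + x)) < r" by (auto simp: dist_norm)
        then have "norm ((p - x) - (p - (z + x))) < 2 * r" using norm_triangle_ineq4[of "p - x" "p - (z + x)"] by linarith
        then show False using False by simp
      qed
      then have "{x. x \<in> ?B \<and> z + x \<in> ?B} = {}" by blast
      then show ?thesis unfolding eq by simp
    qed
  qed
  also have "\<dots> = (?r * ?K) * ?e" by (subst nn_integral_cmult) auto
  also have "\<dots> = ?r * ?e * ?K" by (simp only: ac_simps)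
  finally show ?thesis .
qed

subsection \<open>Compactness\<close>

text \<open>A set \<open>Z\<close> of admissible shifts of positive measure is enough in place of a cone, because the
  compactness argument averages over the shifts.\<close>

definition cone_property :: "'a::euclidean_space set \<Rightarrow> bool" where
  "cone_property S \<longleftrightarrow> (\<forall>p\<in>closure S. \<exists>\<rho>>0. \<forall>r>0. \<exists>Z. Z \<in> sets borel \<and> measure lborel Z > 0 \<and> Z \<subseteq> cball 0 r \<and>
     (\<forall>y\<in>S \<inter> ball p \<rho>. \<forall>z\<in>Z. \<forall>s\<in>{0..1}. y + s *\<^sub>R z \<in> S))"

text \<open>At an interior point a small ball of shifts works. At a frontier point a shift close to
  \<open>t *\<^sub>R e\<close> raises a point by more than the graph of \<open>h\<close> can rise
  under the small sideways part, so points above the graph stay above it along the whole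
  segment.\<close>

lemma lipschitz_boundary_imp_cone_property:
  fixes S :: "'a::euclidean_space set"
  assumes S: "open S" and L: "lipschitz_boundary S"
  shows "cone_property S"
  unfolding cone_property_def
proof
  fix p assume p: "p \<in> closure S"
  show "\<exists>\<rho>>0. \<forall>r>0. \<exists>Z. Z \<in> sets borel \<and> measure lborel Z > 0 \<and> Z \<subseteq> cball 0 r \<and>
     (\<forall>y\<in>S \<inter> ball p \<rho>. \<forall>z\<in>Z. \<forall>s\<in>{0..1}. y + s *\<^sub>R z \<in> S)"
  proof (cases "p \<in> S")
    case True
    then obtain e where e: "e > 0" "ball p e \<subseteq> S" using S openE by blast
    show ?thesis
    proof (intro exI[of _ "e/2"] conjI allI impI)
      fix r :: real assume r: "r > 0"
      show "\<exists>Z. Z \<in> sets borel \<and> measure lborel Z > 0 \<and> Z \<subseteq> cball 0 r \<and>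
        (\<forall>y\<in>S \<inter> ball p (e/2). \<forall>z\<in>Z. \<forall>s\<in>{0..1}. y + s *\<^sub>R z \<in> S)"
      proof (intro exI[of _ "ball 0 (min r (e/2))"] conjI ballI)
        fix y z :: 'a and s :: real assume y: "y \<in> S \<inter> ball p (e/2)" and z: "z \<in> ball 0 (min r (e/2))" and s: "s \<in> {0..1}"
        have "norm (s *\<^sub>R z) \<le> 1 * norm z" using s by (simp only: norm_scaleR) (intro mult_right_mono, auto)
        then have "norm (s *\<^sub>R z) < e/2" using z by simp
        moreover have "dist p (y + s *\<^sub>R z) \<le> dist p y + norm (s *\<^sub>R z)"
          by (metis dist_triangle dist_norm norm_minus_commute add_diff_cancel_left')
        ultimately have "dist p (y + s *\<^sub>R z) < e" using y by simp
        then show "y + s *\<^sub>R z \<in> S" using e by auto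
      qed (use r e content_ball_pos[of "min r (e/2)" "0::'a"] in auto)
    qed (use e in auto)
  next
    case False
    then have "p \<in> frontier S" using p S by (simp add: frontier_def interior_open)
    then obtain e h M r0 where e: "norm e = 1" and r0: "r0 > 0" and M: "M-lipschitz_on {z. z \<bullet> e = 0} h"
      and SE: "\<And>y. y \<in> ball p r0 \<Longrightarrow> y \<in> S \<longleftrightarrow> y \<bullet> e > (h (y - (y \<bullet> e) *\<^sub>R e) :: real)"
      using L unfolding lipschitz_boundary_def by metis
    have M0: "M \<ge> 0" using M lipschitz_on_nonneg by blast
    have ee: "e \<bullet> e = 1" using e by (simp add: norm_eq_1)
    \<comment> \<open>Solves \<open>t - t * \<kappa> = M * (t * \<kappa>)\<close>: the guaranteed
      gain in height equals the largest possible rise of the graph. The strict inequality at the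
      starting point supplies strictness.\<close>
    define \<kappa> where "\<kappa> = 1 / (1 + M)"
    have k: "\<kappa> > 0" "\<kappa> \<le> 1" "\<kappa> * (1 + M) = 1" using M0 unfolding \<kappa>_def by auto
    show ?thesis
    proof (intro exI[of _ "r0/2"] conjI allI impI)
      fix r :: real assume r: "r > 0"
      \<comment> \<open>Shifts have norm at most \<open>2 * t\<close>. This keeps them in
        \<open>cball 0 r\<close>, and points that start in half of the chart ball stay in that
        ball.\<close>
      define t where "t = min r (r0/2) / 2"
      have t: "t > 0" "2 * t \<le> r" "2 * t \<le> r0/2" using r r0 unfolding t_def by auto
      have zb: "norm z \<le> 2 * t \<and> norm z < r0/2" if "z \<in> ball (t *\<^sub>R e) (t * \<kappa>)" for z
      proof -
        have "norm (z - t *\<^sub>R e) < t * \<kappa>" using that by (simp add: dist_norm norm_minus_commute)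
        moreover have "norm z \<le> norm (t *\<^sub>R e) + norm (z - t *\<^sub>R e)" by (metis add.commute diff_add_cancel norm_triangle_ineq)
        moreover have "t * \<kappa> \<le> t" using t(1) k(2) by (simp add: mult_left_le)
        moreover have "norm (t *\<^sub>R e) = t" using e t(1) by simp
        ultimately show ?thesis using t by linarith
      qed
      show "\<exists>Z. Z \<in> sets borel \<and> measure lborel Z > 0 \<and> Z \<subseteq> cball 0 r \<and>
        (\<forall>y\<in>S \<inter> ball p (r0/2). \<forall>z\<in>Z. \<forall>s\<in>{0..1}. y + s *\<^sub>R z \<in> S)"
      proof (intro exI[of _ "ball (t *\<^sub>R e) (t * \<kappa>)"] conjI ballI)
        show "0 < measure lborel (ball (t *\<^sub>R e) (t * \<kappa>))" using t k by (simp add: content_ball_pos)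
        show "ball (t *\<^sub>R e) (t * \<kappa>) \<subseteq> cball 0 r" using zb t by force
        fix y z :: 'a and s :: real assume y: "y \<in> S \<inter> ball p (r0/2)" and z: "z \<in> ball (t *\<^sub>R e) (t * \<kappa>)" and s: "s \<in> {0..1}"
        have "norm (s *\<^sub>R z) \<le> 1 * norm z" using s by (simp only: norm_scaleR) (intro mult_right_mono, auto)
        then have "norm (s *\<^sub>R z) < r0/2" using zb[OF z] by simp
        moreover have "dist p (y + s *\<^sub>R z) \<le> dist p y + norm (s *\<^sub>R z)"
          by (metis dist_triangle dist_norm norm_minus_commute add_diff_cancel_left')
        ultimately have "dist p (y + s *\<^sub>R z) < r0" using y by simp
        then have yz: "y + s *\<^sub>R z \<in> ball p r0" by simp
        have yb: "y \<in> ball p r0" using y r0 by auto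
        define c where "c = z - t *\<^sub>R e"
        have c: "norm c \<le> t * \<kappa>" using z unfolding c_def by (simp add: dist_norm norm_minus_commute less_imp_le)
        define q where "q x = x - (x \<bullet> e) *\<^sub>R e" for x :: 'a
        have qo: "q x \<in> {z. z \<bullet> e = 0}" for x unfolding q_def by (simp add: inner_diff_left ee)
        have "q (y + s *\<^sub>R z) - q y = s *\<^sub>R q c"
          unfolding q_def c_def by (simp add: inner_add_left inner_diff_left ee algebra_simps)
        moreover have "norm (q c) \<le> norm c"
        proof (rule power2_le_imp_le)
          have "(norm (q c))\<^sup>2 = c \<bullet> c - (c \<bullet> e)\<^sup>2"
            unfolding q_def power2_norm_eq_inner by (simp add: inner_diff_left inner_diff_right ee inner_commute power2_eq_square)
          then show "(norm (q c))\<^sup>2 \<le> (norm c)\<^sup>2" by (simp add: power2_norm_eq_inner)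
        qed simp
        ultimately have "norm (q (y + s *\<^sub>R z) - q y) \<le> s * (t * \<kappa>)"
          using s c by (simp add: mult_left_mono)
        then have "M * dist (q (y + s *\<^sub>R z)) (q y) \<le> M * (s * (t * \<kappa>))"
          using M0 by (intro mult_left_mono) (auto simp: dist_norm)
        moreover have "dist (h (q (y + s *\<^sub>R z))) (h (q y)) \<le> M * dist (q (y + s *\<^sub>R z)) (q y)"
          using lipschitz_onD[OF M qo qo] .
        ultimately have h: "h (q (y + s *\<^sub>R z)) \<le> h (q y) + M * (s * (t * \<kappa>))"
          by (simp add: dist_real_def)
        have "h (q y) < y \<bullet> e" using SE[OF yb] y unfolding q_def by simp
        moreover have "z \<bullet> e \<ge> t - t * \<kappa>"
        proof -
          have "z \<bullet> e = t + c \<bullet> e" unfolding c_def by (simp add: inner_diff_left ee)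
          moreover have "\<bar>c \<bullet> e\<bar> \<le> norm c" using Cauchy_Schwarz_ineq2[of c e] e by simp
          ultimately show ?thesis using c by linarith
        qed
        then have "s * (z \<bullet> e) \<ge> s * (t - t * \<kappa>)" using s by (intro mult_left_mono) auto
        moreover have "s * (t - t * \<kappa>) = M * (s * (t * \<kappa>))"
        proof -
          have "t - t * \<kappa> = t * (\<kappa> * (1 + M)) - t * \<kappa>" using k by simp
          also have "\<dots> = M * (t * \<kappa>)" by (simp add: algebra_simps)
          finally show ?thesis by (simp only: mult.left_commute)
        qed
        ultimately have "h (q (y + s *\<^sub>R z)) < (y + s *\<^sub>R z) \<bullet> e"
          using h by (simp add: inner_add_left)
        then show "y + s *\<^sub>R z \<in> S" using SE[OF yz] unfolding q_def by simp
      qed simp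
    qed (use r0 in auto)
  qed
qed

lemma lebesgue_on_nn_integral:
  assumes "S \<in> sets borel" "f \<in> borel_measurable borel"
  shows "(\<integral>\<^sup>+x. f x \<partial>lebesgue_on S) = (\<integral>\<^sup>+x\<in>S. f x \<partial>lborel)"
  using assms by (subst nn_integral_restrict_space) (auto simp: nn_integral_completion)

lemma nn_integral_l2norm:
  fixes f :: "'a::euclidean_space \<Rightarrow> 'b::euclidean_space"
  assumes "S \<in> sets borel" "f \<in> borel_measurable borel" "f \<in> L2 S"
  shows "(\<integral>\<^sup>+x\<in>S. ennreal ((norm (f x))\<^sup>2) \<partial>lborel) = ennreal ((l2norm (lebesgue_on S) f)\<^sup>2)"
proof -
  have "(\<integral>\<^sup>+x\<in>S. ennreal ((norm (f x))\<^sup>2) \<partial>lborel) = (\<integral>\<^sup>+x. ennreal ((norm (f x))\<^sup>2) \<partial>lebesgue_on S)"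
    using assms by (intro lebesgue_on_nn_integral[symmetric]) auto
  also have "\<dots> = ennreal (\<integral>x. (norm (f x))\<^sup>2 \<partial>lebesgue_on S)"
    using assms by (intro nn_integral_eq_integral) (auto simp: L2_iff sq_integrable_def)
  finally show ?thesis by (simp add: l2norm_power2)
qed

text \<open>The mean of \<open>v j\<close> over the shifted set is an integral over a fixed subset
  of \<open>S\<close>, so it tends to zero by weak convergence, boundedly and hence in square mean
  on the patch. The distance of \<open>v j\<close> from this mean is at most \<open>r\<close> times
  the gradient bound, uniformly in \<open>j\<close>. The size \<open>r\<close> of the shifts is
  fixed before \<open>j\<close> grows.\<close>

lemma patch_tendsto_0:
  fixes v :: "nat \<Rightarrow> 'a::euclidean_space \<Rightarrow> real"
  assumes S[measurable]: "S \<in> sets borel" and v: "\<And>j. smooth (v j)"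
    and P[measurable]: "P \<in> sets borel" "bounded P"
    and Z: "\<And>r. r > 0 \<Longrightarrow> \<exists>Z. Z \<in> sets borel \<and> measure lborel Z > 0 \<and> Z \<subseteq> cball 0 r \<and>
       (\<forall>y\<in>P. \<forall>z\<in>Z. \<forall>s\<in>{0..1}. y + s *\<^sub>R z \<in> S)"
    and weak: "\<And>A. A \<in> sets borel \<Longrightarrow> A \<subseteq> S \<Longrightarrow> (\<lambda>j. LINT x:A|lborel. v j x) \<longlonglongrightarrow> 0"
    and C: "C \<ge> 0" "\<And>j. (\<integral>\<^sup>+x\<in>S. ennreal ((v j x)\<^sup>2) \<partial>lborel) \<le> ennreal C"
      "\<And>j. (\<integral>\<^sup>+x\<in>S. ennreal ((norm (grad (v j) x))\<^sup>2) \<partial>lborel) \<le> ennreal C"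
  shows "(\<lambda>j. \<integral>\<^sup>+x\<in>P. ennreal ((v j x)\<^sup>2) \<partial>lborel) \<longlonglongrightarrow> 0"
proof (rule order_tendstoI)
  fix e :: ennreal assume "0 < e"
  then obtain e2 where e2: "0 < e2" "e2 < e" using dense by blast
  then have "e2 \<noteq> top" by (metis not_top_less)
  then obtain e' where "e2 = ennreal e'" "e' \<ge> 0" by (cases e2) auto
  with e2 have e': "ennreal e' < e" "e' > 0" by auto
  \<comment> \<open>Chosen so that \<open>2 * (r\<^sup>2 * C)\<close> is at most
    \<open>e' / 2\<close>; adding \<open>1\<close> to \<open>C\<close> covers
    \<open>C = 0\<close>.\<close>
  define r where "r = sqrt (e' / (4 * (C + 1)))"
  have r: "r > 0" using e' C unfolding r_def by simp
  have "r\<^sup>2 = e' / (4 * (C + 1))" using e' C unfolding r_def by simp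
  then have "r\<^sup>2 * (C + 1) = e' / 4" using C(1) by (simp add: field_simps)
  then have "r\<^sup>2 * C + r\<^sup>2 = e' / 4" by (simp add: distrib_left)
  then have rC: "2 * (r\<^sup>2 * C) \<le> e' / 2" using zero_le_power2[of r] by linarith
  obtain Z where Zb[measurable]: "Z \<in> sets borel" and Zm: "measure lborel Z > 0" "Z \<subseteq> cball 0 r"
    and PZ: "\<And>y z s. y \<in> P \<Longrightarrow> z \<in> Z \<Longrightarrow> s \<in> {0..1} \<Longrightarrow> y + s *\<^sub>R z \<in> S"
    using Z[OF r] by blast
  have bZ: "bounded Z" using Zm(2) bounded_subset[OF bounded_cball] by blast
  let ?m = "measure lborel Z"
  have vc: "continuous_on UNIV (v j)" for j using smooth_continuous[OF v] .
  have [measurable]: "v j \<in> borel_measurable borel" for j using vc by (rule borel_measurable_continuous_onI)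
  define M where "M j y = (LINT z:Z|lborel. v j (y + z)) / ?m" for j y
  have M[measurable]: "M j \<in> borel_measurable borel" for j
    unfolding M_def set_lebesgue_integral_def by measurable
  have M0: "(\<lambda>j. M j y) \<longlonglongrightarrow> 0" if y: "y \<in> P" for y
  proof -
    \<comment> \<open>The translate of \<open>Z\<close> to \<open>y\<close> lies in
      \<open>S\<close>, because the parameter \<open>s = 1\<close> is admissible in the cone
      condition.\<close>
    let ?A = "{x. x - y \<in> Z}"
    have A[measurable]: "?A \<in> sets borel" by measurable
    have AS: "?A \<subseteq> S"
    proof
      fix x assume "x \<in> ?A"
      then show "x \<in> S" using PZ[OF y, of "x - y" 1] by simp
    qed
    have "(LINT z:Z|lborel. v j (y + z)) = (LINT x:?A|lborel. v j x)" for j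
    proof -
      have "(LINT x:?A|lborel. v j x) = (LBINT z. indicator ?A (z + y) *\<^sub>R v j (z + y))"
        unfolding set_lebesgue_integral_def by (intro lborel_integral_translate[symmetric]) measurable
      then show ?thesis unfolding set_lebesgue_integral_def by (simp add: indicator_def add.commute)
    qed
    then have "(\<lambda>j. LINT z:Z|lborel. v j (y + z)) \<longlonglongrightarrow> 0" using weak[OF A AS] by simp
    from tendsto_divide[OF this tendsto_const[of ?m]] show ?thesis using Zm unfolding M_def by simp
  qed
  have Mb: "ennreal ((M j y)\<^sup>2) \<le> ennreal (C / ?m)" if y: "y \<in> P" for j y
  proof -
    have "continuous_on UNIV (\<lambda>z. v j (y + z))" by (intro continuous_on_compose2[OF vc] continuous_intros) auto
    from mean_deviation_le[OF Zb bZ Zm(1) this, of 0]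
    have "ennreal ((M j y)\<^sup>2) * ennreal ?m \<le> (\<integral>\<^sup>+z\<in>Z. ennreal ((v j (y + z))\<^sup>2) \<partial>lborel)"
      unfolding M_def by simp
    also have "\<dots> \<le> (\<integral>\<^sup>+z. ennreal ((v j (z + y))\<^sup>2) * indicator S (z + y) \<partial>lborel)"
      using PZ[OF y, of _ 1] by (intro nn_integral_mono) (auto simp: indicator_def add.commute)
    also have "\<dots> = (\<integral>\<^sup>+x\<in>S. ennreal ((v j x)\<^sup>2) \<partial>lborel)"
      by (rule nn_integral_lborel_translate) measurable
    also have "\<dots> \<le> ennreal C" by (rule C)
    finally have "ennreal ((M j y)\<^sup>2 * ?m) \<le> ennreal C" using Zm by (simp add: ennreal_mult)
    then have "(M j y)\<^sup>2 * ?m \<le> C" using C by simp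
    then show ?thesis using Zm by (intro ennreal_leI) (simp add: field_simps)
  qed
  have "(\<lambda>j. \<integral>\<^sup>+y\<in>P. ennreal ((M j y)\<^sup>2) \<partial>lborel) \<longlonglongrightarrow> (\<integral>\<^sup>+(y::'a). 0 \<partial>lborel)"
  proof (rule nn_integral_dominated_convergence[where w="\<lambda>y. ennreal (C / ?m) * indicator P y"])
    show "(\<integral>\<^sup>+y. ennreal (C / ?m) * indicator P y \<partial>lborel) < \<infinity>"
      using emeasure_bounded_finite[OF P(2)] by (simp add: nn_integral_cmult ennreal_mult_less_top)
    show "AE y in lborel. ennreal ((M j y)\<^sup>2) * indicator P y \<le> ennreal (C / ?m) * indicator P y" for j
      using Mb by (intro AE_I2) (auto simp: indicator_def)
    have "(\<lambda>j. ennreal ((M j y)\<^sup>2) * indicator P y) \<longlonglongrightarrow> 0" for y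
    proof (cases "y \<in> P")
      case True
      have "(\<lambda>j. ennreal ((M j y)\<^sup>2)) \<longlonglongrightarrow> ennreal (0\<^sup>2)"
        by (intro tendsto_ennrealI tendsto_power M0[OF True])
      then show ?thesis using True by simp
    qed simp
    then show "AE y in lborel. (\<lambda>j. ennreal ((M j y)\<^sup>2) * indicator P y) \<longlonglongrightarrow> 0" by simp
  qed measurable
  then have "(\<lambda>j. \<integral>\<^sup>+y\<in>P. ennreal ((M j y)\<^sup>2) \<partial>lborel) \<longlonglongrightarrow> 0" by simp
  then have "\<forall>\<^sub>F j in sequentially. (\<integral>\<^sup>+y\<in>P. ennreal ((M j y)\<^sup>2) \<partial>lborel) < ennreal (e' / 4)"
    using e' by (intro order_tendstoD(2)) auto
  then show "\<forall>\<^sub>F j in sequentially. (\<integral>\<^sup>+x\<in>P. ennreal ((v j x)\<^sup>2) \<partial>lborel) < e"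
  proof eventually_elim
    fix j assume j: "(\<integral>\<^sup>+y\<in>P. ennreal ((M j y)\<^sup>2) \<partial>lborel) < ennreal (e' / 4)"
    have "(\<integral>\<^sup>+x\<in>P. ennreal ((v j x)\<^sup>2) \<partial>lborel)
      \<le> (\<integral>\<^sup>+x. 2 * (ennreal ((M j x)\<^sup>2) * indicator P x) + 2 * (ennreal ((M j x - v j x)\<^sup>2) * indicator P x) \<partial>lborel)"
    proof (rule nn_integral_mono)
      fix x
      \<comment> \<open>Expands the square of \<open>2 * M j x - v j x\<close>, which is
        nonnegative.\<close>
      have "(v j x)\<^sup>2 \<le> 2 * (M j x)\<^sup>2 + 2 * (M j x - v j x)\<^sup>2"
        using zero_le_power2[of "2 * M j x - v j x"] by (simp add: power2_eq_square algebra_simps)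
      then have "ennreal ((v j x)\<^sup>2) \<le> ennreal (2 * (M j x)\<^sup>2 + 2 * (M j x - v j x)\<^sup>2)"
        by (rule ennreal_leI)
      also have "\<dots> = 2 * ennreal ((M j x)\<^sup>2) + 2 * ennreal ((M j x - v j x)\<^sup>2)"
        by (simp add: ennreal_mult)
      finally show "ennreal ((v j x)\<^sup>2) * indicator P x \<le> 2 * (ennreal ((M j x)\<^sup>2) * indicator P x) + 2 * (ennreal ((M j x - v j x)\<^sup>2) * indicator P x)"
        by (auto simp: indicator_def)
    qed
    also have "\<dots> = 2 * (\<integral>\<^sup>+x\<in>P. ennreal ((M j x)\<^sup>2) \<partial>lborel) + 2 * (\<integral>\<^sup>+x\<in>P. ennreal ((M j x - v j x)\<^sup>2) \<partial>lborel)"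
      by (subst nn_integral_add) (auto simp: nn_integral_cmult)
    also have "\<dots> \<le> 2 * ennreal (e' / 4) + 2 * (ennreal (r\<^sup>2) * ennreal C)"
    proof (intro add_mono mult_left_mono)
      show "(\<integral>\<^sup>+x\<in>P. ennreal ((M j x - v j x)\<^sup>2) \<partial>lborel) \<le> ennreal (r\<^sup>2) * ennreal C"
        unfolding M_def
        by (rule order_trans[OF average_estimate[OF v P(1) S Zb Zm PZ]]) (auto intro: mult_left_mono C)
    qed (use j in auto)
    also have "\<dots> = ennreal (e' / 2 + 2 * (r\<^sup>2 * C))"
      using C e' by (simp add: ennreal_mult[symmetric] ennreal_plus[symmetric] flip: ennreal_numeral del: ennreal_plus)
    also have "\<dots> \<le> ennreal e'" using rC by (intro ennreal_leI) simp
    also have "\<dots> < e" by (rule e')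
    finally show "(\<integral>\<^sup>+x\<in>P. ennreal ((v j x)\<^sup>2) \<partial>lborel) < e" .
  qed
qed simp

text \<open>The closure of \<open>S\<close> is compact and the cone condition is available at each
  of its points, so finitely many patches cover \<open>S\<close> and the norm is bounded by the sum
  of their contributions.\<close>

lemma weak_null_imp_strong_null:
  fixes v :: "nat \<Rightarrow> 'a::euclidean_space \<Rightarrow> real"
  assumes S: "bounded S" "open S" "cone_property S" and v: "\<And>j. smooth (v j)"
    and weak: "\<And>A. A \<in> sets borel \<Longrightarrow> A \<subseteq> S \<Longrightarrow> (\<lambda>j. LINT x:A|lborel. v j x) \<longlonglongrightarrow> 0"
    and C: "\<And>j. l2norm (lebesgue_on S) (v j) \<le> C" "\<And>j. l2norm (lebesgue_on S) (grad (v j)) \<le> C"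
  shows "(\<lambda>j. l2norm (lebesgue_on S) (v j)) \<longlonglongrightarrow> 0"
proof -
  have Sb[measurable]: "S \<in> sets borel" using S by auto
  have vm[measurable]: "v j \<in> borel_measurable borel" "grad (v j) \<in> borel_measurable borel" for j
    using smooth_continuous[OF v] smooth_grad_continuous[OF v] by (auto intro: borel_measurable_continuous_onI)
  have C0: "C \<ge> 0" using C(1)[of 0] l2norm_nonneg[of "lebesgue_on S" "v 0"] by linarith
  have nn: "(\<integral>\<^sup>+x\<in>S. ennreal ((v j x)\<^sup>2) \<partial>lborel) = ennreal ((l2norm (lebesgue_on S) (v j))\<^sup>2)" for j
    using nn_integral_l2norm[OF Sb vm(1)[of j] smooth_L2[OF S(1,2) v]] by simp
  have nng: "(\<integral>\<^sup>+x\<in>S. ennreal ((norm (grad (v j) x))\<^sup>2) \<partial>lborel) = ennreal ((l2norm (lebesgue_on S) (grad (v j)))\<^sup>2)" for j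
    by (rule nn_integral_l2norm[OF Sb vm(2)[of j] smooth_grad_L2[OF S(1,2) v]])
  obtain \<rho> where \<rho>: "\<And>p. p \<in> closure S \<Longrightarrow> \<rho> p > 0"
    "\<And>p r. p \<in> closure S \<Longrightarrow> r > 0 \<Longrightarrow> \<exists>Z. Z \<in> sets borel \<and> measure lborel Z > 0 \<and> Z \<subseteq> cball 0 r \<and>
       (\<forall>y\<in>S \<inter> ball p (\<rho> p). \<forall>z\<in>Z. \<forall>s\<in>{0..1}. y + s *\<^sub>R z \<in> S)"
    using S(3) unfolding cone_property_def by metis
  have "compact (closure S)" using S by simp
  moreover have "closure S \<subseteq> (\<Union>p\<in>closure S. ball p (\<rho> p))" using \<rho>(1) by fastforce
  ultimately obtain T where T: "T \<subseteq> closure S" "finite T" "closure S \<subseteq> (\<Union>p\<in>T. ball p (\<rho> p))"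
    using compactE_image[of "closure S" "closure S" "\<lambda>p. ball p (\<rho> p)"] by (metis open_ball)
  have patch: "(\<lambda>j. \<integral>\<^sup>+x\<in>S \<inter> ball p (\<rho> p). ennreal ((v j x)\<^sup>2) \<partial>lborel) \<longlonglongrightarrow> 0" if "p \<in> T" for p
  proof (rule patch_tendsto_0[OF Sb v _ _ \<rho>(2) weak, of p "C\<^sup>2"])
    show "(\<integral>\<^sup>+x\<in>S. ennreal ((v j x)\<^sup>2) \<partial>lborel) \<le> ennreal (C\<^sup>2)" for j
      unfolding nn using C(1)[of j] l2norm_nonneg by (intro ennreal_leI power_mono) auto
    show "(\<integral>\<^sup>+x\<in>S. ennreal ((norm (grad (v j) x))\<^sup>2) \<partial>lborel) \<le> ennreal (C\<^sup>2)" for j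
      unfolding nng using C(2)[of j] l2norm_nonneg by (intro ennreal_leI power_mono) auto
  qed (use that T S in \<open>auto intro: bounded_Int\<close>)
  have "(\<lambda>j. ennreal ((l2norm (lebesgue_on S) (v j))\<^sup>2)) \<longlonglongrightarrow> 0"
  proof (rule tendsto_sandwich[OF _ _ tendsto_const])
    show "(\<lambda>j. \<Sum>p\<in>T. \<integral>\<^sup>+x\<in>S \<inter> ball p (\<rho> p). ennreal ((v j x)\<^sup>2) \<partial>lborel) \<longlonglongrightarrow> 0"
      using tendsto_sum[of T "\<lambda>p j. \<integral>\<^sup>+x\<in>S \<inter> ball p (\<rho> p). ennreal ((v j x)\<^sup>2) \<partial>lborel" "\<lambda>_. 0", OF patch] by simp
    have "ennreal ((l2norm (lebesgue_on S) (v j))\<^sup>2) \<le> (\<Sum>p\<in>T. \<integral>\<^sup>+x\<in>S \<inter> ball p (\<rho> p). ennreal ((v j x)\<^sup>2) \<partial>lborel)" for j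
    proof -
      have b[measurable]: "S \<inter> ball p (\<rho> p) \<in> sets borel" for p by auto
      have "(\<integral>\<^sup>+x\<in>S. ennreal ((v j x)\<^sup>2) \<partial>lborel) \<le> (\<integral>\<^sup>+x. (\<Sum>p\<in>T. ennreal ((v j x)\<^sup>2) * indicator (S \<inter> ball p (\<rho> p)) x) \<partial>lborel)"
      proof (rule nn_integral_mono)
        fix x
        show "ennreal ((v j x)\<^sup>2) * indicator S x \<le> (\<Sum>p\<in>T. ennreal ((v j x)\<^sup>2) * indicator (S \<inter> ball p (\<rho> p)) x)"
        proof (cases "x \<in> S")
          case True
          then obtain p where p: "p \<in> T" "x \<in> ball p (\<rho> p)" using T closure_subset by blast
          have "ennreal ((v j x)\<^sup>2) * indicator S x = ennreal ((v j x)\<^sup>2) * indicator (S \<inter> ball p (\<rho> p)) x"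
            using True p by simp
          also have "\<dots> \<le> (\<Sum>p\<in>T. ennreal ((v j x)\<^sup>2) * indicator (S \<inter> ball p (\<rho> p)) x)"
            by (rule member_le_sum) (use p T in auto)
          finally show ?thesis .
        qed simp
      qed
      also have "\<dots> = (\<Sum>p\<in>T. \<integral>\<^sup>+x\<in>S \<inter> ball p (\<rho> p). ennreal ((v j x)\<^sup>2) \<partial>lborel)"
        by (rule nn_integral_sum) measurable
      finally show ?thesis unfolding nn .
    qed
    then show "\<forall>\<^sub>F j in sequentially. ennreal ((l2norm (lebesgue_on S) (v j))\<^sup>2) \<le> (\<Sum>p\<in>T. \<integral>\<^sup>+x\<in>S \<inter> ball p (\<rho> p). ennreal ((v j x)\<^sup>2) \<partial>lborel)"
      by simp
  qed simp
  then have "(\<lambda>j. (l2norm (lebesgue_on S) (v j))\<^sup>2) \<longlonglongrightarrow> 0"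
    using tendsto_ennreal_iff[of "\<lambda>j. (l2norm (lebesgue_on S) (v j))\<^sup>2" sequentially 0] by simp
  then have "(\<lambda>j. sqrt ((l2norm (lebesgue_on S) (v j))\<^sup>2)) \<longlonglongrightarrow> sqrt 0" by (rule tendsto_real_sqrt)
  then show ?thesis by (simp add: l2norm_nonneg)
qed

text \<open>The limit \<open>U\<close> is not smooth, so \<open>weak_null_imp_strong_null\<close>
  cannot be applied to \<open>W j - U\<close>. It is applied to differences of two members of the
  sequence: if the sequence were not Cauchy, differences bounded away from zero would converge
  weakly to zero.\<close>

theorem weak_imp_strong_convergence:
  fixes W :: "nat \<Rightarrow> 'a::euclidean_space \<Rightarrow> real"
  assumes S: "bounded S" "open S" "cone_property S" and W: "\<And>j. smooth (W j)" and U: "U \<in> L2 S"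
    and weak: "\<And>f. f \<in> L2 S \<Longrightarrow> (\<lambda>j. LINT x|lebesgue_on S. W j x * f x) \<longlonglongrightarrow> (LINT x|lebesgue_on S. U x * f x)"
    and C: "\<And>j. l2norm (lebesgue_on S) (W j) \<le> C" "\<And>j. l2norm (lebesgue_on S) (grad (W j)) \<le> C"
  shows "(\<lambda>j. l2norm (lebesgue_on S) (\<lambda>x. W j x - U x)) \<longlonglongrightarrow> 0"
proof -
  let ?L = "lebesgue_on S"
  have WL: "sq_integrable ?L (W j)" for j using smooth_L2[OF S(1,2) W] by (simp add: L2_iff)
  have GL: "sq_integrable ?L (grad (W j))" for j using smooth_grad_L2[OF S(1,2) W] by (simp add: L2_iff)
  have UL: "sq_integrable ?L U" using U by (simp add: L2_iff)
  have cauchy: "\<exists>N. \<forall>j\<ge>N. \<forall>k\<ge>N. l2norm ?L (\<lambda>x. W j x - W k x) < e" if e: "e > 0" for e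
  proof (rule ccontr)
    assume "\<not> ?thesis"
    then have "\<forall>N. \<exists>j\<ge>N. \<exists>k\<ge>N. l2norm ?L (\<lambda>x. W j x - W k x) \<ge> e" by (meson not_le)
    then obtain j k where jk: "\<And>N. j N \<ge> N" "\<And>N. k N \<ge> N" "\<And>N. l2norm ?L (\<lambda>x. W (j N) x - W (k N) x) \<ge> e" by metis
    have "(\<lambda>N. l2norm ?L (\<lambda>x. W (j N) x - W (k N) x)) \<longlonglongrightarrow> 0"
    proof (rule weak_null_imp_strong_null[OF S])
      show "smooth (\<lambda>x. W (j N) x - W (k N) x)" for N by (intro smooth_diff W)
      show "l2norm ?L (\<lambda>x. W (j N) x - W (k N) x) \<le> 2 * C" for N
        using l2norm_triangle[OF WL sq_integrable_scaleR[OF WL, of "-1"], of "j N" "k N"] C(1)[of "j N"] C(1)[of "k N"]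
        by (simp add: l2norm_uminus)
      have "l2norm ?L (\<lambda>x. grad (W (j N)) x - grad (W (k N)) x) \<le> 2 * C" for N
        using l2norm_triangle[OF GL sq_integrable_scaleR[OF GL, of "-1"], of "j N" "k N"] C(2)[of "j N"] C(2)[of "k N"]
        by (simp add: l2norm_uminus)
      moreover have "grad (\<lambda>x. W (j N) x - W (k N) x) = (\<lambda>x. grad (W (j N)) x - grad (W (k N)) x)" for N
        by (rule ext) (rule grad_diff[OF W W])
      ultimately show "l2norm ?L (grad (\<lambda>x. W (j N) x - W (k N) x)) \<le> 2 * C" for N by simp
    next
      fix A :: "'a set" assume A: "A \<in> sets borel" "A \<subseteq> S"
      have Sb: "S \<in> sets borel" using S by auto
      define f where "f = (indicator A :: 'a \<Rightarrow> real)"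
      have fm: "f \<in> borel_measurable borel" unfolding f_def using A by measurable
      have fL: "f \<in> L2 S" unfolding L2_iff
        by (rule sq_integrable_bounded[OF finite_lebesgue_on[OF S(1,2)] borel_measurable_lebesgue_on[OF fm], of 1]) (simp add: f_def)
      have eq: "(LINT x:A|lborel. w x) = (LINT x|?L. w x * f x)" if w: "smooth w" for w
      proof -
        have wm: "w \<in> borel_measurable borel" using smooth_continuous[OF w] by (rule borel_measurable_continuous_onI)
        have "(LINT x|?L. w x * f x) = (LBINT x. w x * f x)"
          using A fm wm Sb by (intro lebesgue_on_integral_support) (auto simp: f_def indicator_def)
        then show ?thesis unfolding set_lebesgue_integral_def f_def by (simp add: mult.commute)
      qed
      have fj: "filterlim j at_top sequentially" "filterlim k at_top sequentially"
        using jk by (auto intro: filterlim_at_top_mono[OF filterlim_ident])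
      have "(\<lambda>N. (LINT x|?L. W (j N) x * f x) - (LINT x|?L. W (k N) x * f x)) \<longlonglongrightarrow> (LINT x|?L. U x * f x) - (LINT x|?L. U x * f x)"
        by (intro tendsto_diff filterlim_compose[OF weak[OF fL]] fj)
      moreover have "(LINT x|?L. W (j N) x * f x) - (LINT x|?L. W (k N) x * f x) = (LINT x:A|lborel. W (j N) x - W (k N) x)" for N
      proof -
        have "integrable ?L (\<lambda>x. W i x * f x)" for i using sq_integrable_mult[OF WL] fL by (simp add: L2_iff)
        then show ?thesis unfolding eq[OF smooth_diff[OF W W]] by (simp add: left_diff_distrib)
      qed
      ultimately show "(\<lambda>N. LINT x:A|lborel. W (j N) x - W (k N) x) \<longlonglongrightarrow> 0" by simp
    qed
    then have "\<forall>\<^sub>F N in sequentially. l2norm ?L (\<lambda>x. W (j N) x - W (k N) x) < e" using e order_tendstoD(2) by blast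
    then show False using jk(3) by (auto simp: not_less[symmetric] eventually_sequentially)
  qed
  show ?thesis
  proof (rule LIMSEQ_I)
    fix e :: real assume e: "e > 0"
    obtain N where N: "\<And>j k. j \<ge> N \<Longrightarrow> k \<ge> N \<Longrightarrow> l2norm ?L (\<lambda>x. W j x - W k x) < e / 2"
      using cauchy[of "e/2"] e by auto
    have le: "l2norm ?L (\<lambda>x. W j x - U x) \<le> e / 2" if j: "j \<ge> N" for j
    proof -
      let ?d = "\<lambda>x. W j x - U x"
      have d: "sq_integrable ?L ?d" by (rule sq_integrable_diff[OF WL UL])
      have i: "integrable ?L (\<lambda>x. W i x * ?d x)" "integrable ?L (\<lambda>x. U x * ?d x)" for i
        using sq_integrable_mult[OF WL d] sq_integrable_mult[OF UL d] by auto
      \<comment> \<open>\<open>W j - U\<close> itself is the test function: as \<open>k\<close>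
        grows, its pairing with \<open>W j - W k\<close> tends to the square of its norm.\<close>
      have "(\<lambda>k. (LINT x|?L. W j x * ?d x) - (LINT x|?L. W k x * ?d x)) \<longlonglongrightarrow> (LINT x|?L. W j x * ?d x) - (LINT x|?L. U x * ?d x)"
        by (intro tendsto_diff tendsto_const weak) (use d in \<open>simp add: L2_iff\<close>)
      moreover have "(LINT x|?L. W j x * ?d x) - (LINT x|?L. U x * ?d x) = (l2norm ?L ?d)\<^sup>2"
      proof -
        have "(LINT x|?L. W j x * ?d x) - (LINT x|?L. U x * ?d x) = (LINT x|?L. W j x * ?d x - U x * ?d x)"
          using i by simp
        also have "\<dots> = (LINT x|?L. (norm (?d x))\<^sup>2)"
          by (intro Bochner_Integration.integral_cong) (auto simp: power2_eq_square algebra_simps)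
        finally show ?thesis by (simp add: l2norm_power2)
      qed
      ultimately have lim: "(\<lambda>k. (LINT x|?L. W j x * ?d x) - (LINT x|?L. W k x * ?d x)) \<longlonglongrightarrow> (l2norm ?L ?d)\<^sup>2" by simp
      have "(l2norm ?L ?d)\<^sup>2 \<le> (e / 2) * l2norm ?L ?d"
      proof (rule LIMSEQ_le_const2[OF lim], intro exI allI impI)
        fix k assume k: "k \<ge> N"
        have "(LINT x|?L. W j x * ?d x) - (LINT x|?L. W k x * ?d x) = (LINT x|?L. (W j x - W k x) * ?d x)"
          using i by (simp add: left_diff_distrib)
        also have "\<dots> \<le> l2norm ?L (\<lambda>x. W j x - W k x) * l2norm ?L ?d"
          using l2_Cauchy_Schwarz_real[OF sq_integrable_diff[OF WL WL] d, of j k] by linarith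
        also have "\<dots> \<le> (e / 2) * l2norm ?L ?d"
          using N[OF j k] l2norm_nonneg by (intro mult_right_mono) auto
        finally show "(LINT x|?L. W j x * ?d x) - (LINT x|?L. W k x * ?d x) \<le> (e / 2) * l2norm ?L ?d" .
      qed
      then show ?thesis
        using l2norm_nonneg[of ?L ?d] e by (cases "l2norm ?L ?d = 0") (auto simp: power2_eq_square)
    qed
    have "norm (l2norm ?L (\<lambda>x. W j x - U x) - 0) < e" if j: "j \<ge> N" for j
      using le[OF j] l2norm_nonneg[of ?L "\<lambda>x. W j x - U x"] e by simp
    then show "\<exists>N. \<forall>j\<ge>N. norm (l2norm ?L (\<lambda>x. W j x - U x) - 0) < e" by blast
  qed
qed

subsection \<open>Functions that are constant almost everywhere\<close>

text \<open>Nonempty open sets are not negligible. This is used to compare constants on overlaps and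
  to pick sections on which convergence is known.\<close>

lemma AE_lborel_open_witness:
  fixes V :: "'a::euclidean_space set"
  assumes P: "AE x in lborel. P x" and V: "open V" "V \<noteq> {}"
  obtains x where "x \<in> V" "P x"
proof (rule ccontr)
  assume no: "\<not> thesis"
  have "AE x in lebesgue. x \<notin> V"
    using P that no by (intro AE_completion) (auto elim!: eventually_mono)
  then have "V \<in> null_sets lebesgue" using V by (subst AE_iff_null_sets) auto
  then have "negligible V" by (simp add: negligible_iff_null_sets)
  then show False using open_not_negligible[OF V] by simp
qed

text \<open>By Lindelof countably many of the balls cover \<open>D\<close>, and countably many null
  sets have a null union.\<close>

lemma locally_AE_imp_AE:
  fixes D :: "'a::euclidean_space set"
  assumes loc: "\<And>p. p \<in> D \<Longrightarrow> \<exists>\<rho>>0. AE x in lborel. x \<in> ball p \<rho> \<longrightarrow> x \<in> D \<longrightarrow> Q x"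
  shows "AE x in lborel. x \<in> D \<longrightarrow> Q x"
proof -
  obtain \<rho> where r: "\<And>p. p \<in> D \<Longrightarrow> \<rho> p > 0"
    and Q: "\<And>p. p \<in> D \<Longrightarrow> AE x in lborel. x \<in> ball p (\<rho> p) \<longrightarrow> x \<in> D \<longrightarrow> Q x"
    using loc by metis
  have "\<exists>F. F \<subseteq> (\<lambda>p. ball p (\<rho> p)) ` D \<and> countable F \<and> \<Union>F = \<Union>((\<lambda>p. ball p (\<rho> p)) ` D)"
  proof (rule Lindelof[of "(\<lambda>p. ball p (\<rho> p)) ` D"])
    show "open B" if "B \<in> (\<lambda>p. ball p (\<rho> p)) ` D" for B using that by auto
  qed (intro exI conjI)
  then obtain F where F: "F \<subseteq> (\<lambda>p. ball p (\<rho> p)) ` D" "countable F" "\<Union>F = \<Union>((\<lambda>p. ball p (\<rho> p)) ` D)"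
    by (elim exE conjE)
  have "AE x in lborel. x \<in> B \<longrightarrow> x \<in> D \<longrightarrow> Q x" if B: "B \<in> F" for B
  proof -
    obtain p where "p \<in> D" "B = ball p (\<rho> p)" using subsetD[OF F(1) B] by blast
    then show ?thesis using Q[of p] by simp
  qed
  then have "AE x in lborel. \<forall>B\<in>F. x \<in> B \<longrightarrow> x \<in> D \<longrightarrow> Q x"
    unfolding AE_ball_countable[OF F(2)] by blast
  moreover have "x \<in> \<Union>F" if "x \<in> D" for x using that F(3) r by force
  ultimately show ?thesis by (auto elim!: eventually_mono)
qed

text \<open>Two of the balls that meet in \<open>D\<close> do so in an open set of positive measure,
  which forces their constants to agree. The constant is therefore locally constant as a function of
  the centre.\<close>

lemma locally_AE_constant_imp_AE_constant:
  fixes u :: "'a::euclidean_space \<Rightarrow> real"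
  assumes D: "open D" "connected D"
    and loc: "\<And>p. p \<in> D \<Longrightarrow> \<exists>\<rho>>0. \<exists>c. AE x in lborel. x \<in> ball p \<rho> \<longrightarrow> x \<in> D \<longrightarrow> u x = c"
  shows "\<exists>c. AE x in lborel. x \<in> D \<longrightarrow> u x = c"
proof -
  obtain \<rho> c where r: "\<And>p. p \<in> D \<Longrightarrow> \<rho> p > 0"
    and c: "\<And>p. p \<in> D \<Longrightarrow> AE x in lborel. x \<in> ball p (\<rho> p) \<longrightarrow> x \<in> D \<longrightarrow> u x = c p"
    using loc by metis
  have "c constant_on D"
  proof (rule locally_constant_imp_constant[OF D(2)])
    fix a assume a: "a \<in> D"
    show "\<exists>T. openin (top_of_set D) T \<and> a \<in> T \<and> (\<forall>x\<in>T. c x = c a)"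
    proof (intro exI[of _ "D \<inter> ball a (\<rho> a)"] conjI ballI)
      show "openin (top_of_set D) (D \<inter> ball a (\<rho> a))" by (simp add: openin_open_Int)
      show "a \<in> D \<inter> ball a (\<rho> a)" using a r by simp
      fix q assume q: "q \<in> D \<inter> ball a (\<rho> a)"
      then have qD: "q \<in> D" by simp
      have "AE x in lborel. x \<in> D \<inter> ball a (\<rho> a) \<inter> ball q (\<rho> q) \<longrightarrow> c q = c a"
        using c[OF a] c[OF qD] by eventually_elim auto
      moreover have "open (D \<inter> ball a (\<rho> a) \<inter> ball q (\<rho> q))" using D by auto
      moreover have "D \<inter> ball a (\<rho> a) \<inter> ball q (\<rho> q) \<noteq> {}" using q r[OF qD] by auto
      ultimately obtain x where "x \<in> D \<inter> ball a (\<rho> a) \<inter> ball q (\<rho> q)" "x \<in> D \<inter> ball a (\<rho> a) \<inter> ball q (\<rho> q) \<longrightarrow> c q = c a"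
        by (rule AE_lborel_open_witness)
      then show "c q = c a" by simp
    qed
  qed
  then obtain k where k: "\<And>p. p \<in> D \<Longrightarrow> c p = k" unfolding constant_on_def by blast
  have "AE x in lborel. x \<in> D \<longrightarrow> u x = k"
  proof (rule locally_AE_imp_AE)
    fix p assume p: "p \<in> D"
    show "\<exists>\<rho>>0. AE x in lborel. x \<in> ball p \<rho> \<longrightarrow> x \<in> D \<longrightarrow> u x = k"
      using r[OF p] c[OF p] unfolding k[OF p] by blast
  qed
  then show ?thesis by blast
qed

lemma L2_borel_subset:
  fixes f :: "'a::euclidean_space \<Rightarrow> 'b::euclidean_space"
  assumes "B \<subseteq> D" "B \<in> sets borel" "D \<in> sets borel" "f \<in> borel_measurable borel" "f \<in> L2 D"
  shows "f \<in> L2 B" "l2norm (lebesgue_on B) f \<le> l2norm (lebesgue_on D) f"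
proof -
  have m: "(\<lambda>x. (norm (f x))\<^sup>2) \<in> borel_measurable borel" using assms by measurable
  have i: "set_integrable lborel D (\<lambda>x. (norm (f x))\<^sup>2)"
    using assms(5) lebesgue_on_integral(2)[OF assms(3) m] by (simp add: L2_iff sq_integrable_def)
  then have i': "set_integrable lborel B (\<lambda>x. (norm (f x))\<^sup>2)"
    by (rule set_integrable_subset) (use assms in auto)
  then show L: "f \<in> L2 B"
    using lebesgue_on_integral(2)[OF assms(2) m] borel_measurable_lebesgue_on[OF assms(4)]
    by (simp add: L2_iff sq_integrable_def)
  have "(LINT x:B|lborel. (norm (f x))\<^sup>2) \<le> (LINT x:D|lborel. (norm (f x))\<^sup>2)"
    unfolding set_lebesgue_integral_def
    by (rule integral_mono) (use i i' assms(1) in \<open>auto simp: set_integrable_def indicator_def\<close>)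
  then show "l2norm (lebesgue_on B) f \<le> l2norm (lebesgue_on D) f"
    unfolding l2norm_def lebesgue_on_integral(1)[OF assms(2) m] lebesgue_on_integral(1)[OF assms(3) m] by simp
qed

text \<open>Only balls inside \<open>D\<close> are used, on which the Poincare inequality holds
  whatever the shape of \<open>D\<close>. There \<open>w j\<close> approaches its mean because the
  gradient tends to zero, and the means tend to the mean of \<open>u\<close>. Connectedness then
  gives one constant on all of \<open>D\<close>.\<close>

lemma strong_limit_gradient_0_constant:
  fixes w :: "nat \<Rightarrow> 'a::euclidean_space \<Rightarrow> real"
  assumes D: "open D" "connected D" "bounded D" and w: "\<And>j. smooth (w j)"
    and u: "u \<in> borel_measurable borel" "u \<in> L2 D"
    and lim: "(\<lambda>j. l2norm (lebesgue_on D) (\<lambda>x. w j x - u x)) \<longlonglongrightarrow> 0"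
      "(\<lambda>j. l2norm (lebesgue_on D) (grad (w j))) \<longlonglongrightarrow> 0"
  shows "\<exists>c. AE x in lborel. x \<in> D \<longrightarrow> u x = c"
proof (rule locally_AE_constant_imp_AE_constant[OF D(1,2)])
  fix p assume "p \<in> D"
  then obtain r where r: "r > 0" "ball p r \<subseteq> D" using D(1) openE by blast
  let ?B = "ball p r"
  let ?L = "lebesgue_on ?B"
  let ?m = "measure lborel ?B"
  have m: "?m > 0" using content_ball_pos[OF r(1)] by simp
  have Bs[measurable]: "?B \<in> sets borel" "D \<in> sets borel" using D by auto
  have wm[measurable]: "w j \<in> borel_measurable borel" "grad (w j) \<in> borel_measurable borel" for j
    using smooth_continuous[OF w] smooth_grad_continuous[OF w] by (auto intro: borel_measurable_continuous_onI)
  have um[measurable]: "u \<in> borel_measurable borel" by fact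
  interpret finite_measure ?L by (rule finite_lebesgue_on) auto
  have const: "sq_integrable ?L (\<lambda>x. k :: real)" for k
    by (rule sq_integrable_bounded[OF finite_measure_axioms, of _ "\<bar>k\<bar>"]) auto
  have l2const: "l2norm ?L (\<lambda>x. k :: real) = \<bar>k\<bar> * sqrt ?m" for k
    unfolding l2norm_def by (simp add: real_sqrt_mult measure_restrict_space)
  have wL: "sq_integrable ?L (w j)" for j using smooth_L2[OF _ _ w] by (simp add: L2_iff)
  have uL: "sq_integrable ?L u" using L2_borel_subset(1)[OF r(2) Bs um u(2)] by (simp add: L2_iff)
  have wuD: "(\<lambda>x. w j x - u x) \<in> L2 D" for j
    by (rule L2_diff[OF smooth_L2[OF D(3,1) w] u(2)])
  define c where "c j = (LINT x:?B|lborel. w j x) / ?m" for j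
  have lim1: "(\<lambda>j. l2norm ?L (\<lambda>x. w j x - u x)) \<longlonglongrightarrow> 0"
  proof (rule tendsto_sandwich[OF _ _ tendsto_const lim(1)])
    show "\<forall>\<^sub>F j in sequentially. l2norm ?L (\<lambda>x. w j x - u x) \<le> l2norm (lebesgue_on D) (\<lambda>x. w j x - u x)"
      by (intro always_eventually allI L2_borel_subset(2)[OF r(2) Bs _ wuD]) measurable
  qed (simp add: l2norm_nonneg)
  have lim2: "(\<lambda>j. l2norm ?L (\<lambda>x. c j - w j x)) \<longlonglongrightarrow> 0"
  proof -
    \<comment> \<open>\<open>K\<^sup>2\<close> is the constant of \<open>poincare_ball\<close> after
      division by the measure of the ball.\<close>
    define K where "K = sqrt (4 * r\<^sup>2 * measure lborel (ball (0::'a) (2 * r)) / ?m)"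
    have K0: "4 * r\<^sup>2 * measure lborel (ball (0::'a) (2 * r)) / ?m \<ge> 0" using m by simp
    have le: "l2norm ?L (\<lambda>x. c j - w j x) \<le> K * l2norm (lebesgue_on D) (grad (w j))" for j
    proof -
      have cs: "smooth (\<lambda>x. c j - w j x)" by (intro smooth_diff smooth_const w)
      have n1: "(\<integral>\<^sup>+x\<in>?B. ennreal ((c j - w j x)\<^sup>2) \<partial>lborel) = ennreal ((l2norm ?L (\<lambda>x. c j - w j x))\<^sup>2)"
        using nn_integral_l2norm[OF Bs(1) _ smooth_L2[OF _ _ cs]] by simp
      have n2: "(\<integral>\<^sup>+x\<in>?B. ennreal ((norm (grad (w j) x))\<^sup>2) \<partial>lborel) = ennreal ((l2norm ?L (grad (w j)))\<^sup>2)"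
        by (rule nn_integral_l2norm[OF Bs(1) wm(2) smooth_grad_L2[OF _ _ w]]) auto
      have e: "emeasure lborel (ball (0::'a) (2 * r)) = ennreal (measure lborel (ball (0::'a) (2 * r)))"
        using emeasure_bounded_finite[of "ball (0::'a) (2 * r)"] by (intro emeasure_eq_ennreal_measure) auto
      have "ennreal ((l2norm ?L (\<lambda>x. c j - w j x))\<^sup>2) * ennreal ?m
        \<le> ennreal (4 * r\<^sup>2) * ennreal (measure lborel (ball (0::'a) (2 * r))) * ennreal ((l2norm ?L (grad (w j)))\<^sup>2)"
        using poincare_ball[where w="w j" and r=r and p=p, OF w r(1)] by (simp only: c_def[symmetric] n1 n2 e)
      then have "ennreal ((l2norm ?L (\<lambda>x. c j - w j x))\<^sup>2 * ?m)
        \<le> ennreal (4 * r\<^sup>2 * measure lborel (ball (0::'a) (2 * r)) * (l2norm ?L (grad (w j)))\<^sup>2)"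
        by (simp add: ennreal_mult)
      then have "(l2norm ?L (\<lambda>x. c j - w j x))\<^sup>2 * ?m \<le> 4 * r\<^sup>2 * measure lborel (ball (0::'a) (2 * r)) * (l2norm ?L (grad (w j)))\<^sup>2"
        by (subst (asm) ennreal_le_iff) auto
      then have "(l2norm ?L (\<lambda>x. c j - w j x))\<^sup>2 \<le> (4 * r\<^sup>2 * measure lborel (ball (0::'a) (2 * r)) / ?m) * (l2norm ?L (grad (w j)))\<^sup>2"
        using m by (simp add: field_simps)
      also have "\<dots> = (K * l2norm ?L (grad (w j)))\<^sup>2"
        unfolding K_def power_mult_distrib real_sqrt_pow2[OF K0] ..
      finally have "l2norm ?L (\<lambda>x. c j - w j x) \<le> K * l2norm ?L (grad (w j))"
        by (rule power2_le_imp_le) (auto simp: K_def l2norm_nonneg)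
      also have "\<dots> \<le> K * l2norm (lebesgue_on D) (grad (w j))"
        by (intro mult_left_mono L2_borel_subset(2)[OF r(2) Bs wm(2) smooth_grad_L2[OF D(3,1) w]]) (simp add: K_def)
      finally show ?thesis .
    qed
    show ?thesis
    proof (rule tendsto_sandwich[OF _ _ tendsto_const])
      show "(\<lambda>j. K * l2norm (lebesgue_on D) (grad (w j))) \<longlonglongrightarrow> 0"
        using tendsto_mult_left[OF lim(2), of K] by simp
    qed (use le in \<open>auto simp: l2norm_nonneg\<close>)
  qed
  define k where "k = (LINT x:?B|lborel. u x) / ?m"
  have lim3: "(\<lambda>j. \<bar>k - c j\<bar> * sqrt ?m) \<longlonglongrightarrow> 0"
  proof (rule tendsto_sandwich[OF _ _ tendsto_const lim1])
    have "\<bar>k - c j\<bar> * sqrt ?m \<le> l2norm ?L (\<lambda>x. w j x - u x)" for j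
    proof -
      have iw: "integrable ?L (w j)" using sq_integrable_mult[OF wL const[of 1]] by simp
      have iu: "integrable ?L u" using sq_integrable_mult[OF uL const[of 1]] by simp
      have "c j - k = ((LINT x|?L. w j x) - (LINT x|?L. u x)) / ?m"
        unfolding c_def k_def lebesgue_on_integral(1)[OF Bs(1) wm(1)] lebesgue_on_integral(1)[OF Bs(1) um]
        by (simp add: diff_divide_distrib)
      also have "\<dots> = (LINT x|?L. (w j x - u x) * 1) / ?m" using iw iu by simp
      finally have "\<bar>c j - k\<bar> = \<bar>LINT x|?L. (w j x - u x) * 1\<bar> / ?m"
        using m by (simp only: abs_divide abs_of_pos)
      then have "\<bar>k - c j\<bar> = \<bar>LINT x|?L. (w j x - u x) * 1\<bar> / ?m" by (simp only: abs_minus_commute)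
      also have "\<dots> \<le> (l2norm ?L (\<lambda>x. w j x - u x) * l2norm ?L (\<lambda>x. 1::real)) / ?m"
        using m by (intro divide_right_mono l2_Cauchy_Schwarz_real sq_integrable_diff wL uL const) auto
      also have "\<dots> = l2norm ?L (\<lambda>x. w j x - u x) * (sqrt ?m / ?m)" by (simp add: l2const)
      finally have "\<bar>k - c j\<bar> * sqrt ?m \<le> l2norm ?L (\<lambda>x. w j x - u x) * (sqrt ?m / ?m) * sqrt ?m"
        using m by (intro mult_right_mono) auto
      also have "\<dots> = l2norm ?L (\<lambda>x. w j x - u x)" using m by (simp add: field_simps)
      finally show ?thesis .
    qed
    then show "\<forall>\<^sub>F j in sequentially. \<bar>k - c j\<bar> * sqrt ?m \<le> l2norm ?L (\<lambda>x. w j x - u x)" by simp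
  qed (use m in simp)
  have "l2norm ?L (\<lambda>x. u x - k) \<le> l2norm ?L (\<lambda>x. w j x - u x) + l2norm ?L (\<lambda>x. c j - w j x) + \<bar>k - c j\<bar> * sqrt ?m" for j
  proof -
    have "l2norm ?L (\<lambda>x. u x - k) \<le> l2norm ?L (\<lambda>x. u x - w j x) + l2norm ?L (\<lambda>x. w j x - k)"
      by (rule l2norm_triangle_diff[OF uL wL const])
    moreover have "l2norm ?L (\<lambda>x. w j x - k) \<le> l2norm ?L (\<lambda>x. w j x - c j) + l2norm ?L (\<lambda>x. c j - k)"
      by (rule l2norm_triangle_diff[OF wL const const])
    ultimately show ?thesis
      using l2const[of "c j - k"] l2norm_minus_commute[of ?L u "w j"] l2norm_minus_commute[of ?L "w j" "\<lambda>_. c j"]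
      by (simp add: abs_minus_commute)
  qed
  then have "l2norm ?L (\<lambda>x. u x - k) \<le> 0 + 0 + 0"
    by (intro LIMSEQ_le_const[OF tendsto_add[OF tendsto_add[OF lim1 lim2] lim3]]) auto
  then have "l2norm ?L (\<lambda>x. u x - k) = 0" using l2norm_nonneg[of ?L "\<lambda>x. u x - k"] by simp
  then have "AE x in ?L. u x - k = 0" by (rule l2norm_eq_0_imp[OF sq_integrable_diff[OF uL const]])
  then have "AE x in lebesgue. x \<in> ?B \<longrightarrow> u x = k"
    by (subst (asm) AE_restrict_space_iff) auto
  then have "AE x in lborel. x \<in> ?B \<longrightarrow> u x = k"
    by (subst (asm) AE_completion_iff) auto
  then have "AE x in lborel. x \<in> ball p r \<longrightarrow> x \<in> D \<longrightarrow> u x = k" by eventually_elim auto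
  then show "\<exists>\<rho>>0. \<exists>c. AE x in lborel. x \<in> ball p \<rho> \<longrightarrow> x \<in> D \<longrightarrow> u x = c" using r(1) by blast
qed

subsection \<open>Slicing three-dimensional space\<close>

definition cyl :: "real \<Rightarrow> real^2 \<Rightarrow> real^3" where
  "cyl t x = vector [t, x $ 1, x $ 2]"

lemma cyl_nth [simp]: "cyl t x $ 1 = t" "cyl t x $ 2 = x $ 1" "cyl t x $ 3 = x $ 2"
  by (simp_all add: cyl_def)

lemma transverse_nth [simp]: "transverse y $ 1 = y $ 2" "transverse y $ 2 = y $ 3"
  by (simp_all add: transverse_def)

lemma transverse_cyl [simp]: "transverse (cyl t x) = x"
  by (simp add: vec_eq_iff forall_2)

lemma cyl_transverse [simp]: "cyl (y $ 1) (transverse y) = y"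
  by (simp add: vec_eq_iff forall_3)

lemma Basis_real_vec: "Basis = range (\<lambda>i. axis i (1::real) :: real^'n)"
  by (auto simp: Basis_vec_def)

lemma prod_Basis_real_vec: "(\<Prod>b\<in>Basis. f b) = (\<Prod>i\<in>UNIV. f (axis i (1::real) :: real^'n))"
  unfolding Basis_real_vec by (subst prod.reindex) (auto simp: inj_on_def axis_eq_axis)

lemma sum_Basis_real_vec: "(\<Sum>b\<in>Basis. f b) = (\<Sum>i\<in>UNIV. f (axis i (1::real) :: real^'n))"
  unfolding Basis_real_vec by (subst sum.reindex) (auto simp: inj_on_def axis_eq_axis)

lemma cyl_affine: "cyl t x = t *\<^sub>R axis 1 1 + (vector [0, x $ 1, x $ 2] :: real^3)"
  by (simp add: vec_eq_iff forall_3 axis_def)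

lemma cyl_affine': "(vector [0, x $ 1, x $ 2] :: real^3) + t *\<^sub>R axis 1 1 = cyl t x"
  by (simp add: vec_eq_iff forall_3 axis_def)

lemma bounded_linear_vector_0: "bounded_linear (\<lambda>x::real^2. vector [0, x $ 1, x $ 2] :: real^3)"
  by (intro linear_conv_bounded_linear[THEN iffD1] linearI) (simp_all add: vec_eq_iff forall_3)

lemma continuous_on_cyl: "continuous_on UNIV (\<lambda>p. cyl (fst p) (snd p))"
proof (subst continuous_on_componentwise, rule ballI)
  fix b :: "real^3" assume "b \<in> Basis"
  then obtain i where i: "b = axis i 1" unfolding Basis_real_vec by blast
  have 1: "continuous_on UNIV (\<lambda>p::real \<times> (real^2). snd p $ k)" for k
    by (intro continuous_intros)
  have 2: "continuous_on UNIV (\<lambda>p::real \<times> (real^2). fst p)"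
    by (intro continuous_on_fst continuous_on_id)
  show "continuous_on UNIV (\<lambda>p. cyl (fst p) (snd p) \<bullet> b)"
    using exhaust_3[of i] 1[of 1] 1[of 2] 2 unfolding i inner_axis by auto
qed

lemma borel_measurable_cyl [measurable]:
  assumes [measurable]: "f \<in> borel_measurable M" "g \<in> borel_measurable M"
  shows "(\<lambda>x. cyl (f x) (g x)) \<in> borel_measurable M"
proof -
  have "(\<lambda>p. cyl (fst p) (snd p)) \<in> borel_measurable borel"
    by (rule borel_measurable_continuous_onI[OF continuous_on_cyl])
  moreover have "(\<lambda>x. (f x, g x)) \<in> borel_measurable M" by measurable
  ultimately have "(\<lambda>x. (\<lambda>p. cyl (fst p) (snd p)) (f x, g x)) \<in> borel_measurable M"
    by (rule measurable_compose[rotated])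
  then show ?thesis by simp
qed

text \<open>The preimage of a box is an interval times a plane box, and agreement on boxes
  determines the measure. All slicing below is Fubini for the product measure carried over by this
  identity.\<close>

lemma lborel_cyl: "distr (lborel \<Otimes>\<^sub>M lborel) borel (\<lambda>p. cyl (fst p) (snd p)) = lborel"
proof (rule lborel_eqI[symmetric])
  fix l u :: "real^3"
  assume le: "\<And>b. b \<in> Basis \<Longrightarrow> l \<bullet> b \<le> u \<bullet> b"
  have le': "l $ i \<le> u $ i" for i using le[of "axis i 1"] by (simp add: inner_axis)
  have le2: "transverse l $ i \<le> transverse u $ i" for i using le' exhaust_2[of i] by auto
  have pre: "(\<lambda>p. cyl (fst p) (snd p)) -` box l u \<inter> space (lborel \<Otimes>\<^sub>M lborel) = box (l $ 1) (u $ 1) \<times> box (transverse l) (transverse u)"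
    by (auto simp: mem_box_cart forall_3 forall_2 space_pair_measure)
  have "emeasure (distr (lborel \<Otimes>\<^sub>M lborel) borel (\<lambda>p. cyl (fst p) (snd p))) (box l u)
    = emeasure (lborel \<Otimes>\<^sub>M lborel) (box (l $ 1) (u $ 1) \<times> box (transverse l) (transverse u))"
    by (subst emeasure_distr) (auto simp: pre)
  also have "\<dots> = emeasure lborel (box (l $ 1) (u $ 1)) * emeasure lborel (box (transverse l) (transverse u))"
    by (rule lborel.emeasure_pair_measure_Times) auto
  also have "\<dots> = ennreal (u $ 1 - l $ 1) * ennreal ((u $ 2 - l $ 2) * (u $ 3 - l $ 3))"
    using le' le2 by (subst (1 2) emeasure_lborel_box)
      (auto simp: Basis_real_vec inner_axis forall_2 prod_Basis_real_vec[where 'n=2, unfolded Basis_real_vec] UNIV_2 axis_eq_axis inner_diff_left mult.commute)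
  also have "\<dots> = ennreal (\<Prod>b\<in>Basis. (u - l) \<bullet> b)"
  proof -
    have "(\<Prod>b\<in>Basis. (u - l) \<bullet> b) = (u $ 1 - l $ 1) * ((u $ 2 - l $ 2) * (u $ 3 - l $ 3))"
      unfolding prod_Basis_real_vec UNIV_3 by (simp add: inner_axis)
    then show ?thesis using le' by (simp add: ennreal_mult)
  qed
  finally show "emeasure (distr (lborel \<Otimes>\<^sub>M lborel) borel (\<lambda>p. cyl (fst p) (snd p))) (box l u) = ennreal (\<Prod>b\<in>Basis. (u - l) \<bullet> b)" .
qed simp

lemma nn_integral_cyl:
  assumes [measurable]: "f \<in> borel_measurable borel"
  shows "(\<integral>\<^sup>+y. f y \<partial>lborel) = (\<integral>\<^sup>+t. (\<integral>\<^sup>+x. f (cyl t x) \<partial>lborel) \<partial>lborel)"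
proof -
  have "(\<integral>\<^sup>+y. f y \<partial>lborel) = (\<integral>\<^sup>+y. f y \<partial>distr (lborel \<Otimes>\<^sub>M lborel) borel (\<lambda>p. cyl (fst p) (snd p)))"
    by (simp add: lborel_cyl)
  also have "\<dots> = (\<integral>\<^sup>+p. f (cyl (fst p) (snd p)) \<partial>(lborel \<Otimes>\<^sub>M lborel))"
    by (rule nn_integral_distr) auto
  also have "\<dots> = (\<integral>\<^sup>+t. (\<integral>\<^sup>+x. f (cyl t x) \<partial>lborel) \<partial>lborel)"
    using lborel.nn_integral_fst[of "\<lambda>p. f (cyl (fst p) (snd p))" lborel] by simp
  finally show ?thesis .
qed

lemma integrable_cyl_pair:
  fixes f :: "real^3 \<Rightarrow> real"
  assumes "integrable lborel f"
  shows "integrable (lborel \<Otimes>\<^sub>M lborel) (\<lambda>p. f (cyl (fst p) (snd p)))"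
    "(LBINT y. f y) = (\<integral>p. f (cyl (fst p) (snd p)) \<partial>(lborel \<Otimes>\<^sub>M lborel))"
proof -
  have m: "f \<in> borel_measurable borel" using assms by simp
  have "integrable (distr (lborel \<Otimes>\<^sub>M lborel) borel (\<lambda>p. cyl (fst p) (snd p))) f" using assms by (simp add: lborel_cyl)
  then show "integrable (lborel \<Otimes>\<^sub>M lborel) (\<lambda>p. f (cyl (fst p) (snd p)))"
    by (subst (asm) integrable_distr_eq) (use m in auto)
  have "(LBINT y. f y) = (\<integral>y. f y \<partial>distr (lborel \<Otimes>\<^sub>M lborel) borel (\<lambda>p. cyl (fst p) (snd p)))"
    by (simp add: lborel_cyl)
  also have "\<dots> = (\<integral>p. f (cyl (fst p) (snd p)) \<partial>(lborel \<Otimes>\<^sub>M lborel))"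
    by (rule integral_distr) (use m in auto)
  finally show "(LBINT y. f y) = (\<integral>p. f (cyl (fst p) (snd p)) \<partial>(lborel \<Otimes>\<^sub>M lborel))" .
qed

text \<open>The first equation integrates over sections inside, the last one along axial lines
  inside. The last order is the one in which the fundamental theorem of calculus can be
  applied.\<close>

lemma integral_cyl:
  fixes f :: "real^3 \<Rightarrow> real"
  assumes "integrable lborel f"
  shows "(LBINT y. f y) = (LBINT t. LBINT x. f (cyl t x))"
    "integrable lborel (\<lambda>t. LBINT x. f (cyl t x))"
    "AE t in lborel. integrable lborel (\<lambda>x. f (cyl t x))"
    "(LBINT y. f y) = (LBINT x. LBINT t. f (cyl t x))"
  using lborel_pair.integral_fst'[OF integrable_cyl_pair(1)[OF assms]] lborel_pair.integrable_fst'[OF integrable_cyl_pair(1)[OF assms]]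
    lborel_pair.AE_integrable_fst'[OF integrable_cyl_pair(1)[OF assms]] integrable_cyl_pair(2)[OF assms]
    lborel_pair.integral_snd[of "\<lambda>t x. f (cyl t x)"] integrable_cyl_pair(1)[OF assms]
  by (simp_all add: case_prod_beta')

lemma AE_cylD:
  assumes "AE y in lborel. P y" shows "AE t in lborel. AE x in lborel. P (cyl t x)"
proof -
  have "AE p in lborel \<Otimes>\<^sub>M lborel. P (cyl (fst p) (snd p))"
    by (rule AE_distrD[where M'=borel]) (measurable, unfold lborel_cyl, rule assms)
  from lborel_pair.AE_pair[OF this] show ?thesis by simp
qed

text \<open>Null slices make a null set only when the set is known to be measurable, hence the first
  hypothesis.\<close>

lemma AE_cylI:
  assumes P: "{y. P y} \<in> sets borel" and ae: "AE t in lborel. AE x in lborel. P (cyl t x)"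
  shows "AE y in lborel. P y"
proof -
  have "(\<lambda>p. cyl (fst p) (snd p)) \<in> measurable (lborel \<Otimes>\<^sub>M lborel) borel" by measurable
  from measurable_sets[OF this P]
  have "{p \<in> space (lborel \<Otimes>\<^sub>M lborel). P (cyl (fst p) (snd p))} \<in> sets (lborel \<Otimes>\<^sub>M lborel)"
    by (simp add: vimage_def Int_def conj_commute)
  then have "AE p in lborel \<Otimes>\<^sub>M lborel. P (cyl (fst p) (snd p))"
    by (rule lborel_pair.AE_pair_measure) (use ae in simp)
  then have "AE y in distr (lborel \<Otimes>\<^sub>M lborel) borel (\<lambda>p. cyl (fst p) (snd p)). P y"
    by (subst AE_distr_iff) (use P in auto)
  then show ?thesis unfolding lborel_cyl .
qed

lemma smooth_slice: "smooth w \<Longrightarrow> smooth (\<lambda>x. w (cyl t x))"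
  using smooth_affine_compose[OF _ bounded_linear_vector_0, of w "t *\<^sub>R axis 1 1"]
  unfolding cyl_affine' .

text \<open>Fixing the axial variable leaves exactly the components of the gradient that the
  rescaling makes small.\<close>

lemma norm_grad_slice:
  assumes w: "smooth w"
  shows "(norm (grad (\<lambda>x. w (cyl t x)) x))\<^sup>2 = (grad w (cyl t x) $ 2)\<^sup>2 + (grad w (cyl t x) $ 3)\<^sup>2"
proof -
  have "((\<lambda>x. w (cyl t x)) has_derivative (\<lambda>h. (\<Sum>b\<in>Basis. (grad w (cyl t x) \<bullet> vector [0, b $ 1, b $ 2]) *\<^sub>R b) \<bullet> h)) (at x)"
    using has_derivative_affine_compose[where x=x and c="t *\<^sub>R axis 1 1", OF smooth_has_derivative[OF w] bounded_linear_vector_0]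
    unfolding cyl_affine' .
  then have "grad (\<lambda>x. w (cyl t x)) x = (\<Sum>b\<in>Basis. (grad w (cyl t x) \<bullet> vector [0, b $ 1, b $ 2]) *\<^sub>R b)"
    by (rule grad_eqI)
  also have "\<dots> = vector [grad w (cyl t x) $ 2, grad w (cyl t x) $ 3]"
    by (simp add: sum_Basis_real_vec UNIV_2 vec_eq_iff forall_2 axis_def inner_vec_def sum_3)
  finally have eq: "grad (\<lambda>x. w (cyl t x)) x = vector [grad w (cyl t x) $ 2, grad w (cyl t x) $ 3]" .
  show ?thesis unfolding eq power2_norm_eq_inner by (simp add: inner_vec_def sum_2 power2_eq_square)
qed

lemma has_real_derivative_cyl:
  assumes w: "smooth w"
  shows "((\<lambda>t. w (cyl t x)) has_real_derivative (grad w (cyl t x) $ 1)) (at t)"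
  using has_real_derivative_along_line[OF smooth_has_derivative[OF w], of "vector [0, x $ 1, x $ 2]" "axis 1 1" t]
  unfolding cyl_affine' by (simp add: inner_axis)

text \<open>The section integrals tend to zero in \<open>L1\<close> of the axial variable; this
  gives convergence at almost every \<open>t\<close> along a subsequence.\<close>

lemma slice_subsequence:
  fixes f :: "nat \<Rightarrow> real^3 \<Rightarrow> real"
  assumes f: "\<And>n. integrable lborel (f n)" "\<And>n y. 0 \<le> f n y" and lim: "(\<lambda>n. LBINT y. f n y) \<longlonglongrightarrow> 0"
  obtains r where "strict_mono r" "AE t in lborel. (\<lambda>n. LBINT x. f (r n) (cyl t x)) \<longlonglongrightarrow> 0"
proof -
  have "(\<lambda>n. LBINT t. norm (LBINT x. f n (cyl t x))) \<longlonglongrightarrow> 0"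
  proof -
    have "norm (LBINT x. f n (cyl t x)) = (LBINT x. f n (cyl t x))" for n t by (simp add: f(2))
    then show ?thesis using lim by (simp only: integral_cyl(1)[OF f(1)])
  qed
  from tendsto_L1_AE_subseq[OF integral_cyl(2)[OF f(1)] this] show ?thesis using that by blast
qed

subsection \<open>Rescaling the thin rod\<close>

lemma scale_transverse_nth [simp]:
  "scale_transverse c x $ 1 = x $ 1" "scale_transverse c x $ 2 = c * x $ 2" "scale_transverse c x $ 3 = c * x $ 3"
  by (simp_all add: scale_transverse_def)

lemma bounded_linear_scale_transverse: "bounded_linear (scale_transverse c)"
  by (intro linear_conv_bounded_linear[THEN iffD1] linearI) (simp_all add: vec_eq_iff forall_3 algebra_simps)

lemma scale_transverse_inverse:
  "\<epsilon> \<noteq> 0 \<Longrightarrow> scale_transverse \<epsilon> (scale_transverse (1 / \<epsilon>) x) = x"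
  "\<epsilon> \<noteq> 0 \<Longrightarrow> scale_transverse (1 / \<epsilon>) (scale_transverse \<epsilon> x) = x"
  by (simp_all add: vec_eq_iff forall_3)

lemma scale_transverse_mem_thin_rod: "\<epsilon> \<noteq> 0 \<Longrightarrow> scale_transverse \<epsilon> y \<in> thin_rod G \<epsilon> \<longleftrightarrow> y \<in> G"
  by (simp add: thin_rod_def scale_transverse_inverse)

lemma thin_rod_image: "\<epsilon> \<noteq> 0 \<Longrightarrow> thin_rod G \<epsilon> = scale_transverse \<epsilon> ` G"
  by (auto simp: thin_rod_def scale_transverse_inverse image_iff intro!: bexI[of _ "scale_transverse (1 / \<epsilon>) _"])

lemma bounded_thin_rod: "\<epsilon> \<noteq> 0 \<Longrightarrow> bounded G \<Longrightarrow> bounded (thin_rod G \<epsilon>)"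
  by (simp add: thin_rod_image bounded_linear_image bounded_linear_scale_transverse)

lemma open_thin_rod: "open G \<Longrightarrow> open (thin_rod G \<epsilon>)"
  unfolding thin_rod_def
  using open_vimage[of G "scale_transverse (1 / \<epsilon>)"] linear_continuous_on[OF bounded_linear_scale_transverse]
  by (simp add: vimage_def)

text \<open>The diagonal map has Jacobian determinant \<open>\<epsilon>\<^sup>2\<close>. The
  completed measure is used throughout, because eigenfunctions are only Lebesgue measurable and
  their composition with the scaling must remain so.\<close>

lemma scale_transverse_lebesgue:
  assumes "\<epsilon> > 0"
  shows "lebesgue = density (distr lebesgue lebesgue (scale_transverse \<epsilon>)) (\<lambda>_. ennreal (\<epsilon>\<^sup>2))"
    and "scale_transverse \<epsilon> \<in> lebesgue \<rightarrow>\<^sub>M lebesgue"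
proof -
  define c where "c j = (if j = axis 1 1 then 1 else \<epsilon>)" for j :: "real^3"
  have c: "c j \<noteq> 0" for j using assms by (simp add: c_def)
  have T: "(\<lambda>x. 0 + (\<Sum>j\<in>Basis. (c j * (x \<bullet> j)) *\<^sub>R j)) = scale_transverse \<epsilon>"
  proof
    fix x :: "real^3"
    have "0 + (\<Sum>j\<in>Basis. (c j * (x \<bullet> j)) *\<^sub>R j) = x $ 1 *\<^sub>R axis 1 1 + (\<epsilon> * x $ 2) *\<^sub>R axis 2 1 + (\<epsilon> * x $ 3) *\<^sub>R axis 3 1"
      unfolding sum_Basis_real_vec sum_3 by (simp add: c_def axis_eq_axis inner_axis)
    also have "\<dots> = scale_transverse \<epsilon> x" by (simp add: vec_eq_iff forall_3 axis_def)
    finally show "0 + (\<Sum>j\<in>Basis. (c j * (x \<bullet> j)) *\<^sub>R j) = scale_transverse \<epsilon> x" .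
  qed
  have P: "(\<Prod>j\<in>Basis. \<bar>c j\<bar>) = \<epsilon>\<^sup>2"
    unfolding prod_Basis_real_vec UNIV_3 using assms by (simp add: c_def axis_eq_axis power2_eq_square)
  show "lebesgue = density (distr lebesgue lebesgue (scale_transverse \<epsilon>)) (\<lambda>_. ennreal (\<epsilon>\<^sup>2))"
    using lebesgue_affine_euclidean[of c 0] c unfolding T P by simp
  show "scale_transverse \<epsilon> \<in> lebesgue \<rightarrow>\<^sub>M lebesgue"
    using lebesgue_affine_measurable[of c 0] c unfolding T by simp
qed

context
  fixes G :: "(real^3) set" and \<epsilon> :: real
  assumes G: "open G" and e: "\<epsilon> > 0"
begin

lemma thin_rod_lebesgue: "thin_rod G \<epsilon> \<inter> space lebesgue \<in> sets lebesgue" "G \<inter> space lebesgue \<in> sets lebesgue"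
  using open_thin_rod[OF G] G by auto

lemma scale_measurable:
  fixes f :: "real^3 \<Rightarrow> 'b::euclidean_space"
  assumes "f \<in> borel_measurable (lebesgue_on (thin_rod G \<epsilon>))"
  shows "(\<lambda>y. f (scale_transverse \<epsilon> y)) \<in> borel_measurable (lebesgue_on G)"
  by (rule measurable_compose[OF measurable_restrict_space3[OF scale_transverse_lebesgue(2)[OF e]] assms])
    (use e in \<open>auto simp: scale_transverse_mem_thin_rod\<close>)

lemma scale_integral:
  fixes f :: "real^3 \<Rightarrow> real"
  assumes f: "f \<in> borel_measurable (lebesgue_on (thin_rod G \<epsilon>))"
  shows "(LINT x|lebesgue_on (thin_rod G \<epsilon>). f x) = \<epsilon>\<^sup>2 * (LINT y|lebesgue_on G. f (scale_transverse \<epsilon> y))"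
    and "integrable (lebesgue_on (thin_rod G \<epsilon>)) f \<Longrightarrow> integrable (lebesgue_on G) (\<lambda>y. f (scale_transverse \<epsilon> y))"
proof -
  define F where "F x = indicator (thin_rod G \<epsilon>) x *\<^sub>R f x" for x
  have F: "F \<in> borel_measurable lebesgue"
    unfolding F_def using f borel_measurable_restrict_space_iff[OF thin_rod_lebesgue(1)] by blast
  have Fs: "F (scale_transverse \<epsilon> y) = indicator G y *\<^sub>R f (scale_transverse \<epsilon> y)" for y
    using e by (simp add: F_def indicator_def scale_transverse_mem_thin_rod)
  have m: "F \<in> borel_measurable (distr lebesgue lebesgue (scale_transverse \<epsilon>))" using F by simp
  note T = scale_transverse_lebesgue(2)[OF e]
  have "(LINT x|lebesgue_on (thin_rod G \<epsilon>). f x) = (LINT x|lebesgue. F x)"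
    unfolding F_def by (rule integral_restrict_space[OF thin_rod_lebesgue(1)])
  also have "\<dots> = (LINT x|density (distr lebesgue lebesgue (scale_transverse \<epsilon>)) (\<lambda>_. ennreal (\<epsilon>\<^sup>2)). F x)"
    using scale_transverse_lebesgue(1)[OF e] by simp
  also have "\<dots> = (LINT x|distr lebesgue lebesgue (scale_transverse \<epsilon>). \<epsilon>\<^sup>2 *\<^sub>R F x)"
    by (rule integral_density[OF m]) auto
  also have "\<dots> = (LINT y|lebesgue. \<epsilon>\<^sup>2 *\<^sub>R F (scale_transverse \<epsilon> y))"
    by (rule integral_distr[OF T]) (use F in measurable)
  also have "\<dots> = \<epsilon>\<^sup>2 * (LINT y|lebesgue_on G. f (scale_transverse \<epsilon> y))"
    unfolding integral_restrict_space[OF thin_rod_lebesgue(2)] Fs by simp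
  finally show "(LINT x|lebesgue_on (thin_rod G \<epsilon>). f x) = \<epsilon>\<^sup>2 * (LINT y|lebesgue_on G. f (scale_transverse \<epsilon> y))" .
  assume "integrable (lebesgue_on (thin_rod G \<epsilon>)) f"
  then have "integrable lebesgue F"
    unfolding integrable_restrict_space[OF thin_rod_lebesgue(1)] F_def .
  then have "integrable (density (distr lebesgue lebesgue (scale_transverse \<epsilon>)) (\<lambda>_. ennreal (\<epsilon>\<^sup>2))) F"
    using scale_transverse_lebesgue(1)[OF e] by simp
  then have "integrable (distr lebesgue lebesgue (scale_transverse \<epsilon>)) (\<lambda>x. \<epsilon>\<^sup>2 *\<^sub>R F x)"
    by (subst (asm) integrable_density[OF m]) auto
  then have "integrable (distr lebesgue lebesgue (scale_transverse \<epsilon>)) F" using e by simp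
  then have "integrable lebesgue (\<lambda>y. F (scale_transverse \<epsilon> y))"
    by (subst (asm) integrable_distr_eq[OF T]) (use F in auto)
  then show "integrable (lebesgue_on G) (\<lambda>y. f (scale_transverse \<epsilon> y))"
    unfolding integrable_restrict_space[OF thin_rod_lebesgue(2)] Fs .
qed

lemma scale_l2norm:
  fixes f :: "real^3 \<Rightarrow> 'b::euclidean_space"
  assumes f: "f \<in> L2 (thin_rod G \<epsilon>)"
  shows "(\<lambda>y. f (scale_transverse \<epsilon> y)) \<in> L2 G"
    and "l2norm (lebesgue_on (thin_rod G \<epsilon>)) f = \<epsilon> * l2norm (lebesgue_on G) (\<lambda>y. f (scale_transverse \<epsilon> y))"
proof -
  have m: "f \<in> borel_measurable (lebesgue_on (thin_rod G \<epsilon>))"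
    and i: "integrable (lebesgue_on (thin_rod G \<epsilon>)) (\<lambda>x. (norm (f x))\<^sup>2)" using f by (auto simp: L2_def)
  have m2: "(\<lambda>x. (norm (f x))\<^sup>2) \<in> borel_measurable (lebesgue_on (thin_rod G \<epsilon>))" using m by measurable
  show "(\<lambda>y. f (scale_transverse \<epsilon> y)) \<in> L2 G"
    unfolding L2_def using scale_measurable[OF m] scale_integral(2)[OF m2 i] by simp
  show "l2norm (lebesgue_on (thin_rod G \<epsilon>)) f = \<epsilon> * l2norm (lebesgue_on G) (\<lambda>y. f (scale_transverse \<epsilon> y))"
    unfolding l2norm_def scale_integral(1)[OF m2] using e by (simp add: real_sqrt_mult)
qed

end

text \<open>A diagonal map is its own adjoint. With \<open>c = \<epsilon>\<close> this is the source
  of the small factor in the transverse derivatives.\<close>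

lemma grad_scale:
  assumes w: "smooth w"
  shows "grad (\<lambda>y. w (scale_transverse c y)) y = scale_transverse c (grad w (scale_transverse c y))"
proof -
  have "((\<lambda>y. w (scale_transverse c y + 0)) has_derivative
      (\<lambda>h. (\<Sum>b\<in>Basis. (grad w (scale_transverse c y + 0) \<bullet> scale_transverse c b) *\<^sub>R b) \<bullet> h)) (at y)"
    by (rule has_derivative_affine_compose[OF smooth_has_derivative[OF w] bounded_linear_scale_transverse])
  then have "((\<lambda>y. w (scale_transverse c y)) has_derivative
      (\<lambda>h. (\<Sum>b\<in>Basis. (grad w (scale_transverse c y) \<bullet> scale_transverse c b) *\<^sub>R b) \<bullet> h)) (at y)"
    unfolding add_0_right .
  then have "grad (\<lambda>y. w (scale_transverse c y)) y = (\<Sum>b\<in>Basis. (grad w (scale_transverse c y) \<bullet> scale_transverse c b) *\<^sub>R b)"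
    by (rule grad_eqI)
  also have "\<dots> = scale_transverse c (grad w (scale_transverse c y))"
    unfolding sum_Basis_real_vec sum_3 by (simp add: vec_eq_iff forall_3 axis_def inner_vec_def sum_3)
  finally show ?thesis .
qed

lemma smooth_scale: "smooth w \<Longrightarrow> smooth (\<lambda>y. w (scale_transverse c y))"
  using smooth_affine_compose[OF _ bounded_linear_scale_transverse, of w c 0] unfolding add_0_right .

lemma bounded_linear_fst_coord: "bounded_linear (\<lambda>x::real^3. x $ 1)"
  by (rule bounded_linear_vec_nth)

lemma smooth_fst_coord: "smooth \<phi> \<Longrightarrow> smooth (\<lambda>x::real^3. \<phi> (x $ 1))"
  using smooth_affine_compose[OF _ bounded_linear_fst_coord, of \<phi> 0] unfolding add_0_right .

lemma grad_fst_coord: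
  assumes p: "smooth \<phi>"
  shows "grad (\<lambda>x::real^3. \<phi> (x $ 1)) x = grad \<phi> (x $ 1) *\<^sub>R axis 1 1"
proof (rule grad_eqI)
  have "((\<lambda>x::real^3. x $ 1) has_derivative (\<lambda>h. h $ 1)) (at x)"
    by (rule bounded_linear_imp_has_derivative[OF bounded_linear_fst_coord])
  from has_derivative_compose[OF this smooth_has_derivative[OF p]]
  show "((\<lambda>x::real^3. \<phi> (x $ 1)) has_derivative (\<bullet>) (grad \<phi> (x $ 1) *\<^sub>R axis 1 1)) (at x)"
    by (rule has_derivative_eq_rhs) (auto simp: inner_axis' fun_eq_iff)
qed

lemma L2_nth: "f \<in> L2 S \<Longrightarrow> (\<lambda>x. f x $ i :: real) \<in> L2 S"
  unfolding cart_eq_inner_axis by (rule L2_inner_const)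

lemma l2norm_nth_le: "f \<in> L2 S \<Longrightarrow> l2norm (lebesgue_on S) (\<lambda>x. f x $ i :: real) \<le> l2norm (lebesgue_on S) f"
  unfolding cart_eq_inner_axis L2_iff by (rule l2norm_inner_Basis_le) (auto simp: Basis_real_vec)

text \<open>A smooth approximant replaces the eigenfunction because it has values on single sections
  and on the end faces. After rescaling the axial derivative keeps the size
  \<open>sqrt \<mu>\<close> and the transverse ones gain the factor \<open>\<epsilon>\<close>. The
  last conclusion is the eigenvalue equation tested with a function of the axial variable, up to the
  error of approximation.\<close>

lemma scaled_eigenfunction_approx:
  fixes u :: "real^3 \<Rightarrow> real" and l\<^sub>0 l\<^sub>1 :: real
  defines "I \<equiv> {l\<^sub>0<..<l\<^sub>1}"
  assumes G: "open G" "bounded G" and e: "\<epsilon> > 0" "\<epsilon> < 1" and lam: "\<mu> \<ge> 0"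
    and eig: "mixed_eigenpair (thin_rod G \<epsilon>) (end_faces l\<^sub>0 l\<^sub>1 D \<epsilon>) \<mu> u"
    and nrm: "(LINT x|lebesgue_on (thin_rod G \<epsilon>). \<bar>u x\<bar>\<^sup>2) = \<epsilon>\<^sup>2" and d: "\<delta> > 0"
  obtains W where "smooth W" "\<And>y. y \<in> plane_face D l\<^sub>0 \<union> plane_face D l\<^sub>1 \<Longrightarrow> W y = 0"
    "l2norm (lebesgue_on G) (\<lambda>y. W y - u (scale_transverse \<epsilon> y)) \<le> \<delta>"
    "l2norm (lebesgue_on G) (\<lambda>y. u (scale_transverse \<epsilon> y)) = 1"
    "l2norm (lebesgue_on G) (\<lambda>y. grad W y $ 1) \<le> sqrt \<mu> + \<delta>"
    "l2norm (lebesgue_on G) (\<lambda>y. grad W y $ 2) \<le> \<epsilon> * (sqrt \<mu> + \<delta>)"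
    "l2norm (lebesgue_on G) (\<lambda>y. grad W y $ 3) \<le> \<epsilon> * (sqrt \<mu> + \<delta>)"
    "\<And>\<phi>. \<phi> \<in> test_functions I \<Longrightarrow>
       \<bar>(LINT y|lebesgue_on G. grad W y $ 1 * grad \<phi> (y $ 1)) - \<mu> * (LINT y|lebesgue_on G. u (scale_transverse \<epsilon> y) * \<phi> (y $ 1))\<bar>
         \<le> \<delta> * l2norm (lebesgue_on G) (\<lambda>y. grad \<phi> (y $ 1))"
proof -
  let ?S = "thin_rod G \<epsilon>"
  let ?s = "scale_transverse \<epsilon>"
  let ?\<Gamma> = "end_faces l\<^sub>0 l\<^sub>1 D \<epsilon>"
  let ?L = "lebesgue_on ?S"
  have S: "bounded ?S" "open ?S" using G e bounded_thin_rod open_thin_rod by auto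
  have eu: "u \<in> H1_closure ?S {w. smooth w \<and> (\<forall>x\<in>?\<Gamma>. w x = 0)}"
    and eq: "\<And>v. v \<in> H1_vanishing ?S ?\<Gamma> \<Longrightarrow> L2_inner ?S (weak_grad ?S u) (weak_grad ?S v) = \<mu> * L2_inner ?S u v"
    using eig unfolding mixed_eigenpair_def H1_vanishing_def by auto
  have uH: "u \<in> H1 ?S" using eu by (simp add: H1_closure_def)
  have uL: "u \<in> L2 ?S" by (rule H1_L2[OF uH])
  define g where "g = weak_grad ?S u"
  have gL: "g \<in> L2 ?S" unfolding g_def by (rule weak_grad_H1(1)[OF uH])
  have uv: "u \<in> H1_vanishing ?S ?\<Gamma>" using eu unfolding H1_vanishing_def .
  \<comment> \<open>Testing the eigenvalue equation with \<open>u\<close> itself yields the gradient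
    norm \<open>\<epsilon> * sqrt \<mu>\<close> on the thin rod.\<close>
  have "(l2norm ?L g)\<^sup>2 = L2_inner ?S g g"
    by (simp add: l2norm_power2 L2_inner_def dot_square_norm)
  also have "\<dots> = \<mu> * L2_inner ?S u u" unfolding g_def by (rule eq[OF uv])
  also have "L2_inner ?S u u = \<epsilon>\<^sup>2" using nrm by (simp add: L2_inner_def power2_eq_square)
  finally have "l2norm ?L g = sqrt (\<mu> * \<epsilon>\<^sup>2)" by (metis l2norm_nonneg real_sqrt_unique)
  then have gn: "l2norm ?L g = \<epsilon> * sqrt \<mu>" using e by (simp add: real_sqrt_mult)
  \<comment> \<open>Norms on the thin rod are \<open>\<epsilon>\<close> times those of the rescaled
    functions on \<open>G\<close>, so the tolerance \<open>\<epsilon> * \<delta>\<close> becomes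
    \<open>\<delta>\<close>.\<close>
  obtain w where w: "w \<in> {w. smooth w \<and> (\<forall>x\<in>?\<Gamma>. w x = 0)}" "l2norm ?L (\<lambda>x. w x - u x) < \<epsilon> * \<delta>"
    "l2norm ?L (\<lambda>x. grad w x - weak_grad ?S u x) < \<epsilon> * \<delta>"
    by (rule H1_closure_approx[OF S eu, of "\<epsilon> * \<delta>"]) (use e d in auto)
  have ws: "smooth w" using w by simp
  have gw: "grad w \<in> L2 ?S" by (rule smooth_grad_L2[OF S ws])
  define W where "W y = w (?s y)" for y
  have gW: "grad W y = ?s (grad w (?s y))" for y unfolding W_def by (rule grad_scale[OF ws])
  have gwn: "l2norm ?L (\<lambda>x. grad w x $ i) \<le> \<epsilon> * (sqrt \<mu> + \<delta>)" for i
  proof -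
    have "l2norm ?L (\<lambda>x. grad w x $ i) \<le> l2norm ?L (grad w)" by (rule l2norm_nth_le[OF gw])
    also have "\<dots> \<le> l2norm ?L g + l2norm ?L (\<lambda>x. grad w x - g x)"
      using gw gL unfolding L2_iff by (rule l2norm_le_add_diff)
    also have "\<dots> \<le> \<epsilon> * sqrt \<mu> + \<epsilon> * \<delta>" using w(3) gn unfolding g_def by simp
    finally show ?thesis by (simp add: distrib_left)
  qed
  have gWn: "l2norm (lebesgue_on G) (\<lambda>y. grad w (?s y) $ i) \<le> sqrt \<mu> + \<delta>" for i
    using gwn[of i] scale_l2norm(2)[OF G(1) e(1) L2_nth[OF gw, of i]] e by simp
  have gWi: "l2norm (lebesgue_on G) (\<lambda>y. \<epsilon> * grad w (?s y) $ i) \<le> \<epsilon> * (sqrt \<mu> + \<delta>)" for i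
  proof -
    have "l2norm (lebesgue_on G) (\<lambda>y. \<epsilon> * grad w (?s y) $ i) = \<epsilon> * l2norm (lebesgue_on G) (\<lambda>y. grad w (?s y) $ i)"
      using e unfolding l2norm_def by (simp add: abs_mult power_mult_distrib real_sqrt_mult)
    then show ?thesis using gWn[of i] e by simp
  qed
  show thesis
  proof (rule that[of W])
    show "smooth W" unfolding W_def by (rule smooth_scale[OF ws])
    show "W y = 0" if "y \<in> plane_face D l\<^sub>0 \<union> plane_face D l\<^sub>1" for y
    proof -
      have "?s y \<in> ?\<Gamma>" unfolding end_faces_def using that e by (simp add: scale_transverse_inverse)
      then show ?thesis unfolding W_def using w(1) by simp
    qed
    have "\<epsilon> * l2norm (lebesgue_on G) (\<lambda>y. W y - u (?s y)) < \<epsilon> * \<delta>"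
      using w(2) scale_l2norm(2)[OF G(1) e(1) L2_diff[OF smooth_L2[OF S ws] uL]] unfolding W_def by simp
    then show "l2norm (lebesgue_on G) (\<lambda>y. W y - u (?s y)) \<le> \<delta>" using e by simp
    have "l2norm ?L u = \<epsilon>" unfolding l2norm_def using nrm e by simp
    then show "l2norm (lebesgue_on G) (\<lambda>y. u (?s y)) = 1" using scale_l2norm(2)[OF G(1) e(1) uL] e by simp
    show "l2norm (lebesgue_on G) (\<lambda>y. grad W y $ 1) \<le> sqrt \<mu> + \<delta>" using gWn[of 1] unfolding gW by simp
    show "l2norm (lebesgue_on G) (\<lambda>y. grad W y $ 2) \<le> \<epsilon> * (sqrt \<mu> + \<delta>)" using gWi[of 2] unfolding gW by simp
    show "l2norm (lebesgue_on G) (\<lambda>y. grad W y $ 3) \<le> \<epsilon> * (sqrt \<mu> + \<delta>)" using gWi[of 3] unfolding gW by simp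
  next
    fix \<phi> assume p: "\<phi> \<in> test_functions I"
    have ps: "smooth \<phi>" by (rule test_functions_smooth[OF p])
    have pI: "\<phi> t = 0" if "t \<notin> I" for t
    proof -
      obtain K where "K \<subseteq> I" "{x. \<phi> x \<noteq> 0} \<subseteq> K" using p by (rule test_functionsE)
      then show ?thesis using that by auto
    qed
    \<comment> \<open>A function of the axial variable is unchanged by the rescaling, and since
      \<open>\<phi>\<close> vanishes at both ends, \<open>v\<close> is an admissible test function
      on every thin rod.\<close>
    define v where "v x = \<phi> (x $ 1)" for x :: "real^3"
    have vs: "smooth v" unfolding v_def by (rule smooth_fst_coord[OF ps])
    have gv: "grad v x = grad \<phi> (x $ 1) *\<^sub>R axis 1 1" for x unfolding v_def by (rule grad_fst_coord[OF ps])
    have vG: "v x = 0" if "x \<in> ?\<Gamma>" for x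
    proof -
      have "x $ 1 = l\<^sub>0 \<or> x $ 1 = l\<^sub>1" using that by (auto simp: end_faces_def plane_face_def)
      then show ?thesis unfolding v_def by (intro pI) (auto simp: I_def)
    qed
    have vv: "v \<in> H1_vanishing ?S ?\<Gamma>"
      unfolding H1_vanishing_def by (rule smooth_H1_closure[OF S]) (use vs vG in auto)
    have vL: "v \<in> L2 ?S" by (rule smooth_L2[OF S vs])
    have gvL: "grad v \<in> L2 ?S" by (rule smooth_grad_L2[OF S vs])
    have dL: "(\<lambda>x. grad \<phi> (x $ 1)) \<in> L2 ?S"
      using L2_nth[OF gvL, of 1] unfolding gv by (simp add: axis_def)
    have wvL: "weak_grad ?S v \<in> L2 ?S" by (rule weak_grad_H1(1)[OF smooth_H1[OF S vs]])
    have "L2_inner ?S g (weak_grad ?S v) = L2_inner ?S g (grad v)"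
      unfolding L2_inner_def
    proof (rule integral_cong_AE)
      show "AE x in ?L. g x \<bullet> weak_grad ?S v x = g x \<bullet> grad v x"
        using weak_grad_smooth[OF S vs] by eventually_elim simp
    qed (use gL wvL gvL in \<open>auto simp: L2_def\<close>)
    also have "\<dots> = (LINT x|?L. g x $ 1 * grad \<phi> (x $ 1))"
      unfolding L2_inner_def gv by (simp add: inner_axis mult.commute)
    finally have E: "(LINT x|?L. g x $ 1 * grad \<phi> (x $ 1)) = \<mu> * (LINT x|?L. u x * \<phi> (x $ 1))"
      using eq[OF vv] unfolding g_def[symmetric] by (simp add: L2_inner_def v_def)
    have g1: "(\<lambda>x. g x $ 1) \<in> L2 ?S" and w1: "(\<lambda>x. grad w x $ 1) \<in> L2 ?S" using L2_nth gL gw by auto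
    have i1: "integrable ?L (\<lambda>x. grad w x $ 1 * grad \<phi> (x $ 1))" and i2: "integrable ?L (\<lambda>x. g x $ 1 * grad \<phi> (x $ 1))"
      and i3: "integrable ?L (\<lambda>x. u x * v x)"
      using sq_integrable_mult g1 w1 dL uL vL unfolding L2_iff by auto
    have "\<bar>(LINT x|?L. grad w x $ 1 * grad \<phi> (x $ 1)) - \<mu> * (LINT x|?L. u x * \<phi> (x $ 1))\<bar>
      = \<bar>LINT x|?L. (grad w x $ 1 - g x $ 1) * grad \<phi> (x $ 1)\<bar>"
      unfolding E[symmetric] using i1 i2 by (simp add: left_diff_distrib)
    also have "\<dots> \<le> l2norm ?L (\<lambda>x. grad w x $ 1 - g x $ 1) * l2norm ?L (\<lambda>x. grad \<phi> (x $ 1))"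
      using L2_diff[OF w1 g1] dL unfolding L2_iff by (rule l2_Cauchy_Schwarz_real)
    also have "\<dots> \<le> (\<epsilon> * \<delta>) * l2norm ?L (\<lambda>x. grad \<phi> (x $ 1))"
    proof (rule mult_right_mono)
      have "l2norm ?L (\<lambda>x. (grad w x - g x) $ 1) \<le> l2norm ?L (\<lambda>x. grad w x - g x)"
        by (rule l2norm_nth_le[OF L2_diff[OF gw gL]])
      then show "l2norm ?L (\<lambda>x. grad w x $ 1 - g x $ 1) \<le> \<epsilon> * \<delta>" using w(3) unfolding g_def by simp
    qed (rule l2norm_nonneg)
    also have "l2norm ?L (\<lambda>x. grad \<phi> (x $ 1)) = \<epsilon> * l2norm (lebesgue_on G) (\<lambda>y. grad \<phi> (y $ 1))"
      using scale_l2norm(2)[OF G(1) e(1) dL] by simp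
    finally have *: "\<bar>(LINT x|?L. grad w x $ 1 * grad \<phi> (x $ 1)) - \<mu> * (LINT x|?L. u x * \<phi> (x $ 1))\<bar>
      \<le> \<epsilon>\<^sup>2 * (\<delta> * l2norm (lebesgue_on G) (\<lambda>y. grad \<phi> (y $ 1)))" by (simp add: power2_eq_square mult_ac)
    have A: "(LINT x|?L. grad w x $ 1 * grad \<phi> (x $ 1)) = \<epsilon>\<^sup>2 * (LINT y|lebesgue_on G. grad W y $ 1 * grad \<phi> (y $ 1))"
      using scale_integral(1)[OF G(1) e(1) borel_measurable_integrable[OF i1]] unfolding gW by simp
    have B: "(LINT x|?L. u x * \<phi> (x $ 1)) = \<epsilon>\<^sup>2 * (LINT y|lebesgue_on G. u (?s y) * \<phi> (y $ 1))"
      using scale_integral(1)[OF G(1) e(1) borel_measurable_integrable[OF i3]] unfolding v_def by simp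
    have "\<epsilon>\<^sup>2 * \<bar>(LINT y|lebesgue_on G. grad W y $ 1 * grad \<phi> (y $ 1)) - \<mu> * (LINT y|lebesgue_on G. u (?s y) * \<phi> (y $ 1))\<bar>
      \<le> \<epsilon>\<^sup>2 * (\<delta> * l2norm (lebesgue_on G) (\<lambda>y. grad \<phi> (y $ 1)))"
    proof -
      have "\<epsilon>\<^sup>2 * \<bar>a - \<mu> * b\<bar> = \<bar>\<epsilon>\<^sup>2 * a - \<mu> * (\<epsilon>\<^sup>2 * b)\<bar>" for a b
      proof -
        have "\<epsilon>\<^sup>2 * a - \<mu> * (\<epsilon>\<^sup>2 * b) = \<epsilon>\<^sup>2 * (a - \<mu> * b)" by (simp add: algebra_simps)
        then show ?thesis by (simp add: abs_mult)
      qed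
      then show ?thesis using * unfolding A B by simp
    qed
    then show "\<bar>(LINT y|lebesgue_on G. grad W y $ 1 * grad \<phi> (y $ 1)) - \<mu> * (LINT y|lebesgue_on G. u (?s y) * \<phi> (y $ 1))\<bar>
         \<le> \<delta> * l2norm (lebesgue_on G) (\<lambda>y. grad \<phi> (y $ 1))"
      using e by (simp only: mult_le_cancel_left_pos zero_less_power)
  qed
qed

subsection \<open>Cylinders near the end faces\<close>

lemma norm_cyl_diff_le: "norm (cyl t x - cyl s y) \<le> \<bar>t - s\<bar> + norm (x - y)"
proof -
  have eq: "cyl t x - cyl s y = (t - s) *\<^sub>R axis 1 1 + cyl 0 (x - y)"
    by (simp add: vec_eq_iff forall_3 axis_def)
  have "norm (cyl 0 (x - y)) = norm (x - y)"
    by (simp add: norm_eq_sqrt_inner inner_vec_def sum_3 sum_2)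
  moreover have "norm ((t - s) *\<^sub>R axis 1 1 :: real^3) = \<bar>t - s\<bar>" by (simp add: norm_axis_1)
  ultimately show ?thesis unfolding eq using norm_triangle_ineq by metis
qed

lemma norm_transverse_le: "norm (transverse y) \<le> norm y"
  by (simp add: norm_eq_sqrt_inner inner_vec_def sum_3 sum_2)

lemma rod_domainD:
  assumes "rod_domain l\<^sub>0 l\<^sub>1 D G"
  shows "bounded G" "open G" "lipschitz_boundary G"
    "y \<in> G \<longleftrightarrow> l\<^sub>0 < y $ 1 \<and> y $ 1 < l\<^sub>1 \<and> transverse y \<in> D (y $ 1)"
    "l\<^sub>0 < t \<Longrightarrow> t < l\<^sub>1 \<Longrightarrow> open (D t)" "l\<^sub>0 < t \<Longrightarrow> t < l\<^sub>1 \<Longrightarrow> connected (D t)" "l\<^sub>0 < t \<Longrightarrow> t < l\<^sub>1 \<Longrightarrow> D t \<noteq> {}"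
    "l \<in> {l\<^sub>0, l\<^sub>1} \<Longrightarrow> open (D l)"
    "l \<in> {l\<^sub>0, l\<^sub>1} \<Longrightarrow> closure (plane_face D l) = closure G \<inter> {x. x $ 1 = l}"
proof -
  have r: "bounded G" "lipschitz_domain G" "G = {x. x $ 1 \<in> {l\<^sub>0<..<l\<^sub>1} \<and> transverse x \<in> D (x $ 1)}"
    "\<forall>t\<in>{l\<^sub>0<..<l\<^sub>1}. lipschitz_domain (D t)"
    "\<forall>l\<in>{l\<^sub>0, l\<^sub>1}. open (D l) \<and> closure (plane_face D l) = closure G \<inter> {x. x $ 1 = l}"
    using assms[unfolded rod_domain_def, THEN conjunct1] assms[unfolded rod_domain_def, THEN conjunct2, THEN conjunct1]
      assms[unfolded rod_domain_def, THEN conjunct2, THEN conjunct2, THEN conjunct1]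
      assms[unfolded rod_domain_def, THEN conjunct2, THEN conjunct2, THEN conjunct2, THEN conjunct1]
      assms[unfolded rod_domain_def, THEN conjunct2, THEN conjunct2, THEN conjunct2, THEN conjunct2] .
  show "bounded G" "open G" "lipschitz_boundary G" using r by (auto simp: lipschitz_domain_def)
  show "y \<in> G \<longleftrightarrow> l\<^sub>0 < y $ 1 \<and> y $ 1 < l\<^sub>1 \<and> transverse y \<in> D (y $ 1)" by (subst r(3)) simp
  show "l\<^sub>0 < t \<Longrightarrow> t < l\<^sub>1 \<Longrightarrow> open (D t)" "l\<^sub>0 < t \<Longrightarrow> t < l\<^sub>1 \<Longrightarrow> connected (D t)" "l\<^sub>0 < t \<Longrightarrow> t < l\<^sub>1 \<Longrightarrow> D t \<noteq> {}"
    using r(4) by (auto simp: lipschitz_domain_def)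
  show "l \<in> {l\<^sub>0, l\<^sub>1} \<Longrightarrow> open (D l)" "l \<in> {l\<^sub>0, l\<^sub>1} \<Longrightarrow> closure (plane_face D l) = closure G \<inter> {x. x $ 1 = l}"
    using r(5) by auto
qed

text \<open>A disc of the plane face lies in the frontier, which near its centre is the graph of \<open>h\<close> in
  the direction \<open>e\<close>. Hence \<open>e\<close> is not parallel to the face, the graph is the face, and \<open>G\<close> is
  locally a half-space.\<close>

lemma rod_face_cylinder:
  assumes rod: "rod_domain l\<^sub>0 l\<^sub>1 D G" and l: "l \<in> {l\<^sub>0, l\<^sub>1}" and ll: "l\<^sub>0 < l\<^sub>1" and x0: "x\<^sub>0 \<in> D l"
  obtains \<rho> \<delta> where "\<rho> > 0" "\<delta> > 0" "ball x\<^sub>0 \<rho> \<subseteq> D l"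
    "\<And>t x. l\<^sub>0 < t \<Longrightarrow> t < l\<^sub>1 \<Longrightarrow> \<bar>t - l\<bar> < \<delta> \<Longrightarrow> x \<in> ball x\<^sub>0 \<rho> \<Longrightarrow> cyl t x \<in> G"
proof -
  note R = rod_domainD[OF rod]
  obtain \<rho>1 where r1: "\<rho>1 > 0" "ball x\<^sub>0 \<rho>1 \<subseteq> D l" using R(8)[OF l] x0 openE by blast
  define p where "p = cyl l x\<^sub>0"
  have face: "cyl l x \<in> closure G" "cyl l x \<notin> G" if "x \<in> D l" for x
  proof -
    have "cyl l x \<in> plane_face D l" using that by (simp add: plane_face_def)
    then show "cyl l x \<in> closure G" using R(9)[OF l] closure_subset by blast
    show "cyl l x \<notin> G" using l by (auto simp: R(4))
  qed
  have "p \<in> frontier G" unfolding p_def frontier_def using face[OF x0] R(2) by (simp add: interior_open)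
  then obtain e h M r where e: "norm e = 1" and r: "r > 0" and M: "M-lipschitz_on {z. z \<bullet> e = 0} h"
    and GE: "\<And>y. y \<in> ball p r \<Longrightarrow> y \<in> G \<longleftrightarrow> y \<bullet> e > (h (y - (y \<bullet> e) *\<^sub>R e) :: real)"
    using R(3) unfolding lipschitz_boundary_def by metis
  have ee: "e \<bullet> e = 1" using e by (simp add: norm_eq_1)
  define q where "q x = x - (x \<bullet> e) *\<^sub>R e" for x
  have qo: "q x \<in> {z. z \<bullet> e = 0}" for x unfolding q_def by (simp add: inner_diff_left ee)
  have qs: "q (y + s *\<^sub>R e) = q y" for y s unfolding q_def by (simp add: inner_add_left ee algebra_simps)
  have GEq: "y \<in> G \<longleftrightarrow> h (q y) < y \<bullet> e" if "y \<in> ball p r" for y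
    using GE[OF that] unfolding q_def .
  have qc: "continuous_on UNIV q" unfolding q_def by (intro continuous_intros)
  have hc: "continuous_on UNIV (\<lambda>x. h (q x))"
    by (rule continuous_on_compose2[OF lipschitz_on_continuous_on[OF M] qc]) (use qo in auto)
  \<comment> \<open>A point outside \<open>G\<close> has height at most \<open>h\<close>; a limit of
    points of \<open>G\<close> has height at least \<open>h\<close> by continuity.\<close>
  have graph: "y \<bullet> e = h (q y)" if y: "y \<in> ball p r" "y \<in> closure G" "y \<notin> G" for y
  proof -
    have "y \<bullet> e \<le> h (q y)" using GE[OF y(1)] y(3) unfolding q_def by simp
    moreover have "y \<in> closure (ball p r \<inter> G)"
      using y open_Int_closure_subset[of "ball p r" G] by auto
    then have "h (q y) - y \<bullet> e \<le> 0"
    proof (rule continuous_le_on_closure[rotated])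
      show "continuous_on (closure (ball p r \<inter> G)) (\<lambda>y. h (q y) - y \<bullet> e)"
        by (intro continuous_intros continuous_on_subset[OF hc]) auto
      show "h (q z) - z \<bullet> e \<le> 0" if "z \<in> ball p r \<inter> G" for z using GE[of z] that unfolding q_def by simp
    qed
    ultimately show ?thesis by simp
  qed
  have pb: "p \<in> ball p r" using r by simp
  have pg: "p \<bullet> e = h (q p)" using graph[OF pb] face[OF x0] unfolding p_def by simp
  have up: "p + s *\<^sub>R e \<in> G" if "0 < s" "s < r" for s
  proof -
    have "p + s *\<^sub>R e \<in> ball p r" using that e by (simp add: dist_norm)
    then show ?thesis using GEq[of "p + s *\<^sub>R e"] qs[of p s] pg that by (simp add: inner_add_left ee)
  qed
  \<comment> \<open>Since \<open>p + (r/2) *\<^sub>R e\<close> lies in \<open>G\<close>, its axial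
    coordinate lies strictly between the ends. Hence \<open>k\<close> is nonzero and its sign makes
    \<open>e\<close> point from the face into the rod.\<close>
  define k where "k = e $ 1"
  have "p + (r/2) *\<^sub>R e \<in> G" using up[of "r/2"] r by simp
  then have kk: "l\<^sub>0 < l + (r/2) * k" "l + (r/2) * k < l\<^sub>1" unfolding R(4) p_def k_def by auto
  have k0: "k \<noteq> 0" using kk l by auto
  have sgn: "(t - l) / k > 0" if t: "l\<^sub>0 < t" "t < l\<^sub>1" for t
  proof -
    consider "l = l\<^sub>0" "k > 0" | "l = l\<^sub>1" "k < 0"
      using l kk r by (auto simp: zero_less_mult_iff mult_less_0_iff)
    then show ?thesis using t by cases (auto simp: zero_less_divide_iff)
  qed
  have k1: "\<bar>k\<bar> \<le> 1" unfolding k_def using component_le_norm_cart[of e 1] e by simp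
  define \<eta> where "\<eta> = min \<rho>1 r"
  have \<eta>: "\<eta> > 0" "\<eta> \<le> \<rho>1" "\<eta> \<le> r" using r r1 by (auto simp: \<eta>_def)
  show thesis
  proof (rule that[of "\<eta>/2" "\<bar>k\<bar> * (\<eta>/2)"])
    show "\<eta>/2 > 0" "\<bar>k\<bar> * (\<eta>/2) > 0" using \<eta> k0 by auto
    show "ball x\<^sub>0 (\<eta>/2) \<subseteq> D l" using r1 \<eta> by (auto intro!: subsetD[OF r1(2)])
    fix t x assume t: "l\<^sub>0 < t" "t < l\<^sub>1" "\<bar>t - l\<bar> < \<bar>k\<bar> * (\<eta>/2)" and x: "x \<in> ball x\<^sub>0 (\<eta>/2)"
    \<comment> \<open>Going back from \<open>cyl t x\<close> by \<open>s\<close> along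
      \<open>e\<close> one meets the plane of the face, at the point \<open>z\<close>. Half of
      \<open>\<eta>\<close> is spent on the distance of \<open>x\<close> from the centre and half on
      \<open>s\<close>, so \<open>z\<close> stays in the given disc of the face.\<close>
    define s where "s = (t - l) / k"
    have s0: "s > 0" unfolding s_def using sgn[OF t(1,2)] .
    have "\<bar>s\<bar> = \<bar>t - l\<bar> / \<bar>k\<bar>" unfolding s_def by simp
    also have "\<dots> < \<eta>/2" using t(3) k0 by (simp add: divide_less_eq mult.commute)
    finally have s1: "s < \<eta>/2" by simp
    have tl: "\<bar>t - l\<bar> < \<eta>/2"
    proof -
      have "\<bar>k\<bar> * (\<eta>/2) \<le> 1 * (\<eta>/2)" using k1 \<eta> by (intro mult_right_mono) auto
      then show ?thesis using t(3) by simp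
    qed
    let ?y = "cyl t x"
    define z where "z = ?y - s *\<^sub>R e"
    have z1: "z $ 1 = l" unfolding z_def s_def using k0 by (simp add: k_def)
    have tz: "transverse z = x - s *\<^sub>R transverse e" unfolding z_def by (simp add: vec_eq_iff forall_2)
    have "norm (x\<^sub>0 - transverse z) \<le> norm (x\<^sub>0 - x) + norm (s *\<^sub>R transverse e)"
      unfolding tz using norm_triangle_ineq[of "x\<^sub>0 - x" "s *\<^sub>R transverse e"] by (simp add: algebra_simps)
    also have "\<dots> \<le> norm (x\<^sub>0 - x) + s"
      using norm_transverse_le[of e] s0 e by (simp add: mult_left_le)
    also have "\<dots> < \<eta>" using x s1 by (simp add: dist_norm)
    finally have tzb: "norm (x\<^sub>0 - transverse z) < \<eta>" .
    then have "transverse z \<in> D l" using \<eta> by (intro subsetD[OF r1(2)]) (simp add: dist_norm)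
    moreover have zc: "z = cyl l (transverse z)" using z1 cyl_transverse[of z] by simp
    ultimately have zG: "z \<in> closure G" "z \<notin> G" using face by metis+
    have "norm (p - z) \<le> \<bar>l - l\<bar> + norm (x\<^sub>0 - transverse z)"
      unfolding p_def by (subst zc) (rule norm_cyl_diff_le)
    then have "z \<in> ball p r" using tzb \<eta> by (simp add: dist_norm)
    then have zg: "z \<bullet> e = h (q z)" using graph zG by blast
    have yz: "?y = z + s *\<^sub>R e" unfolding z_def by simp
    have "norm (p - ?y) \<le> \<bar>l - t\<bar> + norm (x\<^sub>0 - x)" unfolding p_def by (rule norm_cyl_diff_le)
    then have yb: "?y \<in> ball p r" using tl x \<eta> by (simp add: dist_norm abs_minus_commute)
    have "q ?y = q z" unfolding yz by (rule qs)
    then have "?y \<bullet> e > h (q ?y)" using zg s0 yz by (simp add: inner_add_left ee)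
    then show "?y \<in> G" using GEq[OF yb] by simp
  qed
qed

subsection \<open>Primitives\<close>

lemma set_integral_FTC_Ioo:
  fixes \<psi> :: "real \<Rightarrow> real"
  assumes "a \<le> b" "\<And>t. (\<psi> has_real_derivative \<psi>' t) (at t)" "continuous_on UNIV \<psi>'"
  shows "(LINT t:{a<..<b}|lborel. \<psi>' t) = \<psi> b - \<psi> a"
proof -
  have [measurable]: "\<psi>' \<in> borel_measurable borel" using assms(3) by (rule borel_measurable_continuous_onI)
  have "(LINT t:{a<..<b}|lborel. \<psi>' t) = (LBINT t. \<psi>' t * indicator {a..b} t)"
    unfolding set_lebesgue_integral_def
  proof (rule integral_cong_AE)
    show "AE t in lborel. indicator {a<..<b} t *\<^sub>R \<psi>' t = \<psi>' t * indicator {a..b} t"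
      using AE_lborel_singleton[of a] AE_lborel_singleton[of b] by eventually_elim (auto simp: indicator_def)
  qed measurable
  also have "\<dots> = \<psi> b - \<psi> a"
    using assms by (intro integral_FTC_Icc_real) (auto simp: continuous_on_eq_continuous_at)
  finally show ?thesis .
qed

lemma integrable_pair_mult:
  fixes c :: "'a::euclidean_space \<Rightarrow> real" and d :: "'b::euclidean_space \<Rightarrow> real"
  assumes "integrable lborel c" "integrable lborel d"
  shows "integrable (lborel \<Otimes>\<^sub>M lborel) (\<lambda>p. c (fst p) * d (snd p))"
proof (rule lborel_pair.Fubini_integrable)
  have [measurable]: "c \<in> borel_measurable borel" "d \<in> borel_measurable borel" using assms by auto
  show "(\<lambda>p. c (fst p) * d (snd p)) \<in> borel_measurable (lborel \<Otimes>\<^sub>M lborel)" by measurable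
  show "integrable lborel (\<lambda>x. LBINT y. norm (c (fst (x, y)) * d (snd (x, y))))"
    using assms by (simp add: abs_mult)
  show "AE x in lborel. integrable lborel (\<lambda>y. c (fst (x, y)) * d (snd (x, y)))"
    using assms by simp
qed

text \<open>Fubini on the triangle \<open>s < t\<close>. Since \<open>k\<close> is merely
  integrable, its primitive need not be differentiable everywhere and classical integration by parts
  is not at hand.\<close>

lemma integral_primitive_by_parts:
  fixes k \<psi> :: "real \<Rightarrow> real"
  assumes k: "set_integrable lborel {a<..<b} k"
    and d: "\<And>t. (\<psi> has_real_derivative \<psi>' t) (at t)" "continuous_on UNIV \<psi>'"
  shows "(LINT t:{a<..<b}|lborel. (LINT s:{a<..<t}|lborel. k s) * \<psi>' t) = (LINT s:{a<..<b}|lborel. k s * (\<psi> b - \<psi> s))"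
    (is "?lhs = ?rhs")
proof -
  have [measurable]: "\<psi>' \<in> borel_measurable borel" using d(2) by (rule borel_measurable_continuous_onI)
  define K where "K s = indicator {a<..<b} s * k s" for s
  have K: "integrable lborel K" using k unfolding K_def set_integrable_def by simp
  then have [measurable]: "K \<in> borel_measurable borel" by simp
  define P where "P t = indicator {a<..<b} t * \<psi>' t" for t
  have P: "integrable lborel P"
    using continuous_sq_integrable_restrict(2)[of "{a<..<b}" \<psi>'] d(2) unfolding P_def set_integrable_def by simp
  then have [measurable]: "P \<in> borel_measurable borel" by simp
  define F where "F p = indicator {p. snd p < fst p} p * (P (fst p) * K (snd p))" for p
  have "integrable (lborel \<Otimes>\<^sub>M lborel) F"
  proof (rule Bochner_Integration.integrable_bound[OF integrable_pair_mult[OF P K]])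
    show "F \<in> borel_measurable (lborel \<Otimes>\<^sub>M lborel)" unfolding F_def by measurable
    show "AE p in lborel \<Otimes>\<^sub>M lborel. norm (F p) \<le> norm (P (fst p) * K (snd p))"
      by (rule AE_I2) (auto simp: F_def indicator_def)
  qed
  then have "integrable (lborel \<Otimes>\<^sub>M lborel) (case_prod (\<lambda>t s. F (t, s)))" by simp
  then have "(LBINT s. LBINT t. F (t, s)) = (LBINT t. LBINT s. F (t, s))"
    by (rule lborel_pair.Fubini_integral)
  moreover have "(LBINT s. F (t, s)) = indicator {a<..<b} t *\<^sub>R ((LINT s:{a<..<t}|lborel. k s) * \<psi>' t)" for t
  proof (cases "t \<in> {a<..<b}")
    case True
    then have "F (t, s) = \<psi>' t * (indicator {a<..<t} s *\<^sub>R k s)" for s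
      unfolding F_def K_def P_def by (auto simp: indicator_def)
    then show ?thesis using True unfolding set_lebesgue_integral_def by (simp add: mult.commute)
  qed (simp add: F_def P_def)
  moreover have "(LBINT t. F (t, s)) = indicator {a<..<b} s *\<^sub>R (k s * (\<psi> b - \<psi> s))" for s
  proof (cases "s \<in> {a<..<b}")
    case True
    then have "F (t, s) = k s * (indicator {s<..<b} t *\<^sub>R \<psi>' t)" for t
      unfolding F_def K_def P_def by (auto simp: indicator_def)
    then have "(LBINT t. F (t, s)) = k s * (LINT t:{s<..<b}|lborel. \<psi>' t)" unfolding set_lebesgue_integral_def by simp
    also have "\<dots> = k s * (\<psi> b - \<psi> s)" using True by (subst set_integral_FTC_Ioo[OF _ d]) auto
    finally show ?thesis using True by simp
  qed (simp add: F_def K_def)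
  ultimately show ?thesis unfolding set_lebesgue_integral_def by simp
qed

text \<open>The primitive is a parameter integral with the indicator of \<open>s < t\<close> in the
  integrand, hence Borel by Fubini.\<close>

lemma primitive_measurable:
  fixes k :: "real \<Rightarrow> real"
  assumes k: "set_integrable lborel {a<..<b} k"
  shows "(\<lambda>t. indicator {a<..<b} t * (LINT s:{a<..<t}|lborel. k s)) \<in> borel_measurable borel"
proof -
  have [measurable]: "(\<lambda>s. indicator {a<..<b} s *\<^sub>R k s) \<in> borel_measurable borel"
    using k unfolding set_integrable_def by (simp add: borel_measurable_integrable)
  have "(\<lambda>t. LBINT s. indicator {p. snd p < fst p} (t, s) * (indicator {a<..<b} s *\<^sub>R k s)) \<in> borel_measurable borel"
    by (rule lborel.borel_measurable_lebesgue_integral) measurable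
  then have [measurable]: "(\<lambda>t. indicator {a<..<b} t * (LBINT s. indicator {p. snd p < fst p} (t, s) * (indicator {a<..<b} s *\<^sub>R k s))) \<in> borel_measurable borel"
    by measurable
  have eq: "indicator {a<..<b} t * (LBINT s. indicator {p. snd p < fst p} (t, s) * (indicator {a<..<b} s *\<^sub>R k s))
      = indicator {a<..<b} t * (LINT s:{a<..<t}|lborel. k s)" for t
    unfolding set_lebesgue_integral_def
    by (auto simp: indicator_def intro!: Bochner_Integration.integral_cong)
  show ?thesis unfolding eq[symmetric] by measurable
qed

lemma set_integral_Ioo_split:
  fixes k :: "real \<Rightarrow> real"
  assumes k: "set_integrable lborel {a<..<b} k" and "a \<le> s" "s \<le> t" "t \<le> b"
  shows "(LINT x:{a<..<t}|lborel. k x) = (LINT x:{a<..<s}|lborel. k x) + (LINT x:{s<..<t}|lborel. k x)"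
proof -
  have 1: "set_integrable lborel {a<..<s} k" "set_integrable lborel {s<..<t} k" "set_integrable lborel {a<..<t} k"
    by (rule set_integrable_subset[OF k]; use assms in auto)+
  have "(LINT x:{a<..<t}|lborel. k x) = (LBINT x. indicator {a<..<s} x *\<^sub>R k x + indicator {s<..<t} x *\<^sub>R k x)"
    unfolding set_lebesgue_integral_def
  proof (rule integral_cong_AE)
    show "AE x in lborel. indicator {a<..<t} x *\<^sub>R k x = indicator {a<..<s} x *\<^sub>R k x + indicator {s<..<t} x *\<^sub>R k x"
      using AE_lborel_singleton[of s] by eventually_elim (use assms in \<open>auto simp: indicator_def\<close>)
  qed (use 1 in \<open>auto simp: set_integrable_def\<close>)
  also have "\<dots> = (LINT x:{a<..<s}|lborel. k x) + (LINT x:{s<..<t}|lborel. k x)"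
    using 1 unfolding set_lebesgue_integral_def set_integrable_def by simp
  finally show ?thesis .
qed

text \<open>The constant \<open>c\<close> drops out because \<open>\<psi>'\<close> integrates to
  \<open>\<psi> b - \<psi> a\<close>, which is zero; the remaining term is
  \<open>integral_primitive_by_parts\<close>.\<close>

lemma primitive_weak_derivative:
  fixes k \<psi> :: "real \<Rightarrow> real"
  assumes k: "set_integrable lborel {a<..<b} k" and ab: "a \<le> b"
    and d: "\<And>t. (\<psi> has_real_derivative \<psi>' t) (at t)" "continuous_on UNIV \<psi>'"
    and 0: "\<psi> a = 0" "\<psi> b = 0"
  shows "(LINT t:{a<..<b}|lborel. (c + (LINT s:{a<..<t}|lborel. k s)) * \<psi>' t) = - (LINT s:{a<..<b}|lborel. k s * \<psi> s)"
proof -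
  have i1: "set_integrable lborel {a<..<b} \<psi>'"
    by (rule continuous_sq_integrable_restrict(2)) (use d in auto)
  have m: "\<psi>' \<in> borel_measurable borel" using d(2) by (rule borel_measurable_continuous_onI)
  define K where "K t = (LINT s:{a<..<t}|lborel. k s)" for t
  have Kb: "\<bar>K t\<bar> \<le> (LINT s:{a<..<b}|lborel. \<bar>k s\<bar>)" if "t \<in> {a<..<b}" for t
  proof -
    have s: "{a<..<t} \<subseteq> {a<..<b}" using that by auto
    have kt: "set_integrable lborel {a<..<t} k" by (rule set_integrable_subset[OF k]) (use s in auto)
    have "\<bar>K t\<bar> \<le> (LINT s:{a<..<t}|lborel. \<bar>k s\<bar>)"
      unfolding K_def using set_integral_norm_bound[OF kt] by simp
    also have "\<dots> \<le> (LINT s:{a<..<b}|lborel. \<bar>k s\<bar>)"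
      unfolding set_lebesgue_integral_def
      by (rule integral_mono) (use set_integrable_abs[OF kt] set_integrable_abs[OF k] s in \<open>auto simp: set_integrable_def indicator_def\<close>)
    finally show ?thesis .
  qed
  have "(\<lambda>t. (indicator {a<..<b} t * K t) * \<psi>' t) \<in> borel_measurable borel"
    using m primitive_measurable[OF k] unfolding K_def by measurable
  then have Km: "(\<lambda>t. indicator {a<..<b} t *\<^sub>R (K t * \<psi>' t)) \<in> borel_measurable borel"
    by (simp add: mult.assoc)
  have i2: "set_integrable lborel {a<..<b} (\<lambda>t. K t * \<psi>' t)"
    unfolding set_integrable_def
  proof (rule Bochner_Integration.integrable_bound)
    show "integrable lborel (\<lambda>t. (LINT s:{a<..<b}|lborel. \<bar>k s\<bar>) * (indicator {a<..<b} t *\<^sub>R \<psi>' t))"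
      using i1 unfolding set_integrable_def by simp
    show "AE t in lborel. norm (indicator {a<..<b} t *\<^sub>R (K t * \<psi>' t)) \<le> norm ((LINT s:{a<..<b}|lborel. \<bar>k s\<bar>) * (indicator {a<..<b} t *\<^sub>R \<psi>' t))"
    proof (rule AE_I2)
      fix t
      show "norm (indicator {a<..<b} t *\<^sub>R (K t * \<psi>' t)) \<le> norm ((LINT s:{a<..<b}|lborel. \<bar>k s\<bar>) * (indicator {a<..<b} t *\<^sub>R \<psi>' t))"
      proof (cases "t \<in> {a<..<b}")
        case True
        then have "\<bar>K t\<bar> \<le> \<bar>LINT s:{a<..<b}|lborel. \<bar>k s\<bar>\<bar>" using Kb[OF True] by linarith
        then show ?thesis using True by (simp add: abs_mult mult_right_mono)
      qed simp
    qed
  qed (use Km in simp)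
  have i3: "set_integrable lborel {a<..<b} (\<lambda>s. k s * \<psi> s)"
  proof -
    have pc: "continuous_on UNIV \<psi>" using d(1) by (intro continuous_at_imp_continuous_on) (auto intro: DERIV_isCont)
    have "compact (\<psi> ` {a..b})" using continuous_on_subset[OF pc] by (intro compact_continuous_image) auto
    then obtain C where C: "\<And>t. t \<in> {a..b} \<Longrightarrow> norm (\<psi> t) \<le> C" using compact_imp_bounded bounded_iff by (metis imageI)
    have pm: "\<psi> \<in> borel_measurable borel" using pc by (rule borel_measurable_continuous_onI)
    have km: "(\<lambda>s. indicator {a<..<b} s *\<^sub>R k s) \<in> borel_measurable borel"
      using k unfolding set_integrable_def by (simp add: borel_measurable_integrable)
    show ?thesis unfolding set_integrable_def
    proof (rule Bochner_Integration.integrable_bound)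
      show "integrable lborel (\<lambda>s. C * (indicator {a<..<b} s *\<^sub>R k s))" using k unfolding set_integrable_def by simp
      have "(\<lambda>s. (indicator {a<..<b} s *\<^sub>R k s) * \<psi> s) \<in> borel_measurable borel" using km pm by measurable
      then show "(\<lambda>s. indicator {a<..<b} s *\<^sub>R (k s * \<psi> s)) \<in> borel_measurable lborel" by (simp add: mult.assoc)
      show "AE s in lborel. norm (indicator {a<..<b} s *\<^sub>R (k s * \<psi> s)) \<le> norm (C * (indicator {a<..<b} s *\<^sub>R k s))"
      proof (rule AE_I2)
        fix s
        show "norm (indicator {a<..<b} s *\<^sub>R (k s * \<psi> s)) \<le> norm (C * (indicator {a<..<b} s *\<^sub>R k s))"
        proof (cases "s \<in> {a<..<b}")
          case True
          then have "\<bar>\<psi> s\<bar> \<le> \<bar>C\<bar>" using C[of s] by auto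
          then show ?thesis using True by (simp add: abs_mult mult.commute[of _ "\<bar>k s\<bar>"] mult_left_mono)
        qed simp
      qed
    qed
  qed
  have "(LINT t:{a<..<b}|lborel. (c + K t) * \<psi>' t) = c * (LINT t:{a<..<b}|lborel. \<psi>' t) + (LINT t:{a<..<b}|lborel. K t * \<psi>' t)"
    using i1 i2 by (simp add: distrib_right set_integral_add)
  also have "(LINT t:{a<..<b}|lborel. \<psi>' t) = 0" using set_integral_FTC_Ioo[OF ab d] 0 by simp
  also have "(LINT t:{a<..<b}|lborel. K t * \<psi>' t) = - (LINT s:{a<..<b}|lborel. k s * \<psi> s)"
    unfolding K_def using integral_primitive_by_parts[OF k d] 0 i3 by (simp add: set_lebesgue_integral_def)
  finally show ?thesis unfolding K_def by simp
qed

subsection \<open>The limit profile\<close>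

lemma L2_borel_iff:
  fixes f :: "'a::euclidean_space \<Rightarrow> real"
  assumes S: "S \<in> sets borel" and f[measurable]: "f \<in> borel_measurable borel"
  shows "f \<in> L2 S \<longleftrightarrow> set_integrable lborel S (\<lambda>x. (f x)\<^sup>2)"
    and "f \<in> L2 S \<longleftrightarrow> (\<integral>\<^sup>+x\<in>S. ennreal ((f x)\<^sup>2) \<partial>lborel) < \<infinity>"
proof -
  have m: "(\<lambda>x. (norm (f x))\<^sup>2) \<in> borel_measurable borel" by measurable
  show 1: "f \<in> L2 S \<longleftrightarrow> set_integrable lborel S (\<lambda>x. (f x)\<^sup>2)"
    using lebesgue_on_integral(2)[OF S m] borel_measurable_lebesgue_on[OF f] by (simp add: L2_def)
  have "(\<integral>\<^sup>+x. ennreal (norm (indicator S x *\<^sub>R (f x)\<^sup>2)) \<partial>lborel) = (\<integral>\<^sup>+x\<in>S. ennreal ((f x)\<^sup>2) \<partial>lborel)"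
    by (intro nn_integral_cong) (auto simp: indicator_def)
  moreover have "(\<lambda>x. indicator S x *\<^sub>R (f x)\<^sup>2) \<in> borel_measurable lborel" using S by measurable
  ultimately show "f \<in> L2 S \<longleftrightarrow> (\<integral>\<^sup>+x\<in>S. ennreal ((f x)\<^sup>2) \<partial>lborel) < \<infinity>"
    unfolding 1 set_integrable_def integrable_iff_bounded by simp
qed

lemma L2_mult_set_integrable:
  fixes f g :: "'a::euclidean_space \<Rightarrow> real"
  assumes "S \<in> sets borel" "f \<in> borel_measurable borel" "g \<in> borel_measurable borel" "f \<in> L2 S" "g \<in> L2 S"
  shows "set_integrable lborel S (\<lambda>x. f x * g x)"
  using lebesgue_on_integral(2)[OF assms(1), of "\<lambda>x. f x * g x"] assms sq_integrable_mult[of "lebesgue_on S" f g]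
  by (simp add: L2_iff)

lemma bounded_borel_L2:
  fixes f :: "'a::euclidean_space \<Rightarrow> real"
  assumes "S \<in> sets borel" "bounded S" "f \<in> borel_measurable borel" "\<And>x. \<bar>f x\<bar> \<le> B"
  shows "f \<in> L2 S"
proof -
  have "(f x)\<^sup>2 \<le> B\<^sup>2" for x
    using power_mono[OF assms(4)[of x] abs_ge_zero, of 2] by simp
  then have "(\<integral>\<^sup>+x\<in>S. ennreal ((f x)\<^sup>2) \<partial>lborel) \<le> (\<integral>\<^sup>+x. ennreal (B\<^sup>2) * indicator S x \<partial>lborel)"
    by (intro nn_integral_mono mult_right_mono ennreal_leI) auto
  also have "\<dots> < \<infinity>"
    using assms(1) emeasure_bounded_finite[OF assms(2)] by (simp add: nn_integral_cmult ennreal_mult_less_top)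
  finally show ?thesis using L2_borel_iff(2)[OF assms(1,3)] by simp
qed

lemma L2_imp_set_integrable:
  fixes f :: "'a::euclidean_space \<Rightarrow> real"
  assumes "S \<in> sets borel" "bounded S" "f \<in> borel_measurable borel" "f \<in> L2 S"
  shows "set_integrable lborel S f"
  using L2_mult_set_integrable[OF assms(1,3) _ assms(4), of "\<lambda>_. 1"] bounded_borel_L2[OF assms(1,2), of "\<lambda>_. 1" 1] by simp

text \<open>The set where \<open>Q\<close> fails need not be measurable, so it is first enclosed in
  a Borel null set \<open>N\<close>, to which slicing applies.\<close>

lemma AE_fst_coord:
  assumes "AE t in lborel. Q t" shows "AE y in lborel. Q ((y::real^3) $ 1)"
proof -
  obtain N where N: "{t \<in> space lborel. \<not> Q t} \<subseteq> N" "emeasure lborel N = 0" "N \<in> sets lborel"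
    using AE_E[OF assms] by blast
  have [measurable]: "N \<in> sets borel" using N(3) by simp
  have "AE y in lborel. (y::real^3) $ 1 \<notin> N"
  proof (rule AE_cylI)
    show "{y::real^3. y $ 1 \<notin> N} \<in> sets borel"
    proof -
      have [measurable]: "(\<lambda>y::real^3. y $ 1) \<in> borel_measurable borel"
        by (intro borel_measurable_continuous_onI continuous_intros)
      show ?thesis by measurable
    qed
    have "N \<in> null_sets lborel" using N by auto
    then have "AE t in lborel. t \<notin> N" by (rule AE_not_in)
    then show "AE t in lborel. AE x in lborel. cyl t x $ 1 \<notin> N" by eventually_elim simp
  qed
  then show ?thesis by eventually_elim (use N(1) in auto)
qed

lemma borel_measurable_fst_coord [measurable]: "(\<lambda>y::real^3. y $ 1) \<in> borel_measurable borel"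
  by (intro borel_measurable_continuous_onI continuous_intros)

lemma borel_measurable_transverse [measurable]: "transverse \<in> borel_measurable borel"
proof (rule borel_measurable_continuous_onI)
  have "bounded_linear transverse"
    by (intro linear_conv_bounded_linear[THEN iffD1] linearI) (simp_all add: vec_eq_iff forall_2)
  then show "continuous_on UNIV transverse" by (rule linear_continuous_on)
qed

section \<open>Sections of the rod and functions of the axial variable\<close>

locale rod_limit =
  fixes l\<^sub>0 l\<^sub>1 c\<^sub>0 c\<^sub>1 :: real and D :: "real \<Rightarrow> (real^2) set" and G :: "(real^3) set"
  assumes rod: "rod_domain l\<^sub>0 l\<^sub>1 D G" and ll: "l\<^sub>0 < l\<^sub>1" and c0: "0 < c\<^sub>0"
    and area: "\<And>t. t \<in> {l\<^sub>0..l\<^sub>1} \<Longrightarrow> c\<^sub>0 < area D t \<and> area D t \<le> c\<^sub>1"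
begin

abbreviation "I \<equiv> {l\<^sub>0<..<l\<^sub>1}"

lemma cyl_mem: "cyl t x \<in> G \<longleftrightarrow> t \<in> I \<and> x \<in> D t"
  by (simp add: rod_domainD(4)[OF rod])

lemma G_borel [measurable]: "G \<in> sets borel"
  using rod_domainD(2)[OF rod] by simp

lemma slice_props:
  assumes t: "t \<in> I"
  shows "open (D t)" "connected (D t)" "bounded (D t)" "D t \<in> sets borel" "measure lborel (D t) = area D t"
    "emeasure lborel (D t) = ennreal (area D t)"
proof -
  show o: "open (D t)" "connected (D t)" using rod_domainD(5,6)[OF rod] t by auto
  obtain B where B: "\<And>y. y \<in> G \<Longrightarrow> norm y \<le> B" using rod_domainD(1)[OF rod] bounded_iff by blast
  have "norm x \<le> B" if "x \<in> D t" for x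
    using B[of "cyl t x"] norm_transverse_le[of "cyl t x"] cyl_mem[of t x] t that by auto
  then show b: "bounded (D t)" using bounded_iff by blast
  show s: "D t \<in> sets borel" using o by simp
  show m: "measure lborel (D t) = area D t" using s by (simp add: area_def measure_completion)
  have "emeasure lborel (D t) \<noteq> \<infinity>" using emeasure_bounded_finite[OF b] by simp
  then show "emeasure lborel (D t) = ennreal (area D t)" using m by (simp add: emeasure_eq_ennreal_measure)
qed

text \<open>As an integral of the indicator of \<open>G\<close> over sections, the area is Borel
  measurable by Fubini. For \<open>t\<close> outside \<open>I\<close> no point of \<open>G\<close>
  is met, hence the value \<open>0\<close>.\<close>

lemma area_eq: "(LBINT x. indicator G (cyl t x)) = (if t \<in> I then area D t else 0)"
proof (cases "t \<in> I")
  case True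
  then have "indicator G (cyl t x) = (indicator (D t) x :: real)" for x using cyl_mem[of t x] by (auto simp: indicator_def)
  then show ?thesis using True slice_props[OF True] by simp
next
  case False
  then have "indicator G (cyl t x) = (0 :: real)" for x using cyl_mem[of t x] by (auto simp: indicator_def)
  then have "(LBINT x. indicator G (cyl t x)) = (0 :: real)" by simp
  with False show ?thesis by (simp only: if_False)
qed

lemma area_measurable: "(\<lambda>t. if t \<in> I then area D t else 0) \<in> borel_measurable borel"
  unfolding area_eq[symmetric] by measurable

text \<open>If \<open>F\<close> is almost everywhere constant on a section, this quotient is that
  constant. An explicit formula, in place of a choice of constants, makes the profile measurable in
  \<open>t\<close>.\<close>

definition mean_profile :: "(real^3 \<Rightarrow> real) \<Rightarrow> real \<Rightarrow> real" where
  "mean_profile F t = (LBINT x. indicator G (cyl t x) * F (cyl t x)) / (LBINT x. indicator G (cyl t x))"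

lemma mean_profile_measurable [measurable]:
  assumes [measurable]: "F \<in> borel_measurable borel"
  shows "mean_profile F \<in> borel_measurable borel"
  unfolding mean_profile_def[abs_def] by measurable

lemma mean_profile_eq:
  assumes t: "t \<in> I" and c: "AE x in lborel. x \<in> D t \<longrightarrow> F (cyl t x) = c" and F[measurable]: "F \<in> borel_measurable borel"
  shows "mean_profile F t = c"
proof -
  have "(LBINT x. indicator G (cyl t x) * F (cyl t x)) = (LBINT x. indicator G (cyl t x) * c)"
  proof (rule integral_cong_AE)
    show "AE x in lborel. indicator G (cyl t x) * F (cyl t x) = indicator G (cyl t x) * c"
      using c by eventually_elim (auto simp: indicator_def cyl_mem)
  qed measurable
  also have "\<dots> = area D t * c" using t by (simp add: area_eq)
  finally show ?thesis unfolding mean_profile_def area_eq using t area[of t] c0 by simp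
qed

lemma mean_profile_AE:
  assumes F[measurable]: "F \<in> borel_measurable borel"
    and c: "AE t in lborel. t \<in> I \<longrightarrow> (\<exists>c. AE x in lborel. x \<in> D t \<longrightarrow> F (cyl t x) = c)"
  shows "AE t in lborel. t \<in> I \<longrightarrow> (AE x in lborel. x \<in> D t \<longrightarrow> F (cyl t x) = mean_profile F t)"
    and "AE y in lborel. y \<in> G \<longrightarrow> F y = mean_profile F (y $ 1)"
proof -
  show 1: "AE t in lborel. t \<in> I \<longrightarrow> (AE x in lborel. x \<in> D t \<longrightarrow> F (cyl t x) = mean_profile F t)"
    using c by eventually_elim (use mean_profile_eq F in blast)
  show "AE y in lborel. y \<in> G \<longrightarrow> F y = mean_profile F (y $ 1)"
  proof (rule AE_cylI)
    show "{y. y \<in> G \<longrightarrow> F y = mean_profile F (y $ 1)} \<in> sets borel" by measurable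
    show "AE t in lborel. AE x in lborel. cyl t x \<in> G \<longrightarrow> F (cyl t x) = mean_profile F (cyl t x $ 1)"
      using 1
    proof eventually_elim
      case (elim t)
      show ?case
      proof (cases "t \<in> I")
        case True
        then have "AE x in lborel. x \<in> D t \<longrightarrow> F (cyl t x) = mean_profile F t" using elim by simp
        then show ?thesis by eventually_elim (simp add: cyl_mem)
      next
        case False
        then have "cyl t x \<notin> G" for x using cyl_mem by blast
        then show ?thesis by simp
      qed
    qed
  qed
qed

lemma nn_integral_fst_coord:
  assumes [measurable]: "f \<in> borel_measurable borel" "J \<in> sets borel" and J: "J \<subseteq> I"
  shows "(\<integral>\<^sup>+y\<in>{y \<in> G. y $ 1 \<in> J}. f (y $ 1) \<partial>lborel) = (\<integral>\<^sup>+t\<in>J. ennreal (area D t) * f t \<partial>lborel)"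
proof -
  have "(\<integral>\<^sup>+y\<in>{y \<in> G. y $ 1 \<in> J}. f (y $ 1) \<partial>lborel)
    = (\<integral>\<^sup>+t. (\<integral>\<^sup>+x. f t * indicator {y \<in> G. y $ 1 \<in> J} (cyl t x) \<partial>lborel) \<partial>lborel)"
    by (subst nn_integral_cyl) auto
  also have "\<dots> = (\<integral>\<^sup>+t\<in>J. ennreal (area D t) * f t \<partial>lborel)"
  proof (rule nn_integral_cong)
    fix t
    show "(\<integral>\<^sup>+x. f t * indicator {y \<in> G. y $ 1 \<in> J} (cyl t x) \<partial>lborel) = ennreal (area D t) * f t * indicator J t"
    proof (cases "t \<in> J")
      case True
      then have tI: "t \<in> I" using J by auto
      have "indicator {y \<in> G. y $ 1 \<in> J} (cyl t x) = (indicator (D t) x :: ennreal)" for x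
        using True tI by (auto simp: indicator_def cyl_mem)
      then show ?thesis using True slice_props(4,6)[OF tI] by (simp add: nn_integral_cmult mult.commute)
    qed simp
  qed
  finally show ?thesis .
qed

text \<open>The lower bound \<open>c\<^sub>0\<close> on the area lets the integral over
  \<open>G\<close>, in which the area is a weight, control the unweighted integral over
  \<open>I\<close>.\<close>

lemma profile_L2:
  fixes f :: "real \<Rightarrow> real"
  assumes [measurable]: "f \<in> borel_measurable borel" "F \<in> borel_measurable borel"
    and F: "F \<in> L2 G" and eq: "AE y in lborel. y \<in> G \<longrightarrow> F y = f (y $ 1)"
  shows "f \<in> L2 I"
proof -
  have Gi: "{y \<in> G. y $ 1 \<in> I} = G" using rod_domainD(4)[OF rod] by auto
  have "ennreal c\<^sub>0 * (\<integral>\<^sup>+t\<in>I. ennreal ((f t)\<^sup>2) \<partial>lborel) = (\<integral>\<^sup>+t\<in>I. ennreal c\<^sub>0 * ennreal ((f t)\<^sup>2) \<partial>lborel)"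
    by (simp add: nn_integral_cmult mult.assoc)
  also have "\<dots> \<le> (\<integral>\<^sup>+t\<in>I. ennreal (area D t) * ennreal ((f t)\<^sup>2) \<partial>lborel)"
  proof (rule nn_integral_mono)
    fix t
    show "ennreal c\<^sub>0 * ennreal ((f t)\<^sup>2) * indicator I t \<le> ennreal (area D t) * ennreal ((f t)\<^sup>2) * indicator I t"
      using area[of t] by (cases "t \<in> I") (auto intro!: mult_right_mono ennreal_leI)
  qed
  also have "\<dots> = (\<integral>\<^sup>+y\<in>G. ennreal ((f (y $ 1))\<^sup>2) \<partial>lborel)"
    using nn_integral_fst_coord[of "\<lambda>t. ennreal ((f t)\<^sup>2)" I] unfolding Gi by simp
  also have "\<dots> = (\<integral>\<^sup>+y\<in>G. ennreal ((F y)\<^sup>2) \<partial>lborel)"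
    using eq by (intro nn_integral_cong_AE) (auto elim!: eventually_mono simp: indicator_def)
  also have "\<dots> < \<infinity>" using F L2_borel_iff(2)[of G F] by simp
  finally have "(\<integral>\<^sup>+t\<in>I. ennreal ((f t)\<^sup>2) \<partial>lborel) < \<infinity>"
    using c0 by (auto simp: ennreal_mult_less_top)
  then show ?thesis using L2_borel_iff(2)[of I f] by simp
qed

text \<open>Integrating over the sections first produces the factor \<open>area D t\<close>: this is
  the origin of the weight in the limit problem.\<close>

lemma profile_integral:
  assumes [measurable]: "f \<in> borel_measurable borel" and i: "set_integrable lborel G (\<lambda>y. f (y $ 1))"
  shows "(LINT y:G|lborel. f (y $ 1)) = (LINT t:I|lborel. area D t * f t)"
proof -
  have "(LINT y:G|lborel. f (y $ 1)) = (LBINT t. LBINT x. indicator G (cyl t x) *\<^sub>R f t)"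
    using i unfolding set_lebesgue_integral_def set_integrable_def by (subst integral_cyl(1)) auto
  also have "\<dots> = (LBINT t. (LBINT x. indicator G (cyl t x)) * f t)" by simp
  also have "\<dots> = (LINT t:I|lborel. area D t * f t)"
    unfolding area_eq set_lebesgue_integral_def by (intro Bochner_Integration.integral_cong) auto
  finally show ?thesis .
qed

text \<open>Inside the rod a ball around a point of \<open>G\<close> contains the cylinder. At an
  end the face has positive area, hence a point, around which \<open>rod_face_cylinder\<close>
  applies.\<close>

lemma local_cylinder:
  assumes t0: "t\<^sub>0 \<in> {l\<^sub>0..l\<^sub>1}"
  obtains x\<^sub>0 \<rho> \<delta> where "\<rho> > 0" "\<delta> > 0"
    "\<And>t x. t \<in> I \<Longrightarrow> \<bar>t - t\<^sub>0\<bar> < \<delta> \<Longrightarrow> x \<in> ball x\<^sub>0 \<rho> \<Longrightarrow> cyl t x \<in> G"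
    "t\<^sub>0 \<in> {l\<^sub>0, l\<^sub>1} \<Longrightarrow> ball x\<^sub>0 \<rho> \<subseteq> D t\<^sub>0"
proof (cases "t\<^sub>0 \<in> {l\<^sub>0, l\<^sub>1}")
  case True
  have "D t\<^sub>0 \<noteq> {}" using area[OF t0] c0 by (auto simp: area_def)
  then obtain x0 where "x0 \<in> D t\<^sub>0" by blast
  then show ?thesis using rod_face_cylinder[OF rod True ll] that by (metis greaterThanLessThan_iff)
next
  case False
  then have t0I: "t\<^sub>0 \<in> I" using t0 by auto
  then obtain x0 where x0: "x0 \<in> D t\<^sub>0" using rod_domainD(7)[OF rod] by auto
  then have "cyl t\<^sub>0 x0 \<in> G" using t0I cyl_mem by simp
  then obtain e where e: "e > 0" "ball (cyl t\<^sub>0 x0) e \<subseteq> G" using rod_domainD(2)[OF rod] openE by blast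
  show ?thesis
  proof (rule that[of "e/2" "e/2" x0])
    fix t x assume "\<bar>t - t\<^sub>0\<bar> < e / 2" "x \<in> ball x0 (e / 2)"
    then have "norm (cyl t\<^sub>0 x0 - cyl t x) < e"
      using norm_cyl_diff_le[of t\<^sub>0 x0 t x] by (simp add: dist_norm abs_minus_commute)
    then show "cyl t x \<in> G" using e(2) by (auto simp: dist_norm)
  qed (use e False in auto)
qed

text \<open>The squared distance to \<open>U\<close> and the squares of both transverse derivatives
  are collected in one nonnegative function \<open>f n\<close> with integrals tending to zero, so
  that a single subsequence serves for all three.\<close>

lemma good_slices:
  assumes W: "\<And>j. smooth (W j)" and U[measurable]: "U \<in> borel_measurable borel" and UL: "U \<in> L2 G"
    and strong: "(\<lambda>j. l2norm (lebesgue_on G) (\<lambda>y. W j y - U y)) \<longlonglongrightarrow> 0"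
    and d2: "(\<lambda>j. l2norm (lebesgue_on G) (\<lambda>y. grad (W j) y $ 2)) \<longlonglongrightarrow> 0"
    and d3: "(\<lambda>j. l2norm (lebesgue_on G) (\<lambda>y. grad (W j) y $ 3)) \<longlonglongrightarrow> 0"
  obtains r where "strict_mono (r :: nat \<Rightarrow> nat)"
    "AE t in lborel. t \<in> I \<longrightarrow> (\<lambda>x. U (cyl t x)) \<in> L2 (D t) \<and>
       (\<lambda>n. l2norm (lebesgue_on (D t)) (\<lambda>x. W (r n) (cyl t x) - U (cyl t x))) \<longlonglongrightarrow> 0 \<and>
       (\<lambda>n. l2norm (lebesgue_on (D t)) (grad (\<lambda>x. W (r n) (cyl t x)))) \<longlonglongrightarrow> 0"
proof -
  have GG: "bounded G" "open G" using rod_domainD(1,2)[OF rod] by auto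
  have gm[measurable]: "(\<lambda>y. grad (W j) y $ i) \<in> borel_measurable borel" "W j \<in> borel_measurable borel" for i j
    using smooth_continuous[OF W] smooth_grad_continuous[OF W] by (auto intro!: borel_measurable_continuous_onI continuous_intros)
  define f where "f n y = indicator G y * ((W n y - U y)\<^sup>2 + (grad (W n) y $ 2)\<^sup>2 + (grad (W n) y $ 3)\<^sup>2)" for n y
  have L: "(\<lambda>y. W n y - U y) \<in> L2 G" "(\<lambda>y. grad (W n) y $ i) \<in> L2 G" for n i
    using L2_diff[OF smooth_L2[OF GG W] UL] L2_nth[OF smooth_grad_L2[OF GG W]] by auto
  have i: "set_integrable lborel G (\<lambda>y. (W n y - U y)\<^sup>2)" "set_integrable lborel G (\<lambda>y. (grad (W n) y $ i)\<^sup>2)" for n i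
    using L2_borel_iff(1)[OF G_borel _] L by auto
  have n: "(LINT y:G|lborel. (h y)\<^sup>2) = (l2norm (lebesgue_on G) h)\<^sup>2" if [measurable]: "h \<in> borel_measurable borel" for h :: "real^3 \<Rightarrow> real"
    unfolding l2norm_power2 by (subst lebesgue_on_integral(1)) auto
  have fi: "integrable lborel (f n)" for n
    using i(1)[of n] i(2)[of n 2] i(2)[of n 3] unfolding f_def set_integrable_def by (simp add: distrib_left)
  have "(LBINT y. f n y) = (LINT y:G|lborel. (W n y - U y)\<^sup>2) + (LINT y:G|lborel. (grad (W n) y $ 2)\<^sup>2) + (LINT y:G|lborel. (grad (W n) y $ 3)\<^sup>2)" for n
    using i(1)[of n] i(2)[of n 2] i(2)[of n 3] unfolding f_def set_integrable_def set_lebesgue_integral_def by (simp add: distrib_left)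
  then have "(LBINT y. f n y) = (l2norm (lebesgue_on G) (\<lambda>y. W n y - U y))\<^sup>2 + (l2norm (lebesgue_on G) (\<lambda>y. grad (W n) y $ 2))\<^sup>2
      + (l2norm (lebesgue_on G) (\<lambda>y. grad (W n) y $ 3))\<^sup>2" for n by (simp add: n)
  moreover have "(\<lambda>n. (l2norm (lebesgue_on G) (\<lambda>y. W n y - U y))\<^sup>2 + (l2norm (lebesgue_on G) (\<lambda>y. grad (W n) y $ 2))\<^sup>2
      + (l2norm (lebesgue_on G) (\<lambda>y. grad (W n) y $ 3))\<^sup>2) \<longlonglongrightarrow> 0\<^sup>2 + 0\<^sup>2 + 0\<^sup>2"
    by (intro tendsto_add tendsto_power strong d2 d3)
  ultimately have fl: "(\<lambda>n. LBINT y. f n y) \<longlonglongrightarrow> 0" by simp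
  have f0: "0 \<le> f n y" for n y unfolding f_def by simp
  obtain r where r: "strict_mono r" "AE t in lborel. (\<lambda>n. LBINT x. f (r n) (cyl t x)) \<longlonglongrightarrow> 0"
    by (rule slice_subsequence[OF fi f0 fl])
  have "AE t in lborel. \<forall>n. integrable lborel (\<lambda>x. f (r n) (cyl t x))"
    unfolding AE_all_countable using integral_cyl(3)[OF fi] by blast
  moreover have "integrable lborel (\<lambda>y. indicator G y * (U y)\<^sup>2)"
    using L2_borel_iff(1)[OF G_borel U] UL by (simp add: set_integrable_def)
  from integral_cyl(3)[OF this] have "AE t in lborel. integrable lborel (\<lambda>x. indicator G (cyl t x) * (U (cyl t x))\<^sup>2)" .
  ultimately have "AE t in lborel. t \<in> I \<longrightarrow> (\<lambda>x. U (cyl t x)) \<in> L2 (D t) \<and>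
       (\<lambda>n. l2norm (lebesgue_on (D t)) (\<lambda>x. W (r n) (cyl t x) - U (cyl t x))) \<longlonglongrightarrow> 0 \<and>
       (\<lambda>n. l2norm (lebesgue_on (D t)) (grad (\<lambda>x. W (r n) (cyl t x)))) \<longlonglongrightarrow> 0"
    using r(2)
  proof (eventually_elim, intro impI)
    fix t assume 1: "\<forall>n. integrable lborel (\<lambda>x. f (r n) (cyl t x))"
      and 2: "integrable lborel (\<lambda>x. indicator G (cyl t x) * (U (cyl t x))\<^sup>2)"
      and 3: "(\<lambda>n. LBINT x. f (r n) (cyl t x)) \<longlonglongrightarrow> 0" and t: "t \<in> I"
    note Dt = slice_props[OF t]
    have ind: "indicator G (cyl t x) = (indicator (D t) x :: real)" for x using t by (auto simp: indicator_def cyl_mem)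
    have Um[measurable]: "(\<lambda>x. U (cyl t x)) \<in> borel_measurable borel" by measurable
    have UD: "(\<lambda>x. U (cyl t x)) \<in> L2 (D t)"
      using 2 L2_borel_iff(1)[OF Dt(4) Um] unfolding ind set_integrable_def by simp
    let ?w = "\<lambda>n x. W (r n) (cyl t x)"
    let ?L = "lebesgue_on (D t)"
    have ws: "smooth (?w n)" for n by (rule smooth_slice[OF W])
    have wU: "(\<lambda>x. ?w n x - U (cyl t x)) \<in> L2 (D t)" for n by (rule L2_diff[OF smooth_L2[OF Dt(3,1) ws] UD])
    have gw: "grad (?w n) \<in> L2 (D t)" for n by (rule smooth_grad_L2[OF Dt(3,1) ws])
    have q: "(LBINT x. f (r n) (cyl t x)) = (l2norm ?L (\<lambda>x. ?w n x - U (cyl t x)))\<^sup>2 + (l2norm ?L (grad (?w n)))\<^sup>2" for n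
    proof -
      have [measurable]: "?w n \<in> borel_measurable borel" "grad (?w n) \<in> borel_measurable borel"
        using smooth_continuous[OF ws] smooth_grad_continuous[OF ws] by (auto intro!: borel_measurable_continuous_onI)
      have "(LBINT x. f (r n) (cyl t x)) = (LINT x:D t|lborel. (?w n x - U (cyl t x))\<^sup>2 + (norm (grad (?w n) x))\<^sup>2)"
        unfolding f_def ind norm_grad_slice[OF W] set_lebesgue_integral_def by (simp add: add.assoc)
      also have "\<dots> = (LINT x|?L. (?w n x - U (cyl t x))\<^sup>2 + (norm (grad (?w n) x))\<^sup>2)"
        by (rule lebesgue_on_integral(1)[symmetric, OF Dt(4)]) measurable
      also have "\<dots> = (l2norm ?L (\<lambda>x. ?w n x - U (cyl t x)))\<^sup>2 + (l2norm ?L (grad (?w n)))\<^sup>2"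
        unfolding l2norm_power2 using wU[of n] gw[of n] by (simp add: L2_def)
      finally show ?thesis .
    qed
    have sq: "(\<lambda>n. sqrt (LBINT x. f (r n) (cyl t x))) \<longlonglongrightarrow> 0"
      using tendsto_real_sqrt[OF 3] by simp
    have "(\<lambda>n. l2norm ?L (\<lambda>x. ?w n x - U (cyl t x))) \<longlonglongrightarrow> 0"
      by (rule tendsto_sandwich[OF _ _ tendsto_const sq])
        (auto simp: l2norm_nonneg q intro!: real_le_rsqrt)
    moreover have "(\<lambda>n. l2norm ?L (grad (?w n))) \<longlonglongrightarrow> 0"
      by (rule tendsto_sandwich[OF _ _ tendsto_const sq])
        (auto simp: l2norm_nonneg q intro!: real_le_rsqrt)
    ultimately show "(\<lambda>x. U (cyl t x)) \<in> L2 (D t) \<and> (\<lambda>n. l2norm ?L (\<lambda>x. ?w n x - U (cyl t x))) \<longlonglongrightarrow> 0 \<and> (\<lambda>n. l2norm ?L (grad (?w n))) \<longlonglongrightarrow> 0"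
      using UD by blast
  qed
  then show thesis using r(1) that by blast
qed

end

lemma test_functions_mono: "\<phi> \<in> test_functions S \<Longrightarrow> S \<subseteq> T \<Longrightarrow> \<phi> \<in> test_functions T"
  by (auto simp: test_functions_def)

lemma continuous_on_cyl_fst: "continuous_on A (\<lambda>t. cyl t x)"
  unfolding cyl_affine by (intro continuous_intros)

section \<open>Limits on sections and increments along the axis\<close>

locale rod_slices = rod_limit +
  fixes W :: "nat \<Rightarrow> real^3 \<Rightarrow> real" and U \<gamma> :: "real^3 \<Rightarrow> real"
  assumes W: "\<And>j. smooth (W j)" and W0: "\<And>j y. y \<in> plane_face D l\<^sub>0 \<union> plane_face D l\<^sub>1 \<Longrightarrow> W j y = 0"
    and U [measurable]: "U \<in> borel_measurable borel" and UL: "U \<in> L2 G"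
    and \<gamma> [measurable]: "\<gamma> \<in> borel_measurable borel" and \<gamma>L: "\<gamma> \<in> L2 G"
    and slices: "AE t in lborel. t \<in> I \<longrightarrow> (\<lambda>x. U (cyl t x)) \<in> L2 (D t) \<and>
       (\<lambda>n. l2norm (lebesgue_on (D t)) (\<lambda>x. W n (cyl t x) - U (cyl t x))) \<longlonglongrightarrow> 0 \<and>
       (\<lambda>n. l2norm (lebesgue_on (D t)) (grad (\<lambda>x. W n (cyl t x)))) \<longlonglongrightarrow> 0"
    and weak: "\<And>f. f \<in> L2 G \<Longrightarrow> (\<lambda>j. LINT y|lebesgue_on G. grad (W j) y $ 1 * f y) \<longlonglongrightarrow> (LINT y|lebesgue_on G. \<gamma> y * f y)"
    and wg: "\<And>\<phi>. \<phi> \<in> test_functions G \<Longrightarrow> (LINT y|lebesgue_on G. U y * (grad \<phi> y $ 1)) = - (LINT y|lebesgue_on G. \<gamma> y * \<phi> y)"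
begin

lemma U_slice_constant:
  "AE t in lborel. t \<in> I \<longrightarrow> (\<exists>c. AE x in lborel. x \<in> D t \<longrightarrow> U (cyl t x) = c)"
  using slices
proof (eventually_elim, intro impI)
  fix t assume 1: "t \<in> I \<longrightarrow> (\<lambda>x. U (cyl t x)) \<in> L2 (D t) \<and>
       (\<lambda>n. l2norm (lebesgue_on (D t)) (\<lambda>x. W n (cyl t x) - U (cyl t x))) \<longlonglongrightarrow> 0 \<and>
       (\<lambda>n. l2norm (lebesgue_on (D t)) (grad (\<lambda>x. W n (cyl t x)))) \<longlonglongrightarrow> 0" and t: "t \<in> I"
  show "\<exists>c. AE x in lborel. x \<in> D t \<longrightarrow> U (cyl t x) = c"
  proof (rule strong_limit_gradient_0_constant[where w="\<lambda>n x. W n (cyl t x)"])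
    show "smooth (\<lambda>x. W n (cyl t x))" for n by (rule smooth_slice[OF W])
    show "(\<lambda>x. U (cyl t x)) \<in> borel_measurable borel" by measurable
  qed (use 1 t slice_props[OF t] in auto)
qed

definition V0 :: "real \<Rightarrow> real" where "V0 = mean_profile U"
definition g :: "real \<Rightarrow> real" where "g = mean_profile \<gamma>"

lemma V0_measurable [measurable]: "V0 \<in> borel_measurable borel"
  and g_measurable [measurable]: "g \<in> borel_measurable borel"
  unfolding V0_def g_def by measurable

lemma U_eq_V0: "AE y in lborel. y \<in> G \<longrightarrow> U y = V0 (y $ 1)"
  unfolding V0_def by (rule mean_profile_AE(2)[OF U U_slice_constant])

text \<open>\<open>V0\<close> is determined only almost everywhere. At a good \<open>t\<close> its
  value is the limit of the means of \<open>W n\<close> over every disc of the section, so the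
  increments of \<open>V0\<close> between good sections are exact.\<close>

definition good :: "real \<Rightarrow> bool" where
  "good t \<longleftrightarrow> t \<in> I \<and> (\<forall>x\<^sub>0 \<rho>. ball x\<^sub>0 \<rho> \<subseteq> D t \<longrightarrow>
     (\<lambda>n. LINT x:ball x\<^sub>0 \<rho>|lborel. W n (cyl t x)) \<longlonglongrightarrow> measure lborel (ball x\<^sub>0 \<rho>) * V0 t)"

lemma AE_good: "AE t in lborel. t \<in> I \<longrightarrow> good t"
  using slices mean_profile_AE(1)[OF U U_slice_constant]
proof (eventually_elim, intro impI)
  fix t assume 1: "t \<in> I \<longrightarrow> (\<lambda>x. U (cyl t x)) \<in> L2 (D t) \<and>
       (\<lambda>n. l2norm (lebesgue_on (D t)) (\<lambda>x. W n (cyl t x) - U (cyl t x))) \<longlonglongrightarrow> 0 \<and>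
       (\<lambda>n. l2norm (lebesgue_on (D t)) (grad (\<lambda>x. W n (cyl t x)))) \<longlonglongrightarrow> 0"
    and 2: "t \<in> I \<longrightarrow> (AE x in lborel. x \<in> D t \<longrightarrow> U (cyl t x) = mean_profile U t)" and t: "t \<in> I"
  note Dt = slice_props[OF t]
  show "good t" unfolding good_def
  proof (intro conjI t allI impI)
    fix x\<^sub>0 \<rho> assume R: "ball x\<^sub>0 \<rho> \<subseteq> D t"
    let ?R = "ball x\<^sub>0 \<rho>"
    let ?L = "lebesgue_on (D t)"
    have Rb[measurable]: "?R \<in> sets borel" by simp
    have ws: "smooth (\<lambda>x. W n (cyl t x))" for n by (rule smooth_slice[OF W])
    have wm[measurable]: "(\<lambda>x. W n (cyl t x)) \<in> borel_measurable borel" for n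
      using smooth_continuous[OF ws] by (rule borel_measurable_continuous_onI)
    have hL: "(indicator ?R :: real^2 \<Rightarrow> real) \<in> L2 (D t)"
      by (rule bounded_borel_L2[OF Dt(4,3), of _ 1]) (auto simp: indicator_def)
    have lim: "(\<lambda>n. \<integral>x. W n (cyl t x) * indicator ?R x \<partial>?L) \<longlonglongrightarrow> (\<integral>x. U (cyl t x) * indicator ?R x \<partial>?L)"
      by (rule tendsto_integral_l2) (use 1 t hL smooth_L2[OF Dt(3,1) ws] in \<open>auto simp: L2_iff\<close>)
    have conv: "(\<integral>x. h x * indicator ?R x \<partial>?L) = (LINT x:?R|lborel. h x)" if [measurable]: "h \<in> borel_measurable borel" for h :: "real^2 \<Rightarrow> real"
    proof -
      have "(\<integral>x. h x * indicator ?R x \<partial>?L) = (LBINT x. h x * indicator ?R x)"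
        by (rule lebesgue_on_integral_support[OF Dt(4)]) (use R in \<open>auto simp: indicator_def\<close>)
      then show ?thesis unfolding set_lebesgue_integral_def by (simp add: mult.commute)
    qed
    have "(LINT x:?R|lborel. U (cyl t x)) = (LINT x:?R|lborel. V0 t)"
      unfolding set_lebesgue_integral_def
    proof (rule integral_cong_AE)
      have "AE x in lborel. x \<in> D t \<longrightarrow> U (cyl t x) = V0 t" using 2 t unfolding V0_def by simp
      then show "AE x in lborel. indicator ?R x *\<^sub>R U (cyl t x) = indicator ?R x *\<^sub>R V0 t"
        by eventually_elim (use R in \<open>auto simp: indicator_def\<close>)
    qed measurable
    also have "\<dots> = measure lborel ?R * V0 t" unfolding set_lebesgue_integral_def by simp
    finally show "(\<lambda>n. LINT x:?R|lborel. W n (cyl t x)) \<longlonglongrightarrow> measure lborel ?R * V0 t"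
      using lim by (simp add: conv)
  qed
qed

text \<open>The indicator of the cylinder \<open>B\<close> is a fixed \<open>L2\<close> function.
  Paired with the axial derivative of \<open>W n\<close> it gives, by the fundamental theorem of
  calculus on each axial line, the difference of the integrals over the two ends; in the limit
  \<open>\<gamma>\<close> replaces the derivative. At \<open>s\<close> and \<open>t\<close> only
  convergence of these integrals is required, so that either may be the position of an end
  face.\<close>

lemma box_increment:
  assumes st: "s < t" and R: "R \<in> sets borel" "bounded R"
    and box: "\<And>\<tau> x. s < \<tau> \<Longrightarrow> \<tau> < t \<Longrightarrow> x \<in> R \<Longrightarrow> cyl \<tau> x \<in> G"
    and v: "(\<lambda>n. LINT x:R|lborel. W n (cyl s x)) \<longlonglongrightarrow> v" and v': "(\<lambda>n. LINT x:R|lborel. W n (cyl t x)) \<longlonglongrightarrow> v'"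
  shows "v' - v = (LINT \<tau>:{s<..<t}|lborel. (LINT x:R|lborel. \<gamma> (cyl \<tau> x)))"
    and "set_integrable lborel {s<..<t} (\<lambda>\<tau>. LINT x:R|lborel. \<gamma> (cyl \<tau> x))"
proof -
  have [measurable]: "R \<in> sets borel" by fact
  define B where "B = {y::real^3. y $ 1 \<in> {s<..<t} \<and> transverse y \<in> R}"
  have B[measurable]: "B \<in> sets borel" unfolding B_def by measurable
  have BG: "B \<subseteq> G" using box cyl_transverse unfolding B_def by (metis (no_types, lifting) greaterThanLessThan_iff mem_Collect_eq subsetI)
  have bB: "bounded B" using BG bounded_subset rod_domainD(1)[OF rod] by blast
  have Bc: "indicator B (cyl \<tau> x) = (indicator {s<..<t} \<tau> * indicator R x :: real)" for \<tau> x
    unfolding B_def by (auto simp: indicator_def)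
  have BL: "(indicator B :: real^3 \<Rightarrow> real) \<in> L2 G"
    by (rule bounded_borel_L2[OF G_borel rod_domainD(1)[OF rod], of _ 1]) (auto simp: indicator_def)
  have conv: "(LINT y|lebesgue_on G. h y * indicator B y) = (LBINT y. indicator B y * h y)" if [measurable]: "h \<in> borel_measurable borel" for h :: "real^3 \<Rightarrow> real"
  proof -
    have "(LINT y|lebesgue_on G. h y * indicator B y) = (LBINT y. h y * indicator B y)"
      by (rule lebesgue_on_integral_support[OF G_borel]) (use BG in \<open>auto simp: indicator_def\<close>)
    then show ?thesis by (simp add: mult.commute)
  qed
  have gc: "continuous_on UNIV (\<lambda>y. grad (W n) y $ 1)" for n
    using smooth_grad_continuous[OF W] by (intro continuous_intros)
  have gm: "(\<lambda>y. grad (W n) y $ 1) \<in> borel_measurable borel" for n using gc by (rule borel_measurable_continuous_onI)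
  have W_inc: "(LINT y|lebesgue_on G. grad (W n) y $ 1 * indicator B y) = (LINT x:R|lborel. W n (cyl t x)) - (LINT x:R|lborel. W n (cyl s x))" for n
  proof -
    have i: "integrable lborel (\<lambda>y. indicator B y * (grad (W n) y $ 1))"
      using continuous_sq_integrable_restrict(2)[OF B bB gc] by (simp add: set_integrable_def)
    have inner: "(LBINT \<tau>. indicator B (cyl \<tau> x) * (grad (W n) (cyl \<tau> x) $ 1)) = indicator R x *\<^sub>R (W n (cyl t x) - W n (cyl s x))" for x
    proof -
      have c: "continuous_on UNIV (\<lambda>\<tau>. grad (W n) (cyl \<tau> x) $ 1)"
        by (rule continuous_on_compose2[OF gc continuous_on_cyl_fst]) auto
      have "(LINT \<tau>:{s<..<t}|lborel. grad (W n) (cyl \<tau> x) $ 1) = W n (cyl t x) - W n (cyl s x)"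
        by (rule set_integral_FTC_Ioo[OF _ has_real_derivative_cyl[OF W] c]) (use st in simp)
      then show ?thesis unfolding Bc set_lebesgue_integral_def by (simp add: mult.assoc mult.left_commute)
    qed
    have ri: "set_integrable lborel R (\<lambda>x. W n (cyl \<tau> x))" for \<tau>
      by (rule continuous_sq_integrable_restrict(2)[OF R smooth_continuous[OF smooth_slice[OF W]]])
    have "(LINT y|lebesgue_on G. grad (W n) y $ 1 * indicator B y) = (LBINT x. indicator R x *\<^sub>R (W n (cyl t x) - W n (cyl s x)))"
      unfolding conv[OF gm] integral_cyl(4)[OF i] inner ..
    also have "\<dots> = (LINT x:R|lborel. W n (cyl t x)) - (LINT x:R|lborel. W n (cyl s x))"
      using ri[of t] ri[of s] unfolding set_lebesgue_integral_def set_integrable_def by (simp add: right_diff_distrib)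
    finally show ?thesis .
  qed
  have gi: "integrable lborel (\<lambda>y. indicator B y * \<gamma> y)"
    using L2_imp_set_integrable[OF B bB \<gamma> L2_borel_subset(1)[OF BG B G_borel \<gamma> \<gamma>L]] by (simp add: set_integrable_def)
  have inner: "(LBINT x. indicator B (cyl \<tau> x) * \<gamma> (cyl \<tau> x)) = indicator {s<..<t} \<tau> *\<^sub>R (LINT x:R|lborel. \<gamma> (cyl \<tau> x))" for \<tau>
    unfolding Bc set_lebesgue_integral_def by (simp add: mult.assoc)
  have "(\<lambda>n. (LINT x:R|lborel. W n (cyl t x)) - (LINT x:R|lborel. W n (cyl s x))) \<longlonglongrightarrow> (LBINT y. indicator B y * \<gamma> y)"
    using weak[OF BL] unfolding W_inc conv[OF \<gamma>] .
  moreover have "(\<lambda>n. (LINT x:R|lborel. W n (cyl t x)) - (LINT x:R|lborel. W n (cyl s x))) \<longlonglongrightarrow> v' - v"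
    by (intro tendsto_diff v v')
  ultimately have "v' - v = (LBINT y. indicator B y * \<gamma> y)" using LIMSEQ_unique by blast
  also have "\<dots> = (LINT \<tau>:{s<..<t}|lborel. (LINT x:R|lborel. \<gamma> (cyl \<tau> x)))"
    unfolding integral_cyl(1)[OF gi] inner set_lebesgue_integral_def ..
  finally show "v' - v = (LINT \<tau>:{s<..<t}|lborel. (LINT x:R|lborel. \<gamma> (cyl \<tau> x)))" .
  show "set_integrable lborel {s<..<t} (\<lambda>\<tau>. LINT x:R|lborel. \<gamma> (cyl \<tau> x))"
    using integral_cyl(2)[OF gi] unfolding inner set_integrable_def .
qed

end

section \<open>One cylinder over a fixed disc\<close>

locale rod_cylinder = rod_slices +
  fixes a b \<rho> :: real and x\<^sub>0 :: "real^2"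
  assumes ab: "a < b" "l\<^sub>0 \<le> a" "b \<le> l\<^sub>1" and \<rho>: "\<rho> > 0"
    and cyl: "\<And>t x. a < t \<Longrightarrow> t < b \<Longrightarrow> x \<in> ball x\<^sub>0 \<rho> \<Longrightarrow> cyl t x \<in> G"
begin

abbreviation "R \<equiv> ball x\<^sub>0 \<rho>"
abbreviation "m \<equiv> measure lborel R"

lemma m_pos: "m > 0"
  using content_ball_pos[OF \<rho>] by simp

definition disc_mean :: "real \<Rightarrow> real" where
  "disc_mean t = (LINT x:R|lborel. \<gamma> (cyl t x)) / m"

lemma disc_mean_measurable [measurable]: "disc_mean \<in> borel_measurable borel"
proof -
  have [measurable]: "R \<in> sets borel" by simp
  have "(\<lambda>t. LBINT x. indicator R x *\<^sub>R \<gamma> (cyl t x)) \<in> borel_measurable borel" by measurable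
  then show ?thesis unfolding disc_mean_def[abs_def] set_lebesgue_integral_def by simp
qed

lemma J_sub: "{a<..<b} \<subseteq> I"
  using ab by auto

lemma R_sub: "a < t \<Longrightarrow> t < b \<Longrightarrow> R \<subseteq> D t"
  using cyl cyl_mem by blast

text \<open>Jensen on the disc, for almost every section, followed by Fubini. Square integrability
  is needed for the uniqueness argument that identifies \<open>\<gamma>\<close> with the disc
  mean.\<close>

lemma disc_mean_L2: "disc_mean \<in> L2 {a<..<b}"
proof -
  have i: "integrable lborel (\<lambda>y. indicator G y * (\<gamma> y)\<^sup>2)"
    using L2_borel_iff(1)[OF G_borel \<gamma>] \<gamma>L by (simp add: set_integrable_def)
  have ae: "AE t in lborel. t \<in> {a<..<b} \<longrightarrow> ennreal ((disc_mean t)\<^sup>2) \<le> ennreal (1 / m) * (\<integral>\<^sup>+x\<in>R. ennreal ((\<gamma> (cyl t x))\<^sup>2) \<partial>lborel)"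
    using integral_cyl(3)[OF i]
  proof (eventually_elim, intro impI)
    fix t assume 1: "integrable lborel (\<lambda>x. indicator G (cyl t x) * (\<gamma> (cyl t x))\<^sup>2)" and t: "t \<in> {a<..<b}"
    have tI: "t \<in> I" using t J_sub by blast
    note Dt = slice_props[OF tI]
    have ind: "indicator G (cyl t x) = (indicator (D t) x :: real)" for x using tI by (auto simp: indicator_def cyl_mem)
    let ?h = "\<lambda>x. \<gamma> (cyl t x)"
    have hm[measurable]: "?h \<in> borel_measurable borel" by measurable
    have "?h \<in> L2 (D t)" using 1 L2_borel_iff(1)[OF Dt(4) hm] unfolding ind set_integrable_def by simp
    then have hR: "?h \<in> L2 R" by (rule L2_borel_subset(1)[rotated -1]) (use R_sub t Dt(4) in auto)
    have "(\<integral>x. ?h x \<partial>lebesgue_on R)\<^sup>2 \<le> measure (lebesgue_on R) (space (lebesgue_on R)) * (\<integral>x. (?h x)\<^sup>2 \<partial>lebesgue_on R)"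
      by (rule integral_power2_le[OF finite_lebesgue_on]) (use hR in \<open>auto simp: L2_iff\<close>)
    then have "(LINT x:R|lborel. ?h x)\<^sup>2 \<le> m * (l2norm (lebesgue_on R) ?h)\<^sup>2"
      by (simp add: lebesgue_on_integral(1) l2norm_power2 measure_restrict_space)
    then have "(disc_mean t)\<^sup>2 \<le> (1 / m) * (l2norm (lebesgue_on R) ?h)\<^sup>2"
      unfolding disc_mean_def using m_pos by (simp add: power_divide power2_eq_square[of m] field_simps)
    then have "ennreal ((disc_mean t)\<^sup>2) \<le> ennreal ((1 / m) * (l2norm (lebesgue_on R) ?h)\<^sup>2)" by (rule ennreal_leI)
    also have "\<dots> = ennreal (1 / m) * ennreal ((l2norm (lebesgue_on R) ?h)\<^sup>2)" using m_pos by (intro ennreal_mult) auto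
    also have "ennreal ((l2norm (lebesgue_on R) ?h)\<^sup>2) = (\<integral>\<^sup>+x\<in>R. ennreal ((norm (?h x))\<^sup>2) \<partial>lborel)"
      by (rule nn_integral_l2norm[symmetric]) (use hR in auto)
    finally show "ennreal ((disc_mean t)\<^sup>2) \<le> ennreal (1 / m) * (\<integral>\<^sup>+x\<in>R. ennreal ((\<gamma> (cyl t x))\<^sup>2) \<partial>lborel)" by simp
  qed
  have "(\<integral>\<^sup>+t\<in>{a<..<b}. ennreal ((disc_mean t)\<^sup>2) \<partial>lborel)
    \<le> (\<integral>\<^sup>+t. ennreal (1 / m) * (\<integral>\<^sup>+x. ennreal ((\<gamma> (cyl t x))\<^sup>2) * indicator G (cyl t x) \<partial>lborel) \<partial>lborel)"
  proof (rule nn_integral_mono_AE)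
    show "AE t in lborel. ennreal ((disc_mean t)\<^sup>2) * indicator {a<..<b} t
      \<le> ennreal (1 / m) * (\<integral>\<^sup>+x. ennreal ((\<gamma> (cyl t x))\<^sup>2) * indicator G (cyl t x) \<partial>lborel)"
      using ae
    proof eventually_elim
      case (elim t)
      show ?case
      proof (cases "t \<in> {a<..<b}")
        case True
        have "(\<integral>\<^sup>+x\<in>R. ennreal ((\<gamma> (cyl t x))\<^sup>2) \<partial>lborel) \<le> (\<integral>\<^sup>+x. ennreal ((\<gamma> (cyl t x))\<^sup>2) * indicator G (cyl t x) \<partial>lborel)"
          using True cyl by (intro nn_integral_mono) (auto simp: indicator_def)
        then have "ennreal (1 / m) * (\<integral>\<^sup>+x\<in>R. ennreal ((\<gamma> (cyl t x))\<^sup>2) \<partial>lborel) \<le> ennreal (1 / m) * (\<integral>\<^sup>+x. ennreal ((\<gamma> (cyl t x))\<^sup>2) * indicator G (cyl t x) \<partial>lborel)"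
          by (rule mult_left_mono) simp
        moreover have "ennreal ((disc_mean t)\<^sup>2) \<le> ennreal (1 / m) * (\<integral>\<^sup>+x\<in>R. ennreal ((\<gamma> (cyl t x))\<^sup>2) \<partial>lborel)"
          using elim True by blast
        ultimately show ?thesis using True by (simp only: indicator_simps mult_1_right)
      qed simp
    qed
  qed
  also have "\<dots> = ennreal (1 / m) * (\<integral>\<^sup>+y\<in>G. ennreal ((\<gamma> y)\<^sup>2) \<partial>lborel)"
    by (subst nn_integral_cyl[of "\<lambda>y. ennreal ((\<gamma> y)\<^sup>2) * indicator G y"]) (auto simp: nn_integral_cmult)
  also have "\<dots> < \<infinity>" using \<gamma>L L2_borel_iff(2)[OF G_borel \<gamma>] by (simp add: ennreal_mult_less_top)
  finally show ?thesis using L2_borel_iff(2)[of "{a<..<b}" disc_mean] by simp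
qed

lemma disc_mean_integrable: "set_integrable lborel {a<..<b} disc_mean"
  by (rule L2_imp_set_integrable[OF _ _ disc_mean_measurable disc_mean_L2]) auto

lemma increment:
  assumes st: "s < t" "a \<le> s" "t \<le> b"
    and v: "(\<lambda>n. LINT x:R|lborel. W n (cyl s x)) \<longlonglongrightarrow> m * v" and v': "(\<lambda>n. LINT x:R|lborel. W n (cyl t x)) \<longlonglongrightarrow> m * v'"
  shows "v' - v = (LINT \<tau>:{s<..<t}|lborel. disc_mean \<tau>)"
proof -
  have "m * v' - m * v = (LINT \<tau>:{s<..<t}|lborel. (LINT x:R|lborel. \<gamma> (cyl \<tau> x)))"
    by (rule box_increment(1)[OF st(1) _ _ _ v v']) (use st cyl in auto)
  also have "\<dots> = m * (LINT \<tau>:{s<..<t}|lborel. disc_mean \<tau>)"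
    unfolding disc_mean_def using m_pos by (simp add: set_lebesgue_integral_def)
  finally show ?thesis using m_pos by (simp add: right_diff_distrib[symmetric])
qed

lemma good_increment:
  assumes "s < t" "a < s" "t < b" "good s" "good t"
  shows "V0 t - V0 s = (LINT \<tau>:{s<..<t}|lborel. disc_mean \<tau>)"
  by (rule increment) (use assms R_sub in \<open>auto simp: good_def\<close>)

lemma AE_good_J: "AE t in lborel. t \<in> {a<..<b} \<longrightarrow> good t"
  using AE_good by eventually_elim (use J_sub in blast)

text \<open>Good sections have full measure, so one of them can be fixed as a reference; the
  increment from it determines \<open>V0\<close> at every other good section.\<close>

lemma V0_eq_primitive:
  "\<exists>c. AE t in lborel. t \<in> {a<..<b} \<longrightarrow> V0 t = c + (LINT s:{a<..<t}|lborel. disc_mean s)"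
proof -
  have "open {a<..<b}" "{a<..<b} \<noteq> {}" using ab by auto
  then obtain s where s: "s \<in> {a<..<b}" "good s" using AE_lborel_open_witness[OF AE_good_J] by metis
  have "V0 t = V0 s - (LINT \<tau>:{a<..<s}|lborel. disc_mean \<tau>) + (LINT \<tau>:{a<..<t}|lborel. disc_mean \<tau>)"
    if t: "t \<in> {a<..<b}" "good t" for t
  proof -
    consider "s < t" | "t < s" | "s = t" by linarith
    then show ?thesis
    proof cases
      case 1
      then show ?thesis using good_increment[of s t] set_integral_Ioo_split[OF disc_mean_integrable, of s t] s t by simp
    next
      case 2
      then show ?thesis using good_increment[of t s] set_integral_Ioo_split[OF disc_mean_integrable, of t s] s t by simp
    qed simp
  qed
  then have "AE t in lborel. t \<in> {a<..<b} \<longrightarrow> V0 t = V0 s - (LINT \<tau>:{a<..<s}|lborel. disc_mean \<tau>) + (LINT \<tau>:{a<..<t}|lborel. disc_mean \<tau>)"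
    using AE_good_J by (auto elim!: eventually_mono)
  then show ?thesis by blast
qed

text \<open>On the part of \<open>G\<close> between \<open>a\<close> and \<open>b\<close> both \<open>\<gamma>\<close> and \<open>disc_mean (y $ 1)\<close> are the axial weak
  derivative of \<open>U\<close>, so that they agree.\<close>

lemma \<gamma>_eq_disc_mean: "AE y in lborel. y \<in> G \<longrightarrow> y $ 1 \<in> {a<..<b} \<longrightarrow> \<gamma> y = disc_mean (y $ 1)"
proof -
  define GJ where "GJ = {y \<in> G. y $ 1 \<in> {a<..<b}}"
  have GJs: "GJ \<subseteq> G" unfolding GJ_def by blast
  have GG: "bounded G" "open G" using rod_domainD(1,2)[OF rod] by auto
  have bJ: "bounded GJ" using GJs GG bounded_subset by blast
  have "GJ = G \<inter> {y. a < y $ 1} \<inter> {y. y $ 1 < b}" unfolding GJ_def by auto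
  moreover have "open {y::real^3. a < y $ 1}" "open {y::real^3. y $ 1 < b}"
    by (intro open_Collect_less continuous_intros)+
  ultimately have oJ: "open GJ" using GG by auto
  have GJb[measurable]: "GJ \<in> sets borel" using oJ by simp
  let ?d = "\<lambda>y::real^3. disc_mean (y $ 1)"
  have dm[measurable]: "?d \<in> borel_measurable borel" by measurable
  have dL: "?d \<in> L2 GJ"
  proof -
    have "(\<integral>\<^sup>+y\<in>GJ. ennreal ((?d y)\<^sup>2) \<partial>lborel) = (\<integral>\<^sup>+t\<in>{a<..<b}. ennreal (area D t) * ennreal ((disc_mean t)\<^sup>2) \<partial>lborel)"
      unfolding GJ_def by (rule nn_integral_fst_coord) (use J_sub in auto)
    also have "\<dots> \<le> (\<integral>\<^sup>+t. ennreal c\<^sub>1 * (ennreal ((disc_mean t)\<^sup>2) * indicator {a<..<b} t) \<partial>lborel)"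
    proof (rule nn_integral_mono)
      fix t
      show "ennreal (area D t) * ennreal ((disc_mean t)\<^sup>2) * indicator {a<..<b} t \<le> ennreal c\<^sub>1 * (ennreal ((disc_mean t)\<^sup>2) * indicator {a<..<b} t)"
      proof (cases "t \<in> {a<..<b}")
        case True
        \<comment> \<open>The upper bound on the area carries square integrability from the interval
          to the piece \<open>GJ\<close> of the rod.\<close>
        then have "ennreal (area D t) \<le> ennreal c\<^sub>1" using J_sub area[of t] by (intro ennreal_leI) auto
        then show ?thesis using True by (simp add: mult_right_mono)
      qed simp
    qed
    also have "\<dots> = ennreal c\<^sub>1 * (\<integral>\<^sup>+t\<in>{a<..<b}. ennreal ((disc_mean t)\<^sup>2) \<partial>lborel)" by (simp add: nn_integral_cmult)
    also have "\<dots> < \<infinity>" using disc_mean_L2 L2_borel_iff(2)[of "{a<..<b}" disc_mean] by (simp add: ennreal_mult_less_top)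
    finally show ?thesis using L2_borel_iff(2)[OF GJb dm] by simp
  qed
  have gL: "\<gamma> \<in> L2 GJ" by (rule L2_borel_subset(1)[OF GJs GJb G_borel \<gamma> \<gamma>L])
  obtain c where c: "AE t in lborel. t \<in> {a<..<b} \<longrightarrow> V0 t = c + (LINT s:{a<..<t}|lborel. disc_mean s)"
    using V0_eq_primitive by blast
  have "AE y in lebesgue_on GJ. \<gamma> y - ?d y = 0"
  proof (rule L2_test_orthogonal_imp_0[OF bJ oJ L2_diff[OF gL dL]])
    fix \<phi> assume p: "\<phi> \<in> test_functions GJ"
    have pG: "\<phi> \<in> test_functions G" by (rule test_functions_mono[OF p GJs])
    have ps: "smooth \<phi>" by (rule test_functions_smooth[OF p])
    obtain K where K: "K \<subseteq> GJ" "\<And>y. y \<notin> K \<Longrightarrow> \<phi> y = 0" "\<And>y. y \<notin> K \<Longrightarrow> grad \<phi> y = 0"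
      using test_functions_grad_supportE[OF p] by metis
    have p0: "\<phi> y = 0" "grad \<phi> y = 0" if "y \<notin> GJ" for y using K that by (meson subsetD)+
    have pm[measurable]: "\<phi> \<in> borel_measurable borel" "(\<lambda>y. grad \<phi> y $ 1) \<in> borel_measurable borel"
      using smooth_continuous[OF ps] smooth_grad_continuous[OF ps] by (auto intro!: borel_measurable_continuous_onI continuous_intros)
    have pL: "\<phi> \<in> L2 S" "(\<lambda>y. grad \<phi> y $ 1) \<in> L2 S" if "bounded S" "open S" for S
      using smooth_L2[OF that ps] L2_nth[OF smooth_grad_L2[OF that ps]] by auto
    let ?i = "indicator {a<..<b} :: real \<Rightarrow> real"
    \<comment> \<open>\<open>P'\<close> contains \<open>U\<close>, and \<open>P\<close> the
      primitive in its place. They agree almost everywhere, but only \<open>P\<close> has an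
      explicit form on every axial line.\<close>
    define P where "P y = (c * ?i (y $ 1) + ?i (y $ 1) * (LINT s:{a<..<y $ 1}|lborel. disc_mean s)) * (grad \<phi> y $ 1)" for y :: "real^3"
    define P' where "P' y = indicator G y * (U y * (grad \<phi> y $ 1))" for y
    define Q where "Q y = ?i (y $ 1) * disc_mean (y $ 1) * \<phi> y" for y :: "real^3"
    have [measurable]: "(\<lambda>t. ?i t * (LINT s:{a<..<t}|lborel. disc_mean s)) \<in> borel_measurable borel"
      by (rule primitive_measurable[OF disc_mean_integrable])
    have Pm[measurable]: "P \<in> borel_measurable borel"
    proof -
      have "(\<lambda>y::real^3. (\<lambda>t. ?i t * (LINT s:{a<..<t}|lborel. disc_mean s)) (y $ 1)) \<in> borel_measurable borel"
        by (rule measurable_compose[OF borel_measurable_fst_coord]) measurable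
      then show ?thesis unfolding P_def by measurable
    qed
    have P'm[measurable]: "P' \<in> borel_measurable borel" unfolding P'_def by measurable
    have P'i: "integrable lborel P'"
      using L2_mult_set_integrable[OF G_borel U pm(2) UL pL(2)[OF GG]] unfolding P'_def set_integrable_def by simp
    have eq: "AE y in lborel. P' y = P y"
      using U_eq_V0 AE_fst_coord[OF c]
    proof eventually_elim
      case (elim y)
      show ?case
      proof (cases "y \<in> GJ")
        case True
        then have "y \<in> G" "y $ 1 \<in> {a<..<b}" unfolding GJ_def by auto
        then show ?thesis using elim unfolding P_def P'_def by (simp add: algebra_simps)
      next
        case False
        then show ?thesis unfolding P_def P'_def by (simp add: p0)
      qed
    qed
    have Pi: "integrable lborel P" by (rule integrable_cong_AE_imp[OF P'i]) (use Pm eq in auto)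
    have Qi: "integrable lborel Q"
    proof -
      have "Q y = indicator GJ y *\<^sub>R (?d y * \<phi> y)" for y
        using p0(1)[of y] unfolding Q_def by (cases "y \<in> GJ") (auto simp: GJ_def)
      then have "Q = (\<lambda>y. indicator GJ y *\<^sub>R (?d y * \<phi> y))" by (rule ext)
      then show ?thesis using L2_mult_set_integrable[OF GJb dm pm(1) dL pL(1)[OF bJ oJ]] unfolding set_integrable_def by simp
    qed
    \<comment> \<open>\<open>\<phi>\<close> vanishes outside \<open>GJ\<close>, in particular on the
      planes at \<open>a\<close> and \<open>b\<close>. Integration by parts on an axial line
      therefore has no boundary terms, even if the line leaves \<open>G\<close> in between.\<close>
    have slice: "(LBINT t. P (cyl t x)) = - (LBINT t. Q (cyl t x))" for x
    proof -
      have "continuous_on UNIV (\<lambda>y. grad \<phi> y $ 1)" using smooth_grad_continuous[OF ps] by (intro continuous_intros)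
      from continuous_on_compose2[OF this continuous_on_cyl_fst] have dc: "continuous_on UNIV (\<lambda>t. grad \<phi> (cyl t x) $ 1)" by simp
      have z: "\<phi> (cyl a x) = 0" "\<phi> (cyl b x) = 0" by (rule p0(1), simp add: GJ_def)+
      have "(LBINT t. P (cyl t x)) = (LINT t:{a<..<b}|lborel. (c + (LINT s:{a<..<t}|lborel. disc_mean s)) * (grad \<phi> (cyl t x) $ 1))"
        unfolding P_def set_lebesgue_integral_def by (intro Bochner_Integration.integral_cong) (auto simp: indicator_def)
      also have "\<dots> = - (LINT t:{a<..<b}|lborel. disc_mean t * \<phi> (cyl t x))"
        by (rule primitive_weak_derivative[OF disc_mean_integrable _ has_real_derivative_cyl[OF ps] dc z]) (use ab in simp)
      also have "(LINT t:{a<..<b}|lborel. disc_mean t * \<phi> (cyl t x)) = (LBINT t. Q (cyl t x))"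
        unfolding Q_def set_lebesgue_integral_def by (simp add: mult.assoc)
      finally show ?thesis .
    qed
    have "(LINT y|lebesgue_on G. U y * (grad \<phi> y $ 1)) = (LBINT y. P' y)"
      unfolding P'_def by (subst lebesgue_on_integral(1)) (auto simp: set_lebesgue_integral_def)
    also have "\<dots> = (LBINT y. P y)" by (rule integral_cong_AE) (use eq in auto)
    also have "\<dots> = - (LBINT y. Q y)" unfolding integral_cyl(4)[OF Pi] integral_cyl(4)[OF Qi] slice by simp
    finally have 1: "(LINT y|lebesgue_on G. \<gamma> y * \<phi> y) = (LBINT y. Q y)" using wg[OF pG] by simp
    have 2: "(LINT y|lebesgue_on G. \<gamma> y * \<phi> y) = (LBINT y. \<gamma> y * \<phi> y)"
    proof (rule lebesgue_on_integral_support[OF G_borel])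
      show "\<gamma> y * \<phi> y = 0" if "y \<notin> G" for y using p0(1)[of y] that GJs by auto
    qed measurable
    have gpi: "integrable lborel (\<lambda>y. \<gamma> y * \<phi> y)"
    proof -
      have "\<gamma> y * \<phi> y = indicator GJ y *\<^sub>R (\<gamma> y * \<phi> y)" for y using p0(1)[of y] by (cases "y \<in> GJ") auto
      then have "(\<lambda>y. \<gamma> y * \<phi> y) = (\<lambda>y. indicator GJ y *\<^sub>R (\<gamma> y * \<phi> y))" by (rule ext)
      then show ?thesis using L2_mult_set_integrable[OF GJb \<gamma> pm(1) gL pL(1)[OF bJ oJ]] unfolding set_integrable_def by simp
    qed
    have "(LINT y|lebesgue_on GJ. (\<gamma> y - ?d y) * \<phi> y) = (LBINT y. (\<gamma> y - ?d y) * \<phi> y)"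
    proof (rule lebesgue_on_integral_support[OF GJb])
      show "(\<gamma> y - ?d y) * \<phi> y = 0" if "y \<notin> GJ" for y using p0(1)[OF that] by simp
    qed measurable
    also have "\<dots> = (LBINT y. \<gamma> y * \<phi> y - Q y)"
    proof (rule Bochner_Integration.integral_cong[OF refl])
      fix y
      show "(\<gamma> y - ?d y) * \<phi> y = \<gamma> y * \<phi> y - Q y"
        using p0(1)[of y] unfolding Q_def by (cases "y \<in> GJ") (auto simp: GJ_def algebra_simps)
    qed
    also have "\<dots> = 0" using gpi Qi 1 2 by simp
    finally show "(LINT y|lebesgue_on GJ. (\<gamma> y - ?d y) * \<phi> y) = 0" .
  qed
  then have "AE y in lebesgue. y \<in> GJ \<longrightarrow> \<gamma> y - ?d y = 0"
    by (subst (asm) AE_restrict_space_iff) auto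
  then have "AE y in lborel. y \<in> GJ \<longrightarrow> \<gamma> y - ?d y = 0"
    by (subst (asm) AE_completion_iff) auto
  then show ?thesis unfolding GJ_def by eventually_elim auto
qed

lemma \<gamma>_slice: "AE t in lborel. t \<in> {a<..<b} \<longrightarrow> (AE x in lborel. x \<in> D t \<longrightarrow> \<gamma> (cyl t x) = disc_mean t)"
  using AE_cylD[OF \<gamma>_eq_disc_mean]
proof (eventually_elim, intro impI)
  fix t assume 1: "AE x in lborel. cyl t x \<in> G \<longrightarrow> cyl t x $ 1 \<in> {a<..<b} \<longrightarrow> \<gamma> (cyl t x) = disc_mean (cyl t x $ 1)"
    and t: "t \<in> {a<..<b}"
  have "t \<in> I" using t J_sub by blast
  then show "AE x in lborel. x \<in> D t \<longrightarrow> \<gamma> (cyl t x) = disc_mean t"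
    using 1 t by (auto elim!: eventually_mono simp: cyl_mem)
qed

lemma g_eq_disc_mean: "AE t in lborel. t \<in> {a<..<b} \<longrightarrow> g t = disc_mean t"
  using \<gamma>_slice
proof (eventually_elim, intro impI)
  fix t assume 1: "t \<in> {a<..<b} \<longrightarrow> (AE x in lborel. x \<in> D t \<longrightarrow> \<gamma> (cyl t x) = disc_mean t)" and t: "t \<in> {a<..<b}"
  then show "g t = disc_mean t" unfolding g_def using J_sub by (intro mean_profile_eq) auto
qed

lemma integral_g_eq:
  assumes "a \<le> s" "t \<le> b"
  shows "(LINT \<tau>:{s<..<t}|lborel. g \<tau>) = (LINT \<tau>:{s<..<t}|lborel. disc_mean \<tau>)"
  unfolding set_lebesgue_integral_def
proof (rule integral_cong_AE)
  show "AE \<tau> in lborel. indicator {s<..<t} \<tau> *\<^sub>R g \<tau> = indicator {s<..<t} \<tau> *\<^sub>R disc_mean \<tau>"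
    using g_eq_disc_mean by eventually_elim (use assms in \<open>auto simp: indicator_def\<close>)
qed measurable

end

section \<open>Gluing the cylinders and reading off the end conditions\<close>

context rod_slices
begin

lemma cylinder_at:
  assumes t0: "t\<^sub>0 \<in> {l\<^sub>0..l\<^sub>1}"
  obtains a b \<rho> x\<^sub>0 \<delta> where "rod_cylinder l\<^sub>0 l\<^sub>1 c\<^sub>0 c\<^sub>1 D G W U \<gamma> a b \<rho> x\<^sub>0" "\<delta> > 0"
    "a = max l\<^sub>0 (t\<^sub>0 - \<delta>)" "b = min l\<^sub>1 (t\<^sub>0 + \<delta>)" "t\<^sub>0 \<in> {l\<^sub>0, l\<^sub>1} \<longrightarrow> ball x\<^sub>0 \<rho> \<subseteq> D t\<^sub>0"
proof -
  obtain x\<^sub>0 \<rho> \<delta> where r: "\<rho> > 0" and d: "\<delta> > 0"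
    and c: "\<And>t x. t \<in> I \<Longrightarrow> \<bar>t - t\<^sub>0\<bar> < \<delta> \<Longrightarrow> x \<in> ball x\<^sub>0 \<rho> \<Longrightarrow> cyl t x \<in> G"
    and e: "t\<^sub>0 \<in> {l\<^sub>0, l\<^sub>1} \<Longrightarrow> ball x\<^sub>0 \<rho> \<subseteq> D t\<^sub>0"
    by (rule local_cylinder[OF t0]) (rule that; blast)
  show thesis
  proof (rule that[OF _ d refl refl impI[OF e]])
    show "rod_cylinder l\<^sub>0 l\<^sub>1 c\<^sub>0 c\<^sub>1 D G W U \<gamma> (max l\<^sub>0 (t\<^sub>0 - \<delta>)) (min l\<^sub>1 (t\<^sub>0 + \<delta>)) \<rho> x\<^sub>0"
    proof (intro rod_cylinder.intro rod_cylinder_axioms.intro rod_slices_axioms r)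
      show "max l\<^sub>0 (t\<^sub>0 - \<delta>) < min l\<^sub>1 (t\<^sub>0 + \<delta>)" using ll t0 d by auto
      show "cyl t x \<in> G" if "max l\<^sub>0 (t\<^sub>0 - \<delta>) < t" "t < min l\<^sub>1 (t\<^sub>0 + \<delta>)" "x \<in> ball x\<^sub>0 \<rho>" for t x
        using c[of t x] that by (auto simp: abs_less_iff)
    qed auto
  qed
qed

text \<open>Every point of \<open>I\<close> has a neighbourhood whose part in \<open>I\<close> is
  the axial range of a cylinder, so statements proved for one cylinder spread to \<open>I\<close> by
  \<open>locally_AE_imp_AE\<close>.\<close>

lemma AE_I_local:
  assumes "\<And>a b \<rho> x\<^sub>0. rod_cylinder l\<^sub>0 l\<^sub>1 c\<^sub>0 c\<^sub>1 D G W U \<gamma> a b \<rho> x\<^sub>0 \<Longrightarrow> AE t in lborel. t \<in> {a<..<b} \<longrightarrow> Q t"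
  shows "AE t in lborel. t \<in> I \<longrightarrow> Q t"
proof (rule locally_AE_imp_AE)
  fix t\<^sub>0 assume "t\<^sub>0 \<in> I"
  then have t0: "t\<^sub>0 \<in> {l\<^sub>0..l\<^sub>1}" by auto
  obtain a b \<rho> x\<^sub>0 \<delta> where c: "rod_cylinder l\<^sub>0 l\<^sub>1 c\<^sub>0 c\<^sub>1 D G W U \<gamma> a b \<rho> x\<^sub>0" and d: "\<delta> > 0"
    and ab: "a = max l\<^sub>0 (t\<^sub>0 - \<delta>)" "b = min l\<^sub>1 (t\<^sub>0 + \<delta>)"
    by (rule cylinder_at[OF t0])
  have "AE t in lborel. t \<in> ball t\<^sub>0 \<delta> \<longrightarrow> t \<in> I \<longrightarrow> Q t"
    using assms[OF c] by eventually_elim (auto simp: ab dist_real_def abs_less_iff)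
  then show "\<exists>\<rho>>0. AE t in lborel. t \<in> ball t\<^sub>0 \<rho> \<longrightarrow> t \<in> I \<longrightarrow> Q t" using d by blast
qed

lemma \<gamma>_eq_g: "AE y in lborel. y \<in> G \<longrightarrow> \<gamma> y = g (y $ 1)"
  unfolding g_def
proof (rule mean_profile_AE(2)[OF \<gamma>], rule AE_I_local)
  fix a b \<rho> x\<^sub>0 assume "rod_cylinder l\<^sub>0 l\<^sub>1 c\<^sub>0 c\<^sub>1 D G W U \<gamma> a b \<rho> x\<^sub>0"
  then interpret C: rod_cylinder l\<^sub>0 l\<^sub>1 c\<^sub>0 c\<^sub>1 D G W U \<gamma> a b \<rho> x\<^sub>0 .
  show "AE t in lborel. t \<in> {a<..<b} \<longrightarrow> (\<exists>c. AE x in lborel. x \<in> D t \<longrightarrow> \<gamma> (cyl t x) = c)"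
    using C.\<gamma>_slice by eventually_elim blast
qed

lemma g_L2: "g \<in> L2 I"
  by (rule profile_L2[OF g_measurable \<gamma> \<gamma>L \<gamma>_eq_g])

lemma g_integrable: "set_integrable lborel I g"
  by (rule L2_imp_set_integrable[OF _ _ g_measurable g_L2]) auto

definition defect :: "real \<Rightarrow> real" where
  "defect t = V0 t - (LINT s:{l\<^sub>0<..<t}|lborel. g s)"

lemma W_face_integral: "t \<in> {l\<^sub>0, l\<^sub>1} \<Longrightarrow> R \<subseteq> D t \<Longrightarrow> (LINT x:R|lborel. W n (cyl t x)) = 0"
proof -
  assume "t \<in> {l\<^sub>0, l\<^sub>1}" "R \<subseteq> D t"
  then have "W n (cyl t x) = 0" if "x \<in> R" for x
    using that by (intro W0) (auto simp: plane_face_def)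
  then have "indicator R x *\<^sub>R W n (cyl t x) = 0" for x by (simp add: indicator_def)
  then show ?thesis unfolding set_lebesgue_integral_def by (simp only: Bochner_Integration.integral_zero)
qed

text \<open>On each cylinder the defect takes one value at all good sections, and connectedness of
  \<open>I\<close> makes it one constant. A cylinder at the left face shows that the constant is
  zero; a cylinder at the right face then shows that the whole integral of \<open>g\<close> is
  zero.\<close>

lemma V0_eq_primitive_g:
  shows "AE t in lborel. t \<in> I \<longrightarrow> V0 t = (LINT s:{l\<^sub>0<..<t}|lborel. g s)" and "(LINT s:I|lborel. g s) = 0"
proof -
  have "\<exists>c. AE t in lborel. t \<in> I \<longrightarrow> defect t = c"
  proof (rule locally_AE_constant_imp_AE_constant)
    fix t\<^sub>0 assume "t\<^sub>0 \<in> I"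
    then have t0: "t\<^sub>0 \<in> {l\<^sub>0..l\<^sub>1}" by auto
    obtain a b \<rho> x\<^sub>0 \<delta> where c: "rod_cylinder l\<^sub>0 l\<^sub>1 c\<^sub>0 c\<^sub>1 D G W U \<gamma> a b \<rho> x\<^sub>0" and d: "\<delta> > 0"
      and ab: "a = max l\<^sub>0 (t\<^sub>0 - \<delta>)" "b = min l\<^sub>1 (t\<^sub>0 + \<delta>)"
      by (rule cylinder_at[OF t0])
    interpret C: rod_cylinder l\<^sub>0 l\<^sub>1 c\<^sub>0 c\<^sub>1 D G W U \<gamma> a b \<rho> x\<^sub>0 by (rule c)
    have "open {a<..<b}" "{a<..<b} \<noteq> {}" using C.ab by auto
    then obtain s where s: "s \<in> {a<..<b}" "good s" using AE_lborel_open_witness[OF C.AE_good_J] by metis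
    have mono: "defect p = defect q" if pq: "p < q" "p \<in> {a<..<b}" "q \<in> {a<..<b}" "good p" "good q" for p q
    proof -
      have "V0 q - V0 p = (LINT \<tau>:{p<..<q}|lborel. g \<tau>)"
        using C.good_increment[of p q] C.integral_g_eq[of p q] pq by auto
      moreover have "(LINT \<tau>:{l\<^sub>0<..<q}|lborel. g \<tau>) = (LINT \<tau>:{l\<^sub>0<..<p}|lborel. g \<tau>) + (LINT \<tau>:{p<..<q}|lborel. g \<tau>)"
        by (rule set_integral_Ioo_split[OF g_integrable]) (use pq C.ab in auto)
      ultimately show ?thesis unfolding defect_def by simp
    qed
    have "defect t = defect s" if "t \<in> {a<..<b}" "good t" for t
    proof -
      consider "s < t" | "t < s" | "s = t" by linarith
      then show ?thesis
      proof cases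
        case 1
        show ?thesis by (rule mono[symmetric, OF 1 s(1) that(1) s(2) that(2)])
      next
        case 2
        show ?thesis by (rule mono[OF 2 that(1) s(1) that(2) s(2)])
      qed simp
    qed
    then have "AE t in lborel. t \<in> ball t\<^sub>0 \<delta> \<longrightarrow> t \<in> I \<longrightarrow> defect t = defect s"
      using C.AE_good_J by (auto elim!: eventually_mono simp: ab dist_real_def abs_less_iff)
    then show "\<exists>\<rho>>0. \<exists>c. AE t in lborel. t \<in> ball t\<^sub>0 \<rho> \<longrightarrow> t \<in> I \<longrightarrow> defect t = c" using d by blast
  qed auto
  then obtain c where c: "AE t in lborel. t \<in> I \<longrightarrow> defect t = c" by blast
  have "c = 0"
  proof -
    have t0: "l\<^sub>0 \<in> {l\<^sub>0..l\<^sub>1}" using ll by simp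
    obtain a b \<rho> x\<^sub>0 \<delta> where cy: "rod_cylinder l\<^sub>0 l\<^sub>1 c\<^sub>0 c\<^sub>1 D G W U \<gamma> a b \<rho> x\<^sub>0" and d: "\<delta> > 0"
      and ab: "a = max l\<^sub>0 (l\<^sub>0 - \<delta>)" "b = min l\<^sub>1 (l\<^sub>0 + \<delta>)" and R: "l\<^sub>0 \<in> {l\<^sub>0, l\<^sub>1} \<longrightarrow> ball x\<^sub>0 \<rho> \<subseteq> D l\<^sub>0"
      by (rule cylinder_at[OF t0])
    interpret C: rod_cylinder l\<^sub>0 l\<^sub>1 c\<^sub>0 c\<^sub>1 D G W U \<gamma> a b \<rho> x\<^sub>0 by (rule cy)
    have al: "a = l\<^sub>0" using ab d by simp
    have ae: "AE t in lborel. t \<in> {a<..<b} \<longrightarrow> good t \<and> defect t = c"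
      using C.AE_good_J c by eventually_elim (use C.J_sub in blast)
    have "open {a<..<b}" "{a<..<b} \<noteq> {}" using C.ab by auto
    from ae this obtain t where "t \<in> {a<..<b}" "t \<in> {a<..<b} \<longrightarrow> good t \<and> defect t = c"
      by (rule AE_lborel_open_witness)
    then have t: "t \<in> {a<..<b}" "good t" "defect t = c" by blast+
    \<comment> \<open>The face at \<open>l\<^sub>0\<close> is the lower end of this cylinder, and
      its disc means vanish for every \<open>n\<close>.\<close>
    have "V0 t - 0 = (LINT \<tau>:{l\<^sub>0<..<t}|lborel. C.disc_mean \<tau>)"
    proof (rule C.increment)
      show "(\<lambda>n. LINT x:ball x\<^sub>0 \<rho>|lborel. W n (cyl l\<^sub>0 x)) \<longlonglongrightarrow> measure lborel (ball x\<^sub>0 \<rho>) * 0"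
        using W_face_integral[of l\<^sub>0] R by simp
      show "(\<lambda>n. LINT x:ball x\<^sub>0 \<rho>|lborel. W n (cyl t x)) \<longlonglongrightarrow> measure lborel (ball x\<^sub>0 \<rho>) * V0 t"
        using t C.R_sub[of t] unfolding good_def by auto
    qed (use t al in auto)
    then show ?thesis using t(3) C.integral_g_eq[of l\<^sub>0 t] t(1) al unfolding defect_def by simp
  qed
  then show V: "AE t in lborel. t \<in> I \<longrightarrow> V0 t = (LINT s:{l\<^sub>0<..<t}|lborel. g s)"
    using c unfolding defect_def by simp
  show "(LINT s:I|lborel. g s) = 0"
  proof -
    have t0: "l\<^sub>1 \<in> {l\<^sub>0..l\<^sub>1}" using ll by simp
    obtain a b \<rho> x\<^sub>0 \<delta> where cy: "rod_cylinder l\<^sub>0 l\<^sub>1 c\<^sub>0 c\<^sub>1 D G W U \<gamma> a b \<rho> x\<^sub>0" and d: "\<delta> > 0"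
      and ab: "a = max l\<^sub>0 (l\<^sub>1 - \<delta>)" "b = min l\<^sub>1 (l\<^sub>1 + \<delta>)" and R: "l\<^sub>1 \<in> {l\<^sub>0, l\<^sub>1} \<longrightarrow> ball x\<^sub>0 \<rho> \<subseteq> D l\<^sub>1"
      by (rule cylinder_at[OF t0])
    interpret C: rod_cylinder l\<^sub>0 l\<^sub>1 c\<^sub>0 c\<^sub>1 D G W U \<gamma> a b \<rho> x\<^sub>0 by (rule cy)
    have bl: "b = l\<^sub>1" using ab d by simp
    have ae: "AE t in lborel. t \<in> {a<..<b} \<longrightarrow> good t \<and> V0 t = (LINT s:{l\<^sub>0<..<t}|lborel. g s)"
      using C.AE_good_J V by eventually_elim (use C.J_sub in blast)
    have "open {a<..<b}" "{a<..<b} \<noteq> {}" using C.ab by auto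
    from ae this obtain t where "t \<in> {a<..<b}" "t \<in> {a<..<b} \<longrightarrow> good t \<and> V0 t = (LINT s:{l\<^sub>0<..<t}|lborel. g s)"
      by (rule AE_lborel_open_witness)
    then have t: "t \<in> {a<..<b}" "good t" "V0 t = (LINT s:{l\<^sub>0<..<t}|lborel. g s)" by blast+
    \<comment> \<open>Here the increment ends on the right face with the value \<open>0\<close>;
      together with the primitive up to \<open>t\<close> it covers all of \<open>I\<close>.\<close>
    have "0 - V0 t = (LINT \<tau>:{t<..<l\<^sub>1}|lborel. C.disc_mean \<tau>)"
    proof (rule C.increment)
      show "(\<lambda>n. LINT x:ball x\<^sub>0 \<rho>|lborel. W n (cyl l\<^sub>1 x)) \<longlonglongrightarrow> measure lborel (ball x\<^sub>0 \<rho>) * 0"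
        using W_face_integral[of l\<^sub>1] R by simp
      show "(\<lambda>n. LINT x:ball x\<^sub>0 \<rho>|lborel. W n (cyl t x)) \<longlonglongrightarrow> measure lborel (ball x\<^sub>0 \<rho>) * V0 t"
        using t C.R_sub[of t] unfolding good_def by auto
    qed (use t bl in auto)
    then have "0 - V0 t = (LINT \<tau>:{t<..<l\<^sub>1}|lborel. g \<tau>)" using C.integral_g_eq[of t l\<^sub>1] t(1) bl by simp
    moreover have "(LINT s:I|lborel. g s) = (LINT s:{l\<^sub>0<..<t}|lborel. g s) + (LINT s:{t<..<l\<^sub>1}|lborel. g s)"
      by (rule set_integral_Ioo_split[OF g_integrable]) (use t C.ab in auto)
    ultimately show ?thesis using t(3) by simp
  qed
qed

end

context rod_limit
begin

text \<open>Convergence on sections holds along a subsequence \<open>r\<close> only. This does no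
  harm: the conclusion speaks of \<open>U\<close> and \<open>\<gamma>\<close> alone, and weak
  convergence passes to subsequences.\<close>

theorem limit_profile:
  assumes W: "\<And>j. smooth (W j)" and W0: "\<And>j y. y \<in> plane_face D l\<^sub>0 \<union> plane_face D l\<^sub>1 \<Longrightarrow> W j y = 0"
    and U: "U \<in> borel_measurable borel" "U \<in> L2 G" and \<gamma>: "\<gamma> \<in> borel_measurable borel" "\<gamma> \<in> L2 G"
    and strong: "(\<lambda>j. l2norm (lebesgue_on G) (\<lambda>y. W j y - U y)) \<longlonglongrightarrow> 0"
    and d2: "(\<lambda>j. l2norm (lebesgue_on G) (\<lambda>y. grad (W j) y $ 2)) \<longlonglongrightarrow> 0"
    and d3: "(\<lambda>j. l2norm (lebesgue_on G) (\<lambda>y. grad (W j) y $ 3)) \<longlonglongrightarrow> 0"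
    and weak: "\<And>f. f \<in> L2 G \<Longrightarrow> (\<lambda>j. LINT y|lebesgue_on G. grad (W j) y $ 1 * f y) \<longlonglongrightarrow> (LINT y|lebesgue_on G. \<gamma> y * f y)"
    and wg: "\<And>\<phi>. \<phi> \<in> test_functions G \<Longrightarrow> (LINT y|lebesgue_on G. U y * (grad \<phi> y $ 1)) = - (LINT y|lebesgue_on G. \<gamma> y * \<phi> y)"
  obtains V g where "V \<in> borel_measurable borel" "g \<in> borel_measurable borel" "V \<in> L2 I" "g \<in> L2 I"
    "AE y in lborel. y \<in> G \<longrightarrow> U y = V (y $ 1)" "AE y in lborel. y \<in> G \<longrightarrow> \<gamma> y = g (y $ 1)"
    "AE t in lborel. t \<in> I \<longrightarrow> V t = (LINT s:{l\<^sub>0<..<t}|lborel. g s)" "(LINT s:I|lborel. g s) = 0"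
proof -
  obtain r where r: "strict_mono (r :: nat \<Rightarrow> nat)"
    "AE t in lborel. t \<in> I \<longrightarrow> (\<lambda>x. U (cyl t x)) \<in> L2 (D t) \<and>
       (\<lambda>n. l2norm (lebesgue_on (D t)) (\<lambda>x. W (r n) (cyl t x) - U (cyl t x))) \<longlonglongrightarrow> 0 \<and>
       (\<lambda>n. l2norm (lebesgue_on (D t)) (grad (\<lambda>x. W (r n) (cyl t x)))) \<longlonglongrightarrow> 0"
    by (rule good_slices[OF W U strong d2 d3])
  interpret S: rod_slices l\<^sub>0 l\<^sub>1 c\<^sub>0 c\<^sub>1 D G "\<lambda>n. W (r n)" U \<gamma>
  proof (intro rod_slices.intro rod_limit_axioms rod_slices_axioms.intro W W0 U \<gamma> r(2) wg)
    fix f :: "real^3 \<Rightarrow> real" assume "f \<in> L2 G"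
    from LIMSEQ_subseq_LIMSEQ[OF weak[OF this] r(1)]
    show "(\<lambda>j. LINT y|lebesgue_on G. grad (W (r j)) y $ 1 * f y) \<longlonglongrightarrow> (LINT y|lebesgue_on G. \<gamma> y * f y)"
      by (simp add: o_def)
  qed
  show thesis
    by (rule that[OF S.V0_measurable S.g_measurable profile_L2[OF S.V0_measurable U S.U_eq_V0] S.g_L2
      S.U_eq_V0 S.\<gamma>_eq_g S.V0_eq_primitive_g])
qed

end

section \<open>Borel representatives and weak limits tested on a dense class\<close>

lemma AE_lebesgue_on_iff:
  fixes S :: "'a::euclidean_space set"
  shows "S \<in> sets borel \<Longrightarrow> (AE x in lebesgue_on S. P x) \<longleftrightarrow> (AE x in lborel. x \<in> S \<longrightarrow> P x)"
  by (subst AE_restrict_space_iff) (auto simp: AE_completion_iff)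

text \<open>Sections of a Borel function are Borel, which slicing relies on. Members of
  \<open>L2\<close> are only Lebesgue measurable, so they are replaced once by Borel
  functions.\<close>

lemma L2_borel_representative:
  fixes f :: "'a::euclidean_space \<Rightarrow> real"
  assumes S: "S \<in> sets borel" and f: "f \<in> L2 S"
  obtains f' where "f' \<in> borel_measurable borel" "f' \<in> L2 S" "AE x in lebesgue_on S. f x = f' x"
proof -
  have Sl: "S \<inter> space lebesgue \<in> sets lebesgue" using S by simp
  have fm: "f \<in> borel_measurable (lebesgue_on S)" using f by (simp add: L2_def)
  then have "(\<lambda>x. indicator S x *\<^sub>R f x) \<in> borel_measurable lebesgue"
    using borel_measurable_restrict_space_iff[OF Sl] by blast
  then obtain f' where f': "f' \<in> borel_measurable lborel" "AE x in lborel. indicator S x *\<^sub>R f x = f' x"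
    using completion_ex_borel_measurable_real by blast
  have ae: "AE x in lebesgue_on S. f x = f' x"
    unfolding AE_lebesgue_on_iff[OF S] using f'(2) by eventually_elim auto
  have m: "f' \<in> borel_measurable borel" using f'(1) by simp
  have "f' \<in> L2 S" unfolding L2_iff
    by (rule sq_integrable_AE_cong[OF _ borel_measurable_lebesgue_on[OF m] ae]) (use f in \<open>simp add: L2_iff\<close>)
  then show thesis using that m ae by blast
qed

text \<open>The norms of \<open>F j - H\<close> are bounded by \<open>K\<close>, so the error from
  replacing \<open>f\<close> by a close test function is small uniformly in
  \<open>j\<close>.\<close>

lemma weak_convergence_by_test_functions:
  fixes F :: "nat \<Rightarrow> 'a::euclidean_space \<Rightarrow> real"
  assumes S: "bounded S" "open S" and F: "\<And>j. F j \<in> L2 S" "\<And>j. l2norm (lebesgue_on S) (F j) \<le> C" and H: "H \<in> L2 S"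
    and test: "\<And>\<phi>. \<phi> \<in> test_functions S \<Longrightarrow> (\<lambda>j. LINT x|lebesgue_on S. F j x * \<phi> x) \<longlonglongrightarrow> (LINT x|lebesgue_on S. H x * \<phi> x)"
    and f: "f \<in> L2 S"
  shows "(\<lambda>j. LINT x|lebesgue_on S. F j x * f x) \<longlonglongrightarrow> (LINT x|lebesgue_on S. H x * f x)"
proof -
  let ?L = "lebesgue_on S"
  define K where "K = C + l2norm ?L H"
  have dL: "sq_integrable ?L (\<lambda>x. F j x - H x)" for j using L2_diff[OF F(1) H] by (simp add: L2_iff)
  have dn: "l2norm ?L (\<lambda>x. F j x - H x) \<le> K" for j
  proof -
    have "sq_integrable ?L (F j)" "sq_integrable ?L (\<lambda>x. (-1) *\<^sub>R H x)"
      using F(1) H sq_integrable_scaleR unfolding L2_iff by blast+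
    from l2norm_triangle[OF this] show ?thesis using F(2)[of j] by (simp add: l2norm_uminus K_def)
  qed
  have K0: "K \<ge> 0" using dn[of 0] l2norm_nonneg order_trans by blast
  have split: "(LINT x|?L. F j x * h x) - (LINT x|?L. H x * h x) = (LINT x|?L. (F j x - H x) * h x)" if "h \<in> L2 S" for j h
    using sq_integrable_mult[of ?L "F j" h] sq_integrable_mult[of ?L H h] F(1)[of j] H that by (simp add: L2_iff left_diff_distrib)
  have "(\<lambda>j. LINT x|?L. (F j x - H x) * f x) \<longlonglongrightarrow> 0"
  proof (rule LIMSEQ_I)
    fix e :: real assume e: "e > 0"
    \<comment> \<open>Multiplied by the bound \<open>K\<close> this tolerance is at most
      \<open>e / 2\<close>; the added \<open>1\<close> covers \<open>K = 0\<close>.\<close>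
    obtain \<phi> where p: "\<phi> \<in> test_functions S" "l2norm ?L (\<lambda>x. f x - \<phi> x) < e / (2 * (K + 1))"
      using L2_test_approx[OF S f] e K0 unfolding test_approx_def by (metis divide_pos_pos add_nonneg_pos mult_pos_pos zero_less_numeral zero_less_one)
    have pL: "\<phi> \<in> L2 S" using test_function_L2[OF S p(1)] by (simp add: L2_iff)
    have lim: "(\<lambda>j. LINT x|?L. (F j x - H x) * \<phi> x) \<longlonglongrightarrow> 0"
      using LIM_zero[OF test[OF p(1)]] unfolding split[OF pL] .
    obtain N where N: "\<And>j. j \<ge> N \<Longrightarrow> \<bar>LINT x|?L. (F j x - H x) * \<phi> x\<bar> < e / 2"
      using LIMSEQ_D[OF lim, of "e/2"] e by auto
    have "\<bar>LINT x|?L. (F j x - H x) * f x\<bar> < e" if j: "j \<ge> N" for j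
    proof -
      have fpL: "sq_integrable ?L (\<lambda>x. f x - \<phi> x)" using L2_diff[OF f pL] by (simp add: L2_iff)
      have "(LINT x|?L. (F j x - H x) * f x) = (LINT x|?L. (F j x - H x) * (f x - \<phi> x) + (F j x - H x) * \<phi> x)"
        by (simp add: algebra_simps)
      also have "\<dots> = (LINT x|?L. (F j x - H x) * (f x - \<phi> x)) + (LINT x|?L. (F j x - H x) * \<phi> x)"
        using sq_integrable_mult[OF dL fpL] sq_integrable_mult[OF dL[of j], of \<phi>] pL by (intro Bochner_Integration.integral_add) (auto simp: L2_iff)
      finally have "\<bar>LINT x|?L. (F j x - H x) * f x\<bar> \<le> \<bar>LINT x|?L. (F j x - H x) * (f x - \<phi> x)\<bar> + \<bar>LINT x|?L. (F j x - H x) * \<phi> x\<bar>" by linarith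
      also have "\<bar>LINT x|?L. (F j x - H x) * (f x - \<phi> x)\<bar> \<le> K * (e / (2 * (K + 1)))"
        by (rule order_trans[OF l2_Cauchy_Schwarz_real[OF dL fpL]]) (use dn p K0 l2norm_nonneg in \<open>intro mult_mono; auto\<close>)
      also have "K * (e / (2 * (K + 1))) \<le> e / 2" using K0 e by (simp add: field_simps)
      finally show ?thesis using N[OF j] by linarith
    qed
    then show "\<exists>N. \<forall>j\<ge>N. norm ((LINT x|?L. (F j x - H x) * f x) - 0) < e" by auto
  qed
  then show ?thesis unfolding split[OF f, symmetric] by (rule LIM_zero_cancel)
qed

subsection \<open>Dirichlet conditions on an interval\<close>

lemma smooth_has_real_derivative:
  fixes \<phi> :: "real \<Rightarrow> real"
  assumes "smooth \<phi>" shows "(\<phi> has_real_derivative grad \<phi> t) (at t)"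
proof -
  have "(\<lambda>h. grad \<phi> t \<bullet> h) = (*) (grad \<phi> t)" by (rule ext) simp
  then show ?thesis unfolding has_field_derivative_def using smooth_has_derivative[OF assms, of t] by simp
qed

text \<open>The primitive from \<open>a\<close> is zero to the left of the support of
  \<open>f\<close>; to the right of it, it equals the whole integral, which vanishes. It therefore
  has compact support as well.\<close>

lemma test_function_primitive:
  fixes f :: "real \<Rightarrow> real"
  assumes ab: "a < b" and f: "f \<in> test_functions {a<..<b}" and 0: "(LINT t:{a<..<b}|lborel. f t) = 0"
  obtains w where "w \<in> test_functions {a<..<b}" "\<And>t. grad w t = f t" "\<And>t. t > a \<Longrightarrow> w t = (LINT s:{a<..<t}|lborel. f s)"
proof -
  obtain K where sf: "smooth f" and K: "compact K" "K \<subseteq> {a<..<b}" "{x. f x \<noteq> 0} \<subseteq> K"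
    using f by (rule test_functionsE)
  obtain \<alpha> \<beta> where al: "a < \<alpha>" "\<beta> < b" "K \<subseteq> {\<alpha>..\<beta>}"
  proof (cases "K = {}")
    case True
    \<comment> \<open>For an empty support any point of the open interval would do; the midpoint is
      taken.\<close>
    then show ?thesis using that[of "(a+b)/2" "(a+b)/2"] ab by simp
  next
    case False
    obtain p where p: "p \<in> K" "\<forall>t\<in>K. p \<le> t" using compact_attains_inf[OF K(1) False] by blast
    obtain q where q: "q \<in> K" "\<forall>t\<in>K. t \<le> q" using compact_attains_sup[OF K(1) False] by blast
    show ?thesis
    proof (rule that[of p q])
      show "a < p" "q < b" using p(1) q(1) K(2) by auto
      show "K \<subseteq> {p..q}" using p(2) q(2) by auto
    qed
  qed
  have f0: "f t = 0" if "t < \<alpha> \<or> \<beta> < t" for t using that K(3) al(3) by force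
  have fc: "continuous_on UNIV f" by (rule smooth_continuous[OF sf])
  then have "\<exists>F. \<forall>x::real. (- \<infinity> :: ereal) < x \<longrightarrow> x < (\<infinity> :: ereal) \<longrightarrow> (F has_vector_derivative f x) (at x)"
    by (intro einterval_antiderivative) (auto simp: continuous_on_eq_continuous_at)
  then obtain F where F: "\<And>x. (F has_real_derivative f x) (at x)"
    by (auto simp: has_real_derivative_iff_has_vector_derivative)
  define w where "w t = F t - F a" for t
  have wd: "(w has_real_derivative f t) (at t)" for t
    unfolding w_def using F[of t] by (auto intro!: derivative_eq_intros)
  have inc: "w v - w u = (LINT t:{u<..<v}|lborel. f t)" if "u \<le> v" for u v
    using set_integral_FTC_Ioo[OF that wd fc] by simp
  have z: "(LINT t:{u<..<v}|lborel. f t) = 0" if "v \<le> \<alpha> \<or> \<beta> \<le> u" for u v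
  proof -
    have "indicator {u<..<v} t *\<^sub>R f t = 0" for t using that f0[of t] by (auto simp: indicator_def)
    then show ?thesis unfolding set_lebesgue_integral_def by (simp only: Bochner_Integration.integral_zero)
  qed
  have wa: "w a = 0" by (simp add: w_def)
  have wb: "w b = 0" using inc[of a b] 0 wa ab by simp
  have w0: "w t = 0" if "t \<notin> {\<alpha>..\<beta>}" for t
  proof -
    have "t < \<alpha> \<or> \<beta> < t" using that by auto
    then consider "t \<le> a" | "a \<le> t" "t < \<alpha>" | "\<beta> < t" "t \<le> b" | "b \<le> t" by linarith
    then show ?thesis
    proof cases
      case 1
      then show ?thesis using inc[of t a] z[of a t] wa al by simp
    next
      case 2
      then show ?thesis using inc[of a t] z[of t a] wa by simp
    next
      case 3
      then show ?thesis using inc[of t b] z[of b t] wb by simp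
    next
      case 4
      then show ?thesis using inc[of b t] z[of t b] wb al by simp
    qed
  qed
  have supp: "{t. w t \<noteq> 0} \<subseteq> {\<alpha>..\<beta>}" using w0 by blast
  have "smooth w" unfolding smooth_def
  proof
    fix k
    have "Ck (Suc k) w" by (rule Ck_real_SucI[OF wd]) (use sf in \<open>simp add: smooth_def\<close>)
    then show "Ck k w" by (rule Ck_Suc_imp)
  qed
  then have "w \<in> test_functions {a<..<b}"
    by (rule test_functionsI[OF _ compact_Icc _ supp]) (use al in auto)
  moreover have "grad w t = f t" for t
    by (rule grad_eqI) (use wd[of t] in \<open>simp add: has_field_derivative_def\<close>)
  moreover have "w t = (LINT s:{a<..<t}|lborel. f s)" if "t > a" for t using inc[of a t] wa that by simp
  ultimately show thesis by (rule that)
qed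

lemma primitive_is_weak_grad:
  fixes V g :: "real \<Rightarrow> real"
  assumes ab: "a < b" and m[measurable]: "V \<in> borel_measurable borel" "g \<in> borel_measurable borel" and g: "g \<in> L2 {a<..<b}"
    and V: "AE t in lborel. t \<in> {a<..<b} \<longrightarrow> V t = (LINT s:{a<..<t}|lborel. g s)"
  shows "is_weak_grad {a<..<b} V g"
  unfolding is_weak_grad_iff
proof (intro ballI)
  fix \<phi> :: "real \<Rightarrow> real" and e :: real assume p: "\<phi> \<in> test_functions {a<..<b}" and e: "e \<in> Basis"
  let ?I = "{a<..<b}"
  have I: "?I \<in> sets borel" by simp
  have gi: "set_integrable lborel ?I g" by (rule L2_imp_set_integrable[OF _ _ m(2) g]) auto
  have ps: "smooth \<phi>" by (rule test_functions_smooth[OF p])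
  have [measurable]: "\<phi> \<in> borel_measurable borel" "grad \<phi> \<in> borel_measurable borel"
    using smooth_continuous[OF ps] smooth_grad_continuous[OF ps] by (auto intro: borel_measurable_continuous_onI)
  obtain K where K: "K \<subseteq> ?I" "{x. \<phi> x \<noteq> 0} \<subseteq> K" using p by (rule test_functionsE)
  have z: "\<phi> a = 0" "\<phi> b = 0" using K by auto
  have Km: "(\<lambda>t. indicator ?I t * (LINT s:{a<..<t}|lborel. g s)) \<in> borel_measurable borel" by (rule primitive_measurable[OF gi])
  have "(LINT t|lebesgue_on ?I. V t * grad \<phi> t) = (LINT t:?I|lborel. V t * grad \<phi> t)"
    by (rule lebesgue_on_integral(1)[OF I]) measurable
  also have "\<dots> = (LBINT t. (indicator ?I t * (LINT s:{a<..<t}|lborel. g s)) * grad \<phi> t)"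
    unfolding set_lebesgue_integral_def
  proof (rule integral_cong_AE)
    show "(\<lambda>t. (indicator ?I t * (LBINT s. indicator {a<..<t} s *\<^sub>R g s)) * grad \<phi> t) \<in> borel_measurable lborel"
      using Km unfolding set_lebesgue_integral_def by measurable
    show "AE t in lborel. indicator ?I t *\<^sub>R (V t * grad \<phi> t) = (indicator ?I t * (LBINT s. indicator {a<..<t} s *\<^sub>R g s)) * grad \<phi> t"
      using V unfolding set_lebesgue_integral_def by eventually_elim (auto simp: indicator_def)
  qed measurable
  also have "\<dots> = (LINT t:?I|lborel. (0 + (LINT s:{a<..<t}|lborel. g s)) * grad \<phi> t)"
    unfolding set_lebesgue_integral_def by (simp add: mult.assoc)
  also have "\<dots> = - (LINT t:?I|lborel. g t * \<phi> t)"
    by (rule primitive_weak_derivative[OF gi _ smooth_has_real_derivative[OF ps] smooth_grad_continuous[OF ps] z]) (use ab in simp)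
  also have "(LINT t:?I|lborel. g t * \<phi> t) = (LINT t|lebesgue_on ?I. g t * \<phi> t)"
    by (rule lebesgue_on_integral(1)[OF I, symmetric]) measurable
  finally show "(LINT x|lebesgue_on ?I. V x * (grad \<phi> x \<bullet> e)) = - (LINT x|lebesgue_on ?I. (g x \<bullet> e) * \<phi> x)"
    using e by simp
qed

text \<open>Test functions close to \<open>g\<close> are corrected to have integral zero, which is
  possible with vanishing error because \<open>g\<close> has integral zero. Their primitives are
  then test functions, and they approximate \<open>V\<close> together with the derivative.\<close>

lemma primitive_in_H1_0:
  fixes V g :: "real \<Rightarrow> real"
  assumes ab: "a < b" and m[measurable]: "V \<in> borel_measurable borel" "g \<in> borel_measurable borel"
    and VL: "V \<in> L2 {a<..<b}" and g: "g \<in> L2 {a<..<b}"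
    and V: "AE t in lborel. t \<in> {a<..<b} \<longrightarrow> V t = (LINT s:{a<..<t}|lborel. g s)"
    and 0: "(LINT s:{a<..<b}|lborel. g s) = 0"
  shows "V \<in> H1_0 {a<..<b}"
proof -
  let ?I = "{a<..<b}"
  let ?L = "lebesgue_on ?I"
  have I: "bounded ?I" "open ?I" and Ib[measurable]: "?I \<in> sets borel" by auto
  interpret finite_measure ?L by (rule finite_lebesgue_on[OF I])
  have gL: "sq_integrable ?L g" using g by (simp add: L2_iff)
  have oneL: "sq_integrable ?L (\<lambda>_. 1::real)" by (rule sq_integrable_bounded[OF finite_measure_axioms, of _ 1]) auto
  have tm: "f \<in> borel_measurable borel" if "f \<in> test_functions ?I" for f
    using smooth_continuous[OF test_functions_smooth[OF that]] by (rule borel_measurable_continuous_onI)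
  have tL: "sq_integrable ?L f" if "f \<in> test_functions ?I" for f by (rule test_function_L2[OF I that])
  have int_lim: "(\<lambda>k. LINT t|?L. F k t) \<longlonglongrightarrow> (LINT t|?L. h t)" if "\<And>k. sq_integrable ?L (F k)" "sq_integrable ?L h"
    "(\<lambda>k. l2norm ?L (\<lambda>t. F k t - h t)) \<longlonglongrightarrow> 0" for F :: "nat \<Rightarrow> real \<Rightarrow> real" and h
    using tendsto_integral_l2[OF that(1,2) oneL that(3)] by simp
  obtain \<phi> where p: "\<And>k::nat. \<phi> k \<in> test_functions ?I" "(\<lambda>k. l2norm ?L (\<lambda>t. \<phi> k t - g t)) \<longlonglongrightarrow> 0"
    using L2_test_sequence[OF I g] by metis
  \<comment> \<open>Test functions close to the constant \<open>1\<close> eventually have positive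
    integral; one of them, divided by its integral, is the corrector \<open>\<eta>\<close>.\<close>
  obtain \<eta>' where e': "\<And>k::nat. \<eta>' k \<in> test_functions ?I" "(\<lambda>k. l2norm ?L (\<lambda>t. \<eta>' k t - 1)) \<longlonglongrightarrow> 0"
    using L2_test_sequence[OF I, of "\<lambda>_. 1"] oneL unfolding L2_iff by metis
  have "(\<lambda>k. LINT t|?L. \<eta>' k t) \<longlonglongrightarrow> (LINT t|?L. 1)" by (rule int_lim[OF tL[OF e'(1)] oneL e'(2)])
  moreover have "(LINT t|?L. (1::real)) > 0" using ab by (simp add: measure_restrict_space)
  ultimately have "\<forall>\<^sub>F k in sequentially. 0 < (LINT t|?L. \<eta>' k t)" by (rule order_tendstoD(1))
  then obtain k0 where k0: "0 < (LINT t|?L. \<eta>' k0 t)" using eventually_sequentially by auto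
  define c where "c = (LINT t|?L. \<eta>' k0 t)"
  define \<eta> where "\<eta> t = (1 / c) * \<eta>' k0 t" for t
  have et: "\<eta> \<in> test_functions ?I" unfolding \<eta>_def by (rule test_functions_mult[OF e'(1) smooth_const])
  have e1: "(LINT t|?L. \<eta> t) = 1" unfolding \<eta>_def using k0 by (simp add: c_def)
  define s where "s k = (LINT t|?L. \<phi> k t)" for k
  have "(LINT t|?L. g t) = 0" using 0 lebesgue_on_integral(1)[OF Ib m(2)] by simp
  then have s0: "s \<longlonglongrightarrow> 0" using int_lim[OF tL[OF p(1)] gL p(2)] unfolding s_def by simp
  \<comment> \<open>Removes the integral \<open>s k\<close> of \<open>\<phi> k\<close>, since
    \<open>\<eta>\<close> has integral \<open>1\<close>; the correction vanishes in the limit with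
    \<open>s k\<close>.\<close>
  define f where "f k t = \<phi> k t - s k * \<eta> t" for k t
  have ft: "f k \<in> test_functions ?I" for k
  proof -
    obtain K1 where K1: "compact K1" "K1 \<subseteq> ?I" "{x. \<phi> k x \<noteq> 0} \<subseteq> K1" using p(1)[of k] by (rule test_functionsE)
    obtain K2 where K2: "compact K2" "K2 \<subseteq> ?I" "{x. \<eta> x \<noteq> 0} \<subseteq> K2" using et by (rule test_functionsE)
    show ?thesis
    proof (rule test_functionsI[of _ "K1 \<union> K2"])
      show "smooth (f k)" unfolding f_def using p(1) et by (intro smooth_diff smooth_mult smooth_const test_functions_smooth)
      show "{x. f k x \<noteq> 0} \<subseteq> K1 \<union> K2"
      proof
        fix x assume "x \<in> {x. f k x \<noteq> 0}"
        then have "\<phi> k x \<noteq> 0 \<or> \<eta> x \<noteq> 0" unfolding f_def by auto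
        then show "x \<in> K1 \<union> K2" using K1(3) K2(3) by blast
      qed
    qed (use K1 K2 in auto)
  qed
  have fi: "(LINT t:?I|lborel. f k t) = 0" for k
  proof -
    have "integrable ?L (\<phi> k)" "integrable ?L \<eta>"
      using sq_integrable_mult[OF tL[OF p(1)] oneL] sq_integrable_mult[OF tL[OF et] oneL] by auto
    then have "(LINT t|?L. f k t) = 0" unfolding f_def by (simp add: e1 s_def)
    then show ?thesis using lebesgue_on_integral(1)[OF Ib tm[OF ft]] by simp
  qed
  have fg: "(\<lambda>k. l2norm ?L (\<lambda>t. f k t - g t)) \<longlonglongrightarrow> 0"
  proof (rule tendsto_sandwich[OF _ _ tendsto_const])
    show "(\<lambda>k. l2norm ?L (\<lambda>t. \<phi> k t - g t) + \<bar>s k\<bar> * l2norm ?L \<eta>) \<longlonglongrightarrow> 0"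
      using tendsto_add[OF p(2) tendsto_mult[OF tendsto_rabs_zero[OF s0] tendsto_const[of "l2norm ?L \<eta>"]]] by simp
    have "l2norm ?L (\<lambda>t. f k t - g t) \<le> l2norm ?L (\<lambda>t. \<phi> k t - g t) + \<bar>s k\<bar> * l2norm ?L \<eta>" for k
    proof -
      have "l2norm ?L (\<lambda>t. (\<phi> k t - g t) + (- s k) * \<eta> t) \<le> l2norm ?L (\<lambda>t. \<phi> k t - g t) + l2norm ?L (\<lambda>t. (- s k) * \<eta> t)"
        by (intro l2norm_triangle sq_integrable_diff sq_integrable_cmult tL p et gL)
      moreover have "l2norm ?L (\<lambda>t. (- s k) * \<eta> t) = \<bar>s k\<bar> * l2norm ?L \<eta>"
        unfolding l2norm_def by (simp add: abs_mult power_mult_distrib real_sqrt_mult)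
      ultimately show ?thesis unfolding f_def by (simp add: algebra_simps)
    qed
    then show "\<forall>\<^sub>F k in sequentially. l2norm ?L (\<lambda>t. f k t - g t) \<le> l2norm ?L (\<lambda>t. \<phi> k t - g t) + \<bar>s k\<bar> * l2norm ?L \<eta>" by simp
  qed (simp add: l2norm_nonneg)
  have "\<exists>w. w \<in> test_functions ?I \<and> (\<forall>t. grad w t = f k t) \<and> (\<forall>t>a. w t = (LINT s:{a<..<t}|lborel. f k s))" for k
    using test_function_primitive[OF ab ft fi] by metis
  then obtain w where w: "\<And>k. w k \<in> test_functions ?I" "\<And>k t. grad (w k) t = f k t"
    "\<And>k t. t > a \<Longrightarrow> w k t = (LINT s:{a<..<t}|lborel. f k s)" by metis
  \<comment> \<open>The difference is the primitive of \<open>f k - g\<close>. Cauchy-Schwarz on a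
    subinterval bounds its square pointwise with one factor \<open>b - a\<close>, and integrating
    over the interval adds the second.\<close>
  have wV: "l2norm ?L (\<lambda>t. w k t - V t) \<le> (b - a) * l2norm ?L (\<lambda>t. f k t - g t)" for k
  proof -
    let ?N = "l2norm ?L (\<lambda>t. f k t - g t)"
    have fm[measurable]: "f k \<in> borel_measurable borel" by (rule tm[OF ft])
    have dL: "(\<lambda>t. f k t - g t) \<in> L2 ?I" using tL[OF ft] gL sq_integrable_diff unfolding L2_iff by blast
    have pt: "AE t in ?L. (norm (w k t - V t))\<^sup>2 \<le> (b - a) * ?N\<^sup>2"
      unfolding AE_lebesgue_on_iff[OF Ib] using V
    proof (eventually_elim, intro impI)
      fix t assume 1: "t \<in> ?I \<longrightarrow> V t = (LINT s:{a<..<t}|lborel. g s)" and t: "t \<in> ?I"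
      let ?J = "{a<..<t}"
      have J: "?J \<subseteq> ?I" "?J \<in> sets borel" using t by auto
      have fJ: "set_integrable lborel ?J (f k)" "set_integrable lborel ?J g"
        using L2_imp_set_integrable[OF J(2) _ fm] L2_imp_set_integrable[OF J(2) _ m(2)]
          L2_borel_subset(1)[OF J Ib fm] L2_borel_subset(1)[OF J Ib m(2)] tL[OF ft] gL by (auto simp: L2_iff)
      have dJ: "(\<lambda>t. f k t - g t) \<in> L2 ?J" "l2norm (lebesgue_on ?J) (\<lambda>t. f k t - g t) \<le> ?N"
        using L2_borel_subset[OF J Ib _ dL] by auto
      have "w k t - V t = (LINT s:?J|lborel. f k s - g s)"
        using w(3)[of t k] 1 t fJ by (simp add: set_integral_diff)
      also have "\<dots> = (LINT s|lebesgue_on ?J. f k s - g s)" by (rule lebesgue_on_integral(1)[OF J(2), symmetric]) measurable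
      finally have "(w k t - V t)\<^sup>2 \<le> measure (lebesgue_on ?J) (space (lebesgue_on ?J)) * (\<integral>s. (f k s - g s)\<^sup>2 \<partial>lebesgue_on ?J)"
        using integral_power2_le[of "lebesgue_on ?J" "\<lambda>s. f k s - g s"] finite_lebesgue_on[of ?J] dJ by (simp add: L2_iff)
      also have "\<dots> = (t - a) * (l2norm (lebesgue_on ?J) (\<lambda>t. f k t - g t))\<^sup>2"
        using t by (simp add: l2norm_power2 measure_restrict_space)
      also have "\<dots> \<le> (b - a) * ?N\<^sup>2"
        using t dJ(2) l2norm_nonneg by (intro mult_mono power_mono) auto
      finally show "(norm (w k t - V t))\<^sup>2 \<le> (b - a) * ?N\<^sup>2" by simp
    qed
    have wVL: "sq_integrable ?L (\<lambda>t. w k t - V t)" using tL[OF w(1)] VL sq_integrable_diff unfolding L2_iff by blast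
    have "(l2norm ?L (\<lambda>t. w k t - V t))\<^sup>2 \<le> (\<integral>t. (b - a) * ?N\<^sup>2 \<partial>?L)"
      unfolding l2norm_power2[of ?L "\<lambda>t. w k t - V t"]
      by (rule integral_mono_AE) (use pt wVL in \<open>auto simp: sq_integrable_def\<close>)
    also have "\<dots> = ((b - a) * ?N)\<^sup>2" using ab by (simp add: measure_restrict_space power2_eq_square)
    finally show ?thesis by (rule power2_le_imp_le) (use ab in \<open>simp add: l2norm_nonneg\<close>)
  qed
  have wV0: "(\<lambda>k. l2norm ?L (\<lambda>t. w k t - V t)) \<longlonglongrightarrow> 0"
  proof (rule tendsto_sandwich[OF _ _ tendsto_const])
    show "(\<lambda>k. (b - a) * l2norm ?L (\<lambda>t. f k t - g t)) \<longlonglongrightarrow> 0" using tendsto_mult_right_zero[OF fg] by simp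
  qed (use wV in \<open>auto simp: l2norm_nonneg\<close>)
  have gw0: "(\<lambda>k. l2norm ?L (\<lambda>t. grad (w k) t - g t)) \<longlonglongrightarrow> 0" unfolding w(2) by (rule fg)
  show ?thesis unfolding H1_0_def
    by (rule H1_closureI[OF I VL g primitive_is_weak_grad[OF ab m g V] w(1) test_functions_smooth[OF w(1)] wV0 gw0])
qed

subsection \<open>The limit problem\<close>

text \<open>Pairing with \<open>f\<close> is linear and, by Cauchy-Schwarz, bounded by a multiple of
  the \<open>H1\<close> norm, so it is among the functionals in the definition of weak
  convergence.\<close>

lemma H1_weakly_converges_integral:
  assumes U: "H1_weakly_converges S U V" and f: "f \<in> L2 S"
  shows "(\<lambda>j. LINT x|lebesgue_on S. U j x * f x) \<longlonglongrightarrow> (LINT x|lebesgue_on S. V x * f x)"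
proof -
  have fL: "sq_integrable (lebesgue_on S) f" using f by (simp add: L2_iff)
  have vL: "sq_integrable (lebesgue_on S) v" if "v \<in> H1 S" for v using H1_L2[OF that] by (simp add: L2_iff)
  have lin: "(LINT x|lebesgue_on S. (a * v x + b * w x) * f x) = a * (LINT x|lebesgue_on S. v x * f x) + b * (LINT x|lebesgue_on S. w x * f x)"
    if "v \<in> H1 S" "w \<in> H1 S" for v w a b
  proof -
    have "(LINT x|lebesgue_on S. (a * v x + b * w x) * f x) = (LINT x|lebesgue_on S. a * (v x * f x) + b * (w x * f x))"
      by (simp add: algebra_simps)
    then show ?thesis using sq_integrable_mult[OF vL fL, of v] sq_integrable_mult[OF vL fL, of w] that by simp
  qed
  have bdd: "\<bar>LINT x|lebesgue_on S. v x * f x\<bar> \<le> l2norm (lebesgue_on S) f * H1_norm S v" if "v \<in> H1 S" for v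
  proof -
    have "l2norm (lebesgue_on S) v \<le> H1_norm S v" unfolding H1_norm_def L2_norm_eq by (intro real_le_rsqrt) simp
    then have "l2norm (lebesgue_on S) v * l2norm (lebesgue_on S) f \<le> H1_norm S v * l2norm (lebesgue_on S) f"
      by (intro mult_right_mono l2norm_nonneg)
    then show ?thesis using l2_Cauchy_Schwarz_real[OF vL[OF that] fL] by (simp add: mult.commute)
  qed
  show ?thesis
    using U[unfolded H1_weakly_converges_def, THEN conjunct2, THEN conjunct2, rule_format,
        of "\<lambda>v. LINT x|lebesgue_on S. v x * f x"] lin bdd by blast
qed

text \<open>Three components bounded by \<open>C\<close> give the square root of three times
  \<open>C\<close>; \<open>2 * C\<close> is a convenient upper bound.\<close>

lemma l2norm_grad_le:
  fixes w :: "real^3 \<Rightarrow> real"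
  assumes g: "grad w \<in> L2 S" and C: "\<And>i. l2norm (lebesgue_on S) (\<lambda>y. grad w y $ i) \<le> C"
  shows "l2norm (lebesgue_on S) (grad w) \<le> 2 * C"
proof -
  have C0: "C \<ge> 0" using C[of 1] l2norm_nonneg order_trans by blast
  have i: "integrable (lebesgue_on S) (\<lambda>y. (norm (grad w y $ i))\<^sup>2)" for i
    using L2_nth[OF g, of i] by (simp add: L2_def)
  have "(norm (grad w y))\<^sup>2 = (norm (grad w y $ 1))\<^sup>2 + (norm (grad w y $ 2))\<^sup>2 + (norm (grad w y $ 3))\<^sup>2" for y
    unfolding power2_norm_eq_inner by (simp add: inner_vec_def sum_3 power2_eq_square)
  then have "(l2norm (lebesgue_on S) (grad w))\<^sup>2 = (l2norm (lebesgue_on S) (\<lambda>y. grad w y $ 1))\<^sup>2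
      + (l2norm (lebesgue_on S) (\<lambda>y. grad w y $ 2))\<^sup>2 + (l2norm (lebesgue_on S) (\<lambda>y. grad w y $ 3))\<^sup>2"
    unfolding l2norm_power2 using i[of 1] i[of 2] i[of 3] by simp
  also have "\<dots> \<le> C\<^sup>2 + C\<^sup>2 + C\<^sup>2"
    by (intro add_mono power_mono C l2norm_nonneg)
  also have "\<dots> \<le> (2 * C)\<^sup>2" using zero_le_power2[of C] by (simp add: power_mult_distrib)
  finally show ?thesis by (rule power2_le_imp_le) (use C0 in simp)
qed

section \<open>The weighted Dirichlet problem and the passage to the limit\<close>

context rod_limit
begin

text \<open>Test functions are dense in \<open>H1_0\<close> by definition and the area is bounded,
  so both sides of the equation extend continuously to all of \<open>H1_0\<close>. The boundary
  values of \<open>V\<close> are supplied by \<open>primitive_in_H1_0\<close>.\<close>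

lemma area_test_equation_imp_eigenpair:
  fixes V g :: "real \<Rightarrow> real"
  assumes m[measurable]: "V \<in> borel_measurable borel" "g \<in> borel_measurable borel"
    and VL: "V \<in> L2 I" and gL: "g \<in> L2 I"
    and V: "AE t in lborel. t \<in> I \<longrightarrow> V t = (LINT s:{l\<^sub>0<..<t}|lborel. g s)" and 0: "(LINT s:I|lborel. g s) = 0"
    and nz: "\<not> (AE t in lebesgue_on I. V t = 0)"
    and eq: "\<And>\<phi>. \<phi> \<in> test_functions I \<Longrightarrow>
      (LINT t:I|lborel. area D t * (g t * grad \<phi> t)) = \<mu> * (LINT t:I|lborel. area D t * (V t * \<phi> t))"
  shows "limit_eigenpair l\<^sub>0 l\<^sub>1 (area D) \<mu> V"
proof -
  let ?L = "lebesgue_on I"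
  have Io: "bounded I" "open I" and Ib[measurable]: "I \<in> sets borel" by auto
  \<comment> \<open>Cut off outside \<open>I\<close>, the area becomes a Borel function on the whole
    line that is bounded by \<open>c\<^sub>1\<close>.\<close>
  define A where "A t = (if t \<in> I then area D t else 0)" for t
  have Am[measurable]: "A \<in> borel_measurable borel" unfolding A_def[abs_def] by (rule area_measurable)
  have Ab: "\<bar>A t\<bar> \<le> c\<^sub>1" for t unfolding A_def using area[of t] c0 area[of l\<^sub>0] ll by auto
  have AL: "(\<lambda>t. A t * h t) \<in> L2 I" if hm[measurable]: "h \<in> borel_measurable borel" and h: "h \<in> L2 I" for h
  proof -
    have "(\<integral>\<^sup>+t\<in>I. ennreal ((A t * h t)\<^sup>2) \<partial>lborel) \<le> (\<integral>\<^sup>+t. ennreal (c\<^sub>1\<^sup>2) * (ennreal ((h t)\<^sup>2) * indicator I t) \<partial>lborel)"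
    proof (rule nn_integral_mono)
      fix t
      have "(A t * h t)\<^sup>2 \<le> c\<^sub>1\<^sup>2 * (h t)\<^sup>2"
        using power_mono[OF Ab[of t] abs_ge_zero, of 2] by (simp add: power_mult_distrib mult_right_mono)
      then have "ennreal ((A t * h t)\<^sup>2) \<le> ennreal (c\<^sub>1\<^sup>2) * ennreal ((h t)\<^sup>2)"
        by (simp add: ennreal_mult[symmetric] ennreal_leI)
      then show "ennreal ((A t * h t)\<^sup>2) * indicator I t \<le> ennreal (c\<^sub>1\<^sup>2) * (ennreal ((h t)\<^sup>2) * indicator I t)"
        by (simp add: mult_right_mono flip: mult.assoc)
    qed
    also have "\<dots> = ennreal (c\<^sub>1\<^sup>2) * (\<integral>\<^sup>+t\<in>I. ennreal ((h t)\<^sup>2) \<partial>lborel)" by (simp add: nn_integral_cmult)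
    also have "\<dots> < \<infinity>" using h L2_borel_iff(2)[OF Ib hm] by (simp add: ennreal_mult_less_top)
    finally show ?thesis using L2_borel_iff(2)[OF Ib, of "\<lambda>t. A t * h t"] by simp
  qed
  have VH: "V \<in> H1_0 I" by (rule primitive_in_H1_0[OF ll m VL gL V 0])
  have wgV: "AE t in ?L. weak_grad I V t = g t"
    by (rule weak_grad_AE_eq[OF Io gL primitive_is_weak_grad[OF ll m gL V]])
  have VH1: "V \<in> H1 I" using VH by (simp add: H1_0_def H1_closure_def)
  have gA: "sq_integrable ?L (\<lambda>t. A t * g t)" and VA: "sq_integrable ?L (\<lambda>t. A t * V t)"
    using AL[OF m(2) gL] AL[OF m(1) VL] by (auto simp: L2_iff)
  have main: "(LINT t|?L. area D t * weak_grad I V t * weak_grad I \<phi> t) = \<mu> * (LINT t|?L. area D t * V t * \<phi> t)"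
    if ph: "\<phi> \<in> H1_0 I" for \<phi>
  proof -
    have pH: "\<phi> \<in> H1_closure I (test_functions I)" using ph by (simp add: H1_0_def)
    have pH1: "\<phi> \<in> H1 I" using pH by (simp add: H1_closure_def)
    have pL: "sq_integrable ?L \<phi>" and wL: "sq_integrable ?L (weak_grad I \<phi>)"
      using H1_L2[OF pH1] weak_grad_H1(1)[OF pH1] by (auto simp: L2_iff)
    have "\<exists>w. w \<in> test_functions I \<and> l2norm ?L (\<lambda>x. w x - \<phi> x) < 1 / real (Suc k) \<and> l2norm ?L (\<lambda>x. grad w x - weak_grad I \<phi> x) < 1 / real (Suc k)" for k
    proof -
      obtain w where "w \<in> test_functions I" "l2norm ?L (\<lambda>x. w x - \<phi> x) < 1 / real (Suc k)"
        "l2norm ?L (\<lambda>x. grad w x - weak_grad I \<phi> x) < 1 / real (Suc k)"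
        by (rule H1_closure_approx[OF Io pH, where e="1 / real (Suc k)"]) (simp_all add: test_functions_smooth)
      then show ?thesis by (intro exI conjI)
    qed
    then obtain w where w: "\<And>k. w k \<in> test_functions I" "\<And>k. l2norm ?L (\<lambda>x. w k x - \<phi> x) < 1 / real (Suc k)"
      "\<And>k. l2norm ?L (\<lambda>x. grad (w k) x - weak_grad I \<phi> x) < 1 / real (Suc k)" by metis
    have s0: "(\<lambda>k. 1 / real (Suc k)) \<longlonglongrightarrow> 0" using LIMSEQ_inverse_real_of_nat by (simp add: inverse_eq_divide)
    have l1: "(\<lambda>k. l2norm ?L (\<lambda>x. w k x - \<phi> x)) \<longlonglongrightarrow> 0"
      by (rule tendsto_sandwich[OF _ _ tendsto_const s0]) (use w(2) in \<open>auto simp: l2norm_nonneg less_imp_le\<close>)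
    have l2: "(\<lambda>k. l2norm ?L (\<lambda>x. grad (w k) x - weak_grad I \<phi> x)) \<longlonglongrightarrow> 0"
      by (rule tendsto_sandwich[OF _ _ tendsto_const s0]) (use w(3) in \<open>auto simp: l2norm_nonneg less_imp_le\<close>)
    have wsq: "sq_integrable ?L (w k)" "sq_integrable ?L (grad (w k))" for k
      using test_function_L2[OF Io w(1)] smooth_grad_L2[OF Io test_functions_smooth[OF w(1)]] by (auto simp: L2_iff)
    have lim1: "(\<lambda>k. LINT t|?L. grad (w k) t * (A t * g t)) \<longlonglongrightarrow> (LINT t|?L. weak_grad I \<phi> t * (A t * g t))"
      by (rule tendsto_integral_l2[OF wsq(2) wL gA l2])
    have lim2: "(\<lambda>k. LINT t|?L. w k t * (A t * V t)) \<longlonglongrightarrow> (LINT t|?L. \<phi> t * (A t * V t))"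
      by (rule tendsto_integral_l2[OF wsq(1) pL VA l1])
    have e: "(LINT t|?L. grad (w k) t * (A t * g t)) = \<mu> * (LINT t|?L. w k t * (A t * V t))" for k
    proof -
      have ws: "smooth (w k)" by (rule test_functions_smooth[OF w(1)])
      have [measurable]: "w k \<in> borel_measurable borel" "grad (w k) \<in> borel_measurable borel"
        using smooth_continuous[OF ws] smooth_grad_continuous[OF ws] by (auto intro: borel_measurable_continuous_onI)
      have "(LINT t|?L. grad (w k) t * (A t * g t)) = (LINT t:I|lborel. area D t * (g t * grad (w k) t))"
        unfolding lebesgue_on_integral(1)[OF Ib, of "\<lambda>t. grad (w k) t * (A t * g t)", simplified] set_lebesgue_integral_def
        by (intro Bochner_Integration.integral_cong) (auto simp: A_def indicator_def)
      moreover have "(LINT t|?L. w k t * (A t * V t)) = (LINT t:I|lborel. area D t * (V t * w k t))"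
        unfolding lebesgue_on_integral(1)[OF Ib, of "\<lambda>t. w k t * (A t * V t)", simplified] set_lebesgue_integral_def
        by (intro Bochner_Integration.integral_cong) (auto simp: A_def indicator_def)
      ultimately show ?thesis using eq[OF w(1)] by simp
    qed
    have lims: "(LINT t|?L. weak_grad I \<phi> t * (A t * g t)) = \<mu> * (LINT t|?L. \<phi> t * (A t * V t))"
      using LIMSEQ_unique[OF lim1] tendsto_mult_left[OF lim2, of \<mu>] unfolding e by blast
    have "(LINT t|?L. area D t * weak_grad I V t * weak_grad I \<phi> t) = (LINT t|?L. A t * weak_grad I V t * weak_grad I \<phi> t)"
      by (intro Bochner_Integration.integral_cong) (auto simp: A_def)
    also have "\<dots> = (LINT t|?L. weak_grad I \<phi> t * (A t * g t))"
    proof (rule integral_cong_AE)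
      show "AE t in ?L. A t * weak_grad I V t * weak_grad I \<phi> t = weak_grad I \<phi> t * (A t * g t)"
        using wgV by eventually_elim simp
      have mm: "A \<in> borel_measurable ?L" "g \<in> borel_measurable ?L" "weak_grad I V \<in> borel_measurable ?L" "weak_grad I \<phi> \<in> borel_measurable ?L"
        using borel_measurable_lebesgue_on[OF Am] borel_measurable_lebesgue_on[OF m(2)] weak_grad_H1(1)[OF VH1] weak_grad_H1(1)[OF pH1]
        by (auto simp: L2_def)
      show "(\<lambda>t. A t * weak_grad I V t * weak_grad I \<phi> t) \<in> borel_measurable ?L"
        by (intro borel_measurable_times mm)
      show "(\<lambda>t. weak_grad I \<phi> t * (A t * g t)) \<in> borel_measurable ?L"
        by (intro borel_measurable_times mm)
    qed
    also have "\<dots> = \<mu> * (LINT t|?L. \<phi> t * (A t * V t))" by (rule lims)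
    also have "(LINT t|?L. \<phi> t * (A t * V t)) = (LINT t|?L. area D t * V t * \<phi> t)"
      by (intro Bochner_Integration.integral_cong) (auto simp: A_def)
    finally show ?thesis .
  qed
  show ?thesis unfolding limit_eigenpair_def Let_def using VH nz main by blast
qed

theorem convergence:
  fixes u :: "nat \<Rightarrow> real^3 \<Rightarrow> real" and \<mu> \<epsilon> :: "nat \<Rightarrow> real"
  assumes e: "\<And>j. 0 < \<epsilon> j \<and> \<epsilon> j < 1" and e0: "\<epsilon> \<longlonglongrightarrow> 0" and mu: "\<And>j. 0 < \<mu> j" and mu0: "\<mu> \<longlonglongrightarrow> \<mu>\<^sub>0"
    and eig: "\<And>j. mixed_eigenpair (thin_rod G (\<epsilon> j)) (end_faces l\<^sub>0 l\<^sub>1 D (\<epsilon> j)) (\<mu> j) (u j)"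
    and nrm: "\<And>j. (LINT x|lebesgue_on (thin_rod G (\<epsilon> j)). \<bar>u j x\<bar>\<^sup>2) = (\<epsilon> j)\<^sup>2"
    and wk: "H1_weakly_converges G (\<lambda>j y. u j (scale_transverse (\<epsilon> j) y)) U0"
  shows "\<not> (AE y in lebesgue_on G. U0 y = 0) \<and>
         (\<exists>V. (AE y in lebesgue_on G. U0 y = V (y $ 1)) \<and> limit_eigenpair l\<^sub>0 l\<^sub>1 (area D) \<mu>\<^sub>0 V)"
proof -
  note GG = rod_domainD(1,2)[OF rod]
  let ?L = "lebesgue_on G"
  define Uj where "Uj j y = u j (scale_transverse (\<epsilon> j) y)" for j y
  \<comment> \<open>The accuracy with which a smooth function approximates the rescaled
    \<open>u j\<close>; it tends to zero, so that both have the same limits.\<close>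
  define d where "d j = 1 / real (Suc j)" for j
  have d: "d j > 0" "d j \<le> 1" for j by (auto simp: d_def)
  have d0: "d \<longlonglongrightarrow> 0" unfolding d_def using LIMSEQ_inverse_real_of_nat by (simp add: inverse_eq_divide)
  have UjH: "Uj j \<in> H1 G" for j
    using wk[unfolded H1_weakly_converges_def, THEN conjunct1] unfolding Uj_def[abs_def] by (rule spec)
  have U0H: "U0 \<in> H1 G"
    by (rule wk[unfolded H1_weakly_converges_def, THEN conjunct2, THEN conjunct1])
  have UjL: "sq_integrable ?L (Uj j)" for j using H1_L2[OF UjH] by (simp add: L2_iff)
  have U0L: "sq_integrable ?L U0" using H1_L2[OF U0H] by (simp add: L2_iff)
  \<comment> \<open>One predicate gathers all properties of an approximant, so that the whole
    sequence \<open>W\<close> can be chosen at once.\<close>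
  define Q where "Q j W \<longleftrightarrow> smooth W \<and> (\<forall>y\<in>plane_face D l\<^sub>0 \<union> plane_face D l\<^sub>1. W y = 0) \<and>
    l2norm ?L (\<lambda>y. W y - Uj j y) \<le> d j \<and> l2norm ?L (Uj j) = 1 \<and>
    l2norm ?L (\<lambda>y. grad W y $ 1) \<le> sqrt (\<mu> j) + d j \<and>
    l2norm ?L (\<lambda>y. grad W y $ 2) \<le> \<epsilon> j * (sqrt (\<mu> j) + d j) \<and>
    l2norm ?L (\<lambda>y. grad W y $ 3) \<le> \<epsilon> j * (sqrt (\<mu> j) + d j) \<and>
    (\<forall>\<phi>\<in>test_functions I. \<bar>(LINT y|?L. grad W y $ 1 * grad \<phi> (y $ 1)) - \<mu> j * (LINT y|?L. Uj j y * \<phi> (y $ 1))\<bar>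
         \<le> d j * l2norm ?L (\<lambda>y. grad \<phi> (y $ 1)))" for j W
  have "\<exists>W. Q j W" for j
  proof (rule scaled_eigenfunction_approx[OF GG(2,1) conjunct1[OF e] conjunct2[OF e] less_imp_le[OF mu] eig nrm d(1), of j j], goal_cases)
    case (1 W)
    show ?case
      unfolding Q_def Uj_def by (intro exI[of _ W] conjI ballI) (fact 1)+
  qed
  then obtain W where Q: "\<And>j. Q j (W j)" by metis
  have W: "smooth (W j)" "y \<in> plane_face D l\<^sub>0 \<union> plane_face D l\<^sub>1 \<Longrightarrow> W j y = 0"
    "l2norm ?L (\<lambda>y. W j y - Uj j y) \<le> d j" "l2norm ?L (Uj j) = 1"
    "l2norm ?L (\<lambda>y. grad (W j) y $ 1) \<le> sqrt (\<mu> j) + d j"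
    "l2norm ?L (\<lambda>y. grad (W j) y $ 2) \<le> \<epsilon> j * (sqrt (\<mu> j) + d j)"
    "l2norm ?L (\<lambda>y. grad (W j) y $ 3) \<le> \<epsilon> j * (sqrt (\<mu> j) + d j)"
    "\<phi> \<in> test_functions I \<Longrightarrow> \<bar>(LINT y|?L. grad (W j) y $ 1 * grad \<phi> (y $ 1)) - \<mu> j * (LINT y|?L. Uj j y * \<phi> (y $ 1))\<bar>
         \<le> d j * l2norm ?L (\<lambda>y. grad \<phi> (y $ 1))" for j y \<phi>
    using Q[of j] unfolding Q_def by blast+
  have WL: "sq_integrable ?L (W j)" and gWL: "grad (W j) \<in> L2 G" for j
    using smooth_L2[OF GG W(1)] smooth_grad_L2[OF GG W(1)] by (auto simp: L2_iff)
  obtain B where B: "\<And>j. \<bar>\<mu> j\<bar> \<le> B" using convergent_imp_Bseq[OF convergentI[OF mu0]] unfolding Bseq_def by auto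
  \<comment> \<open>Exceeds every \<open>sqrt (\<mu> j) + d j\<close>, because \<open>B\<close>
    bounds the convergent eigenvalues and \<open>d j\<close> is at most \<open>1\<close>.\<close>
  define C where "C = sqrt B + 2"
  have C: "sqrt (\<mu> j) + d j \<le> C" for j
    using real_sqrt_le_mono[of "\<mu> j" B] B[of j] d(2)[of j] unfolding C_def by linarith
  have C0: "C \<ge> 0" using C[of 0] d(1)[of 0] mu[of 0] by (smt (verit) real_sqrt_ge_zero)
  have sd0: "sqrt (\<mu> j) + d j \<ge> 0" for j using d(1)[of j] mu[of j] by (simp add: less_imp_le)
  have ed: "(\<lambda>j. \<epsilon> j * C) \<longlonglongrightarrow> 0" using tendsto_mult_left_zero[OF e0] by simp
  have gb: "l2norm ?L (\<lambda>y. grad (W j) y $ 2) \<le> \<epsilon> j * C" "l2norm ?L (\<lambda>y. grad (W j) y $ 3) \<le> \<epsilon> j * C" for j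
  proof -
    have "\<epsilon> j * (sqrt (\<mu> j) + d j) \<le> \<epsilon> j * C" using C[of j] e[of j] by (intro mult_left_mono) auto
    then show "l2norm ?L (\<lambda>y. grad (W j) y $ 2) \<le> \<epsilon> j * C" "l2norm ?L (\<lambda>y. grad (W j) y $ 3) \<le> \<epsilon> j * C"
      using W(6,7)[of j] by auto
  qed
  have g2: "(\<lambda>j. l2norm ?L (\<lambda>y. grad (W j) y $ 2)) \<longlonglongrightarrow> 0" and g3: "(\<lambda>j. l2norm ?L (\<lambda>y. grad (W j) y $ 3)) \<longlonglongrightarrow> 0"
    by (rule tendsto_sandwich[OF _ _ tendsto_const ed]; use gb in \<open>simp add: l2norm_nonneg\<close>)+
  have g1: "l2norm ?L (\<lambda>y. grad (W j) y $ 1) \<le> C" for j using W(5)[of j] C[of j] by linarith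
  have eC: "\<epsilon> j * C \<le> C" for j using e[of j] C0 by (simp add: mult_left_le_one_le)
  have gC: "l2norm ?L (\<lambda>y. grad (W j) y $ i) \<le> C" for i j
    using exhaust_3[of i] g1[of j] gb[of j] eC[of j] by auto
  have gW: "l2norm ?L (grad (W j)) \<le> 2 * C" for j by (rule l2norm_grad_le[OF gWL gC])
  have Wn: "l2norm ?L (W j) \<le> 2" for j
    using l2norm_le_add_diff[OF WL UjL, of j j] W(3)[of j] W(4)[of j] d(2)[of j] by linarith
  have WUj: "(\<lambda>j. l2norm ?L (\<lambda>y. W j y - Uj j y)) \<longlonglongrightarrow> 0"
    by (rule tendsto_sandwich[OF _ _ tendsto_const d0]) (use W(3) in \<open>auto simp: l2norm_nonneg\<close>)
  have weakU: "(\<lambda>j. LINT y|?L. Uj j y * f y) \<longlonglongrightarrow> (LINT y|?L. U0 y * f y)" if "f \<in> L2 G" for f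
    using H1_weakly_converges_integral[OF wk that] unfolding Uj_def .
  have weakW: "(\<lambda>j. LINT y|?L. W j y * f y) \<longlonglongrightarrow> (LINT y|?L. U0 y * f y)" if f: "f \<in> L2 G" for f
  proof -
    have fL: "sq_integrable ?L f" using f by (simp add: L2_iff)
    have "(\<lambda>j. LINT y|?L. (W j y - Uj j y) * f y) \<longlonglongrightarrow> 0"
    proof (rule Lim_null_comparison)
      show "(\<lambda>j. l2norm ?L (\<lambda>y. W j y - Uj j y) * l2norm ?L f) \<longlonglongrightarrow> 0" using tendsto_mult_left_zero[OF WUj] by simp
      show "\<forall>\<^sub>F j in sequentially. norm (LINT y|?L. (W j y - Uj j y) * f y) \<le> l2norm ?L (\<lambda>y. W j y - Uj j y) * l2norm ?L f"
        using l2_Cauchy_Schwarz_real[OF sq_integrable_diff[OF WL UjL] fL] by (intro always_eventually) simp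
    qed
    from tendsto_add[OF this weakU[OF f]]
    have "(\<lambda>j. (LINT y|?L. (W j y - Uj j y) * f y) + (LINT y|?L. Uj j y * f y)) \<longlonglongrightarrow> (LINT y|?L. U0 y * f y)" by simp
    moreover have "(LINT y|?L. (W j y - Uj j y) * f y) + (LINT y|?L. Uj j y * f y) = (LINT y|?L. W j y * f y)" for j
      using sq_integrable_mult[OF WL fL, of j] sq_integrable_mult[OF UjL fL, of j] by (simp add: left_diff_distrib)
    ultimately show ?thesis by simp
  qed
  have cone: "cone_property G" by (rule lipschitz_boundary_imp_cone_property[OF GG(2) rod_domainD(3)[OF rod]])
  define C' where "C' = max 2 (2 * C)"
  have strong0: "(\<lambda>j. l2norm ?L (\<lambda>y. W j y - U0 y)) \<longlonglongrightarrow> 0"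
    by (rule weak_imp_strong_convergence[OF GG cone W(1) H1_L2[OF U0H] weakW, of C'])
      (use Wn gW in \<open>auto simp: C'_def le_max_iff_disj\<close>)
  \<comment> \<open>The rescaled eigenfunctions have norm exactly \<open>1\<close>, their
    approximants have norms tending to \<open>1\<close>, and strong convergence preserves the limit
    of the norms.\<close>
  have U0n: "l2norm ?L U0 = 1"
  proof (rule LIMSEQ_unique[OF l2norm_tendsto[OF WL U0L strong0]])
    have "\<bar>l2norm ?L (W j) - 1\<bar> \<le> d j" for j
      using l2norm_le_add_diff[OF WL UjL, of j j] l2norm_le_add_diff[OF UjL WL, of j j] W(3)[of j] W(4)[of j]
        l2norm_minus_commute[of ?L "Uj j" "W j"] by linarith
    then have "(\<lambda>j. l2norm ?L (W j) - 1) \<longlonglongrightarrow> 0"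
      by (intro Lim_null_comparison[OF _ d0]) simp
    then show "(\<lambda>j. l2norm ?L (W j)) \<longlonglongrightarrow> 1" by (rule LIM_zero_cancel)
  qed
  have U0nz: "\<not> (AE y in ?L. U0 y = 0)"
  proof
    assume "AE y in ?L. U0 y = 0"
    then have "l2norm ?L U0 = l2norm ?L (\<lambda>_. 0::real)"
      using U0L by (intro l2norm_AE_cong) (auto simp: sq_integrable_def)
    then show False using U0n by (simp add: l2norm_def)
  qed
  define G0 where "G0 y = weak_grad G U0 y $ 1" for y
  have G0L: "G0 \<in> L2 G" unfolding G0_def[abs_def] by (rule L2_nth[OF weak_grad_H1(1)[OF U0H]])
  have wg0: "(LINT y|?L. U0 y * (grad \<phi> y $ 1)) = - (LINT y|?L. G0 y * \<phi> y)" if "\<phi> \<in> test_functions G" for \<phi>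
    using weak_grad_H1(2)[OF U0H] that unfolding is_weak_grad_iff G0_def
    by (auto simp: Basis_real_vec inner_axis dest!: bspec[of _ _ \<phi>] spec[of _ 1])
  obtain U where U: "U \<in> borel_measurable borel" "U \<in> L2 G" "AE y in ?L. U0 y = U y"
    by (rule L2_borel_representative[OF G_borel H1_L2[OF U0H]])
  obtain \<gamma> where \<gamma>: "\<gamma> \<in> borel_measurable borel" "\<gamma> \<in> L2 G" "AE y in ?L. G0 y = \<gamma> y"
    by (rule L2_borel_representative[OF G_borel G0L])
  have U0m: "U0 \<in> borel_measurable ?L" "U \<in> borel_measurable ?L" "G0 \<in> borel_measurable ?L" "\<gamma> \<in> borel_measurable ?L"
    using U0L U(2) G0L \<gamma>(2) by (auto simp: sq_integrable_def L2_def)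
  have UU: "(LINT y|?L. U0 y * f y) = (LINT y|?L. U y * f y)" if "f \<in> L2 G" for f
  proof (rule integral_cong_AE)
    have fm: "f \<in> borel_measurable ?L" using that by (simp add: L2_def)
    show "(\<lambda>y. U0 y * f y) \<in> borel_measurable ?L" "(\<lambda>y. U y * f y) \<in> borel_measurable ?L"
      by (intro borel_measurable_times U0m fm)+
    show "AE y in ?L. U0 y * f y = U y * f y" using U(3) by eventually_elim simp
  qed
  have gg: "(LINT y|?L. G0 y * f y) = (LINT y|?L. \<gamma> y * f y)" if "f \<in> L2 G" for f
  proof (rule integral_cong_AE)
    have fm: "f \<in> borel_measurable ?L" using that by (simp add: L2_def)
    show "(\<lambda>y. G0 y * f y) \<in> borel_measurable ?L" "(\<lambda>y. \<gamma> y * f y) \<in> borel_measurable ?L"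
      by (intro borel_measurable_times U0m fm)+
    show "AE y in ?L. G0 y * f y = \<gamma> y * f y" using \<gamma>(3) by eventually_elim simp
  qed
  have tL: "\<phi> \<in> L2 G" "(\<lambda>y. grad \<phi> y $ 1) \<in> L2 G" if "\<phi> \<in> test_functions G" for \<phi>
    using smooth_L2[OF GG test_functions_smooth[OF that]] L2_nth[OF smooth_grad_L2[OF GG test_functions_smooth[OF that]]] by auto
  have wg: "(LINT y|?L. U y * (grad \<phi> y $ 1)) = - (LINT y|?L. \<gamma> y * \<phi> y)" if "\<phi> \<in> test_functions G" for \<phi>
    using wg0[OF that] UU[OF tL(2)[OF that]] gg[OF tL(1)[OF that]] by simp
  have strong: "(\<lambda>j. l2norm ?L (\<lambda>y. W j y - U y)) \<longlonglongrightarrow> 0"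
  proof -
    have "l2norm ?L (\<lambda>y. W j y - U y) = l2norm ?L (\<lambda>y. W j y - U0 y)" for j
    proof (rule l2norm_AE_cong)
      have Wm: "W j \<in> borel_measurable ?L" using WL[of j] by (simp add: sq_integrable_def)
      show "(\<lambda>y. W j y - U y) \<in> borel_measurable ?L" "(\<lambda>y. W j y - U0 y) \<in> borel_measurable ?L"
        by (intro borel_measurable_diff Wm U0m)+
      show "AE y in ?L. W j y - U y = W j y - U0 y" using U(3) by eventually_elim simp
    qed
    then show ?thesis using strong0 by simp
  qed
  \<comment> \<open>Against a test function, integration by parts moves the derivative away from
    \<open>W j\<close>, and weak convergence of \<open>W\<close> suffices. The gradient bound
    extends this to all of \<open>L2 G\<close>.\<close>
  have weak: "(\<lambda>j. LINT y|?L. grad (W j) y $ 1 * f y) \<longlonglongrightarrow> (LINT y|?L. \<gamma> y * f y)" if "f \<in> L2 G" for f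
  proof (rule weak_convergence_by_test_functions[OF GG L2_nth[OF gWL] g1 \<gamma>(2) _ that])
    fix \<phi> assume p: "\<phi> \<in> test_functions G"
    have ibp: "(LINT y|?L. grad (W j) y $ 1 * \<phi> y) = - (LINT y|?L. W j y * (grad \<phi> y $ 1))" for j
    proof -
      have "axis 1 1 \<in> (Basis :: (real^3) set)" by (simp add: Basis_real_vec)
      from is_weak_grad_smooth[OF GG W(1)[of j], unfolded is_weak_grad_iff, rule_format, OF p this]
      show ?thesis by (simp add: inner_axis)
    qed
    have "(\<lambda>j. - (LINT y|?L. W j y * (grad \<phi> y $ 1))) \<longlonglongrightarrow> - (LINT y|?L. U0 y * (grad \<phi> y $ 1))"
      by (intro tendsto_minus weakW tL(2)[OF p])
    then show "(\<lambda>j. LINT y|?L. grad (W j) y $ 1 * \<phi> y) \<longlonglongrightarrow> (LINT y|?L. \<gamma> y * \<phi> y)"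
      unfolding ibp wg0[OF p] gg[OF tL(1)[OF p]] by simp
  qed
  obtain V g where V: "V \<in> borel_measurable borel" "g \<in> borel_measurable borel" "V \<in> L2 I" "g \<in> L2 I"
    "AE y in lborel. y \<in> G \<longrightarrow> U y = V (y $ 1)" "AE y in lborel. y \<in> G \<longrightarrow> \<gamma> y = g (y $ 1)"
    "AE t in lborel. t \<in> I \<longrightarrow> V t = (LINT s:{l\<^sub>0<..<t}|lborel. g s)" "(LINT s:I|lborel. g s) = 0"
    by (rule limit_profile[OF W(1,2) U(1,2) \<gamma>(1,2) strong g2 g3 weak wg])
  have U0V: "AE y in ?L. U0 y = V (y $ 1)"
    using U(3) V(5)[folded AE_lebesgue_on_iff[OF G_borel]] by eventually_elim simp
  have nzV: "\<not> (AE t in lebesgue_on I. V t = 0)"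
  proof
    assume "AE t in lebesgue_on I. V t = 0"
    then have "AE t in lborel. t \<in> I \<longrightarrow> V t = 0" by (subst (asm) AE_lebesgue_on_iff) auto
    from AE_fst_coord[OF this] have "AE y in ?L. V (y $ 1) = 0"
      unfolding AE_lebesgue_on_iff[OF G_borel]
      by eventually_elim (use rod_domainD(4)[OF rod] in auto)
    with U0V have "AE y in ?L. U0 y = 0" by eventually_elim simp
    then show False using U0nz by blast
  qed
  have eq: "(LINT t:I|lborel. area D t * (g t * grad \<phi> t)) = \<mu>\<^sub>0 * (LINT t:I|lborel. area D t * (V t * \<phi> t))"
    if p: "\<phi> \<in> test_functions I" for \<phi>
  proof -
    have ps: "smooth \<phi>" by (rule test_functions_smooth[OF p])
    have pm[measurable]: "\<phi> \<in> borel_measurable borel" "grad \<phi> \<in> borel_measurable borel"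
      using smooth_continuous[OF ps] smooth_grad_continuous[OF ps] by (auto intro: borel_measurable_continuous_onI)
    have vs: "smooth (\<lambda>y::real^3. \<phi> (y $ 1))" by (rule smooth_fst_coord[OF ps])
    have vL: "(\<lambda>y::real^3. \<phi> (y $ 1)) \<in> L2 G" by (rule smooth_L2[OF GG vs])
    have dL: "(\<lambda>y::real^3. grad \<phi> (y $ 1)) \<in> L2 G"
      using L2_nth[OF smooth_grad_L2[OF GG vs], of 1] unfolding grad_fst_coord[OF ps] by (simp add: axis_def)
    note [measurable] = V(1,2) U(1) \<gamma>(1)
    have z: "(\<lambda>j. (LINT y|?L. grad (W j) y $ 1 * grad \<phi> (y $ 1)) - \<mu> j * (LINT y|?L. Uj j y * \<phi> (y $ 1))) \<longlonglongrightarrow> 0"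
    proof (rule Lim_null_comparison)
      show "(\<lambda>j. d j * l2norm ?L (\<lambda>y. grad \<phi> (y $ 1))) \<longlonglongrightarrow> 0" using tendsto_mult_left_zero[OF d0] by simp
    qed (use W(8)[OF p] in simp)
    \<comment> \<open>The sequence that tends to zero by the approximate eigenvalue equation also
      tends to the difference of the two limit integrals; uniqueness of the limit gives the equation
      on \<open>G\<close>.\<close>
    have "(\<lambda>j. (LINT y|?L. grad (W j) y $ 1 * grad \<phi> (y $ 1)) - \<mu> j * (LINT y|?L. Uj j y * \<phi> (y $ 1)))
      \<longlonglongrightarrow> (LINT y|?L. \<gamma> y * grad \<phi> (y $ 1)) - \<mu>\<^sub>0 * (LINT y|?L. U0 y * \<phi> (y $ 1))"
      by (intro tendsto_diff tendsto_mult weak weakU mu0 vL dL)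
    from LIMSEQ_unique[OF this z]
    have E: "(LINT y|?L. \<gamma> y * grad \<phi> (y $ 1)) = \<mu>\<^sub>0 * (LINT y|?L. U y * \<phi> (y $ 1))" using UU[OF vL] by simp
    \<comment> \<open>Once both sides involve only functions of the axial variable,
      \<open>profile_integral\<close> turns them into integrals over \<open>I\<close> weighted by
      the area.\<close>
    have conv: "(LINT y|?L. F y * h (y $ 1)) = (LINT t:I|lborel. area D t * (f t * h t))"
      if [measurable]: "F \<in> borel_measurable borel" "f \<in> borel_measurable borel" "h \<in> borel_measurable borel"
        and FL: "F \<in> L2 G" and hL: "(\<lambda>y. h (y $ 1)) \<in> L2 G" and ae: "AE y in lborel. y \<in> G \<longrightarrow> F y = f (y $ 1)" for F f h
    proof -
      have hm: "(\<lambda>y::real^3. h (y $ 1)) \<in> borel_measurable borel" by measurable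
      have i: "set_integrable lborel G (\<lambda>y. F y * h (y $ 1))"
        by (rule L2_mult_set_integrable[OF G_borel that(1) hm FL hL])
      have ae': "AE y in lborel. indicator G y *\<^sub>R (F y * h (y $ 1)) = indicator G y *\<^sub>R (f (y $ 1) * h (y $ 1))"
        using ae by eventually_elim (auto simp: indicator_def)
      have i': "set_integrable lborel G (\<lambda>y. f (y $ 1) * h (y $ 1))"
        unfolding set_integrable_def
        by (rule integrable_cong_AE_imp[OF i[unfolded set_integrable_def]]) (use ae' in auto)
      have "(LINT y|?L. F y * h (y $ 1)) = (LINT y:G|lborel. F y * h (y $ 1))"
        by (rule lebesgue_on_integral(1)[OF G_borel]) measurable
      also have "\<dots> = (LINT y:G|lborel. f (y $ 1) * h (y $ 1))"
        unfolding set_lebesgue_integral_def by (rule integral_cong_AE) (use ae' in auto)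
      also have "\<dots> = (LINT t:I|lborel. area D t * (f t * h t))"
        by (rule profile_integral[of "\<lambda>t. f t * h t"]) (use i' in auto)
      finally show ?thesis .
    qed
    show ?thesis
      using E conv[OF \<gamma>(1) V(2) pm(2) \<gamma>(2) dL V(6)] conv[OF U(1) V(1) pm(1) U(2) vL V(5)] by simp
  qed
  have "limit_eigenpair l\<^sub>0 l\<^sub>1 (area D) \<mu>\<^sub>0 V"
    by (rule area_test_equation_imp_eigenpair[OF V(1-4) V(7,8) nzV eq])
  then show ?thesis using U0nz U0V by blast
qed

end

theorem theorem2:
  fixes l\<^sub>0 l\<^sub>1 c\<^sub>0 c\<^sub>1 :: real
    and D :: "real \<Rightarrow> (real^2) set" and G :: "(real^3) set"
    and lam :: "real \<Rightarrow> nat \<Rightarrow> real" and u :: "real \<Rightarrow> nat \<Rightarrow> real^3 \<Rightarrow> real"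
    and n :: nat and eps :: "nat \<Rightarrow> real"
    and lam0 :: real and U0 :: "real^3 \<Rightarrow> real"
  assumes "l\<^sub>0 \<le> 0" and "0 < l\<^sub>1"
    and "rod_domain l\<^sub>0 l\<^sub>1 D G"
    and "\<And>\<epsilon>. 0 < \<epsilon> \<Longrightarrow> \<epsilon> < 1 \<Longrightarrow>
           mixed_eigensystem (thin_rod G \<epsilon>) (end_faces l\<^sub>0 l\<^sub>1 D \<epsilon>) (\<epsilon>\<^sup>2) (lam \<epsilon>) (u \<epsilon>)"
    and "piecewise_continuous l\<^sub>0 l\<^sub>1 (area D)"
    and "0 < c\<^sub>0"
    and "\<And>t. t \<in> {l\<^sub>0..l\<^sub>1} \<Longrightarrow> c\<^sub>0 < area D t \<and> area D t \<le> c\<^sub>1"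
    and "\<And>j. 0 < eps j \<and> eps j < 1" and "eps \<longlonglongrightarrow> 0"
    and "(\<lambda>j. lam (eps j) n) \<longlonglongrightarrow> lam0"
    and "H1_weakly_converges G (\<lambda>j y. u (eps j) n (scale_transverse (eps j) y)) U0"
  shows "\<not> (AE y in lebesgue_on G. U0 y = 0) \<and>
         (\<exists>V. (AE y in lebesgue_on G. U0 y = V (y $ 1)) \<and> limit_eigenpair l\<^sub>0 l\<^sub>1 (area D) lam0 V)"
proof -
  have "l\<^sub>0 < l\<^sub>1" using assms(1,2) by linarith
  then interpret rod_limit l\<^sub>0 l\<^sub>1 c\<^sub>0 c\<^sub>1 D G
    by unfold_locales (use assms(3,6,7) in auto)
  have sys: "mixed_eigensystem (thin_rod G (eps j)) (end_faces l\<^sub>0 l\<^sub>1 D (eps j)) ((eps j)\<^sup>2) (lam (eps j)) (u (eps j))" for j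
    using assms(4)[of "eps j"] assms(8)[of j] by blast
  show ?thesis
  proof (rule convergence[OF assms(8,9) _ assms(10) _ _ assms(11)])
    fix j
    note s = sys[of j, unfolded mixed_eigensystem_def]
    show "0 < lam (eps j) n" using s[THEN conjunct1] by (rule spec)
    show "mixed_eigenpair (thin_rod G (eps j)) (end_faces l\<^sub>0 l\<^sub>1 D (eps j)) (lam (eps j) n) (u (eps j) n)"
      using s[THEN conjunct2, THEN conjunct2, THEN conjunct2, THEN conjunct1] by (rule spec)
    show "(LINT x|lebesgue_on (thin_rod G (eps j)). \<bar>u (eps j) n x\<bar>\<^sup>2) = (eps j)\<^sup>2"
      using s[THEN conjunct2, THEN conjunct2, THEN conjunct2, THEN conjunct2, THEN conjunct1] by (rule spec)
  qed
qed

end
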